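(* If $(M,g)$ is a cohomogeneity-one fiberwise Kähler toric manifold, with metric determined by the function $h(x)$ and the constants $a_j,b_j,d_j$ ($1\le j\le m$), then the function $h$ satisfies $$h=\frac{1}{\prod_{j=1}^m(b_jx+a_j)^{d_j/2}}\int\left[\int\left(\sum_{j=1}^m\frac{d_j}{b_jx+a_j}-S\right)\prod_{j=1}^m(b_jx+a_j)^{d_j/2}\,dx\right]dx,$$ where $S=S(x)$ is the scalar curvature of the manifold.
   Context: The iterated indefinite integral is understood up to a choice of the two constants of integration. A fiberwise Kähler toric manifold of cohomogeneity one is a Kähler manifold $(M,g,J)$ of one of two kinds. (Construction One) $M$ is irreducible, not hyperkähler, and of cohomogeneity one (principal orbits of real codimension one) under an isometric action of a compact connected semisimple Lie group $G$ with principal isotropy group $K$; the moment map sends each principal orbit $G/K$ onto a coadjoint orbit $G/L$ with $L/K\cong S^1$, and the isotropy representation of $G/K$ is $\mathfrak t^1\oplus\mathfrak p_1\oplus\dots\oplus\mathfrak p_m$ with $\mathfrak t^1$ trivial one-dimensional and $\mathfrak p_i$ nontrivial, irreducible, pairwise inequivalent, of real dimension $d_i$; $g_i^*$ denotes an invariant background inner product on $\mathfrak p_i$ normalized so that the Ricci tensor $r^*$ of the induced Kähler metric on $G/L$ satisfies $r^*(Y,Y)=1$ for unit $Y\in\mathfrak p_i$. (Construction Two) $(M_i,g_i^* )$, $1\le i\le m$, are compact Kähler–Einstein manifolds of real dimension $d_i$ with Einstein constant $1$ and Kähler forms $\omega_i^*$, and each principal orbit is a principal $S^1$-bundle $\pi:P\to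 M_1\times\dots\times M_m$ with connection form $\theta$, $d\theta=\pi^*\sum_i b_i\omega_i^*$. In both cases, on the open dense union of principal orbits, parametrized by $x$ in an open interval, $$g=\frac1{h}\,dx^2+h\,\theta\otimes\theta+\sum_{i=1}^m A_i\,g_i^*,\qquad h=h(x)>0,\quad A_i=b_ix+a_i>0,$$ with $\theta$ dual to the generator $\partial_\phi$ of the $S^1$-fibres, $J$ mapping the $x$-direction to the $\partial_\phi$-direction and restricting to the lifted complex structure of the base, and $a_i,b_i$ real constants; the $d_i$ are even, and the constants $b_i$ (determined by the principal orbit type) are not all zero. *)

theory Defs
  imports "HOL-Analysis.Analysis" "HOL-Algebra.Group"
begin

section \<open>Calculus on coordinate subspaces\<close>

text \<open>
  Local coordinates take values in \<open>span D\<close> for a set \<open>D \<subseteq> Basis\<close> of coordinate directions of a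
  Euclidean space, so that manifolds of different dimensions can share one model type (this is what
  a product of \<open>m\<close> manifolds with \<open>m\<close> arbitrary needs).  Only derivatives in directions of
  \<open>span D\<close> are ever taken.
\<close>

definition dd :: "('e::euclidean_space \<Rightarrow> 'f::real_normed_vector) \<Rightarrow> 'e \<Rightarrow> 'e \<Rightarrow> 'f" where
  "dd f v u = vector_derivative (\<lambda>t. f (u + t *\<^sub>R v)) (at 0)"

primrec ck_on :: "nat \<Rightarrow> 'e::euclidean_space set \<Rightarrow> 'e set \<Rightarrow> ('e \<Rightarrow> 'f::real_normed_vector) \<Rightarrow> bool"
where
  "ck_on 0 D W f \<longleftrightarrow> continuous_on W f"
| "ck_on (Suc k) D W f \<longleftrightarrow> continuous_on W f \<and>
     (\<forall>b\<in>D. (\<forall>u\<in>W. (\<lambda>t. f (u + t *\<^sub>R b)) differentiable (at (0::real))) \<and> ck_on k D W (dd f b))"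

text \<open>For \<open>W\<close> open in \<open>span D\<close>: all iterated partial derivatives exist and are continuous.\<close>

definition smooth_on :: "'e::euclidean_space set \<Rightarrow> 'e set \<Rightarrow> ('e \<Rightarrow> 'f::real_normed_vector) \<Rightarrow> bool"
  where "smooth_on D W f \<longleftrightarrow> (\<forall>k. ck_on k D W f)"


section \<open>Smooth manifolds\<close>

type_synonym ('a, 'e) chart = "'a set \<times> ('a \<Rightarrow> 'e)"

record ('a, 'e) mfd =
  topo :: "'a topology"
  atlas :: "('a, 'e) chart set"
  coords :: "'e set"

abbreviation pts :: "('a, 'e) mfd \<Rightarrow> 'a set" where "pts M \<equiv> topspace (topo M)"

abbreviation cinv :: "('a, 'e) chart \<Rightarrow> 'e \<Rightarrow> 'a" where "cinv c \<equiv> inv_into (fst c) (snd c)"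

abbreviation cimg :: "('a, 'e) chart \<Rightarrow> 'e set" where "cimg c \<equiv> snd c ` fst c"

definition smooth_manifold :: "('a, 'e::euclidean_space) mfd \<Rightarrow> bool" where
  "smooth_manifold M \<longleftrightarrow>
     Hausdorff_space (topo M) \<and> second_countable (topo M) \<and> coords M \<subseteq> Basis \<and>
     pts M = (\<Union>c\<in>atlas M. fst c) \<and>
     (\<forall>c\<in>atlas M. openin (topo M) (fst c) \<and>
        openin (top_of_set (span (coords M))) (cimg c) \<and>
        homeomorphic_map (subtopology (topo M) (fst c)) (top_of_set (cimg c)) (snd c)) \<and>
     (\<forall>c\<in>atlas M. \<forall>c'\<in>atlas M. smooth_on (coords M) (snd c ` (fst c \<inter> fst c')) (snd c' \<circ> cinv c))"

definition mdim :: "('a, 'e) mfd \<Rightarrow> nat" where "mdim M = card (coords M)"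

definition chart_at :: "('a, 'e) mfd \<Rightarrow> 'a \<Rightarrow> ('a, 'e) chart" where
  "chart_at M p = (SOME c. c \<in> atlas M \<and> p \<in> fst c)"

definition smooth_map ::
    "('a, 'e::euclidean_space) mfd \<Rightarrow> ('b, 'f::euclidean_space) mfd \<Rightarrow> ('a \<Rightarrow> 'b) \<Rightarrow> bool" where
  "smooth_map M N f \<longleftrightarrow> continuous_map (topo M) (topo N) f \<and>
     (\<forall>c\<in>atlas M. \<forall>c'\<in>atlas N.
        smooth_on (coords M) (snd c ` (fst c \<inter> f -` fst c')) (snd c' \<circ> f \<circ> cinv c))"

definition diffeo ::
    "('a, 'e::euclidean_space) mfd \<Rightarrow> ('b, 'f::euclidean_space) mfd \<Rightarrow> ('a \<Rightarrow> 'b) \<Rightarrow> bool" where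
  "diffeo M N f \<longleftrightarrow> bij_betw f (pts M) (pts N) \<and> smooth_map M N f \<and>
     smooth_map N M (inv_into (pts M) f)"

definition open_sub :: "('a, 'e) mfd \<Rightarrow> 'a set \<Rightarrow> ('a, 'e) mfd" where
  "open_sub M W = \<lparr>topo = subtopology (topo M) W,
                   atlas = (\<lambda>c. (fst c \<inter> W, snd c)) ` atlas M, coords = coords M\<rparr>"

definition interval_mfd :: "real set \<Rightarrow> (real, real) mfd" where
  "interval_mfd I = \<lparr>topo = top_of_set I, atlas = {(I, \<lambda>x. x)}, coords = Basis\<rparr>"

definition prod_mfd ::
    "('a, 'e::euclidean_space) mfd \<Rightarrow> ('b, 'f::euclidean_space) mfd \<Rightarrow> ('a \<times> 'b, 'e \<times> 'f) mfd" where
  "prod_mfd M N =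
     \<lparr>topo = prod_topology (topo M) (topo N),
      atlas = {(fst c \<times> fst c', \<lambda>(p, q). (snd c p, snd c' q)) | c c'. c \<in> atlas M \<and> c' \<in> atlas N},
      coords = (\<lambda>b. (b, 0)) ` coords M \<union> (\<lambda>b. (0, b)) ` coords N\<rparr>"

text \<open>
  The product of the manifolds \<open>Ms i\<close>, \<open>i \<in> A\<close>, for finite \<open>A\<close>.  The sets \<open>coords (Ms i)\<close> have to be
  pairwise disjoint, so that the sum of the charts of the factors is a chart of the product.
\<close>

definition Prod_mfd :: "'i set \<Rightarrow> ('i \<Rightarrow> ('b, 'f::euclidean_space) mfd) \<Rightarrow> ('i \<Rightarrow> 'b, 'f) mfd" where
  "Prod_mfd A Ms =
     \<lparr>topo = product_topology (\<lambda>i. topo (Ms i)) A,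
      atlas = {(\<Pi>\<^sub>E i\<in>A. fst (c i), \<lambda>q. \<Sum>i\<in>A. snd (c i) (q i)) | c. \<forall>i\<in>A. c i \<in> atlas (Ms i)},
      coords = (\<Union>i\<in>A. coords (Ms i))\<rparr>"


section \<open>Tangent vectors and tensor fields\<close>

text \<open>Tangent vectors are derivations on functions that are smooth near the base point, extended by
  0 to all other functions.\<close>

type_synonym 'a tv = "('a \<Rightarrow> real) \<Rightarrow> real"

definition smooth_near :: "('a, 'e::euclidean_space) mfd \<Rightarrow> 'a \<Rightarrow> ('a \<Rightarrow> real) \<Rightarrow> bool" where
  "smooth_near M p f \<longleftrightarrow> (\<exists>W. openin (topo M) W \<and> p \<in> W \<and>
     (\<forall>c\<in>atlas M. smooth_on (coords M) (snd c ` (fst c \<inter> W)) (f \<circ> cinv c)))"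

definition coord_vec :: "('a, 'e::euclidean_space) mfd \<Rightarrow> ('a, 'e) chart \<Rightarrow> 'a \<Rightarrow> 'e \<Rightarrow> 'a tv" where
  "coord_vec M c p v = (\<lambda>f. if smooth_near M p f then dd (f \<circ> cinv c) v (snd c p) else 0)"

definition tangent :: "('a, 'e::euclidean_space) mfd \<Rightarrow> 'a \<Rightarrow> 'a tv set" where
  "tangent M p = {coord_vec M c p v | c v. c \<in> atlas M \<and> p \<in> fst c \<and> v \<in> span (coords M)}"

definition tcomp :: "('a, 'e::euclidean_space) mfd \<Rightarrow> ('a, 'e) chart \<Rightarrow> 'a tv \<Rightarrow> 'e" where
  "tcomp M c \<xi> = (\<Sum>b\<in>coords M. \<xi> (\<lambda>q. snd c q \<bullet> b) *\<^sub>R b)"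

definition tlin :: "real \<Rightarrow> 'a tv \<Rightarrow> real \<Rightarrow> 'a tv \<Rightarrow> 'a tv" where
  "tlin s \<xi> t \<eta> = (\<lambda>f. s * \<xi> f + t * \<eta> f)"

definition tzero :: "'a tv" where "tzero = (\<lambda>f. 0)"

definition tsubspace :: "'a tv set \<Rightarrow> 'a tv set \<Rightarrow> bool" where
  "tsubspace T W \<longleftrightarrow> W \<subseteq> T \<and> tzero \<in> W \<and> (\<forall>\<xi>\<in>W. \<forall>\<eta>\<in>W. \<forall>s t. tlin s \<xi> t \<eta> \<in> W)"

definition tdim :: "('a, 'e::euclidean_space) mfd \<Rightarrow> 'a \<Rightarrow> 'a tv set \<Rightarrow> nat" where
  "tdim M p W = dim (tcomp M (chart_at M p) ` W)"

text \<open>\<open>push N f p\<close> is the differential at \<open>p\<close> of a map \<open>f\<close> into the manifold \<open>N\<close>.\<close>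

definition push :: "('b, 'f::euclidean_space) mfd \<Rightarrow> ('a \<Rightarrow> 'b) \<Rightarrow> 'a \<Rightarrow> 'a tv \<Rightarrow> 'b tv" where
  "push N f p \<xi> = (\<lambda>\<psi>. if smooth_near N (f p) \<psi> then \<xi> (\<psi> \<circ> f) else 0)"

definition velocity :: "('a, 'e::euclidean_space) mfd \<Rightarrow> (real \<Rightarrow> 'a) \<Rightarrow> real \<Rightarrow> 'a tv" where
  "velocity M \<gamma> t = (\<lambda>\<psi>. if smooth_near M (\<gamma> t) \<psi> then deriv (\<lambda>s. \<psi> (\<gamma> s)) t else 0)"

type_synonym 'a form1 = "'a \<Rightarrow> 'a tv \<Rightarrow> real"
type_synonym 'a form2 = "'a \<Rightarrow> 'a tv \<Rightarrow> 'a tv \<Rightarrow> real"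
type_synonym 'a endo = "'a \<Rightarrow> 'a tv \<Rightarrow> 'a tv"

definition comp1 ::
    "('a, 'e::euclidean_space) mfd \<Rightarrow> 'a form1 \<Rightarrow> ('a, 'e) chart \<Rightarrow> 'e \<Rightarrow> 'e \<Rightarrow> real" where
  "comp1 M \<alpha> c u v = (let p = cinv c u in \<alpha> p (coord_vec M c p v))"

definition comp2 ::
    "('a, 'e::euclidean_space) mfd \<Rightarrow> 'a form2 \<Rightarrow> ('a, 'e) chart \<Rightarrow> 'e \<Rightarrow> 'e \<Rightarrow> 'e \<Rightarrow> real" where
  "comp2 M \<beta> c u v w = (let p = cinv c u in \<beta> p (coord_vec M c p v) (coord_vec M c p w))"

definition compJ ::
    "('a, 'e::euclidean_space) mfd \<Rightarrow> 'a endo \<Rightarrow> ('a, 'e) chart \<Rightarrow> 'e \<Rightarrow> 'e \<Rightarrow> 'e" where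
  "compJ M J c u v = (let p = cinv c u in tcomp M c (J p (coord_vec M c p v)))"

definition linear_on_tangent :: "'a tv set \<Rightarrow> ('a tv \<Rightarrow> real) \<Rightarrow> bool" where
  "linear_on_tangent T \<alpha> \<longleftrightarrow> (\<forall>\<xi>\<in>T. \<forall>\<eta>\<in>T. \<forall>s t. \<alpha> (tlin s \<xi> t \<eta>) = s * \<alpha> \<xi> + t * \<alpha> \<eta>)"

definition smooth_form1 :: "('a, 'e::euclidean_space) mfd \<Rightarrow> 'a form1 \<Rightarrow> bool" where
  "smooth_form1 M \<alpha> \<longleftrightarrow>
     (\<forall>p\<in>pts M. linear_on_tangent (tangent M p) (\<alpha> p)) \<and>
     (\<forall>c\<in>atlas M. \<forall>v\<in>coords M. smooth_on (coords M) (cimg c) (\<lambda>u. comp1 M \<alpha> c u v))"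

definition smooth_sym2 :: "('a, 'e::euclidean_space) mfd \<Rightarrow> 'a form2 \<Rightarrow> bool" where
  "smooth_sym2 M \<beta> \<longleftrightarrow>
     (\<forall>p\<in>pts M. \<forall>\<xi>\<in>tangent M p. linear_on_tangent (tangent M p) (\<beta> p \<xi>) \<and>
        (\<forall>\<eta>\<in>tangent M p. \<beta> p \<xi> \<eta> = \<beta> p \<eta> \<xi>)) \<and>
     (\<forall>c\<in>atlas M. \<forall>v\<in>coords M. \<forall>w\<in>coords M.
        smooth_on (coords M) (cimg c) (\<lambda>u. comp2 M \<beta> c u v w))"

definition smooth_endo :: "('a, 'e::euclidean_space) mfd \<Rightarrow> 'a endo \<Rightarrow> bool" where
  "smooth_endo M J \<longleftrightarrow>
     (\<forall>p\<in>pts M. \<forall>\<xi>\<in>tangent M p. J p \<xi> \<in> tangent M p \<and>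
        (\<forall>\<eta>\<in>tangent M p. \<forall>s t. J p (tlin s \<xi> t \<eta>) = tlin s (J p \<xi>) t (J p \<eta>))) \<and>
     (\<forall>c\<in>atlas M. \<forall>v\<in>coords M. smooth_on (coords M) (cimg c) (\<lambda>u. compJ M J c u v))"

text \<open>Exterior derivative of a 1-form, with \<open>d\<alpha>(X,Y) = X \<alpha>(Y) - Y \<alpha>(X) - \<alpha>([X,Y])\<close> (no factor 1/2).\<close>

definition ext_d1 :: "('a, 'e::euclidean_space) mfd \<Rightarrow> 'a form1 \<Rightarrow> 'a form2" where
  "ext_d1 M \<alpha> p \<xi> \<eta> =
     (let c = chart_at M p; v = tcomp M c \<xi>; w = tcomp M c \<eta> in
      dd (\<lambda>u. comp1 M \<alpha> c u w) v (snd c p) - dd (\<lambda>u. comp1 M \<alpha> c u v) w (snd c p))"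

definition closed2 :: "('a, 'e::euclidean_space) mfd \<Rightarrow> 'a form2 \<Rightarrow> bool" where
  "closed2 M \<beta> \<longleftrightarrow> (\<forall>c\<in>atlas M. \<forall>z\<in>cimg c.
     \<forall>u\<in>span (coords M). \<forall>v\<in>span (coords M). \<forall>w\<in>span (coords M).
       dd (\<lambda>y. comp2 M \<beta> c y v w) u z + dd (\<lambda>y. comp2 M \<beta> c y w u) v z
         + dd (\<lambda>y. comp2 M \<beta> c y u v) w z = 0)"


section \<open>Riemannian and Kaehler geometry\<close>

definition riemannian :: "('a, 'e::euclidean_space) mfd \<Rightarrow> 'a form2 \<Rightarrow> bool" where
  "riemannian M g \<longleftrightarrow> smooth_manifold M \<and> smooth_sym2 M g \<and>
     (\<forall>p\<in>pts M. \<forall>\<xi>\<in>tangent M p. \<xi> \<noteq> tzero \<longrightarrow> g p \<xi> \<xi> > 0)"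

text \<open>The vector of \<open>span D\<close> dual to the linear form \<open>\<alpha>\<close> under the inner product \<open>\<beta>\<close>.\<close>

definition sharp :: "'e::euclidean_space set \<Rightarrow> ('e \<Rightarrow> 'e \<Rightarrow> real) \<Rightarrow> ('e \<Rightarrow> real) \<Rightarrow> 'e" where
  "sharp D \<beta> \<alpha> = (THE z. z \<in> span D \<and> (\<forall>y\<in>span D. \<beta> z y = \<alpha> y))"

text \<open>\<open>christoffel M g c u v w\<close> is the covariant derivative (Levi-Civita, by the Koszul formula) at
  \<open>u\<close> in direction \<open>v\<close> of the coordinate vector field with constant components \<open>w\<close>.\<close>

definition christoffel ::
    "('a, 'e::euclidean_space) mfd \<Rightarrow> 'a form2 \<Rightarrow> ('a, 'e) chart \<Rightarrow> 'e \<Rightarrow> 'e \<Rightarrow> 'e \<Rightarrow> 'e" where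
  "christoffel M g c u v w = sharp (coords M) (comp2 M g c u)
     (\<lambda>y. (dd (\<lambda>z. comp2 M g c z w y) v u + dd (\<lambda>z. comp2 M g c z v y) w u
            - dd (\<lambda>z. comp2 M g c z v w) y u) / 2)"

definition curvature ::
    "('a, 'e::euclidean_space) mfd \<Rightarrow> 'a form2 \<Rightarrow> ('a, 'e) chart \<Rightarrow> 'e \<Rightarrow> 'e \<Rightarrow> 'e \<Rightarrow> 'e \<Rightarrow> 'e" where
  "curvature M g c u x y z = (let \<Gamma> = christoffel M g c in
     dd (\<lambda>u. \<Gamma> u y z) x u - dd (\<lambda>u. \<Gamma> u x z) y u + \<Gamma> u x (\<Gamma> u y z) - \<Gamma> u y (\<Gamma> u x z))"

definition ricci_comp ::
    "('a, 'e::euclidean_space) mfd \<Rightarrow> 'a form2 \<Rightarrow> ('a, 'e) chart \<Rightarrow> 'e \<Rightarrow> 'e \<Rightarrow> 'e \<Rightarrow> real" where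
  "ricci_comp M g c u y z = (\<Sum>b\<in>coords M. curvature M g c u b y z \<bullet> b)"

definition ricci :: "('a, 'e::euclidean_space) mfd \<Rightarrow> 'a form2 \<Rightarrow> 'a form2" where
  "ricci M g p \<xi> \<eta> =
     (let c = chart_at M p in ricci_comp M g c (snd c p) (tcomp M c \<xi>) (tcomp M c \<eta>))"

definition scalar_curvature :: "('a, 'e::euclidean_space) mfd \<Rightarrow> 'a form2 \<Rightarrow> 'a \<Rightarrow> real" where
  "scalar_curvature M g p =
     (let c = chart_at M p; u = snd c p in
      \<Sum>b\<in>coords M. sharp (coords M) (comp2 M g c u) (ricci_comp M g c u b) \<bullet> b)"

definition nijenhuis ::
    "('a, 'e::euclidean_space) mfd \<Rightarrow> 'a endo \<Rightarrow> ('a, 'e) chart \<Rightarrow> 'e \<Rightarrow> 'e \<Rightarrow> 'e \<Rightarrow> 'e" where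
  "nijenhuis M J c u v w = (let Jc = compJ M J c in
     dd (\<lambda>z. Jc z w) (Jc u v) u - dd (\<lambda>z. Jc z v) (Jc u w) u
       + Jc u (dd (\<lambda>z. Jc z v) w u) - Jc u (dd (\<lambda>z. Jc z w) v u))"

definition complex_structure :: "('a, 'e::euclidean_space) mfd \<Rightarrow> 'a endo \<Rightarrow> bool" where
  "complex_structure M J \<longleftrightarrow> smooth_manifold M \<and> smooth_endo M J \<and>
     (\<forall>p\<in>pts M. \<forall>\<xi>\<in>tangent M p. J p (J p \<xi>) = tlin (-1) \<xi> 0 \<xi>) \<and>
     (\<forall>c\<in>atlas M. \<forall>u\<in>cimg c. \<forall>v\<in>span (coords M). \<forall>w\<in>span (coords M). nijenhuis M J c u v w = 0)"

definition kaehler_form :: "'a form2 \<Rightarrow> 'a endo \<Rightarrow> 'a form2" where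
  "kaehler_form g J p \<xi> \<eta> = g p (J p \<xi>) \<eta>"

definition kaehler :: "('a, 'e::euclidean_space) mfd \<Rightarrow> 'a form2 \<Rightarrow> 'a endo \<Rightarrow> bool" where
  "kaehler M g J \<longleftrightarrow> riemannian M g \<and> complex_structure M J \<and>
     (\<forall>p\<in>pts M. \<forall>\<xi>\<in>tangent M p. \<forall>\<eta>\<in>tangent M p. g p (J p \<xi>) (J p \<eta>) = g p \<xi> \<eta>) \<and>
     closed2 M (kaehler_form g J)"

definition hyperkaehler :: "('a, 'e::euclidean_space) mfd \<Rightarrow> 'a form2 \<Rightarrow> bool" where
  "hyperkaehler M g \<longleftrightarrow> (\<exists>J\<^sub>1 J\<^sub>2 J\<^sub>3. kaehler M g J\<^sub>1 \<and> kaehler M g J\<^sub>2 \<and> kaehler M g J\<^sub>3 \<and>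
     (\<forall>p\<in>pts M. \<forall>\<xi>\<in>tangent M p. J\<^sub>1 p (J\<^sub>2 p \<xi>) = J\<^sub>3 p \<xi>))"

definition parallel_along ::
    "('a, 'e::euclidean_space) mfd \<Rightarrow> 'a form2 \<Rightarrow> real set \<Rightarrow> (real \<Rightarrow> 'a) \<Rightarrow> (real \<Rightarrow> 'a tv) \<Rightarrow> bool"
where
  "parallel_along M g I \<gamma> V \<longleftrightarrow> (\<forall>t\<in>I. V t \<in> tangent M (\<gamma> t) \<and>
     (\<forall>c\<in>atlas M. \<gamma> t \<in> fst c \<longrightarrow>
       ((\<lambda>s. tcomp M c (V s)) has_vector_derivative
          - christoffel M g c (snd c (\<gamma> t)) (vector_derivative (\<lambda>s. snd c (\<gamma> s)) (at t))
              (tcomp M c (V t))) (at t)))"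

definition transport ::
    "('a, 'e::euclidean_space) mfd \<Rightarrow> 'a form2 \<Rightarrow> 'a \<times> 'a tv \<Rightarrow> 'a \<times> 'a tv \<Rightarrow> bool" where
  "transport M g P Q \<longleftrightarrow> (\<exists>\<gamma> V. smooth_map (interval_mfd {-1<..<2}) M \<gamma> \<and>
     parallel_along M g {-1<..<2} \<gamma> V \<and> (\<gamma> 0, V 0) = P \<and> (\<gamma> 1, V 1) = Q)"

text \<open>Irreducibility of the holonomy representation; composing transports along smooth curves gives
  parallel transport along piecewise smooth ones.\<close>

definition irreducible_riemannian :: "('a, 'e::euclidean_space) mfd \<Rightarrow> 'a form2 \<Rightarrow> bool" where
  "irreducible_riemannian M g \<longleftrightarrow> (\<forall>p\<in>pts M. \<forall>W.
     tsubspace (tangent M p) W \<and>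
     (\<forall>\<xi>\<in>W. \<forall>\<eta>. (transport M g)\<^sup>*\<^sup>* (p, \<xi>) (p, \<eta>) \<longrightarrow> \<eta> \<in> W) \<longrightarrow>
     W = {tzero} \<or> W = tangent M p)"


section \<open>Lie groups, homogeneous spaces and circle bundles\<close>

text \<open>In this section \<open>G\<close> carries the group structure and \<open>N\<close> the manifold structure.\<close>

definition lie_group :: "'g monoid \<Rightarrow> ('g, 'k::euclidean_space) mfd \<Rightarrow> bool" where
  "lie_group G N \<longleftrightarrow> group G \<and> smooth_manifold N \<and> pts N = carrier G \<and>
     smooth_map (prod_mfd N N) N (\<lambda>(x, y). x \<otimes>\<^bsub>G\<^esub> y) \<and> smooth_map N N (\<lambda>x. inv\<^bsub>G\<^esub> x)"

abbreviation lie_alg :: "'g monoid \<Rightarrow> ('g, 'k::euclidean_space) mfd \<Rightarrow> 'g tv set" where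
  "lie_alg G N \<equiv> tangent N \<one>\<^bsub>G\<^esub>"

definition left_field :: "'g monoid \<Rightarrow> ('g, 'k::euclidean_space) mfd \<Rightarrow> 'g tv \<Rightarrow> 'g \<Rightarrow> 'g tv" where
  "left_field G N X x = push N (\<lambda>y. x \<otimes>\<^bsub>G\<^esub> y) \<one>\<^bsub>G\<^esub> X"

text \<open>Value at the identity of the commutator of the left-invariant extensions.\<close>

definition lie_bracket ::
    "'g monoid \<Rightarrow> ('g, 'k::euclidean_space) mfd \<Rightarrow> 'g tv \<Rightarrow> 'g tv \<Rightarrow> 'g tv" where
  "lie_bracket G N X Y = (\<lambda>f. if smooth_near N \<one>\<^bsub>G\<^esub> f
     then X (\<lambda>x. left_field G N Y x f) - Y (\<lambda>x. left_field G N X x f) else 0)"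

definition semisimple :: "'g monoid \<Rightarrow> ('g, 'k::euclidean_space) mfd \<Rightarrow> bool" where
  "semisimple G N \<longleftrightarrow> (\<forall>A. tsubspace (lie_alg G N) A \<and>
     (\<forall>X\<in>lie_alg G N. \<forall>Y\<in>A. lie_bracket G N X Y \<in> A) \<and>
     (\<forall>X\<in>A. \<forall>Y\<in>A. lie_bracket G N X Y = tzero) \<longrightarrow> A = {tzero})"

definition Ad :: "'g monoid \<Rightarrow> ('g, 'k::euclidean_space) mfd \<Rightarrow> 'g \<Rightarrow> 'g tv \<Rightarrow> 'g tv" where
  "Ad G N x X = push N (\<lambda>y. x \<otimes>\<^bsub>G\<^esub> y \<otimes>\<^bsub>G\<^esub> inv\<^bsub>G\<^esub> x) \<one>\<^bsub>G\<^esub> X"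

definition coad :: "'g monoid \<Rightarrow> ('g, 'k::euclidean_space) mfd \<Rightarrow> 'g \<Rightarrow> ('g tv \<Rightarrow> real) \<Rightarrow> 'g tv \<Rightarrow> real"
  where "coad G N x \<nu> X = \<nu> (Ad G N (inv\<^bsub>G\<^esub> x) X)"

definition isometric_action ::
    "'g monoid \<Rightarrow> ('g, 'k::euclidean_space) mfd \<Rightarrow> ('a, 'n::euclidean_space) mfd \<Rightarrow> 'a form2 \<Rightarrow>
     ('g \<Rightarrow> 'a \<Rightarrow> 'a) \<Rightarrow> bool" where
  "isometric_action G N M g act \<longleftrightarrow>
     smooth_map (prod_mfd N M) M (\<lambda>(x, p). act x p) \<and>
     (\<forall>p\<in>pts M. act \<one>\<^bsub>G\<^esub> p = p \<and>
        (\<forall>x\<in>carrier G. \<forall>y\<in>carrier G. act (x \<otimes>\<^bsub>G\<^esub> y) p = act x (act y p))) \<and>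
     (\<forall>x\<in>carrier G. \<forall>p\<in>pts M. \<forall>\<xi>\<in>tangent M p. \<forall>\<eta>\<in>tangent M p.
        g (act x p) (push M (act x) p \<xi>) (push M (act x) p \<eta>) = g p \<xi> \<eta>)"

definition isotropy :: "'g monoid \<Rightarrow> ('g \<Rightarrow> 'a \<Rightarrow> 'a) \<Rightarrow> 'a \<Rightarrow> 'g set" where
  "isotropy G act p = {x \<in> carrier G. act x p = p}"

text \<open>Points on principal orbits: their isotropy group is subconjugate to every other one.\<close>

definition principal_points :: "'g monoid \<Rightarrow> ('g \<Rightarrow> 'a \<Rightarrow> 'a) \<Rightarrow> ('a, 'n) mfd \<Rightarrow> 'a set" where
  "principal_points G act M = {p \<in> pts M. \<forall>q\<in>pts M. \<exists>x\<in>carrier G.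
     (\<lambda>y. x \<otimes>\<^bsub>G\<^esub> y \<otimes>\<^bsub>G\<^esub> inv\<^bsub>G\<^esub> x) ` isotropy G act p \<subseteq> isotropy G act q}"

definition moment_map ::
    "'g monoid \<Rightarrow> ('g, 'k::euclidean_space) mfd \<Rightarrow> ('a, 'n::euclidean_space) mfd \<Rightarrow> 'a form2 \<Rightarrow>
     ('g \<Rightarrow> 'a \<Rightarrow> 'a) \<Rightarrow> ('a \<Rightarrow> 'g tv \<Rightarrow> real) \<Rightarrow> bool" where
  "moment_map G N M \<omega> act \<mu> \<longleftrightarrow>
     (\<forall>p\<in>pts M. linear_on_tangent (lie_alg G N) (\<mu> p)) \<and>
     (\<forall>X\<in>lie_alg G N. \<forall>p\<in>pts M. smooth_near M p (\<lambda>q. \<mu> q X) \<and>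
        (\<forall>\<xi>\<in>tangent M p. \<xi> (\<lambda>q. \<mu> q X) = \<omega> p (push M (\<lambda>x. act x p) \<one>\<^bsub>G\<^esub> X) \<xi>)) \<and>
     (\<forall>x\<in>carrier G. \<forall>p\<in>pts M. \<forall>X\<in>lie_alg G N. \<mu> (act x p) X = coad G N x (\<mu> p) X)"

definition submersion ::
    "('a, 'e::euclidean_space) mfd \<Rightarrow> ('b, 'f::euclidean_space) mfd \<Rightarrow> ('a \<Rightarrow> 'b) \<Rightarrow> bool" where
  "submersion M N f \<longleftrightarrow> smooth_map M N f \<and> (\<forall>p\<in>pts M. push N f p ` tangent M p = tangent N (f p))"

text \<open>\<open>q\<close> exhibits the manifold \<open>Q\<close> as \<open>G/H\<close>: as a smooth manifold, \<open>G/H\<close> is determined by this.\<close>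

definition homogeneous_quotient ::
    "'g monoid \<Rightarrow> ('g, 'k::euclidean_space) mfd \<Rightarrow> 'g set \<Rightarrow> ('b, 'f::euclidean_space) mfd \<Rightarrow>
     ('g \<Rightarrow> 'b) \<Rightarrow> bool" where
  "homogeneous_quotient G N H Q q \<longleftrightarrow> smooth_manifold Q \<and> submersion N Q q \<and> q ` carrier G = pts Q \<and>
     (\<forall>x\<in>carrier G. \<forall>y\<in>carrier G. q x = q y \<longleftrightarrow> inv\<^bsub>G\<^esub> x \<otimes>\<^bsub>G\<^esub> y \<in> H)"

text \<open>The left translation by \<open>x\<close> on \<open>G/H\<close>.\<close>

definition ltrans :: "'g monoid \<Rightarrow> ('g \<Rightarrow> 'b) \<Rightarrow> 'g \<Rightarrow> 'b \<Rightarrow> 'b" where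
  "ltrans G q x p = q (x \<otimes>\<^bsub>G\<^esub> inv_into (carrier G) q p)"

text \<open>\<open>L/K \<cong> S\<^sup>1\<close>, through a continuous epimorphism \<open>ch\<close> from \<open>L\<close> to the unit circle with kernel \<open>K\<close>.\<close>

definition circle_quotient ::
    "'g monoid \<Rightarrow> ('g, 'k) mfd \<Rightarrow> 'g set \<Rightarrow> 'g set \<Rightarrow> ('g \<Rightarrow> complex) \<Rightarrow> bool" where
  "circle_quotient G N L K ch \<longleftrightarrow> continuous_map (subtopology (topo N) L) euclidean ch \<and>
     (\<forall>x\<in>L. \<forall>y\<in>L. ch (x \<otimes>\<^bsub>G\<^esub> y) = ch x * ch y) \<and> ch ` L = sphere 0 1 \<and> K = {x \<in> L. ch x = 1}"

text \<open>
  Principal circle bundle \<open>\<pi> : P \<rightarrow> B\<close>.  The structure group is \<open>\<real>/\<tau>\<int>\<close> (acting through \<open>R\<close>); no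
  particular period \<open>\<tau>\<close> is imposed.  A local section \<open>\<sigma>\<close> gives the local trivialization
  \<open>(b, s) \<mapsto> R s (\<sigma> b)\<close>.
\<close>

definition circle_bundle ::
    "('p, 'r::euclidean_space) mfd \<Rightarrow> ('q, 'e::euclidean_space) mfd \<Rightarrow> ('p \<Rightarrow> 'q) \<Rightarrow>
     (real \<Rightarrow> 'p \<Rightarrow> 'p) \<Rightarrow> real \<Rightarrow> bool" where
  "circle_bundle P B \<pi> R \<tau> \<longleftrightarrow>
     smooth_manifold P \<and> smooth_manifold B \<and> \<tau> > 0 \<and>
     smooth_map (prod_mfd (interval_mfd UNIV) P) P (\<lambda>(s, p). R s p) \<and>
     (\<forall>p\<in>pts P. R 0 p = p \<and> (\<forall>s t. R (s + t) p = R s (R t p)) \<and>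
        (\<forall>s. R s p = p \<longleftrightarrow> (\<exists>k::int. s = of_int k * \<tau>))) \<and>
     smooth_map P B \<pi> \<and> \<pi> ` pts P = pts B \<and>
     (\<forall>p\<in>pts P. \<forall>q\<in>pts P. \<pi> p = \<pi> q \<longleftrightarrow> (\<exists>s. q = R s p)) \<and>
     (\<forall>b\<in>pts B. \<exists>W \<sigma>. openin (topo B) W \<and> b \<in> W \<and> smooth_map (open_sub B W) P \<sigma> \<and>
        (\<forall>u\<in>W. \<pi> (\<sigma> u) = u))"

definition fibre_vec :: "('p, 'r::euclidean_space) mfd \<Rightarrow> (real \<Rightarrow> 'p \<Rightarrow> 'p) \<Rightarrow> 'p \<Rightarrow> 'p tv" where
  "fibre_vec P R p = velocity P (\<lambda>s. R s p) 0"

definition connection_form ::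
    "('p, 'r::euclidean_space) mfd \<Rightarrow> (real \<Rightarrow> 'p \<Rightarrow> 'p) \<Rightarrow> 'p form1 \<Rightarrow> bool" where
  "connection_form P R \<theta> \<longleftrightarrow> smooth_form1 P \<theta> \<and>
     (\<forall>p\<in>pts P. \<theta> p (fibre_vec P R p) = 1 \<and>
        (\<forall>s. \<forall>\<xi>\<in>tangent P p. \<theta> (R s p) (push P (R s) p \<xi>) = \<theta> p \<xi>))"


section \<open>Group representations on subspaces of tangent spaces\<close>

definition invariant_under :: "'g set \<Rightarrow> ('g \<Rightarrow> 'a tv \<Rightarrow> 'a tv) \<Rightarrow> 'a tv set \<Rightarrow> bool" where
  "invariant_under K \<rho> W \<longleftrightarrow> (\<forall>k\<in>K. \<forall>\<xi>\<in>W. \<rho> k \<xi> \<in> W)"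

definition irreducible_rep :: "'g set \<Rightarrow> ('g \<Rightarrow> 'a tv \<Rightarrow> 'a tv) \<Rightarrow> 'a tv set \<Rightarrow> bool" where
  "irreducible_rep K \<rho> W \<longleftrightarrow> tsubspace W W \<and> invariant_under K \<rho> W \<and> W \<noteq> {tzero} \<and>
     (\<forall>U. tsubspace W U \<and> invariant_under K \<rho> U \<longrightarrow> U = {tzero} \<or> U = W)"

definition equivalent_reps ::
    "'g set \<Rightarrow> ('g \<Rightarrow> 'a tv \<Rightarrow> 'a tv) \<Rightarrow> 'a tv set \<Rightarrow> 'a tv set \<Rightarrow> bool" where
  "equivalent_reps K \<rho> U W \<longleftrightarrow> (\<exists>F. bij_betw F U W \<and>
     (\<forall>\<xi>\<in>U. \<forall>\<eta>\<in>U. \<forall>s t. F (tlin s \<xi> t \<eta>) = tlin s (F \<xi>) t (F \<eta>)) \<and>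
     (\<forall>k\<in>K. \<forall>\<xi>\<in>U. F (\<rho> k \<xi>) = \<rho> k (F \<xi>)))"

text \<open>\<open>T = \<real>e \<oplus> pp 1 \<oplus> \<dots> \<oplus> pp m\<close> with \<open>e\<close> fixed by \<open>K\<close>, and with \<open>pp i\<close> nontrivial, irreducible and
  pairwise inequivalent.\<close>

definition isotropy_decomposition ::
    "'g set \<Rightarrow> ('g \<Rightarrow> 'a tv \<Rightarrow> 'a tv) \<Rightarrow> 'a tv set \<Rightarrow> 'a tv \<Rightarrow> nat \<Rightarrow> (nat \<Rightarrow> 'a tv set) \<Rightarrow> bool" where
  "isotropy_decomposition K \<rho> T e m pp \<longleftrightarrow>
     (\<forall>k\<in>K. \<rho> k e = e) \<and>
     (\<forall>i\<in>{1..m}. tsubspace T (pp i) \<and> irreducible_rep K \<rho> (pp i) \<and> (\<exists>k\<in>K. \<exists>\<xi>\<in>pp i. \<rho> k \<xi> \<noteq> \<xi>)) \<and>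
     (\<forall>i\<in>{1..m}. \<forall>j\<in>{1..m}. i \<noteq> j \<longrightarrow> \<not> equivalent_reps K \<rho> (pp i) (pp j)) \<and>
     (\<forall>s. \<forall>w\<in>Pi\<^sub>E {1..m} pp. (\<lambda>f. s * e f + (\<Sum>i=1..m. w i f)) \<in> T) \<and>
     (\<forall>\<xi>\<in>T. \<exists>!sw. snd sw \<in> Pi\<^sub>E {1..m} pp \<and> \<xi> = (\<lambda>f. fst sw * e f + (\<Sum>i=1..m. snd sw i f)))"


section \<open>Fiberwise Kaehler toric manifolds of cohomogeneity one\<close>

definition A_coef :: "(nat \<Rightarrow> real) \<Rightarrow> (nat \<Rightarrow> real) \<Rightarrow> nat \<Rightarrow> real \<Rightarrow> real" where
  "A_coef a b i x = b i * x + a i"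

text \<open>The tensors \<open>g\<^sub>i\<^sup>*\<close> appear as symmetric, in general degenerate, tensors \<open>gs i\<close> on the base \<open>B\<close>.\<close>

definition base_metric ::
    "nat \<Rightarrow> (nat \<Rightarrow> real) \<Rightarrow> (nat \<Rightarrow> real) \<Rightarrow> (nat \<Rightarrow> 'q form2) \<Rightarrow> real \<Rightarrow> 'q form2" where
  "base_metric m a b gs x q \<xi> \<eta> = (\<Sum>i=1..m. A_coef a b i x * gs i q \<xi> \<eta>)"

text \<open>
  The part common to both constructions: \<open>\<Phi>\<close> identifies \<open>I \<times> P\<close> with the open dense union of
  principal orbits, \<open>\<Phi> ` ({x} \<times> P)\<close> being the principal orbit with parameter \<open>x\<close>, and \<open>P\<close> is a circle
  bundle over \<open>B\<close> (\<open>G/K \<rightarrow> G/L\<close>, respectively \<open>P \<rightarrow> M\<^sub>1 \<times> \<dots> \<times> M\<^sub>m\<close>).  There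
  \<open>g = dx\<^sup>2/h + h \<theta>\<otimes>\<theta> + \<Sum> A\<^sub>i g\<^sub>i\<^sup>*\<close>; a tangent vector \<open>\<zeta>\<close> of \<open>I \<times> P\<close> has \<open>dx(\<zeta>) = \<zeta> fst\<close>.  As \<open>g\<close>
  gives \<open>\<partial>\<^sub>x\<close> and \<open>\<partial>\<^sub>\<phi>\<close> the square lengths \<open>1/h\<close> and \<open>h\<close>, the positive multiple of \<open>\<partial>\<^sub>\<phi>\<close> to which \<open>J\<close>
  maps \<open>\<partial>\<^sub>x\<close> is \<open>\<partial>\<^sub>\<phi>/h\<close>.  The complex structure of the base is \<open>JB\<close>.
\<close>

definition cohom_one_form ::
    "('a, 'n::euclidean_space) mfd \<Rightarrow> 'a form2 \<Rightarrow> 'a endo \<Rightarrow> real set \<Rightarrow>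
     ('p, 'r::euclidean_space) mfd \<Rightarrow> ('q, 'e::euclidean_space) mfd \<Rightarrow> (real \<times> 'p \<Rightarrow> 'a) \<Rightarrow>
     ('p \<Rightarrow> 'q) \<Rightarrow> (real \<Rightarrow> 'p \<Rightarrow> 'p) \<Rightarrow> real \<Rightarrow> 'p form1 \<Rightarrow> 'q endo \<Rightarrow>
     nat \<Rightarrow> (nat \<Rightarrow> nat) \<Rightarrow> (nat \<Rightarrow> real) \<Rightarrow> (nat \<Rightarrow> real) \<Rightarrow> (nat \<Rightarrow> 'q form2) \<Rightarrow> (real \<Rightarrow> real) \<Rightarrow> bool"
where
  "cohom_one_form M g J I P B \<Phi> \<pi> R \<tau> \<theta> JB m d a b gs h \<longleftrightarrow>
     open I \<and> is_interval I \<and> I \<noteq> {} \<and> pts P \<noteq> {} \<and>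
     circle_bundle P B \<pi> R \<tau> \<and> connection_form P R \<theta> \<and> complex_structure B JB \<and>
     (\<forall>i\<in>{1..m}. smooth_sym2 B (gs i) \<and> even (d i)) \<and> (\<exists>i\<in>{1..m}. b i \<noteq> 0) \<and>
     (\<forall>x\<in>I. h x > 0 \<and> (\<forall>i\<in>{1..m}. A_coef a b i x > 0)) \<and>
     (let M\<^sub>0 = \<Phi> ` (I \<times> pts P) in
        openin (topo M) M\<^sub>0 \<and> topo M closure_of M\<^sub>0 = pts M \<and>
        diffeo (prod_mfd (interval_mfd I) P) (open_sub M M\<^sub>0) \<Phi>) \<and>
     (\<forall>x\<in>I. \<forall>p\<in>pts P.
        (\<forall>\<zeta>\<in>tangent (prod_mfd (interval_mfd I) P) (x, p).
         \<forall>\<eta>\<in>tangent (prod_mfd (interval_mfd I) P) (x, p).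
           let \<zeta>\<^sub>P = push P snd (x, p) \<zeta>; \<eta>\<^sub>P = push P snd (x, p) \<eta> in
           g (\<Phi> (x, p)) (push M \<Phi> (x, p) \<zeta>) (push M \<Phi> (x, p) \<eta>) =
             \<zeta> fst * \<eta> fst / h x + h x * (\<theta> p \<zeta>\<^sub>P * \<theta> p \<eta>\<^sub>P)
             + base_metric m a b gs x (\<pi> p) (push B \<pi> p \<zeta>\<^sub>P) (push B \<pi> p \<eta>\<^sub>P)) \<and>
        J (\<Phi> (x, p)) (velocity M (\<lambda>s. \<Phi> (s, p)) x) =
          (\<lambda>f. velocity M (\<lambda>s. \<Phi> (x, R s p)) 0 f / h x) \<and>
        (\<forall>\<xi>\<in>tangent P p. \<theta> p \<xi> = 0 \<longrightarrow>
           (\<exists>\<eta>\<in>tangent P p. \<theta> p \<eta> = 0 \<and> push B \<pi> p \<eta> = JB (\<pi> p) (push B \<pi> p \<xi>) \<and>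
              J (\<Phi> (x, p)) (push M (\<lambda>p. \<Phi> (x, p)) p \<xi>) = push M (\<lambda>p. \<Phi> (x, p)) p \<eta>)))"

text \<open>
  Construction One.  \<open>P = G/K\<close> via \<open>qP\<close>, \<open>B = G/L\<close> via \<open>qB\<close>, \<open>L\<close> is the coadjoint isotropy group of the
  moment map image of \<open>\<Phi> (x, K)\<close>, and the circle action on \<open>G/K\<close> is right translation by \<open>L/K\<close>.
  Equivariance of \<open>\<mu>\<close> makes the image of the orbit of \<open>\<Phi> (x, K)\<close> the coadjoint orbit \<open>G/L\<close>, and
  \<open>base_metric m a b gs x\<close> is the Kaehler metric induced on it.  The background inner
  product on \<open>pp i\<close> is \<open>gs i\<close> transported by the differential of \<open>\<pi>\<close>.
\<close>

definition construction_one ::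
    "('a, 'n::euclidean_space) mfd \<Rightarrow> 'a form2 \<Rightarrow> 'a endo \<Rightarrow> real set \<Rightarrow>
     ('p, 'r::euclidean_space) mfd \<Rightarrow> ('q, 'e::euclidean_space) mfd \<Rightarrow> (real \<times> 'p \<Rightarrow> 'a) \<Rightarrow>
     ('p \<Rightarrow> 'q) \<Rightarrow> (real \<Rightarrow> 'p \<Rightarrow> 'p) \<Rightarrow> real \<Rightarrow> 'p form1 \<Rightarrow>
     nat \<Rightarrow> (nat \<Rightarrow> nat) \<Rightarrow> (nat \<Rightarrow> real) \<Rightarrow> (nat \<Rightarrow> real) \<Rightarrow> (nat \<Rightarrow> 'q form2) \<Rightarrow>
     'g monoid \<Rightarrow> ('g, 'k::euclidean_space) mfd \<Rightarrow> ('g \<Rightarrow> 'a \<Rightarrow> 'a) \<Rightarrow> ('a \<Rightarrow> 'g tv \<Rightarrow> real) \<Rightarrow>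
     'g set \<Rightarrow> 'g set \<Rightarrow> ('g \<Rightarrow> complex) \<Rightarrow> ('g \<Rightarrow> 'p) \<Rightarrow> ('g \<Rightarrow> 'q) \<Rightarrow> (nat \<Rightarrow> 'p tv set) \<Rightarrow> bool"
where
  "construction_one M g J I P B \<Phi> \<pi> R \<tau> \<theta> m d a b gs G N act \<mu> K L ch qP qB pp \<longleftrightarrow>
     connected_space (topo M) \<and> irreducible_riemannian M g \<and> \<not> hyperkaehler M g \<and>
     lie_group G N \<and> compact_space (topo N) \<and> connected_space (topo N) \<and> semisimple G N \<and>
     isometric_action G N M g act \<and> moment_map G N M (kaehler_form g J) act \<mu> \<and>
     mdim M = mdim P + 1 \<and> \<Phi> ` (I \<times> pts P) = principal_points G act M \<and>
     homogeneous_quotient G N K P qP \<and> homogeneous_quotient G N L B qB \<and>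
     (\<forall>x\<in>I. isotropy G act (\<Phi> (x, qP \<one>\<^bsub>G\<^esub>)) = K \<and>
        L = {y \<in> carrier G. \<forall>X\<in>lie_alg G N.
               coad G N y (\<mu> (\<Phi> (x, qP \<one>\<^bsub>G\<^esub>))) X = \<mu> (\<Phi> (x, qP \<one>\<^bsub>G\<^esub>)) X} \<and>
        (\<forall>y\<in>carrier G. \<forall>p\<in>pts P. \<Phi> (x, ltrans G qP y p) = act y (\<Phi> (x, p)))) \<and>
     circle_quotient G N L K ch \<and>
     (\<forall>y\<in>carrier G. \<pi> (qP y) = qB y \<and>
        (\<forall>l\<in>L. \<forall>s. ch l = cis (2 * pi * s / \<tau>) \<longrightarrow> R s (qP y) = qP (y \<otimes>\<^bsub>G\<^esub> l))) \<and>
     (\<forall>y\<in>carrier G.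
        (\<forall>p\<in>pts P. \<forall>\<xi>\<in>tangent P p.
           \<theta> (ltrans G qP y p) (push P (ltrans G qP y) p \<xi>) = \<theta> p \<xi>) \<and>
        (\<forall>i\<in>{1..m}. \<forall>q\<in>pts B. \<forall>\<xi>\<in>tangent B q. \<forall>\<eta>\<in>tangent B q.
           gs i (ltrans G qB y q) (push B (ltrans G qB y) q \<xi>) (push B (ltrans G qB y) q \<eta>)
             = gs i q \<xi> \<eta>)) \<and>
     (let o\<^sub>P = qP \<one>\<^bsub>G\<^esub>; o\<^sub>B = qB \<one>\<^bsub>G\<^esub>; D\<pi> = push B \<pi> o\<^sub>P in
        isotropy_decomposition K (\<lambda>k. push P (ltrans G qP k) o\<^sub>P) (tangent P o\<^sub>P)
          (fibre_vec P R o\<^sub>P) m pp \<and>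
        (\<forall>i\<in>{1..m}. tdim P o\<^sub>P (pp i) = d i \<and>
           (\<forall>Y\<in>pp i. Y \<noteq> tzero \<longrightarrow> gs i o\<^sub>B (D\<pi> Y) (D\<pi> Y) > 0) \<and>
           (\<forall>j\<in>{1..m}. j \<noteq> i \<longrightarrow> (\<forall>Y\<in>pp j. \<forall>\<eta>\<in>tangent B o\<^sub>B. gs i o\<^sub>B (D\<pi> Y) \<eta> = 0)) \<and>
           (\<forall>x\<in>I. \<forall>Y\<in>pp i. gs i o\<^sub>B (D\<pi> Y) (D\<pi> Y) = 1 \<longrightarrow>
              ricci B (base_metric m a b gs x) o\<^sub>B (D\<pi> Y) (D\<pi> Y) = 1)))"

text \<open>
  Construction Two.  The maps \<open>pr i\<close> exhibit \<open>B\<close> as the product of the compact Kaehler--Einstein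
  manifolds \<open>(Ms i, gM i, JM i)\<close>.
\<close>

definition construction_two ::
    "('p, 'r::euclidean_space) mfd \<Rightarrow> ('q, 'e::euclidean_space) mfd \<Rightarrow> ('p \<Rightarrow> 'q) \<Rightarrow> 'p form1 \<Rightarrow>
     'q endo \<Rightarrow> nat \<Rightarrow> (nat \<Rightarrow> nat) \<Rightarrow> (nat \<Rightarrow> real) \<Rightarrow> (nat \<Rightarrow> 'q form2) \<Rightarrow>
     (nat \<Rightarrow> ('b, 'f::euclidean_space) mfd) \<Rightarrow> (nat \<Rightarrow> 'b form2) \<Rightarrow> (nat \<Rightarrow> 'b endo) \<Rightarrow>
     (nat \<Rightarrow> 'q \<Rightarrow> 'b) \<Rightarrow> bool"
where
  "construction_two P B \<pi> \<theta> JB m d b gs Ms gM JM pr \<longleftrightarrow>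
     (\<forall>i\<in>{1..m}. kaehler (Ms i) (gM i) (JM i) \<and> compact_space (topo (Ms i)) \<and> mdim (Ms i) = d i \<and>
        (\<forall>p\<in>pts (Ms i). \<forall>\<xi>\<in>tangent (Ms i) p. \<forall>\<eta>\<in>tangent (Ms i) p.
           ricci (Ms i) (gM i) p \<xi> \<eta> = gM i p \<xi> \<eta>)) \<and>
     disjoint_family_on (\<lambda>i. coords (Ms i)) {1..m} \<and>
     diffeo B (Prod_mfd {1..m} Ms) (\<lambda>q. \<lambda>i\<in>{1..m}. pr i q) \<and>
     (\<forall>i\<in>{1..m}. \<forall>q\<in>pts B. \<forall>\<xi>\<in>tangent B q.
        push (Ms i) (pr i) q (JB q \<xi>) = JM i (pr i q) (push (Ms i) (pr i) q \<xi>) \<and>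
        (\<forall>\<eta>\<in>tangent B q.
           gs i q \<xi> \<eta> = gM i (pr i q) (push (Ms i) (pr i) q \<xi>) (push (Ms i) (pr i) q \<eta>))) \<and>
     (\<forall>p\<in>pts P. \<forall>\<xi>\<in>tangent P p. \<forall>\<eta>\<in>tangent P p.
        ext_d1 P \<theta> p \<xi> \<eta> =
          (\<Sum>i=1..m. b i * kaehler_form (gM i) (JM i) (pr i (\<pi> p))
             (push (Ms i) (pr i \<circ> \<pi>) p \<xi>) (push (Ms i) (pr i \<circ> \<pi>) p \<eta>)))"

end

theory Submission
  imports Defs
begin

text \<open>
  In the coordinates given by \<open>x\<close>, the fibre coordinate \<open>s\<close> and coordinates of the base, the metric is
  \<open>dx\<^sup>2/h + h (ds + \<alpha>)\<^sup>2 + G\<^sub>x\<close>, where \<open>G\<^sub>x\<close> is affine in \<open>x\<close> and has the eigenvalues \<open>A\<^sub>j\<close> with respect to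
  the background metrics.  With \<open>\<kappa>\<^sub>j = b\<^sub>j / A\<^sub>j\<close> counted \<open>d\<^sub>j\<close> times, its scalar curvature is
  \<open>scal G\<^sub>x - h'' - h' (\<Sum> \<kappa>) + 3/4 h (\<Sum> \<kappa>\<^sup>2) - h/4 |d\<alpha>|\<^sup>2 - h/4 (\<Sum> \<kappa>)\<^sup>2\<close>.
  That the Kaehler form is closed gives \<open>d\<alpha> = G' (J _, _)\<close>, hence \<open>|d\<alpha>|\<^sup>2 = \<Sum> \<kappa>\<^sup>2\<close>.  In Construction One
  \<open>G\<^sub>x\<close> has Ricci tensor 1 on the background unit vectors, and in Construction Two it is a product of
  Einstein metrics scaled by \<open>A\<^sub>j\<close>; in both cases \<open>scal G\<^sub>x = \<Sum> d\<^sub>j / A\<^sub>j\<close>.  Since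
  the product \<open>p\<close> of the powers of the \<open>A\<^sub>j\<close> with exponents \<open>d\<^sub>j / 2\<close> has logarithmic derivative \<open>(\<Sum> \<kappa>) / 2\<close>, this says that
  \<open>(h p)'' = (\<Sum> d\<^sub>j / A\<^sub>j - S) p\<close>.
\<close>

section \<open>Calculus on coordinate subspaces\<close>

text \<open>The definition of scalar curvature hides its value twice: the Christoffel symbols come
  from the definite description in \<open>sharp\<close>, and the chart is the unspecified
  \<open>chart_at M p\<close>. Both are removed before any geometry enters. Pairing curvature with
  an orthogonal frame turns it into \<open>scal\<close>, an expression in first and second
  derivatives of the metric components alone, and \<open>pb_scal\<close> shows that
  \<open>scal\<close> survives pulling the metric back. This frees the choice of coordinates: the
  moment parameter \<open>x\<close>, the flow time \<open>s\<close> of the circle action, and a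
  parametrization of the base lifted by a local section. The frame has to be orthogonal only at the
  one point where curvature is evaluated, so its vectors are constant in the coordinates and no
  bracket terms arise. Smoothness of \<open>h\<close> and positivity of the base metric are derived
  from the corresponding properties of \<open>g\<close>. In Construction One the splitting into the
  spaces \<open>pp i\<close> and the Ricci condition are given at the base point of
  \<open>G/K\<close> only; isometries, which preserve scalar curvature, carry the result to the rest
  of each orbit.\<close>

definition oset :: "'e::euclidean_space set \<Rightarrow> 'e set \<Rightarrow> bool" where
  "oset D W \<longleftrightarrow> D \<subseteq> Basis \<and> openin (top_of_set (span D)) W"

lemma oset_sub_span: "oset D W \<Longrightarrow> W \<subseteq> span D"
  by (auto simp: oset_def dest: openin_imp_subset)

lemma oset_in_span: "oset D W \<Longrightarrow> u \<in> W \<Longrightarrow> u \<in> span D"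
  using oset_sub_span by blast

lemma finite_coords: "D \<subseteq> (Basis::'e::euclidean_space set) \<Longrightarrow> finite D"
  using finite_Basis finite_subset by blast

lemma oset_finite: "oset D W \<Longrightarrow> finite D"
  by (auto simp: oset_def intro: finite_coords)

lemma oset_ball:
  assumes "oset D W" "u \<in> W"
  obtains e where "e > 0" "\<And>v. v \<in> span D \<Longrightarrow> norm v < e \<Longrightarrow> u + v \<in> W"
proof -
  from assms obtain T where T: "open T" "W = span D \<inter> T"
    unfolding oset_def openin_open by auto
  then obtain e where e: "e > 0" "ball u e \<subseteq> T"
    using assms by (auto simp: open_contains_ball)
  have "u + v \<in> W" if "v \<in> span D" "norm v < e" for v
  proof -
    have "u + v \<in> ball u e" using that by (simp add: dist_norm)
    moreover have "u + v \<in> span D" using that oset_in_span[OF assms] by (simp add: span_add)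
    ultimately show ?thesis using T e by auto
  qed
  with e show thesis using that by blast
qed

lemma oset_ev_curve:
  assumes "oset D W" "\<gamma> t \<in> W" "isCont \<gamma> t" "\<forall>\<^sub>F s in nhds t. \<gamma> s \<in> span D"
  shows "\<forall>\<^sub>F s in nhds t. \<gamma> s \<in> W"
proof -
  obtain T where T: "open T" "W = span D \<inter> T"
    using assms(1) unfolding oset_def openin_open by auto
  have "(\<gamma> \<longlongrightarrow> \<gamma> t) (nhds t)"
    using assms(3) by (simp add: continuous_at tendsto_nhds_iff)
  then have "\<forall>\<^sub>F s in nhds t. \<gamma> s \<in> T"
    using topological_tendstoD[of \<gamma> "\<gamma> t" "nhds t" T] T assms(2) by auto
  then show ?thesis using assms(4) by eventually_elim (use T in auto)
qed

lemma oset_ev_line: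
  fixes u v :: "'e::euclidean_space"
  assumes "oset D W" "u \<in> W" "v \<in> span D"
  shows "\<forall>\<^sub>F t in nhds (0::real). u + t *\<^sub>R v \<in> W"
proof (rule oset_ev_curve[OF assms(1)])
  show "u + 0 *\<^sub>R v \<in> W" using assms by simp
  show "isCont (\<lambda>t. u + t *\<^sub>R v) 0" by (intro continuous_intros)
  have "u + t *\<^sub>R v \<in> span D" for t
    using assms by (simp add: oset_in_span span_add span_scale)
  then show "\<forall>\<^sub>F t in nhds 0. u + t *\<^sub>R v \<in> span D" by simp
qed

lemma span_coords_sum:
  assumes "D \<subseteq> (Basis::'e::euclidean_space set)" "v \<in> span D"
  shows "(\<Sum>b\<in>D. (v \<bullet> b) *\<^sub>R b) = v"
proof -
  have "v \<bullet> b = 0" if "b \<in> Basis - D" for b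
  proof -
    have "\<forall>d\<in>D. orthogonal b d"
      using assms that by (auto simp: orthogonal_def inner_Basis)
    then have "orthogonal b v" using assms(2) orthogonal_to_span by blast
    then show ?thesis by (simp add: orthogonal_def inner_commute)
  qed
  then have "(\<Sum>b\<in>D. (v \<bullet> b) *\<^sub>R b) = (\<Sum>b\<in>Basis. (v \<bullet> b) *\<^sub>R b)"
    using assms(1) by (intro sum.mono_neutral_left) auto
  then show ?thesis by (simp add: euclidean_representation)
qed

lemma span_coords_iff:
  assumes "D \<subseteq> (Basis::'e::euclidean_space set)"
  shows "v \<in> span D \<longleftrightarrow> (\<forall>b\<in>Basis - D. v \<bullet> b = 0)"
proof
  assume v: "v \<in> span D"
  show "\<forall>b\<in>Basis - D. v \<bullet> b = 0"
  proof
    fix b assume b: "b \<in> Basis - D"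
    have "v \<bullet> b = (\<Sum>c\<in>D. (v \<bullet> c) *\<^sub>R c) \<bullet> b" using span_coords_sum[OF assms v] by simp
    also have "\<dots> = 0"
      using b assms by (auto simp: inner_sum_left inner_Basis intro!: sum.neutral)
    finally show "v \<bullet> b = 0" .
  qed
next
  assume v: "\<forall>b\<in>Basis - D. v \<bullet> b = 0"
  have "v = (\<Sum>b\<in>Basis. (v \<bullet> b) *\<^sub>R b)" by (simp add: euclidean_representation)
  also have "\<dots> = (\<Sum>b\<in>D. (v \<bullet> b) *\<^sub>R b)"
    using assms v by (intro sum.mono_neutral_right) auto
  also have "\<dots> \<in> span D" by (intro span_sum span_scale span_base)
  finally show "v \<in> span D" .
qed

section \<open>Directional derivatives and the classes \<open>ck_on\<close>: locality\<close>

lemma dd_eqI: "((\<lambda>t. f (u + t *\<^sub>R v)) has_vector_derivative f') (at 0) \<Longrightarrow> dd f v u = f'"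
  unfolding dd_def by (rule vector_derivative_at)

lemma dd_has:
  "(\<lambda>t. f (u + t *\<^sub>R v)) differentiable (at 0) \<Longrightarrow>
   ((\<lambda>t. f (u + t *\<^sub>R v)) has_vector_derivative dd f v u) (at 0)"
  unfolding dd_def using vector_derivative_works by blast

lemma ck_on_continuous: "ck_on k D W f \<Longrightarrow> continuous_on W f"
  by (cases k) auto

lemma ck_on_Suc_imp: "ck_on (Suc k) D W f \<Longrightarrow> ck_on k D W f"
  by (induction k arbitrary: f) auto

lemma ck_on_1: "ck_on (Suc k) D W f \<Longrightarrow> ck_on (Suc 0) D W f"
  using ck_on_continuous by fastforce

lemma smooth_on_ck: "smooth_on D W f \<Longrightarrow> ck_on k D W f"
  by (simp add: smooth_on_def)

lemma smooth_on_continuous: "smooth_on D W f \<Longrightarrow> continuous_on W f"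
  using ck_on_continuous smooth_on_ck by blast

text \<open>A line in a direction of \<open>span D\<close> stays in \<open>W\<close> for small
  times, so values of the functions off \<open>W\<close> never enter. This is used constantly,
  because inverse charts are built from \<open>inv_into\<close> and are arbitrary outside the chart
  image.\<close>

lemma dd_cong:
  assumes "oset D W" "u \<in> W" "v \<in> span D" "\<And>u. u \<in> W \<Longrightarrow> f u = g u"
  shows "dd f v u = dd g v u"
  unfolding dd_def
proof (rule vector_derivative_cong_eq)
  show "\<forall>\<^sub>F x in nhds 0. x \<in> UNIV \<longrightarrow> f (u + x *\<^sub>R v) = g (u + x *\<^sub>R v)"
    using oset_ev_line[OF assms(1-3)] by eventually_elim (auto simp: assms(4))
qed auto

lemma differentiable_line_cong:
  fixes f g :: "'e::euclidean_space \<Rightarrow> 'f::real_normed_vector"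
  assumes "oset D W" "u \<in> W" "v \<in> span D" "\<And>u. u \<in> W \<Longrightarrow> f u = g u"
    and "(\<lambda>t. f (u + t *\<^sub>R v)) differentiable (at (0::real))"
  shows "(\<lambda>t. g (u + t *\<^sub>R v)) differentiable (at (0::real))"
proof -
  have ev: "\<forall>\<^sub>F x in nhds (0::real). f (u + x *\<^sub>R v) = g (u + x *\<^sub>R v)"
    using oset_ev_line[OF assms(1-3)] by eventually_elim (auto simp: assms(4))
  obtain f' where "((\<lambda>t. f (u + t *\<^sub>R v)) has_derivative f') (at 0)"
    using assms(5) unfolding differentiable_def by blast
  then have "((\<lambda>t. g (u + t *\<^sub>R v)) has_derivative f') (at 0)"
    using has_derivative_transform_eventually[of "\<lambda>t. f (u + t *\<^sub>R v)" f' 0 UNIV "\<lambda>t. g (u + t *\<^sub>R v)"]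
      ev eventually_nhds_x_imp_x[OF ev] eventually_nhds_conv_at by fastforce
  then show ?thesis unfolding differentiable_def by blast
qed

lemma ck_on_cong:
  assumes "oset D W" "\<And>u. u \<in> W \<Longrightarrow> f u = g u" "ck_on k D W f"
  shows "ck_on k D W g"
  using assms(2,3)
proof (induction k arbitrary: f g)
  case 0
  then show ?case using continuous_on_eq by fastforce
next
  case (Suc k)
  have c: "continuous_on W g" using Suc.prems continuous_on_eq by fastforce
  have "(\<lambda>t. g (u + t *\<^sub>R b)) differentiable (at (0::real))" if "b \<in> D" "u \<in> W" for b u
    by (rule differentiable_line_cong[OF assms(1) that(2) span_base[OF that(1)], of f])
      (use Suc.prems that in auto)
  moreover have "ck_on k D W (dd g b)" if "b \<in> D" for b
  proof (rule Suc.IH)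
    show "ck_on k D W (dd f b)" using Suc.prems that by auto
    show "dd f b u = dd g b u" if "u \<in> W" for u
      using dd_cong[OF assms(1) that span_base[OF \<open>b \<in> D\<close>] Suc.prems(1)] .
  qed
  ultimately show ?case using c by auto
qed

lemma ck_on_subset: "ck_on k D W f \<Longrightarrow> V \<subseteq> W \<Longrightarrow> ck_on k D V f"
  by (induction k arbitrary: f) (auto intro: continuous_on_subset)

lemma smooth_on_cong:
  "oset D W \<Longrightarrow> smooth_on D W f \<Longrightarrow> (\<And>u. u \<in> W \<Longrightarrow> f u = g u) \<Longrightarrow> smooth_on D W g"
  unfolding smooth_on_def using ck_on_cong by blast

lemma smooth_on_subset: "smooth_on D W f \<Longrightarrow> V \<subseteq> W \<Longrightarrow> smooth_on D V f"
  unfolding smooth_on_def using ck_on_subset by blast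

lemma oset_Int: "oset D W \<Longrightarrow> oset D V \<Longrightarrow> oset D (W \<inter> V)"
  by (auto simp: oset_def)

lemma continuous_on_oset_local:
  assumes "\<And>u. u \<in> W \<Longrightarrow> \<exists>V. oset D V \<and> u \<in> V \<and> continuous_on (V \<inter> W) f" "oset D W"
  shows "continuous_on W f"
proof -
  have "continuous (at u within W) f" if u: "u \<in> W" for u
  proof -
    obtain V where V: "oset D V" "u \<in> V" "continuous_on (V \<inter> W) f" using assms u by blast
    then obtain T where T: "open T" "V = span D \<inter> T" unfolding oset_def openin_open by auto
    have "continuous (at u within (V \<inter> W)) f"
      using V u by (simp add: continuous_on_eq_continuous_within)
    moreover have "V \<inter> W = W \<inter> T" using T oset_sub_span[OF assms(2)] by auto
    moreover have "u \<in> T" using V T by auto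
    ultimately show ?thesis
      using T(1) at_within_nhd[of u T "W \<inter> T" W] by (auto simp: continuous_within Int_ac)
  qed
  then show ?thesis by (simp add: continuous_on_eq_continuous_within)
qed

lemma ck_on_local:
  assumes "oset D W" "\<And>u. u \<in> W \<Longrightarrow> \<exists>V. oset D V \<and> u \<in> V \<and> ck_on k D (V \<inter> W) f"
  shows "ck_on k D W f"
  using assms(2)
proof (induction k arbitrary: f)
  case 0
  then show ?case using continuous_on_oset_local[OF _ assms(1)] by auto
next
  case (Suc k)
  have "continuous_on W f"
    using continuous_on_oset_local[OF _ assms(1), of f] Suc.prems by fastforce
  moreover have "ck_on k D W (dd f b)" if "b \<in> D" for b
    using Suc.IH[of "dd f b"] Suc.prems that by fastforce
  moreover have "(\<lambda>t. f (u + t *\<^sub>R b)) differentiable (at (0::real))" if "b \<in> D" "u \<in> W" for b u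
    using Suc.prems that by fastforce
  ultimately show ?case by auto
qed

lemma smooth_on_local:
  assumes "oset D W" "\<And>u. u \<in> W \<Longrightarrow> \<exists>V. oset D V \<and> u \<in> V \<and> smooth_on D (V \<inter> W) f"
  shows "smooth_on D W f"
  unfolding smooth_on_def
  by (intro allI ck_on_local[OF assms(1)]) (meson assms(2) smooth_on_ck)


section \<open>Total differentiability from continuous partial derivatives, and the chain rule along
  curves\<close>

lemma norm_partial_sum_le:
  assumes "D \<subseteq> (Basis::'e::euclidean_space set)" "E \<subseteq> D" "b \<in> D - E" "\<bar>t\<bar> \<le> \<bar>w \<bullet> b\<bar>"
  shows "norm ((\<Sum>c\<in>E. (w \<bullet> c) *\<^sub>R c) + t *\<^sub>R b) \<le> norm w"
proof (rule norm_le_componentwise)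
  fix i :: 'e assume i: "i \<in> Basis"
  have fin: "finite E" using assms finite_coords finite_subset by blast
  have 1: "(\<Sum>c\<in>E. (w \<bullet> c) *\<^sub>R c) \<bullet> i = (\<Sum>c\<in>E. if c = i then w \<bullet> i else 0)"
    unfolding inner_sum_left by (rule sum.cong) (use i assms in \<open>auto simp: inner_Basis\<close>)
  have 2: "(t *\<^sub>R b) \<bullet> i = (if b = i then t else 0)" using i assms by (auto simp: inner_Basis)
  show "\<bar>((\<Sum>c\<in>E. (w \<bullet> c) *\<^sub>R c) + t *\<^sub>R b) \<bullet> i\<bar> \<le> \<bar>w \<bullet> i\<bar>"
    unfolding inner_add_left 1 2 using fin assms by (auto simp: sum.delta)
qed

text \<open>The mean value inequality for \<open>f (z + t *\<^sub>R b) - t *\<^sub>R L\<close>,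
  whose derivative is the deviation of the partial derivative from \<open>L\<close>. It controls one
  coordinate step in the proof of differentiability.\<close>

lemma line_increment_bound:
  fixes f :: "'e::euclidean_space \<Rightarrow> 'f::real_normed_vector"
  assumes "\<And>t. \<bar>t\<bar> \<le> \<bar>s\<bar> \<Longrightarrow> (\<lambda>r. f ((z + t *\<^sub>R b) + r *\<^sub>R b)) differentiable (at (0::real))"
    and "\<And>t. \<bar>t\<bar> \<le> \<bar>s\<bar> \<Longrightarrow> norm (dd f b (z + t *\<^sub>R b) - L) \<le> B"
  shows "norm (f (z + s *\<^sub>R b) - f z - s *\<^sub>R L) \<le> B * \<bar>s\<bar>"
proof -
  define g where "g t = f (z + t *\<^sub>R b) - t *\<^sub>R L" for t
  \<comment> \<open>The symmetric interval covers both signs of \<open>s\<close>.\<close>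
  let ?S = "{-\<bar>s\<bar>..\<bar>s\<bar>}"
  have d: "(g has_derivative (\<lambda>h. h *\<^sub>R (dd f b (z + t *\<^sub>R b) - L))) (at t within ?S)" if "t \<in> ?S" for t
  proof -
    have "((\<lambda>r. f ((z + t *\<^sub>R b) + r *\<^sub>R b)) has_vector_derivative dd f b (z + t *\<^sub>R b)) (at 0)"
      using assms(1) that by (intro dd_has) auto
    then have 0: "((\<lambda>r. f (z + (t + r) *\<^sub>R b)) has_vector_derivative dd f b (z + t *\<^sub>R b)) (at 0)"
      by (simp add: algebra_simps)
    have "((\<lambda>r. f (z + (t + (r - t)) *\<^sub>R b)) has_vector_derivative dd f b (z + t *\<^sub>R b)) (at t)"
    proof -
      have "((\<lambda>r. r - t) has_vector_derivative 1) (at t)" by (auto intro!: derivative_eq_intros)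
      from vector_diff_chain_at[OF this, of "\<lambda>r. f (z + (t + r) *\<^sub>R b)"] 0
      show ?thesis by (simp add: o_def)
    qed
    then have "(g has_vector_derivative (dd f b (z + t *\<^sub>R b) - L)) (at t)"
      unfolding g_def by (auto intro!: derivative_eq_intros)
    then show ?thesis
      unfolding has_vector_derivative_def by (rule has_derivative_at_withinI)
  qed
  have "norm (g s - g 0) \<le> B * norm (s - 0)"
  proof (rule differentiable_bound[OF _ d])
    show "convex ?S" by simp
    show "onorm (\<lambda>h. h *\<^sub>R (dd f b (z + t *\<^sub>R b) - L)) \<le> B" if "t \<in> ?S" for t
    proof (rule onorm_le)
      have "norm (dd f b (z + t *\<^sub>R b) - L) \<le> B" using assms(2)[of t] that by auto
      then show "norm (x *\<^sub>R (dd f b (z + t *\<^sub>R b) - L)) \<le> B * norm x" for x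
        by (simp add: mult.commute[of B] mult_left_mono)
    qed
  qed auto
  then show ?thesis by (simp add: g_def algebra_simps)
qed

text \<open>The increment is telescoped: one walks from \<open>u\<close> to \<open>u + w\<close>
  changing one coordinate at a time, and each step is compared with the partial derivative at
  \<open>u\<close>, which is close by continuity. The derivative is taken within
  \<open>span D\<close>, the only directions in which \<open>f\<close> is controlled.\<close>

lemma C1_has_derivative:
  fixes f :: "'e::euclidean_space \<Rightarrow> 'f::real_normed_vector"
  assumes o: "oset D W" and f: "ck_on (Suc 0) D W f" and u: "u \<in> W"
  shows "(f has_derivative (\<lambda>v. \<Sum>b\<in>D. (v \<bullet> b) *\<^sub>R dd f b u)) (at u within span D)"
  unfolding has_derivative_within_alt
proof (intro conjI allI impI)
  show "bounded_linear (\<lambda>v. \<Sum>b\<in>D. (v \<bullet> b) *\<^sub>R dd f b u)"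
    by (intro bounded_linear_sum bounded_linear_compose[OF bounded_linear_scaleR_left]
        bounded_linear_inner_left)
  fix e :: real assume e: "e > 0"
  have finD: "finite D" using o oset_finite by blast
  have DB: "D \<subseteq> Basis" using o by (simp add: oset_def)
  \<comment> \<open>The error \<open>e\<close> is shared among the \<open>card D\<close> coordinate
    steps; the added 1 keeps the quotient meaningful for empty \<open>D\<close>.\<close>
  define e' where "e' = e / (card D + 1)"
  have e': "e' > 0" using e by (simp add: e'_def)
  obtain r where r: "r > 0" "\<And>v. v \<in> span D \<Longrightarrow> norm v < r \<Longrightarrow> u + v \<in> W"
    using oset_ball[OF o u] by blast
  have "\<exists>s>0. \<forall>w\<in>W. dist w u < s \<longrightarrow> dist (dd f b w) (dd f b u) < e'" if "b \<in> D" for b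
    using f that u e' by (auto simp: continuous_on_iff)
  then obtain s where s: "\<And>b. b \<in> D \<Longrightarrow> s b > 0"
      "\<And>b w. b \<in> D \<Longrightarrow> w \<in> W \<Longrightarrow> dist w u < s b \<Longrightarrow> dist (dd f b w) (dd f b u) < e'"
    by metis
  define q where "q = Min (insert r (s ` D))"
  have q: "q > 0" "q \<le> r" "\<And>b. b \<in> D \<Longrightarrow> q \<le> s b"
    using finD r s by (auto simp: q_def)
  have step: "norm (f (u + (\<Sum>b\<in>E. (w \<bullet> b) *\<^sub>R b)) - f u - (\<Sum>b\<in>E. (w \<bullet> b) *\<^sub>R dd f b u))
      \<le> e' * (\<Sum>b\<in>E. \<bar>w \<bullet> b\<bar>)" if ED: "E \<subseteq> D" and wD: "w \<in> span D" and wq: "norm w < q" for w E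
    using finite_subset[OF ED finD] ED
  proof (induction E rule: finite_induct)
    case empty
    then show ?case by simp
  next
    case (insert b E)
    define z where "z = u + (\<Sum>c\<in>E. (w \<bullet> c) *\<^sub>R c)"
    \<comment> \<open>Every intermediate point differs from \<open>u\<close> by a vector dominated
      componentwise by \<open>w\<close>, so the whole path stays in the ball where the estimates
      hold.\<close>
    have zt: "z + t *\<^sub>R b \<in> W \<and> norm (z + t *\<^sub>R b - u) < q" if t: "\<bar>t\<bar> \<le> \<bar>w \<bullet> b\<bar>" for t
    proof -
      have "norm ((\<Sum>c\<in>E. (w \<bullet> c) *\<^sub>R c) + t *\<^sub>R b) \<le> norm w"
        using norm_partial_sum_le[OF DB, of E b t w] insert t by auto
      then have n: "norm ((\<Sum>c\<in>E. (w \<bullet> c) *\<^sub>R c) + t *\<^sub>R b) < q" using wq by simp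
      moreover have "(\<Sum>c\<in>E. (w \<bullet> c) *\<^sub>R c) + t *\<^sub>R b \<in> span D"
        using insert by (intro span_add span_sum span_scale span_base) auto
      ultimately have "u + ((\<Sum>c\<in>E. (w \<bullet> c) *\<^sub>R c) + t *\<^sub>R b) \<in> W" using r q by auto
      with n show ?thesis by (simp add: z_def add.assoc)
    qed
    have bD: "b \<in> D" using insert by auto
    have "norm (f (z + (w \<bullet> b) *\<^sub>R b) - f z - (w \<bullet> b) *\<^sub>R dd f b u) \<le> e' * \<bar>w \<bullet> b\<bar>"
    proof (rule line_increment_bound)
      fix t assume t: "\<bar>t\<bar> \<le> \<bar>w \<bullet> b\<bar>"
      show "(\<lambda>r. f ((z + t *\<^sub>R b) + r *\<^sub>R b)) differentiable (at (0::real))"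
        using f bD zt[OF t] by auto
      show "norm (dd f b (z + t *\<^sub>R b) - dd f b u) \<le> e'"
        using s(2)[OF bD, of "z + t *\<^sub>R b"] zt[OF t] q(3)[OF bD] by (auto simp: dist_norm)
    qed
    moreover have "norm (f z - f u - (\<Sum>c\<in>E. (w \<bullet> c) *\<^sub>R dd f c u)) \<le> e' * (\<Sum>c\<in>E. \<bar>w \<bullet> c\<bar>)"
      using insert unfolding z_def by auto
    ultimately have "norm ((f (z + (w \<bullet> b) *\<^sub>R b) - f z - (w \<bullet> b) *\<^sub>R dd f b u)
        + (f z - f u - (\<Sum>c\<in>E. (w \<bullet> c) *\<^sub>R dd f c u))) \<le> e' * \<bar>w \<bullet> b\<bar> + e' * (\<Sum>c\<in>E. \<bar>w \<bullet> c\<bar>)"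
      by (rule norm_triangle_le[OF add_mono])
    then show ?case using insert by (simp add: z_def algebra_simps)
  qed
  show "\<exists>d>0. \<forall>y\<in>span D. norm (y - u) < d \<longrightarrow>
      norm (f y - f u - (\<Sum>b\<in>D. ((y - u) \<bullet> b) *\<^sub>R dd f b u)) \<le> e * norm (y - u)"
  proof (intro exI[of _ q] conjI ballI impI)
    show "q > 0" by fact
    fix y assume y: "y \<in> span D" "norm (y - u) < q"
    have w: "y - u \<in> span D" using y u o by (intro span_diff) (auto simp: oset_in_span)
    have "norm (f y - f u - (\<Sum>b\<in>D. ((y - u) \<bullet> b) *\<^sub>R dd f b u)) \<le> e' * (\<Sum>b\<in>D. \<bar>(y - u) \<bullet> b\<bar>)"
      using step[OF order.refl w y(2)] span_coords_sum[OF DB w] by simp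
    also have "(\<Sum>b\<in>D. \<bar>(y - u) \<bullet> b\<bar>) \<le> card D * norm (y - u)"
      using DB by (intro sum_bounded_above) (auto simp: Basis_le_norm)
    also have "e' * (card D * norm (y - u)) \<le> e * norm (y - u)"
    proof -
      have "e' * card D \<le> e" using e by (simp add: e'_def field_simps)
      then have "(e' * card D) * norm (y - u) \<le> e * norm (y - u)" by (intro mult_right_mono) auto
      then show ?thesis by (simp add: mult.assoc)
    qed
    finally show "norm (f y - f u - (\<Sum>b\<in>D. ((y - u) \<bullet> b) *\<^sub>R dd f b u)) \<le> e * norm (y - u)"
      using e' by (simp add: mult_left_mono)
  qed
qed

lemma C1_curve_aux:
  fixes f :: "'e::euclidean_space \<Rightarrow> 'f::real_normed_vector"
  assumes o: "oset D W" and f: "ck_on (Suc 0) D W f" and u: "\<gamma> t \<in> W"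
    and g: "(\<gamma> has_vector_derivative v) (at t)" and s: "\<forall>\<^sub>F r in nhds t. \<gamma> r \<in> span D"
  shows "((\<lambda>r. f (\<gamma> r)) has_vector_derivative (\<Sum>b\<in>D. (v \<bullet> b) *\<^sub>R dd f b (\<gamma> t))) (at t)"
proof -
  from s obtain S where S: "open S" "t \<in> S" "\<And>r. r \<in> S \<Longrightarrow> \<gamma> r \<in> span D"
    unfolding eventually_nhds by auto
  have "(f has_derivative (\<lambda>v. \<Sum>b\<in>D. (v \<bullet> b) *\<^sub>R dd f b (\<gamma> t))) (at (\<gamma> t) within \<gamma> ` S)"
    using C1_has_derivative[OF o f u] by (rule has_derivative_subset) (use S in auto)
  moreover have "(\<gamma> has_derivative (\<lambda>x. x *\<^sub>R v)) (at t within S)"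
    using g unfolding has_vector_derivative_def by (rule has_derivative_at_withinI)
  ultimately have "((\<lambda>r. f (\<gamma> r)) has_derivative (\<lambda>x. \<Sum>b\<in>D. ((x *\<^sub>R v) \<bullet> b) *\<^sub>R dd f b (\<gamma> t))) (at t within S)"
    using has_derivative_in_compose by blast
  moreover have "(\<Sum>b\<in>D. ((x *\<^sub>R v) \<bullet> b) *\<^sub>R dd f b (\<gamma> t)) = x *\<^sub>R (\<Sum>b\<in>D. (v \<bullet> b) *\<^sub>R dd f b (\<gamma> t))" for x
    by (simp only: inner_scaleR_left scaleR_sum_right scaleR_scaleR)
  ultimately show ?thesis
    unfolding has_vector_derivative_def at_within_open[OF S(2,1)] by (simp only:)
qed

lemma C1_line:
  fixes f :: "'e::euclidean_space \<Rightarrow> 'f::real_normed_vector"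
  assumes o: "oset D W" and f: "ck_on (Suc 0) D W f" and u: "u \<in> W" and v: "v \<in> span D"
  shows "((\<lambda>r. f (u + r *\<^sub>R v)) has_vector_derivative dd f v u) (at 0)"
    and dd_sum: "dd f v u = (\<Sum>b\<in>D. (v \<bullet> b) *\<^sub>R dd f b u)"
proof -
  have "u + r *\<^sub>R v \<in> span D" for r
    using v oset_in_span[OF o u] by (simp add: span_add span_scale)
  then have *: "((\<lambda>r. f (u + r *\<^sub>R v)) has_vector_derivative (\<Sum>b\<in>D. (v \<bullet> b) *\<^sub>R dd f b u)) (at 0)"
  proof -
    have "((\<lambda>r. u + r *\<^sub>R v) has_vector_derivative v) (at 0)"
      by (auto intro!: derivative_eq_intros)
    then show ?thesis
      using C1_curve_aux[OF o f, of "\<lambda>r. u + r *\<^sub>R v" 0 v] u \<open>\<And>r. u + r *\<^sub>R v \<in> span D\<close> by simp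
  qed
  from dd_eqI[OF this] show "dd f v u = (\<Sum>b\<in>D. (v \<bullet> b) *\<^sub>R dd f b u)" .
  with * show "((\<lambda>r. f (u + r *\<^sub>R v)) has_vector_derivative dd f v u) (at 0)" by simp
qed

lemma C1_curve:
  fixes f :: "'e::euclidean_space \<Rightarrow> 'f::real_normed_vector"
  assumes o: "oset D W" and f: "ck_on (Suc 0) D W f" and u: "\<gamma> t \<in> W" and v: "v \<in> span D"
    and g: "(\<gamma> has_vector_derivative v) (at t)" and s: "\<forall>\<^sub>F r in nhds t. \<gamma> r \<in> span D"
  shows "((\<lambda>r. f (\<gamma> r)) has_vector_derivative dd f v (\<gamma> t)) (at t)"
  using C1_curve_aux[OF o f, where \<gamma> = \<gamma>, OF u g s] dd_sum[OF o f u v] by simp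

lemma dd_linear:
  fixes f :: "'e::euclidean_space \<Rightarrow> 'f::real_normed_vector"
  assumes o: "oset D W" and f: "ck_on (Suc 0) D W f" and u: "u \<in> W" and v: "v \<in> span D" "w \<in> span D"
  shows "dd f (s *\<^sub>R v + t *\<^sub>R w) u = s *\<^sub>R dd f v u + t *\<^sub>R dd f w u"
proof -
  have "s *\<^sub>R v + t *\<^sub>R w \<in> span D" using v by (intro span_add span_scale)
  then show ?thesis
    unfolding dd_sum[OF o f u v(1)] dd_sum[OF o f u v(2)] dd_sum[OF o f u \<open>s *\<^sub>R v + t *\<^sub>R w \<in> span D\<close>]
    by (simp only: inner_add_left inner_scaleR_left scaleR_left_distrib sum.distrib scaleR_sum_right
        scaleR_scaleR)
qed

text \<open>The components of \<phi> in the directions outside \<open>D'\<close> vanish on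
  \<open>W\<close>, hence so do their derivatives.\<close>

lemma dd_in_span:
  fixes \<phi> :: "'e::euclidean_space \<Rightarrow> 'f::euclidean_space"
  assumes o: "oset D W" and f: "ck_on (Suc 0) D W \<phi>" and u: "u \<in> W" and v: "v \<in> span D"
    and D': "D' \<subseteq> Basis" and sp: "\<And>u. u \<in> W \<Longrightarrow> \<phi> u \<in> span D'"
  shows "dd \<phi> v u \<in> span D'"
  unfolding span_coords_iff[OF D']
proof
  fix b assume b: "b \<in> Basis - D'"
  have "((\<lambda>r. \<phi> (u + r *\<^sub>R v) \<bullet> b) has_vector_derivative dd \<phi> v u \<bullet> b) (at 0)"
    using bounded_linear.has_vector_derivative[OF bounded_linear_inner_left C1_line(1)[OF o f u v]] .
  then have 1: "dd (\<lambda>u. \<phi> u \<bullet> b) v u = dd \<phi> v u \<bullet> b" by (rule dd_eqI)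
  have "dd (\<lambda>u. \<phi> u \<bullet> b) v u = dd (\<lambda>u. 0) v u"
  proof (rule dd_cong[OF o u v])
    fix u assume "u \<in> W"
    then have "\<phi> u \<in> span D'" by (rule sp)
    then show "\<phi> u \<bullet> b = 0" using b unfolding span_coords_iff[OF D'] by blast
  qed
  also have "\<dots> = 0" by (rule dd_eqI) (rule has_vector_derivative_const)
  finally show "dd \<phi> v u \<bullet> b = 0" using 1 by simp
qed

lemma has_vector_derivative_cong_nhds:
  assumes "(f has_vector_derivative f') (at x)" "\<forall>\<^sub>F t in nhds x. f t = g t"
  shows "(g has_vector_derivative f') (at x)"
  using assms(1) unfolding has_vector_derivative_def
  by (rule has_derivative_transform_eventually)
    (use assms(2) eventually_nhds_x_imp_x[OF assms(2)] in \<open>auto simp: eventually_nhds_conv_at\<close>)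

section \<open>Stability of C^k maps under algebraic operations and composition\<close>

lemma ck_on_SucI:
  assumes "continuous_on W f"
    and "\<And>b u. b \<in> D \<Longrightarrow> u \<in> W \<Longrightarrow> ((\<lambda>t. f (u + t *\<^sub>R b)) has_vector_derivative F b u) (at 0)"
    and "\<And>b. b \<in> D \<Longrightarrow> ck_on k D W (F b)" and "oset D W"
  shows "ck_on (Suc k) D W f"
proof -
  have "ck_on k D W (dd f b)" if b: "b \<in> D" for b
    using ck_on_cong[OF assms(4) _ assms(3)[OF b], of "dd f b"] dd_eqI[OF assms(2)[OF b]] by simp
  moreover have "(\<lambda>t. f (u + t *\<^sub>R b)) differentiable (at (0::real))" if "b \<in> D" "u \<in> W" for b u
    using assms(2)[OF that] unfolding has_vector_derivative_def differentiable_def by blast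
  ultimately show ?thesis using assms(1) by simp
qed

lemma ck_on_const: "oset D W \<Longrightarrow> ck_on k D W (\<lambda>u. c)"
proof (induction k arbitrary: c)
  case (Suc k)
  show ?case by (rule ck_on_SucI[where F = "\<lambda>b u. 0"]) (use Suc in auto)
qed simp

lemma ck_on_add:
  assumes "oset D W" "ck_on k D W f" "ck_on k D W g"
  shows "ck_on k D W (\<lambda>u. f u + g u)"
  using assms(2,3)
proof (induction k arbitrary: f g)
  case 0
  then show ?case by (auto intro: continuous_on_add)
next
  case (Suc k)
  show ?case
  proof (rule ck_on_SucI[where F = "\<lambda>b u. dd f b u + dd g b u"])
    show "continuous_on W (\<lambda>u. f u + g u)"
      using Suc.prems by (auto intro: continuous_on_add)
    show "((\<lambda>t. f (u + t *\<^sub>R b) + g (u + t *\<^sub>R b)) has_vector_derivative dd f b u + dd g b u) (at 0)"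
      if "b \<in> D" "u \<in> W" for b u
      using Suc.prems that by (intro has_vector_derivative_add dd_has) auto
    show "ck_on k D W (\<lambda>u. dd f b u + dd g b u)" if "b \<in> D" for b
      using Suc.prems that by (intro Suc.IH) auto
  qed fact
qed

lemma ck_on_bilinear:
  assumes h: "bounded_bilinear h" and "oset D W" "ck_on k D W f" "ck_on k D W g"
  shows "ck_on k D W (\<lambda>u. h (f u) (g u))"
  using assms(3,4)
proof (induction k arbitrary: f g)
  case 0
  then show ?case using h by (auto intro: bounded_bilinear.continuous_on)
next
  case (Suc k)
  show ?case
  proof (rule ck_on_SucI[where F = "\<lambda>b u. h (f u) (dd g b u) + h (dd f b u) (g u)"])
    show "continuous_on W (\<lambda>u. h (f u) (g u))"
      using Suc.prems h by (auto intro: bounded_bilinear.continuous_on)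
    show "((\<lambda>t. h (f (u + t *\<^sub>R b)) (g (u + t *\<^sub>R b))) has_vector_derivative
        h (f u) (dd g b u) + h (dd f b u) (g u)) (at 0)" if "b \<in> D" "u \<in> W" for b u
    proof -
      have "((\<lambda>t. f (u + t *\<^sub>R b)) has_vector_derivative dd f b u) (at 0)"
        "((\<lambda>t. g (u + t *\<^sub>R b)) has_vector_derivative dd g b u) (at 0)"
        using Suc.prems that by (auto intro!: dd_has)
      from bounded_bilinear.has_vector_derivative[OF h this] show ?thesis by simp
    qed
    show "ck_on k D W (\<lambda>u. h (f u) (dd g b u) + h (dd f b u) (g u))" if "b \<in> D" for b
    proof (intro ck_on_add assms(2) Suc.IH)
      show "ck_on k D W (dd f b)" "ck_on k D W (dd g b)" using Suc.prems that by auto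
      show "ck_on k D W f" "ck_on k D W g" using Suc.prems ck_on_Suc_imp by blast+
    qed
  qed fact
qed

lemma ck_on_bounded_linear:
  assumes "bounded_linear h" "oset D W" "ck_on k D W f"
  shows "ck_on k D W (\<lambda>u. h (f u))"
  using assms(3)
proof (induction k arbitrary: f)
  case 0
  then show ?case using assms(1) by (auto intro: bounded_linear.continuous_on)
next
  case (Suc k)
  show ?case
  proof (rule ck_on_SucI[where F = "\<lambda>b u. h (dd f b u)"])
    show "continuous_on W (\<lambda>u. h (f u))"
      using Suc.prems assms(1) by (auto intro: bounded_linear.continuous_on)
    show "((\<lambda>t. h (f (u + t *\<^sub>R b))) has_vector_derivative h (dd f b u)) (at 0)"
      if "b \<in> D" "u \<in> W" for b u
      using Suc.prems that
      by (intro bounded_linear.has_vector_derivative[OF assms(1)] dd_has) auto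
    show "ck_on k D W (\<lambda>u. h (dd f b u))" if "b \<in> D" for b
      using Suc.prems that by (intro Suc.IH) auto
  qed fact
qed

lemma ck_on_ident:
  assumes "oset D W"
  shows "ck_on k D W (\<lambda>u. u)"
proof (cases k)
  case (Suc k)
  have "ck_on (Suc k) D W (\<lambda>u. u)"
    by (rule ck_on_SucI[where F = "\<lambda>b u. b"])
      (use assms in \<open>auto intro!: derivative_eq_intros ck_on_const\<close>)
  with Suc show ?thesis by simp
qed simp

lemma ck_on_sum:
  assumes "oset D W" "\<And>i. i \<in> A \<Longrightarrow> ck_on k D W (f i)"
  shows "ck_on k D W (\<lambda>u. \<Sum>i\<in>A. f i u)"
  using assms(2)
proof (induction A rule: infinite_finite_induct)
  case (insert i A)
  then show ?case by (auto intro!: ck_on_add assms(1))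
qed (auto intro: ck_on_const assms(1))

lemma ck_on_C1_compose:
  assumes o: "oset D W" and o': "oset D' W'" and f: "ck_on (Suc 0) D W f"
    and p: "ck_on (Suc 0) D' W' \<phi>" and im: "\<phi> ` W' \<subseteq> W" and u: "u \<in> W'" and v: "v \<in> span D'"
  shows "((\<lambda>t. f (\<phi> (u + t *\<^sub>R v))) has_vector_derivative dd f (dd \<phi> v u) (\<phi> u)) (at 0)"
    and "dd \<phi> v u \<in> span D"
proof -
  have sp: "\<And>u. u \<in> W' \<Longrightarrow> \<phi> u \<in> span D" using im oset_sub_span[OF o] by blast
  show 1: "dd \<phi> v u \<in> span D"
    using dd_in_span[OF o' p u v _ sp] o by (simp add: oset_def)
  have "\<forall>\<^sub>F t in nhds 0. \<phi> (u + t *\<^sub>R v) \<in> span D"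
    using oset_ev_line[OF o' u v] by eventually_elim (rule sp)
  then show "((\<lambda>t. f (\<phi> (u + t *\<^sub>R v))) has_vector_derivative dd f (dd \<phi> v u) (\<phi> u)) (at 0)"
    using C1_curve[OF o f, of "\<lambda>t. \<phi> (u + t *\<^sub>R v)" 0, OF _ 1 C1_line(1)[OF o' p u v]] u im by auto
qed

text \<open>By the chain rule the partial derivatives of the composite are sums of products of a
  partial derivative of \<phi> with a composite \<open>dd f c (\<phi> u)\<close>. The induction is
  on \<open>k\<close> with \<open>f\<close> varying and \<phi> fixed, so it applies to those
  composites.\<close>

lemma ck_on_compose:
  assumes o: "oset D W" and o': "oset D' W'" and f: "ck_on k D W f"
    and p: "ck_on k D' W' \<phi>" and im: "\<phi> ` W' \<subseteq> W"
  shows "ck_on k D' W' (\<lambda>u. f (\<phi> u))"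
  using f p
proof (induction k arbitrary: f)
  case 0
  then show ?case using continuous_on_compose2[of W f W' \<phi>] im by auto
next
  case (Suc k)
  have f1: "ck_on (Suc 0) D W f" and p1: "ck_on (Suc 0) D' W' \<phi>"
    using Suc.prems ck_on_1 by blast+
  have pk: "ck_on k D' W' \<phi>" using Suc.prems ck_on_Suc_imp by blast
  show ?case
  proof (rule ck_on_SucI[where F = "\<lambda>b u. \<Sum>c\<in>D. (dd \<phi> b u \<bullet> c) *\<^sub>R dd f c (\<phi> u)"])
    show "continuous_on W' (\<lambda>u. f (\<phi> u))"
      using continuous_on_compose2[of W f W' \<phi>] im f1 p1 by auto
    show "((\<lambda>t. f (\<phi> (u + t *\<^sub>R b))) has_vector_derivative
        (\<Sum>c\<in>D. (dd \<phi> b u \<bullet> c) *\<^sub>R dd f c (\<phi> u))) (at 0)" if b: "b \<in> D'" and u: "u \<in> W'" for b u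
    proof -
      note * = ck_on_C1_compose[OF o o' f1 p1 im u span_base[OF b]]
      have "dd f (dd \<phi> b u) (\<phi> u) = (\<Sum>c\<in>D. (dd \<phi> b u \<bullet> c) *\<^sub>R dd f c (\<phi> u))"
        using dd_sum[OF o f1 _ *(2)] u im by auto
      with *(1) show ?thesis by simp
    qed
    show "ck_on k D' W' (\<lambda>u. \<Sum>c\<in>D. (dd \<phi> b u \<bullet> c) *\<^sub>R dd f c (\<phi> u))" if "b \<in> D'" for b
    proof (intro ck_on_sum ck_on_bilinear[OF bounded_bilinear_scaleR] o')
      fix c assume c: "c \<in> D"
      show "ck_on k D' W' (\<lambda>u. dd \<phi> b u \<bullet> c)"
        by (rule ck_on_bounded_linear[OF bounded_linear_inner_left o']) (use Suc.prems that in auto)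
      show "ck_on k D' W' (\<lambda>u. dd f c (\<phi> u))"
        by (rule Suc.IH) (use Suc.prems c pk in auto)
    qed
  qed fact
qed

lemma ck_on_dd:
  assumes o: "oset D W" and "ck_on (Suc k) D W f" "v \<in> span D"
  shows "ck_on k D W (dd f v)"
proof (rule ck_on_cong[OF o])
  show "ck_on k D W (\<lambda>u. \<Sum>b\<in>D. (v \<bullet> b) *\<^sub>R dd f b u)"
    by (intro ck_on_sum o ck_on_bounded_linear[OF bounded_linear_scaleR_right]) (use assms in auto)
  show "(\<Sum>b\<in>D. (v \<bullet> b) *\<^sub>R dd f b u) = dd f v u" if "u \<in> W" for u
    using dd_sum[OF o ck_on_1[OF assms(2)] that assms(3)] by simp
qed

lemma smooth_on_const: "oset D W \<Longrightarrow> smooth_on D W (\<lambda>u. c)"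
  by (simp add: smooth_on_def ck_on_const)

lemma smooth_on_add:
  "oset D W \<Longrightarrow> smooth_on D W f \<Longrightarrow> smooth_on D W g \<Longrightarrow> smooth_on D W (\<lambda>u. f u + g u)"
  unfolding smooth_on_def by (blast intro: ck_on_add)

lemma smooth_on_sum:
  "oset D W \<Longrightarrow> (\<And>i. i \<in> A \<Longrightarrow> smooth_on D W (f i)) \<Longrightarrow> smooth_on D W (\<lambda>u. \<Sum>i\<in>A. f i u)"
  unfolding smooth_on_def by (blast intro: ck_on_sum)

lemma smooth_on_ident: "oset D W \<Longrightarrow> smooth_on D W (\<lambda>u. u)"
  unfolding smooth_on_def by (blast intro: ck_on_ident)

lemma smooth_on_bounded_linear:
  "bounded_linear h \<Longrightarrow> oset D W \<Longrightarrow> smooth_on D W f \<Longrightarrow> smooth_on D W (\<lambda>u. h (f u))"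
  unfolding smooth_on_def by (blast intro: ck_on_bounded_linear)

lemma smooth_on_bilinear:
  "bounded_bilinear h \<Longrightarrow> oset D W \<Longrightarrow> smooth_on D W f \<Longrightarrow> smooth_on D W g \<Longrightarrow>
    smooth_on D W (\<lambda>u. h (f u) (g u))"
  unfolding smooth_on_def by (blast intro: ck_on_bilinear)

lemma smooth_on_mult:
  fixes f g :: "'e::euclidean_space \<Rightarrow> real"
  shows "oset D W \<Longrightarrow> smooth_on D W f \<Longrightarrow> smooth_on D W g \<Longrightarrow> smooth_on D W (\<lambda>u. f u * g u)"
  by (rule smooth_on_bilinear[OF bounded_bilinear_mult])

lemma smooth_on_compose:
  "oset D W \<Longrightarrow> oset D' W' \<Longrightarrow> smooth_on D W f \<Longrightarrow> smooth_on D' W' \<phi> \<Longrightarrow> \<phi> ` W' \<subseteq> W \<Longrightarrow>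
    smooth_on D' W' (\<lambda>u. f (\<phi> u))"
  unfolding smooth_on_def by (blast intro: ck_on_compose[of D W])

lemma smooth_on_dd: "oset D W \<Longrightarrow> smooth_on D W f \<Longrightarrow> v \<in> span D \<Longrightarrow> smooth_on D W (dd f v)"
  unfolding smooth_on_def by (blast intro: ck_on_dd)

lemma smooth_on_line:
  "oset D W \<Longrightarrow> smooth_on D W f \<Longrightarrow> u \<in> W \<Longrightarrow> v \<in> span D \<Longrightarrow>
    ((\<lambda>r. f (u + r *\<^sub>R v)) has_vector_derivative dd f v u) (at 0)"
  by (rule C1_line[OF _ smooth_on_ck])

lemma dd_compose:
  assumes "oset D W" "oset D' W'" "smooth_on D W f" "smooth_on D' W' \<phi>" "\<phi> ` W' \<subseteq> W"
    "u \<in> W'" "v \<in> span D'"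
  shows "dd (\<lambda>u. f (\<phi> u)) v u = dd f (dd \<phi> v u) (\<phi> u)"
  by (rule dd_eqI, rule ck_on_C1_compose[OF assms(1,2) _ _ assms(5-7)])
    (use assms smooth_on_ck in blast)+

lemma dd_smooth_in_span:
  assumes "oset D W" "oset D' W'" "smooth_on D' W' \<phi>" "\<phi> ` W' \<subseteq> W" "u \<in> W'" "v \<in> span D'"
  shows "dd \<phi> v u \<in> span D"
  using dd_in_span[OF assms(2) smooth_on_ck[OF assms(3)] assms(5,6)] assms(1,4) oset_sub_span[OF assms(1)]
  by (auto simp: oset_def)

section \<open>Symmetry of second derivatives\<close>

lemma second_difference:
  fixes f :: "'e::euclidean_space \<Rightarrow> real"
  assumes o: "oset D W" and f: "ck_on (Suc (Suc 0)) D W f" and v: "v \<in> span D" and w: "w \<in> span D"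
    and s: "s > 0" and W: "\<And>x y. 0 \<le> x \<Longrightarrow> x \<le> s \<Longrightarrow> 0 \<le> y \<Longrightarrow> y \<le> s \<Longrightarrow> u + x *\<^sub>R v + y *\<^sub>R w \<in> W"
  obtains x y where "0 \<le> x" "x \<le> s" "0 \<le> y" "y \<le> s"
    "f (u + s *\<^sub>R v + s *\<^sub>R w) - f (u + s *\<^sub>R v) - f (u + s *\<^sub>R w) + f u
      = s^2 * dd (dd f v) w (u + x *\<^sub>R v + y *\<^sub>R w)"
proof -
  have f1: "ck_on (Suc 0) D W f" using ck_on_1[OF f] .
  have f2: "ck_on (Suc 0) D W (dd f v)" by (rule ck_on_dd[OF o f v])
  have D: "((\<lambda>t. F (z + t *\<^sub>R c)) has_real_derivative dd F c (z + t *\<^sub>R c)) (at t)"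
    if "ck_on (Suc 0) D W F" "z + t *\<^sub>R c \<in> W" "c \<in> span D" for F :: "'e \<Rightarrow> real" and z c t
  proof -
    have "((\<lambda>r. F ((z + t *\<^sub>R c) + r *\<^sub>R c)) has_vector_derivative dd F c (z + t *\<^sub>R c)) (at 0)"
      using C1_line(1)[OF o that] .
    then have 0: "((\<lambda>r. F (z + (t + r) *\<^sub>R c)) has_vector_derivative dd F c (z + t *\<^sub>R c)) (at 0)"
      by (simp add: algebra_simps)
    have "((\<lambda>r. r - t) has_vector_derivative 1) (at t)" by (auto intro!: derivative_eq_intros)
    from vector_diff_chain_at[OF this, of "\<lambda>r. F (z + (t + r) *\<^sub>R c)"] 0
    show ?thesis by (simp add: o_def has_real_derivative_iff_has_vector_derivative)
  qed
  have e: "u + x *\<^sub>R v + s *\<^sub>R w = (u + s *\<^sub>R w) + x *\<^sub>R v" for x by simp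
  \<comment> \<open>The second difference is the increment of \<phi> over \<open>[0, s]\<close>. One
    mean value theorem in direction \<open>v\<close> and another in direction \<open>w\<close>,
    applied to the derivative of \<open>f\<close> along \<open>v\<close>, produce the intermediate
    point.\<close>
  define \<phi> where "\<phi> x = f ((u + s *\<^sub>R w) + x *\<^sub>R v) - f (u + x *\<^sub>R v)" for x
  have "\<exists>z. z > 0 \<and> z < s \<and> \<phi> s - \<phi> 0 = (s - 0) * (dd f v ((u + s *\<^sub>R w) + z *\<^sub>R v) - dd f v (u + z *\<^sub>R v))"
  proof (rule MVT2[OF s])
    fix x assume x: "0 \<le> x" "x \<le> s"
    show "(\<phi> has_real_derivative dd f v ((u + s *\<^sub>R w) + x *\<^sub>R v) - dd f v (u + x *\<^sub>R v)) (at x)"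
      unfolding \<phi>_def using W[of x s] W[of x 0] x s e[of x]
      by (intro DERIV_diff D f1 v) auto
  qed
  then obtain x where x: "x > 0" "x < s"
      "\<phi> s - \<phi> 0 = s * (dd f v ((u + s *\<^sub>R w) + x *\<^sub>R v) - dd f v (u + x *\<^sub>R v))" by auto
  have "\<exists>z. z > 0 \<and> z < s \<and> dd f v ((u + x *\<^sub>R v) + s *\<^sub>R w) - dd f v ((u + x *\<^sub>R v) + 0 *\<^sub>R w)
      = (s - 0) * dd (dd f v) w ((u + x *\<^sub>R v) + z *\<^sub>R w)"
    by (rule MVT2[OF s]) (use x W in \<open>auto intro!: D f2 w\<close>)
  then obtain y where y: "y > 0" "y < s"
    "dd f v ((u + x *\<^sub>R v) + s *\<^sub>R w) - dd f v (u + x *\<^sub>R v) = s * dd (dd f v) w (u + x *\<^sub>R v + y *\<^sub>R w)"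
    by auto
  have "\<phi> s - \<phi> 0 = s^2 * dd (dd f v) w (u + x *\<^sub>R v + y *\<^sub>R w)"
    using x(3) y(3) e[of x] by (simp add: power2_eq_square)
  then show thesis
    using that[of x y] x y e[of s] by (simp add: \<phi>_def)
qed

text \<open>The second difference over a parallelogram is symmetric in \<open>v\<close> and
  \<open>w\<close>. Divided by \<open>s^2\<close> it is a value of either mixed derivative at some
  point of the parallelogram, so two different values at \<open>u\<close> contradict continuity once
  the parallelogram is small.\<close>

lemma dd_commute_real:
  fixes f :: "'e::euclidean_space \<Rightarrow> real"
  assumes o: "oset D W" and f: "ck_on (Suc (Suc 0)) D W f" and u: "u \<in> W" and v: "v \<in> span D" and w: "w \<in> span D"
  shows "dd (dd f v) w u = dd (dd f w) v u"
proof (rule ccontr)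
  assume ne: "dd (dd f v) w u \<noteq> dd (dd f w) v u"
  \<comment> \<open>Half the gap: the common value cannot be closer than \<open>e\<close> to both
    mixed derivatives at \<open>u\<close>.\<close>
  define e where "e = \<bar>dd (dd f v) w u - dd (dd f w) v u\<bar> / 2"
  have e: "e > 0" using ne by (simp add: e_def)
  have c: "continuous_on W (dd (dd f v) w)" "continuous_on W (dd (dd f w) v)"
    using ck_on_dd[OF o ck_on_dd[OF o f v] w] ck_on_dd[OF o ck_on_dd[OF o f w] v] by auto
  obtain r1 where r1: "r1 > 0" "\<And>z. z \<in> W \<Longrightarrow> dist z u < r1 \<Longrightarrow> dist (dd (dd f v) w z) (dd (dd f v) w u) < e"
    using c(1)[unfolded continuous_on_iff] u e by metis
  obtain r2 where r2: "r2 > 0" "\<And>z. z \<in> W \<Longrightarrow> dist z u < r2 \<Longrightarrow> dist (dd (dd f w) v z) (dd (dd f w) v u) < e"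
    using c(2)[unfolded continuous_on_iff] u e by metis
  obtain r3 where r3: "r3 > 0" "\<And>z. z \<in> span D \<Longrightarrow> norm z < r3 \<Longrightarrow> u + z \<in> W"
    using oset_ball[OF o u] by blast
  define r where "r = min r1 (min r2 r3)"
  \<comment> \<open>With this side length the parallelogram has radius at most \<open>r / 2\<close>;
    the added 1 avoids division by zero when \<open>v\<close> and \<open>w\<close> vanish.\<close>
  define s where "s = r / (2 * (norm v + norm w + 1))"
  have r: "r > 0" using r1 r2 r3 by (simp add: r_def)
  have s: "s > 0" using r by (auto simp: s_def intro!: divide_pos_pos add_nonneg_pos)
  have small: "norm (x *\<^sub>R v + y *\<^sub>R w) < r" if "0 \<le> x" "x \<le> s" "0 \<le> y" "y \<le> s" for x y
  proof -
    have "norm (x *\<^sub>R v + y *\<^sub>R w) \<le> x * norm v + y * norm w"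
      using that by (metis abs_of_nonneg norm_scaleR norm_triangle_ineq)
    also have "\<dots> \<le> s * norm v + s * norm w" using that by (intro add_mono mult_right_mono) auto
    also have "\<dots> \<le> s * (norm v + norm w + 1)" using s by (simp add: algebra_simps)
    also have "\<dots> = r / 2" 
    proof -
      have "norm v + norm w + 1 \<noteq> 0" using norm_ge_zero[of v] norm_ge_zero[of w] by linarith
      then show ?thesis unfolding s_def by (metis divide_divide_eq_left nonzero_eq_divide_eq)
    qed
    also have "\<dots> < r" using r by simp
    finally show ?thesis .
  qed
  have inW: "u + x *\<^sub>R v + y *\<^sub>R w \<in> W" if "0 \<le> x" "x \<le> s" "0 \<le> y" "y \<le> s" for x y
    using r3(2)[of "x *\<^sub>R v + y *\<^sub>R w"] small[OF that] v w
    by (simp add: r_def span_add span_scale add.assoc)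
  have inW': "u + x *\<^sub>R w + y *\<^sub>R v \<in> W" if "0 \<le> x" "x \<le> s" "0 \<le> y" "y \<le> s" for x y
    using inW[of y x] that by (simp add: algebra_simps)
  obtain x y where 1: "0 \<le> x" "x \<le> s" "0 \<le> y" "y \<le> s"
    "f (u + s *\<^sub>R v + s *\<^sub>R w) - f (u + s *\<^sub>R v) - f (u + s *\<^sub>R w) + f u
      = s^2 * dd (dd f v) w (u + x *\<^sub>R v + y *\<^sub>R w)"
    by (rule second_difference[of D W f v w s u, OF o f v w s inW])
  obtain x' y' where 2: "0 \<le> x'" "x' \<le> s" "0 \<le> y'" "y' \<le> s"
    "f (u + s *\<^sub>R w + s *\<^sub>R v) - f (u + s *\<^sub>R w) - f (u + s *\<^sub>R v) + f u
      = s^2 * dd (dd f w) v (u + x' *\<^sub>R w + y' *\<^sub>R v)"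
    by (rule second_difference[of D W f w v s u, OF o f w v s inW'])
  have "u + s *\<^sub>R w + s *\<^sub>R v = u + s *\<^sub>R v + s *\<^sub>R w" by simp
  then have "s^2 * dd (dd f v) w (u + x *\<^sub>R v + y *\<^sub>R w) = s^2 * dd (dd f w) v (u + x' *\<^sub>R w + y' *\<^sub>R v)"
    using 1(5) 2(5)[unfolded \<open>u + s *\<^sub>R w + s *\<^sub>R v = u + s *\<^sub>R v + s *\<^sub>R w\<close>] by linarith
  then have eq: "dd (dd f v) w (u + x *\<^sub>R v + y *\<^sub>R w) = dd (dd f w) v (u + x' *\<^sub>R w + y' *\<^sub>R v)"
    using s by simp
  have a: "\<bar>dd (dd f v) w (u + x *\<^sub>R v + y *\<^sub>R w) - dd (dd f v) w u\<bar> < e"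
    using r1(2)[OF inW[OF 1(1-4)]] small[OF 1(1-4)] unfolding dist_norm add.assoc r_def by simp
  have "norm (x' *\<^sub>R w + y' *\<^sub>R v) < r"
    using small[OF 2(3,4) 2(1,2)] add.commute[of "x' *\<^sub>R w"] by metis
  then have b: "\<bar>dd (dd f w) v (u + x' *\<^sub>R w + y' *\<^sub>R v) - dd (dd f w) v u\<bar> < e"
    using r2(2)[OF inW'[OF 2(1-4)]] unfolding dist_norm add.assoc r_def by simp
  have tri: "\<bar>A - B\<bar> \<le> \<bar>C - A\<bar> + \<bar>C - B\<bar>" for A B C :: real by linarith
  show False
    using a b tri[of "dd (dd f v) w u" "dd (dd f w) v u" "dd (dd f v) w (u + x *\<^sub>R v + y *\<^sub>R w)"]
    unfolding eq e_def by simp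
qed

lemma dd_inner:
  fixes f :: "'e::euclidean_space \<Rightarrow> 'f::euclidean_space"
  assumes "oset D W" "ck_on (Suc 0) D W f" "u \<in> W" "v \<in> span D"
  shows "dd (\<lambda>u. f u \<bullet> c) v u = dd f v u \<bullet> c"
  by (rule dd_eqI, rule bounded_linear.has_vector_derivative[OF bounded_linear_inner_left],
      rule C1_line(1)[OF assms])

lemma dd_commute:
  fixes f :: "'e::euclidean_space \<Rightarrow> 'f::euclidean_space"
  assumes o: "oset D W" and f: "smooth_on D W f" and u: "u \<in> W" and v: "v \<in> span D" and w: "w \<in> span D"
  shows "dd (dd f v) w u = dd (dd f w) v u"
proof (rule euclidean_eqI)
  fix c :: 'f assume "c \<in> Basis"
  have *: "dd (dd f v) w u \<bullet> c = dd (dd (\<lambda>u. f u \<bullet> c) v) w u" if "v \<in> span D" "w \<in> span D" for v w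
  proof -
    have "dd (dd f v) w u \<bullet> c = dd (\<lambda>u. dd f v u \<bullet> c) w u"
      by (rule dd_inner[symmetric, OF o smooth_on_ck[OF smooth_on_dd[OF o f that(1)]] u that(2)])
    also have "\<dots> = dd (dd (\<lambda>u. f u \<bullet> c) v) w u"
      by (rule dd_cong[OF o u that(2)]) (rule dd_inner[symmetric, OF o smooth_on_ck[OF f] _ that(1)])
    finally show ?thesis .
  qed
  have "smooth_on D W (\<lambda>u. f u \<bullet> c)"
    by (rule smooth_on_bounded_linear[OF bounded_linear_inner_left o f])
  then show "dd (dd f v) w u \<bullet> c = dd (dd f w) v u \<bullet> c"
    unfolding *[OF v w] *[OF w v] by (rule dd_commute_real[OF o smooth_on_ck u v w])
qed

section \<open>Symmetric forms and orthogonal frames\<close>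

text \<open>Linearity relative to \<open>V\<close>: tensor components are controlled on
  \<open>span (coords M)\<close> only and are arbitrary for other vectors of the model space, so the
  global notion \<open>linear\<close> does not fit.\<close>

definition slin :: "'e::euclidean_space set \<Rightarrow> ('e \<Rightarrow> real) \<Rightarrow> bool" where
  "slin V f \<longleftrightarrow> (\<forall>v\<in>V. \<forall>w\<in>V. \<forall>s t. f (s *\<^sub>R v + t *\<^sub>R w) = s * f v + t * f w)"

lemma slinD: "slin V f \<Longrightarrow> v \<in> V \<Longrightarrow> w \<in> V \<Longrightarrow> f (s *\<^sub>R v + t *\<^sub>R w) = s * f v + t * f w"
  by (simp add: slin_def)

lemma slin_scale_arg: "slin V f \<Longrightarrow> v \<in> V \<Longrightarrow> f (s *\<^sub>R v) = s * f v"
  using slinD[of V f v v s 0] by simp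

lemma slin_zero: "slin V f \<Longrightarrow> subspace V \<Longrightarrow> f 0 = 0"
  using slin_scale_arg[of V f 0 0] subspace_0 by force

lemma slin_sum_arg:
  assumes "slin V f" "subspace V" "\<And>i. i \<in> A \<Longrightarrow> x i \<in> V"
  shows "f (\<Sum>i\<in>A. c i *\<^sub>R x i) = (\<Sum>i\<in>A. c i * f (x i))"
  using assms(3)
proof (induction A rule: infinite_finite_induct)
  case (insert i A)
  have "(\<Sum>i\<in>A. c i *\<^sub>R x i) \<in> V"
    using insert.prems by (intro subspace_sum assms(2) subspace_scale) auto
  then have "f (c i *\<^sub>R x i + 1 *\<^sub>R (\<Sum>i\<in>A. c i *\<^sub>R x i)) = c i * f (x i) + 1 * f (\<Sum>i\<in>A. c i *\<^sub>R x i)"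
    using insert.prems by (intro slinD[OF assms(1)]) auto
  then show ?case using insert by simp
qed (simp_all add: slin_zero[OF assms(1,2)])

lemma slin_basis:
  assumes "D \<subseteq> (Basis::'e::euclidean_space set)" "slin (span D) f" "v \<in> span D"
  shows "f v = (\<Sum>b\<in>D. (v \<bullet> b) * f b)"
proof -
  have "f (\<Sum>b\<in>D. (v \<bullet> b) *\<^sub>R b) = (\<Sum>b\<in>D. (v \<bullet> b) * f b)"
    by (rule slin_sum_arg[OF assms(2) subspace_span span_base])
  then show ?thesis unfolding span_coords_sum[OF assms(1,3)] .
qed

lemma slin_sum_fun: "(\<And>i. i \<in> A \<Longrightarrow> slin V (f i)) \<Longrightarrow> slin V (\<lambda>v. \<Sum>i\<in>A. f i v)"
  by (simp add: slin_def sum.distrib sum_distrib_left)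

lemma slin_add: "slin V f \<Longrightarrow> slin V g \<Longrightarrow> slin V (\<lambda>v. f v + g v)"
  by (simp add: slin_def algebra_simps)

lemma slin_diff: "slin V f \<Longrightarrow> slin V g \<Longrightarrow> slin V (\<lambda>v. f v - g v)"
  by (simp add: slin_def algebra_simps)

lemma slin_cmult: "slin V f \<Longrightarrow> slin V (\<lambda>v. c * f v)"
  by (simp add: slin_def algebra_simps)

lemma slin_multc: "slin V f \<Longrightarrow> slin V (\<lambda>v. f v * c)"
  by (simp add: slin_def algebra_simps)

lemma slin_divide: "slin V f \<Longrightarrow> slin V (\<lambda>v. f v / c)"
  by (simp add: slin_def add_divide_distrib)

lemmas slin_intros = slin_sum_fun slin_add slin_diff slin_cmult slin_multc slin_divide

section \<open>Inner products on a subspace and their orthogonal frames\<close>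

definition symform :: "'e::euclidean_space set \<Rightarrow> ('e \<Rightarrow> 'e \<Rightarrow> real) \<Rightarrow> bool" where
  "symform V b \<longleftrightarrow> subspace V \<and> (\<forall>w\<in>V. slin V (\<lambda>v. b v w)) \<and> (\<forall>v\<in>V. \<forall>w\<in>V. b v w = b w v)"

definition posform :: "'e::euclidean_space set \<Rightarrow> ('e \<Rightarrow> 'e \<Rightarrow> real) \<Rightarrow> bool" where
  "posform V b \<longleftrightarrow> symform V b \<and> (\<forall>v\<in>V. v \<noteq> 0 \<longrightarrow> b v v > 0)"

lemma symform_slin1: "symform V b \<Longrightarrow> w \<in> V \<Longrightarrow> slin V (\<lambda>v. b v w)"
  by (simp add: symform_def)

lemma symform_sym: "symform V b \<Longrightarrow> v \<in> V \<Longrightarrow> w \<in> V \<Longrightarrow> b v w = b w v"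
  by (simp add: symform_def)

lemma symform_sum1:
  assumes "symform V b" "w \<in> V" "\<And>i. i \<in> A \<Longrightarrow> x i \<in> V"
  shows "b (\<Sum>i\<in>A. c i *\<^sub>R x i) w = (\<Sum>i\<in>A. c i * b (x i) w)"
  by (rule slin_sum_arg[OF symform_slin1[OF assms(1,2)]])
    (use assms in \<open>auto simp: symform_def\<close>)

lemma symform_slin2: "symform V b \<Longrightarrow> v \<in> V \<Longrightarrow> slin V (\<lambda>w. b v w)"
  unfolding slin_def symform_def by (metis subspace_add subspace_scale)

text \<open>The vectors are not normalised. The frames used later are orthonormal for the background
  tensors, hence of square length \<open>A_coef a b i x\<close> in the metric whose curvature is
  taken.\<close>

definition frame :: "'e::euclidean_space set \<Rightarrow> ('e \<Rightarrow> 'e \<Rightarrow> real) \<Rightarrow> 'e set \<Rightarrow> bool" where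
  "frame V b E \<longleftrightarrow> finite E \<and> E \<subseteq> V \<and> span E = V \<and> (\<forall>e\<in>E. b e e > 0) \<and>
     (\<forall>e\<in>E. \<forall>e'\<in>E. e \<noteq> e' \<longrightarrow> b e e' = 0)"

lemma frame_pos: "frame V b E \<Longrightarrow> e \<in> E \<Longrightarrow> b e e > 0"
  and frame_in: "frame V b E \<Longrightarrow> e \<in> E \<Longrightarrow> e \<in> V"
  and frame_orth: "frame V b E \<Longrightarrow> e \<in> E \<Longrightarrow> e' \<in> E \<Longrightarrow> e \<noteq> e' \<Longrightarrow> b e e' = 0"
  by (auto simp: frame_def)

lemma orthogonal_coefficient:
  assumes "symform V b" "finite E" "E \<subseteq> V" "\<And>e'. e' \<in> E \<Longrightarrow> e \<noteq> e' \<Longrightarrow> b e' e = 0" "e \<in> E"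
  shows "b (\<Sum>e'\<in>E. c e' *\<^sub>R e') e = c e * b e e"
proof -
  have "b (\<Sum>e'\<in>E. c e' *\<^sub>R e') e = (\<Sum>e'\<in>E. c e' * b e' e)"
    using assms(2-) by (intro symform_sum1[OF assms(1)]) auto
  also have "\<dots> = (\<Sum>e'\<in>E. if e' = e then c e * b e e else 0)"
    using assms by (intro sum.cong) auto
  finally show ?thesis using assms by simp
qed

lemma frame_expand:
  assumes "symform V b" "frame V b E" "v \<in> V"
  shows "v = (\<Sum>e\<in>E. (b v e / b e e) *\<^sub>R e)"
proof -
  have fin: "finite E" using assms by (simp add: frame_def)
  have "v \<in> span E" using assms(2,3) by (simp add: frame_def)
  then have "v \<in> range (\<lambda>u. \<Sum>e\<in>E. u e *\<^sub>R e)" unfolding span_finite[OF fin] .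
  then obtain c where c: "v = (\<Sum>e\<in>E. c e *\<^sub>R e)" by blast
  have "b v e = c e * b e e" if "e \<in> E" for e
    unfolding c by (rule orthogonal_coefficient[OF assms(1) fin])
      (use assms(2) that in \<open>auto simp: frame_def\<close>)
  then have "c e = b v e / b e e" if "e \<in> E" for e
    using frame_pos[OF assms(2) that] that by simp
  then have "(\<Sum>e\<in>E. c e *\<^sub>R e) = (\<Sum>e\<in>E. (b v e / b e e) *\<^sub>R e)" by (intro sum.cong) auto
  with c show ?thesis by (rule trans)
qed

lemma slin_frame_expand:
  assumes "symform V b" "frame V b E" "v \<in> V" "slin V f"
  shows "f v = (\<Sum>e\<in>E. b v e * f e / b e e)"
proof -
  have "f v = f (\<Sum>e\<in>E. (b v e / b e e) *\<^sub>R e)" using frame_expand[OF assms(1-3)] by simp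
  also have "\<dots> = (\<Sum>e\<in>E. (b v e / b e e) * f e)"
    using assms(1,2) by (intro slin_sum_arg[OF assms(4)]) (auto simp: symform_def frame_def)
  finally show ?thesis by (simp add: field_simps)
qed

text \<open>An orthonormal set is independent, so its size is bounded by \<open>dim V\<close> and
  one of maximal size exists. If it failed to span \<open>V\<close>, subtracting the projection of a
  missing vector and normalising the remainder would enlarge it.\<close>

lemma orthonormal_frame_exists:
  assumes pf: "posform V b"
  obtains E where "frame V b E" "\<And>e. e \<in> E \<Longrightarrow> b e e = 1"
proof -
  have sf: "symform V b" and sub: "subspace V" using pf by (auto simp: posform_def symform_def)
  define on where "on E \<longleftrightarrow> finite E \<and> E \<subseteq> V \<and> (\<forall>e\<in>E. b e e = 1) \<and>
    (\<forall>e\<in>E. \<forall>e'\<in>E. e \<noteq> e' \<longrightarrow> b e e' = 0)" for E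
  have card: "card E \<le> dim V" if "on E" for E
  proof -
    have "independent E"
      unfolding independent_explicit_finite_subsets
    proof (intro allI impI ballI)
      fix S u v
      assume S: "S \<subseteq> E" "finite S" "(\<Sum>v\<in>S. u v *\<^sub>R v) = 0" "v \<in> S"
      have "b (\<Sum>e'\<in>S. u e' *\<^sub>R e') v = u v * b v v"
      proof (rule orthogonal_coefficient[OF sf S(2) _ _ S(4)])
        show "S \<subseteq> V" using that S(1) by (auto simp: on_def)
        show "b e' v = 0" if "e' \<in> S" "v \<noteq> e'" for e'
          using \<open>on E\<close> S(1,4) that unfolding on_def by (metis subsetD)
      qed
      moreover have "b 0 v = 0"
        using slin_zero[OF symform_slin1[OF sf] sub] S that by (auto simp: on_def)
      ultimately show "u v = 0" using S that by (auto simp: on_def)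
    qed
    then show ?thesis using that independent_card_le_dim by (auto simp: on_def)
  qed
  have "on {}" by (simp add: on_def)
  then obtain E where E: "on E" "\<And>E'. on E' \<Longrightarrow> card E' \<le> card E"
    using ex_has_greatest_nat[of on "{}" card "Suc (dim V)"] card by (auto simp: less_Suc_eq_le)
  have "V \<subseteq> span E"
  proof (rule ccontr)
    assume "\<not> V \<subseteq> span E"
    then obtain w where w: "w \<in> V" "w \<notin> span E" by blast
    define s where "s = (\<Sum>e\<in>E. b w e *\<^sub>R e)"
    define w' where "w' = w - s"
    have sV: "s \<in> V" unfolding s_def
      using E(1) by (intro subspace_sum[OF sub] subspace_scale[OF sub]) (auto simp: on_def)
    have "s \<in> span E" unfolding s_def by (intro span_sum span_scale span_base)
    then have "w' \<noteq> 0" using w by (auto simp: w'_def)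
    have w'V: "w' \<in> V" using w sV by (simp add: w'_def subspace_diff[OF sub])
    have pos: "b w' w' > 0" using pf w'V \<open>w' \<noteq> 0\<close> by (simp add: posform_def)
    have orth: "b w' e = 0" if e: "e \<in> E" for e
    proof -
      have "b s e = b w e * b e e" unfolding s_def
        using E(1) e by (intro orthogonal_coefficient[OF sf]) (auto simp: on_def)
      moreover have "b (1 *\<^sub>R w + (-1) *\<^sub>R s) e = 1 * b w e + (-1) * b s e"
        using E(1) e w sV by (intro slinD[OF symform_slin1[OF sf]]) (auto simp: on_def)
      ultimately show ?thesis using E(1) e by (auto simp: w'_def on_def)
    qed
    define f where "f = (1 / sqrt (b w' w')) *\<^sub>R w'"
    have fV: "f \<in> V" using w'V by (simp add: f_def subspace_scale[OF sub])
    have fe: "b f e = 0" if e: "e \<in> E" for e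
    proof -
      have "e \<in> V" using e E(1) by (auto simp: on_def)
      then have "b f e = (1 / sqrt (b w' w')) * b w' e"
        unfolding f_def by (intro slin_scale_arg[OF symform_slin1[OF sf] w'V])
      then show ?thesis using orth[OF e] by simp
    qed
    have ff: "b f f = 1"
    proof -
      have "b f f = (1 / sqrt (b w' w')) * b w' f"
        using slin_scale_arg[OF symform_slin1[OF sf fV] w'V] by (simp only: f_def)
      also have "b w' f = (1 / sqrt (b w' w')) * b w' w'"
        unfolding f_def by (rule slin_scale_arg[OF symform_slin2[OF sf w'V] w'V])
      finally show ?thesis using pos by (simp add: field_simps)
    qed
    have ef: "b e f = 0" if e: "e \<in> E" for e
    proof -
      have "e \<in> V" using e E(1) by (auto simp: on_def)
      then show ?thesis using symform_sym[OF sf _ fV] fe[OF e] by metis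
    qed
    have "f \<notin> E" using fe ff by auto
    moreover have "on (insert f E)"
      using E(1) fV fe ff ef unfolding on_def by simp
    moreover have "finite E" using E(1) by (simp add: on_def)
    ultimately show False using E(2)[of "insert f E"] by simp
  qed
  moreover have "span E \<subseteq> V" using E(1) sub span_minimal by (auto simp: on_def)
  ultimately show thesis using that[of E] E(1) by (auto simp: on_def frame_def)
qed

text \<open>In an orthonormal frame the representing vector is written down directly; two such
  vectors differ by one of length 0. This is what gives meaning to the definite description in
  \<open>sharp\<close>.\<close>

lemma riesz:
  assumes pf: "posform V b" and a: "slin V \<alpha>"
  shows "\<exists>!z. z \<in> V \<and> (\<forall>y\<in>V. b z y = \<alpha> y)"
proof -
  have sf: "symform V b" and sub: "subspace V" using pf by (auto simp: posform_def symform_def)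
  obtain E where E: "frame V b E" "\<And>e. e \<in> E \<Longrightarrow> b e e = 1"
    using orthonormal_frame_exists[OF pf] by blast
  have fE: "finite E" "E \<subseteq> V" using E by (auto simp: frame_def)
  define z where "z = (\<Sum>e\<in>E. \<alpha> e *\<^sub>R e)"
  have z: "z \<in> V" unfolding z_def
    using fE by (intro subspace_sum[OF sub] subspace_scale[OF sub]) auto
  have "b z y = \<alpha> y" if y: "y \<in> V" for y
  proof -
    have "b z y = (\<Sum>e\<in>E. \<alpha> e * b e y)"
      unfolding z_def using fE by (intro slin_sum_arg[OF symform_slin1[OF sf y] sub]) auto
    also have "\<dots> = (\<Sum>e\<in>E. b y e * \<alpha> e / b e e)"
      using E fE y symform_sym[OF sf] by (intro sum.cong) auto
    also have "\<dots> = \<alpha> y" using slin_frame_expand[OF sf E(1) y a] by simp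
    finally show ?thesis .
  qed
  moreover have "z' = z" if "z' \<in> V" "\<forall>y\<in>V. b z' y = \<alpha> y" for z'
  proof (rule ccontr)
    assume "z' \<noteq> z"
    define d where "d = z' - z"
    have d: "d \<in> V" "d \<noteq> 0" using that z \<open>z' \<noteq> z\<close> by (auto simp: d_def subspace_diff[OF sub])
    have "b (1 *\<^sub>R z' + (-1) *\<^sub>R z) d = 1 * b z' d + (-1) * b z d"
      by (rule slinD[OF symform_slin1[OF sf d(1)] that(1) z])
    then have "b d d = 0" using that(2) calculation d(1) by (simp add: d_def)
    then show False using pf d by (auto simp: posform_def)
  qed
  ultimately show ?thesis using z by blast
qed

lemma sharp_props:
  assumes "posform (span D) b" "slin (span D) \<alpha>"
  shows "sharp D b \<alpha> \<in> span D" "y \<in> span D \<Longrightarrow> b (sharp D b \<alpha>) y = \<alpha> y"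
  using theI'[OF riesz[OF assms]] unfolding sharp_def by auto

text \<open>The trace of an endomorphism does not depend on the basis; the definitions take it over
  coordinate vectors, the computation needs it over a frame. Linearity of \<open>f\<close> is asked
  only after pairing with frame vectors, the form in which it is known for the curvature and for
  \<open>sharp\<close>.\<close>

lemma frame_trace:
  assumes sf: "symform (span D) b" and E: "frame (span D) b E" and D: "D \<subseteq> (Basis::'e::euclidean_space set)"
    and f: "\<And>b. b \<in> D \<Longrightarrow> f b \<in> span D" and lin: "\<And>e. e \<in> E \<Longrightarrow> slin (span D) (\<lambda>v. b (f v) e)"
  shows "(\<Sum>c\<in>D. f c \<bullet> c) = (\<Sum>e\<in>E. b (f e) e / b e e)"
proof -
  have "f c \<bullet> c = (\<Sum>e\<in>E. (b (f c) e / b e e) * (e \<bullet> c))" if "c \<in> D" for c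
  proof -
    have "f c \<bullet> c = (\<Sum>e\<in>E. (b (f c) e / b e e) *\<^sub>R e) \<bullet> c"
      using frame_expand[OF sf E f[OF that]] by simp
    then show ?thesis by (simp add: inner_sum_left)
  qed
  then have "(\<Sum>c\<in>D. f c \<bullet> c) = (\<Sum>c\<in>D. \<Sum>e\<in>E. (b (f c) e / b e e) * (e \<bullet> c))" by simp
  also have "\<dots> = (\<Sum>e\<in>E. \<Sum>c\<in>D. (b (f c) e / b e e) * (e \<bullet> c))" by (rule sum.swap)
  also have "\<dots> = (\<Sum>e\<in>E. b (f e) e / b e e)"
  proof (rule sum.cong)
    fix e assume e: "e \<in> E"
    have "b (f (\<Sum>c\<in>D. (e \<bullet> c) *\<^sub>R c)) e = (\<Sum>c\<in>D. (e \<bullet> c) * b (f c) e)"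
      by (rule slin_sum_arg[OF lin[OF e]]) (auto intro: span_base)
    moreover have "(\<Sum>c\<in>D. (e \<bullet> c) *\<^sub>R c) = e"
      using span_coords_sum[OF D frame_in[OF E e]] .
    ultimately show "(\<Sum>c\<in>D. (b (f c) e / b e e) * (e \<bullet> c)) = b (f e) e / b e e"
      by (simp add: sum_divide_distrib mult.commute)
  qed simp
  finally show ?thesis .
qed

section \<open>Sectional curvature of a metric in coordinates\<close>

definition d1 :: "('e::euclidean_space \<Rightarrow> 'e \<Rightarrow> 'e \<Rightarrow> real) \<Rightarrow> 'e \<Rightarrow> 'e \<Rightarrow> 'e \<Rightarrow> 'e \<Rightarrow> real" where
  "d1 \<beta> x v w u = dd (\<lambda>z. \<beta> z v w) x u"

definition d2 :: "('e::euclidean_space \<Rightarrow> 'e \<Rightarrow> 'e \<Rightarrow> real) \<Rightarrow> 'e \<Rightarrow> 'e \<Rightarrow> 'e \<Rightarrow> 'e \<Rightarrow> 'e \<Rightarrow> real" where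
  "d2 \<beta> x y v w u = dd (d1 \<beta> y v w) x u"

text \<open>The Koszul formula for \<open>g(nabla_v w, y)\<close> with constant coordinate fields,
  whose brackets vanish: the Christoffel symbol of the first kind. It contains no inverse of the
  metric.\<close>

definition chr1 :: "('e::euclidean_space \<Rightarrow> 'e \<Rightarrow> 'e \<Rightarrow> real) \<Rightarrow> 'e \<Rightarrow> 'e \<Rightarrow> 'e \<Rightarrow> 'e \<Rightarrow> real" where
  "chr1 \<beta> v w y u = (d1 \<beta> v w y u + d1 \<beta> w v y u - d1 \<beta> y v w u) / 2"

definition chr :: "'e::euclidean_space set \<Rightarrow> ('e \<Rightarrow> 'e \<Rightarrow> 'e \<Rightarrow> real) \<Rightarrow> 'e \<Rightarrow> 'e \<Rightarrow> 'e \<Rightarrow> 'e" where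
  "chr D \<beta> u v w = sharp D (\<beta> u) (\<lambda>y. chr1 \<beta> v w y u)"

text \<open>The value \<open>R(x,y,y,x)\<close> of the curvature tensor, written with the Christoffel symbols of the first
  kind and an orthogonal frame \<open>E\<close>, so that it involves derivatives of the metric only.\<close>

definition sec :: "('e::euclidean_space \<Rightarrow> 'e \<Rightarrow> 'e \<Rightarrow> real) \<Rightarrow> 'e set \<Rightarrow> 'e \<Rightarrow> 'e \<Rightarrow> 'e \<Rightarrow> real" where
  "sec \<beta> E u x y = d2 \<beta> x y x y u - d2 \<beta> x x y y u / 2 - d2 \<beta> y y x x u / 2
     + (\<Sum>e\<in>E. ((chr1 \<beta> x y e u)\<^sup>2 - chr1 \<beta> x x e u * chr1 \<beta> y y e u) / \<beta> u e e)"

text \<open>The polarized form of \<open>sec\<close>, that is \<open>g(R(x,y)z, w)\<close>. The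
  contraction with the inverse metric in the quadratic terms is the sum over the orthogonal frame
  \<open>E\<close>.\<close>

definition riem :: "('e::euclidean_space \<Rightarrow> 'e \<Rightarrow> 'e \<Rightarrow> real) \<Rightarrow> 'e set \<Rightarrow> 'e \<Rightarrow> 'e \<Rightarrow> 'e \<Rightarrow> 'e \<Rightarrow> 'e \<Rightarrow> real" where
  "riem \<beta> E u x y z w =
     (d2 \<beta> x y z w u + d2 \<beta> x z y w u - d2 \<beta> x w y z u) / 2
     - (d2 \<beta> y x z w u + d2 \<beta> y z x w u - d2 \<beta> y w x z u) / 2
     + (\<Sum>e\<in>E. (chr1 \<beta> y w e u * chr1 \<beta> x z e u - chr1 \<beta> x w e u * chr1 \<beta> y z e u) / \<beta> u e e)"

definition scal :: "('e::euclidean_space \<Rightarrow> 'e \<Rightarrow> 'e \<Rightarrow> real) \<Rightarrow> 'e set \<Rightarrow> 'e \<Rightarrow> real" where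
  "scal \<beta> E u = (\<Sum>x\<in>E. \<Sum>y\<in>E. sec \<beta> E u x y / (\<beta> u x x * \<beta> u y y))"

lemma christoffel_chr: "christoffel M g c u v w = chr (coords M) (comp2 M g c) u v w"
  by (simp add: christoffel_def chr_def chr1_def d1_def)

lemma slin_dd_fun:
  assumes o: "oset D W" and lin: "\<And>u. u \<in> W \<Longrightarrow> slin (span D') (\<lambda>v. F v u)"
    and sm: "\<And>v. v \<in> span D' \<Longrightarrow> smooth_on D W (F v)" and u: "u \<in> W" and x: "x \<in> span D"
  shows "slin (span D') (\<lambda>v. dd (F v) x u)"
  unfolding slin_def
proof (intro ballI allI)
  fix v w s t assume vw: "v \<in> span D'" "w \<in> span D'"
  have "dd (F (s *\<^sub>R v + t *\<^sub>R w)) x u = dd (\<lambda>u. s * F v u + t * F w u) x u"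
    by (rule dd_cong[OF o u x]) (use slinD[OF lin] vw in blast)
  also have "\<dots> = s * dd (F v) x u + t * dd (F w) x u"
    by (rule dd_eqI) (auto intro!: derivative_eq_intros smooth_on_line[OF o sm u x] vw)
  finally show "dd (F (s *\<^sub>R v + t *\<^sub>R w)) x u = s * dd (F v) x u + t * dd (F w) x u" .
qed

lemma slin_dd_dir:
  assumes "oset D W" "smooth_on D W f" "u \<in> W"
  shows "slin (span D) (\<lambda>x. dd f x u)"
  unfolding slin_def using dd_linear[OF assms(1) smooth_on_ck[OF assms(2)] assms(3)] by simp

text \<open>A symmetric tensor in coordinates. Positivity is separated off into
  \<open>lmetric\<close>, because the background tensors and the coefficients \<open>G0\<close>,
  \<open>G1\<close> of the affine family are handled in the same way although they may be degenerate
  or indefinite.\<close>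

locale lform =
  fixes D W :: "'e::euclidean_space set" and \<beta> :: "'e \<Rightarrow> 'e \<Rightarrow> 'e \<Rightarrow> real"
  assumes o: "oset D W"
    and sm: "v \<in> span D \<Longrightarrow> w \<in> span D \<Longrightarrow> smooth_on D W (\<lambda>u. \<beta> u v w)"
    and sf: "u \<in> W \<Longrightarrow> symform (span D) (\<beta> u)"
begin

lemma lin1: "u \<in> W \<Longrightarrow> w \<in> span D \<Longrightarrow> slin (span D) (\<lambda>v. \<beta> u v w)"
  using symform_slin1[OF sf] .

lemma lin2: "u \<in> W \<Longrightarrow> v \<in> span D \<Longrightarrow> slin (span D) (\<lambda>w. \<beta> u v w)"
  using symform_slin2[OF sf] .

lemma d1_sym:
  assumes "u \<in> W" "x \<in> span D" "v \<in> span D" "w \<in> span D"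
  shows "d1 \<beta> x v w u = d1 \<beta> x w v u"
  unfolding d1_def by (rule dd_cong[OF o assms(1,2)]) (use symform_sym[OF sf] assms(3,4) in blast)

lemma d1_smooth:
  "x \<in> span D \<Longrightarrow> v \<in> span D \<Longrightarrow> w \<in> span D \<Longrightarrow> smooth_on D W (d1 \<beta> x v w)"
  unfolding d1_def using smooth_on_dd[OF o sm] by simp

lemma d1_lin_dir: "u \<in> W \<Longrightarrow> v \<in> span D \<Longrightarrow> w \<in> span D \<Longrightarrow> slin (span D) (\<lambda>x. d1 \<beta> x v w u)"
  unfolding d1_def by (rule slin_dd_dir[OF o sm])

lemma d1_lin1: "u \<in> W \<Longrightarrow> x \<in> span D \<Longrightarrow> w \<in> span D \<Longrightarrow> slin (span D) (\<lambda>v. d1 \<beta> x v w u)"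
  unfolding d1_def by (rule slin_dd_fun[OF o]) (auto intro: lin1 sm)

lemma d1_lin2: "u \<in> W \<Longrightarrow> x \<in> span D \<Longrightarrow> v \<in> span D \<Longrightarrow> slin (span D) (\<lambda>w. d1 \<beta> x v w u)"
  unfolding d1_def by (rule slin_dd_fun[OF o]) (auto intro: lin2 sm)

lemma d2_commute:
  assumes "u \<in> W" "x \<in> span D" "y \<in> span D" "v \<in> span D" "w \<in> span D"
  shows "d2 \<beta> x y v w u = d2 \<beta> y x v w u"
  unfolding d2_def d1_def using dd_commute[OF o sm assms(1) assms(3,2)] assms by simp

lemma d2_sym:
  assumes "u \<in> W" "x \<in> span D" "y \<in> span D" "v \<in> span D" "w \<in> span D"
  shows "d2 \<beta> x y v w u = d2 \<beta> x y w v u"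
  unfolding d2_def by (rule dd_cong[OF o assms(1,2)]) (rule d1_sym[OF _ assms(3-5)])

lemma d2_lin_dir:
  "u \<in> W \<Longrightarrow> y \<in> span D \<Longrightarrow> v \<in> span D \<Longrightarrow> w \<in> span D \<Longrightarrow> slin (span D) (\<lambda>x. d2 \<beta> x y v w u)"
  unfolding d2_def by (rule slin_dd_dir[OF o d1_smooth])

lemma d2_lin_dir2:
  "u \<in> W \<Longrightarrow> x \<in> span D \<Longrightarrow> v \<in> span D \<Longrightarrow> w \<in> span D \<Longrightarrow> slin (span D) (\<lambda>y. d2 \<beta> x y v w u)"
  unfolding d2_def by (rule slin_dd_fun[OF o]) (auto intro: d1_lin_dir d1_smooth)

lemma d2_lin1:
  "u \<in> W \<Longrightarrow> x \<in> span D \<Longrightarrow> y \<in> span D \<Longrightarrow> w \<in> span D \<Longrightarrow> slin (span D) (\<lambda>v. d2 \<beta> x y v w u)"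
  unfolding d2_def by (rule slin_dd_fun[OF o]) (auto intro: d1_lin1 d1_smooth)

lemma chr1_lin1: "u \<in> W \<Longrightarrow> w \<in> span D \<Longrightarrow> y \<in> span D \<Longrightarrow> slin (span D) (\<lambda>v. chr1 \<beta> v w y u)"
  unfolding chr1_def by (intro slin_divide slin_add slin_diff d1_lin_dir d1_lin1)

lemma d2_lin2:
  "u \<in> W \<Longrightarrow> x \<in> span D \<Longrightarrow> y \<in> span D \<Longrightarrow> v \<in> span D \<Longrightarrow> slin (span D) (\<lambda>w. d2 \<beta> x y v w u)"
  unfolding d2_def by (rule slin_dd_fun[OF o]) (auto intro: d1_lin2 d1_smooth)

lemma chr1_lin2: "u \<in> W \<Longrightarrow> v \<in> span D \<Longrightarrow> y \<in> span D \<Longrightarrow> slin (span D) (\<lambda>w. chr1 \<beta> v w y u)"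
  unfolding chr1_def by (intro slin_divide slin_add slin_diff d1_lin_dir d1_lin1 d1_lin2)

lemma chr1_lin3: "u \<in> W \<Longrightarrow> v \<in> span D \<Longrightarrow> w \<in> span D \<Longrightarrow> slin (span D) (\<lambda>y. chr1 \<beta> v w y u)"
  unfolding chr1_def by (intro slin_divide slin_add slin_diff d1_lin_dir d1_lin2)

lemma chr1_smooth: "v \<in> span D \<Longrightarrow> w \<in> span D \<Longrightarrow> y \<in> span D \<Longrightarrow> smooth_on D W (chr1 \<beta> v w y)"
proof -
  assume *: "v \<in> span D" "w \<in> span D" "y \<in> span D"
  have "smooth_on D W (\<lambda>u. (d1 \<beta> v w y u + d1 \<beta> w v y u + (-1) * d1 \<beta> y v w u) * (1/2))"
    by (intro smooth_on_mult smooth_on_add d1_smooth smooth_on_const o *)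
  then show ?thesis by (rule smooth_on_cong[OF o]) (simp add: chr1_def)
qed

lemma chr1_sym:
  "u \<in> W \<Longrightarrow> v \<in> span D \<Longrightarrow> w \<in> span D \<Longrightarrow> y \<in> span D \<Longrightarrow> chr1 \<beta> v w y u = chr1 \<beta> w v y u"
  unfolding chr1_def using d1_sym[of u y v w] by simp

lemma metric_compatible:
  "u \<in> W \<Longrightarrow> x \<in> span D \<Longrightarrow> v \<in> span D \<Longrightarrow> w \<in> span D \<Longrightarrow>
    d1 \<beta> x v w u = chr1 \<beta> x v w u + chr1 \<beta> x w v u"
  unfolding chr1_def using d1_sym[of u x v w] d1_sym[of u v x w] d1_sym[of u w x v] by (simp add: field_simps)

lemma riem_lin:
  assumes "u \<in> W" "E \<subseteq> span D" "y \<in> span D" "z \<in> span D" "w \<in> span D"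
  shows "slin (span D) (\<lambda>x. riem \<beta> E u x y z w)"
  unfolding riem_def
  by (intro slin_intros d2_lin_dir d2_lin_dir2 d2_lin1 chr1_lin1) (use assms in auto)

lemma riem_lin2:
  assumes "u \<in> W" "E \<subseteq> span D" "x \<in> span D" "z \<in> span D" "w \<in> span D"
  shows "slin (span D) (\<lambda>y. riem \<beta> E u x y z w)"
  unfolding riem_def
  by (intro slin_intros d2_lin_dir d2_lin_dir2 d2_lin1 chr1_lin1) (use assms in auto)

lemma riem_lin3:
  assumes "u \<in> W" "E \<subseteq> span D" "x \<in> span D" "y \<in> span D" "w \<in> span D"
  shows "slin (span D) (\<lambda>z. riem \<beta> E u x y z w)"
  unfolding riem_def
  by (intro slin_intros d2_lin_dir2 d2_lin1 d2_lin2 chr1_lin2) (use assms in auto)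

lemma riem_sec:
  assumes "u \<in> W" "x \<in> span D" "y \<in> span D" "E \<subseteq> span D"
  shows "riem \<beta> E u x y y x = sec \<beta> E u x y"
proof -
  have "(\<Sum>e\<in>E. (chr1 \<beta> y x e u * chr1 \<beta> x y e u - chr1 \<beta> x x e u * chr1 \<beta> y y e u) / \<beta> u e e)
    = (\<Sum>e\<in>E. ((chr1 \<beta> x y e u)\<^sup>2 - chr1 \<beta> x x e u * chr1 \<beta> y y e u) / \<beta> u e e)"
    by (rule sum.cong) (use assms chr1_sym[of u y x] in \<open>auto simp: power2_eq_square\<close>)
  then show ?thesis
    unfolding riem_def sec_def
    using d2_commute[of u y x x y] d2_sym[of u x y x y] d2_sym[of u y x x y] assms
    by (simp add: field_simps)
qed

end

section \<open>The positive definite case: Levi-Civita connection and curvature\<close>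

locale lmetric = lform +
  assumes pos: "u \<in> W \<Longrightarrow> v \<in> span D \<Longrightarrow> v \<noteq> 0 \<Longrightarrow> \<beta> u v v > 0"
begin

lemma pf: "u \<in> W \<Longrightarrow> posform (span D) (\<beta> u)"
  using sf pos by (simp add: posform_def)

lemma chr_in: "u \<in> W \<Longrightarrow> v \<in> span D \<Longrightarrow> w \<in> span D \<Longrightarrow> chr D \<beta> u v w \<in> span D"
  unfolding chr_def by (rule sharp_props(1)[OF pf chr1_lin3])

lemma chr_eq:
  "u \<in> W \<Longrightarrow> v \<in> span D \<Longrightarrow> w \<in> span D \<Longrightarrow> y \<in> span D \<Longrightarrow> \<beta> u (chr D \<beta> u v w) y = chr1 \<beta> v w y u"
  unfolding chr_def by (rule sharp_props(2)[OF pf chr1_lin3])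

text \<open>With \<open>Q t\<close> the coefficients of a difference quotient, this differentiates the solution of a linear
  system (the Christoffel symbols) without an inverse matrix.\<close>

lemma near_identity_limit:
  fixes Q L :: "real \<Rightarrow> 'i \<Rightarrow> real" and m :: "real \<Rightarrow> 'i \<Rightarrow> 'i \<Rightarrow> real"
  assumes fin: "finite E"
    and eq: "\<forall>\<^sub>F t in at 0. \<forall>e\<in>E. (\<Sum>e'\<in>E. Q t e' * m t e' e) = L t e"
    and L: "\<And>e. e \<in> E \<Longrightarrow> ((\<lambda>t. L t e) \<longlongrightarrow> l e) (at 0)"
    and m: "\<And>e e'. e \<in> E \<Longrightarrow> e' \<in> E \<Longrightarrow> ((\<lambda>t. m t e' e) \<longlongrightarrow> (if e' = e then 1 else 0)) (at 0)"
    and e: "e \<in> E"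
  shows "((\<lambda>t. Q t e) \<longlongrightarrow> l e) (at 0)"
proof -
  define n where "n t e' e = m t e' e - (if e' = e then 1 else 0)" for t e' e
  define \<epsilon> where "\<epsilon> t = (\<Sum>e\<in>E. \<Sum>e'\<in>E. \<bar>n t e' e\<bar>)" for t
  define S where "S t = (\<Sum>e\<in>E. \<bar>Q t e\<bar>)" for t
  define K where "K t = (\<Sum>e\<in>E. \<bar>L t e\<bar>)" for t
  have n0: "((\<lambda>t. n t e' e) \<longlongrightarrow> 0) (at 0)" if "e \<in> E" "e' \<in> E" for e e'
    unfolding n_def using tendsto_diff[OF m[OF that] tendsto_const[of "if e' = e then 1 else 0"]] by simp
  have \<epsilon>0: "(\<epsilon> \<longlongrightarrow> 0) (at 0)"
    unfolding \<epsilon>_def by (intro tendsto_null_sum tendsto_rabs_zero n0)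
  have KL: "(K \<longlongrightarrow> (\<Sum>e\<in>E. \<bar>l e\<bar>)) (at 0)"
    unfolding K_def by (intro tendsto_sum tendsto_rabs L)
  have key: "\<bar>Q t e - L t e\<bar> \<le> (\<Sum>e'\<in>E. \<bar>n t e' e\<bar>) * S t"
    if t: "\<forall>e\<in>E. (\<Sum>e'\<in>E. Q t e' * m t e' e) = L t e" and e: "e \<in> E" for t e
  proof -
    have "(\<Sum>e'\<in>E. Q t e' * m t e' e) = (\<Sum>e'\<in>E. (if e' = e then Q t e else 0) + Q t e' * n t e' e)"
      unfolding n_def by (rule sum.cong) (auto simp: algebra_simps)
    also have "\<dots> = Q t e + (\<Sum>e'\<in>E. Q t e' * n t e' e)"
      using fin e by (simp add: sum.distrib)
    finally have "Q t e - L t e = - (\<Sum>e'\<in>E. Q t e' * n t e' e)" using t e by auto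
    then have "\<bar>Q t e - L t e\<bar> \<le> (\<Sum>e'\<in>E. \<bar>Q t e' * n t e' e\<bar>)" by (simp add: sum_abs)
    also have "\<dots> \<le> (\<Sum>e'\<in>E. \<bar>n t e' e\<bar> * S t)"
    proof (rule sum_mono)
      fix e' assume "e' \<in> E"
      then have "\<bar>Q t e'\<bar> \<le> S t" unfolding S_def using fin by (intro member_le_sum) auto
      then show "\<bar>Q t e' * n t e' e\<bar> \<le> \<bar>n t e' e\<bar> * S t"
        unfolding abs_mult mult.commute[of "\<bar>n t e' e\<bar>"] by (rule mult_right_mono) simp
    qed
    finally show ?thesis by (simp add: sum_distrib_right)
  qed
  have ev\<epsilon>: "\<forall>\<^sub>F t in at 0. \<epsilon> t < 1 / 2" by (rule order_tendstoD(2)[OF \<epsilon>0]) simp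
  have bnd: "\<forall>\<^sub>F t in at 0. \<bar>Q t e - L t e\<bar> \<le> \<epsilon> t * (2 * K t)"
    using eq ev\<epsilon>
  proof eventually_elim
    case (elim t)
    have S0: "S t \<ge> 0" by (simp add: S_def sum_nonneg)
    \<comment> \<open>Summing \<open>key\<close> over \<open>e\<close> gives
      \<open>S \<le> K + \<epsilon> S\<close>; as \<epsilon> is below 1/2, the last term is absorbed
      on the left. The coefficients \<open>Q\<close> are thereby bounded by data that
      converge.\<close>
    have "S t \<le> (\<Sum>e\<in>E. \<bar>L t e\<bar> + (\<Sum>e'\<in>E. \<bar>n t e' e\<bar>) * S t)"
      unfolding S_def[of t] by (rule sum_mono) (use key[OF elim(1)] S_def[of t] in force)
    also have "\<dots> = K t + \<epsilon> t * S t"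
      by (simp add: K_def \<epsilon>_def sum.distrib sum_distrib_right)
    also have "\<epsilon> t * S t \<le> (1 / 2) * S t" using elim(2) S0 by (intro mult_right_mono) auto
    finally have S2: "S t \<le> 2 * K t" by simp
    have "\<bar>Q t e - L t e\<bar> \<le> (\<Sum>e'\<in>E. \<bar>n t e' e\<bar>) * S t" using key[OF elim(1) e] .
    also have "\<dots> \<le> \<epsilon> t * S t"
      unfolding \<epsilon>_def using fin e S0
      by (intro mult_right_mono member_le_sum[of e E "\<lambda>e. \<Sum>e'\<in>E. \<bar>n t e' e\<bar>"]) (auto simp: sum_nonneg)
    also have "\<dots> \<le> \<epsilon> t * (2 * K t)"
      using S2 by (intro mult_left_mono) (auto simp: \<epsilon>_def sum_nonneg)
    finally show ?case .
  qed
  have "((\<lambda>t. \<epsilon> t * (2 * K t)) \<longlongrightarrow> 0) (at 0)"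
    using tendsto_mult[OF \<epsilon>0 tendsto_mult[OF tendsto_const[of 2] KL]] by simp
  then have "((\<lambda>t. Q t e - L t e) \<longlongrightarrow> 0) (at 0)"
    using bnd by (intro Lim_null_comparison[OF _ \<open>((\<lambda>t. \<epsilon> t * (2 * K t)) \<longlongrightarrow> 0) (at 0)\<close>]) auto
  from tendsto_add[OF this L[OF e]] show ?thesis by simp
qed

text \<open>\<open>chr\<close> is given by a description, so its differentiability needs proof. In a
  frame orthonormal at \<open>u\<close>, the coefficients of its difference quotients solve a linear
  system whose matrix tends to the identity, and \<open>near_identity_limit\<close> gives their
  limits. The value of the derivative is the product rule applied to
  \<open>\<beta> u (chr D \<beta> u y z) w = chr1 \<beta> y z w u\<close>.\<close>

lemma chr_has_derivative:
  assumes u: "u \<in> W" and x: "x \<in> span D" and y: "y \<in> span D" and z: "z \<in> span D"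
  shows "((\<lambda>t. chr D \<beta> (u + t *\<^sub>R x) y z) has_vector_derivative dd (\<lambda>u. chr D \<beta> u y z) x u) (at 0)"
    and "dd (\<lambda>u. chr D \<beta> u y z) x u \<in> span D"
    and "w \<in> span D \<Longrightarrow> \<beta> u (dd (\<lambda>u. chr D \<beta> u y z) x u) w
      = dd (chr1 \<beta> y z w) x u - d1 \<beta> x (chr D \<beta> u y z) w u"
proof -
  obtain E where E: "frame (span D) (\<beta> u) E" "\<And>e. e \<in> E \<Longrightarrow> \<beta> u e e = 1"
    using orthonormal_frame_exists[OF pf[OF u]] by blast
  have fin: "finite E" and ED: "\<And>e. e \<in> E \<Longrightarrow> e \<in> span D" using E by (auto simp: frame_def)
  define Z where "Z t = chr D \<beta> (u + t *\<^sub>R x) y z" for t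
  have Z0: "Z 0 \<in> span D" and Z0': "chr D \<beta> u y z = Z 0" using chr_in[OF u y z] by (auto simp: Z_def)
  have evW: "\<forall>\<^sub>F t in nhds 0. u + t *\<^sub>R x \<in> W" by (rule oset_ev_line[OF o u x])
  define c where "c t e = \<beta> u (Z t) e" for t e
  define l where "l e = dd (chr1 \<beta> y z e) x u - d1 \<beta> x (Z 0) e u" for e
  have Zexp: "Z t = (\<Sum>e\<in>E. c t e *\<^sub>R e)" if "u + t *\<^sub>R x \<in> W" for t
    using frame_expand[OF sf[OF u] E(1) chr_in[OF that y z]] E(2) by (simp add: c_def Z_def)
  have der: "((\<lambda>t. c t e) has_real_derivative l e) (at 0)" if e: "e \<in> E" for e
    unfolding DERIV_def
  proof -
    \<comment> \<open>The right-hand side of the system for the difference quotients: from the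
      defining equation of \<open>Z t\<close> subtract the same form evaluated on
      \<open>Z 0\<close>, and divide by \<open>t\<close>.\<close>
    define L where "L t e = (chr1 \<beta> y z e (u + t *\<^sub>R x) - \<beta> (u + t *\<^sub>R x) (Z 0) e) / t" for t e
    have "((\<lambda>t. (c t e - c 0 e) / t) \<longlongrightarrow> l e) (at 0)"
    proof (rule near_identity_limit[OF fin _ _ _ e, where L = L and m = "\<lambda>t e' e. \<beta> (u + t *\<^sub>R x) e' e"])
      show "((\<lambda>t. \<beta> (u + t *\<^sub>R x) e' e) \<longlongrightarrow> (if e' = e then 1 else 0)) (at 0)"
        if "e \<in> E" "e' \<in> E" for e e'
      proof -
        have "isCont (\<lambda>t. \<beta> (u + t *\<^sub>R x) e' e) 0"
          using smooth_on_line[OF o sm[OF ED ED] u x, of e' e] that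
          by (auto intro: has_vector_derivative_continuous)
        then show ?thesis using frame_orth[OF E(1)] E(2) that by (auto simp: isCont_def)
      qed
      show "((\<lambda>t. L t e) \<longlongrightarrow> l e) (at 0)" if e: "e \<in> E" for e
      proof -
        have "((\<lambda>t. chr1 \<beta> y z e (u + t *\<^sub>R x) - \<beta> (u + t *\<^sub>R x) (Z 0) e) has_vector_derivative l e) (at 0)"
          unfolding l_def d1_def
          by (intro has_vector_derivative_diff smooth_on_line[OF o _ u x] chr1_smooth sm y z ED e Z0)
        then have *: "((\<lambda>t. chr1 \<beta> y z e (u + t *\<^sub>R x) - \<beta> (u + t *\<^sub>R x) (Z 0) e) has_real_derivative l e) (at 0)"
          by (simp add: has_real_derivative_iff_has_vector_derivative)
        have "chr1 \<beta> y z e u = \<beta> u (Z 0) e" using chr_eq[OF u y z ED[OF e]] Z0' by simp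
        with * show ?thesis by (simp add: DERIV_def L_def)
      qed
      have "\<forall>\<^sub>F t in at 0. u + t *\<^sub>R x \<in> W" using evW by (simp add: eventually_nhds_conv_at)
      then show "\<forall>\<^sub>F t in at 0. \<forall>e\<in>E. (\<Sum>e'\<in>E. (c t e' - c 0 e') / t * \<beta> (u + t *\<^sub>R x) e' e) = L t e"
      proof eventually_elim
        case (elim t)
        show ?case
        proof
          fix e assume e: "e \<in> E"
          have "(\<Sum>e'\<in>E. c t e' * \<beta> (u + t *\<^sub>R x) e' e) = \<beta> (u + t *\<^sub>R x) (Z t) e"
            unfolding Zexp[OF elim] by (rule symform_sum1[OF sf[OF elim] ED[OF e] ED, symmetric])
          also have "\<dots> = chr1 \<beta> y z e (u + t *\<^sub>R x)"
            unfolding Z_def by (rule chr_eq[OF elim y z ED[OF e]])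
          finally have 1: "(\<Sum>e'\<in>E. c t e' * \<beta> (u + t *\<^sub>R x) e' e) = chr1 \<beta> y z e (u + t *\<^sub>R x)" .
          have 2: "(\<Sum>e'\<in>E. c 0 e' * \<beta> (u + t *\<^sub>R x) e' e) = \<beta> (u + t *\<^sub>R x) (Z 0) e"
            using symform_sum1[OF sf[OF elim] ED[OF e] ED, of E "\<lambda>e. e" "c 0"] Zexp[of 0] u by simp
          have "(\<Sum>e'\<in>E. (c t e' - c 0 e') / t * \<beta> (u + t *\<^sub>R x) e' e)
              = ((\<Sum>e'\<in>E. c t e' * \<beta> (u + t *\<^sub>R x) e' e) - (\<Sum>e'\<in>E. c 0 e' * \<beta> (u + t *\<^sub>R x) e' e)) / t"
            by (simp add: sum_subtractf[symmetric] sum_divide_distrib left_diff_distrib diff_divide_distrib)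
          then show "(\<Sum>e'\<in>E. (c t e' - c 0 e') / t * \<beta> (u + t *\<^sub>R x) e' e) = L t e"
            unfolding 1 2 L_def .
        qed
      qed
    qed
    then show "(\<lambda>h. (c (0 + h) e - c 0 e) / h) \<midarrow>0\<rightarrow> l e" by simp
  qed
  define Z' where "Z' = (\<Sum>e\<in>E. l e *\<^sub>R e)"
  have Z'D: "Z' \<in> span D" unfolding Z'_def by (intro span_sum span_scale ED)
  have "((\<lambda>t. \<Sum>e\<in>E. c t e *\<^sub>R e) has_vector_derivative Z') (at 0)"
    unfolding Z'_def using der
    by (intro has_vector_derivative_sum)
      (auto intro!: derivative_eq_intros simp: has_real_derivative_iff_has_vector_derivative)
  moreover have "\<forall>\<^sub>F t in nhds 0. (\<Sum>e\<in>E. c t e *\<^sub>R e) = Z t"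
    using evW by eventually_elim (use Zexp in simp)
  ultimately have hv: "(Z has_vector_derivative Z') (at 0)"
    by (rule has_vector_derivative_cong_nhds)
  then have ddZ: "dd (\<lambda>u. chr D \<beta> u y z) x u = Z'" unfolding Z_def by (rule dd_eqI)
  show "((\<lambda>t. chr D \<beta> (u + t *\<^sub>R x) y z) has_vector_derivative dd (\<lambda>u. chr D \<beta> u y z) x u) (at 0)"
    using hv unfolding ddZ Z_def .
  show "dd (\<lambda>u. chr D \<beta> u y z) x u \<in> span D" using Z'D ddZ by simp
  have linl: "slin (span D) l"
    unfolding l_def
    by (intro slin_diff d1_lin2[OF u x Z0] slin_dd_fun[OF o _ _ u x] chr1_lin3 chr1_smooth y z)
  show "\<beta> u (dd (\<lambda>u. chr D \<beta> u y z) x u) w = dd (chr1 \<beta> y z w) x u - d1 \<beta> x (chr D \<beta> u y z) w u"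
    if w: "w \<in> span D"
  proof -
    have "\<beta> u Z' w = (\<Sum>e\<in>E. l e * \<beta> u e w)"
      unfolding Z'_def by (rule symform_sum1[OF sf[OF u] w ED])
    also have "\<dots> = (\<Sum>e\<in>E. \<beta> u w e * l e / \<beta> u e e)"
      using E(2) symform_sym[OF sf[OF u] ED w] by (intro sum.cong) auto
    also have "\<dots> = l w" using slin_frame_expand[OF sf[OF u] E(1) w linl] by simp
    finally show ?thesis unfolding ddZ l_def Z0' .
  qed
qed


text \<open>Lowering the index turns each derivative of \<open>chr\<close> into a derivative of
  \<open>chr1\<close> minus a derivative of the metric. Metric compatibility splits the latter into
  two terms, one of which cancels against the product of Christoffel symbols; the remaining one is
  expanded in the frame.\<close>

lemma curvature_riem:
  fixes x y z w u
  defines "K \<equiv> (\<lambda>x. dd (\<lambda>u. chr D \<beta> u y z) x u - dd (\<lambda>u. chr D \<beta> u x z) y u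
      + chr D \<beta> u x (chr D \<beta> u y z) - chr D \<beta> u y (chr D \<beta> u x z))"
  assumes u: "u \<in> W" and x: "x \<in> span D" and y: "y \<in> span D" and z: "z \<in> span D"
    and E: "frame (span D) (\<beta> u) E"
  shows "K x \<in> span D" and "w \<in> span D \<Longrightarrow> \<beta> u (K x) w = riem \<beta> E u x y z w"
proof -
  note c = chr_in[OF u y z] chr_in[OF u x z] chr_in[OF u x chr_in[OF u y z]] chr_in[OF u y chr_in[OF u x z]]
    chr_has_derivative(2)[OF u x y z] chr_has_derivative(2)[OF u y x z]
  show "K x \<in> span D" unfolding K_def using c by (intro span_add span_diff)
  assume w: "w \<in> span D"
  have ED: "E \<subseteq> span D" using E by (simp add: frame_def)
  define a1 where "a1 = dd (\<lambda>u. chr D \<beta> u y z) x u"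
  define a2 where "a2 = dd (\<lambda>u. chr D \<beta> u x z) y u"
  define a3 where "a3 = chr D \<beta> u x (chr D \<beta> u y z)"
  define a4 where "a4 = chr D \<beta> u y (chr D \<beta> u x z)"
  have a: "a1 \<in> span D" "a2 \<in> span D" "a3 \<in> span D" "a4 \<in> span D"
    using c by (simp_all add: a1_def a2_def a3_def a4_def)
  have "K x = 1 *\<^sub>R (1 *\<^sub>R a1 + (-1) *\<^sub>R a2) + 1 *\<^sub>R (1 *\<^sub>R a3 + (-1) *\<^sub>R a4)"
    by (simp add: K_def a1_def a2_def a3_def a4_def)
  also have "\<beta> u \<dots> w = \<beta> u a1 w - \<beta> u a2 w + \<beta> u a3 w - \<beta> u a4 w"
    using slinD[OF lin1[OF u w]] a by (simp only: slinD[OF lin1[OF u w]] span_add span_scale a) simp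
  finally have 1: "\<beta> u (K x) w = \<beta> u a1 w - \<beta> u a2 w + \<beta> u a3 w - \<beta> u a4 w" .
  have G: "chr1 \<beta> p q (chr D \<beta> u r s) u = (\<Sum>e\<in>E. chr1 \<beta> p q e u * chr1 \<beta> r s e u / \<beta> u e e)"
    if "p \<in> span D" "q \<in> span D" "r \<in> span D" "s \<in> span D" for p q r s
  proof -
    have "chr1 \<beta> p q (chr D \<beta> u r s) u
        = (\<Sum>e\<in>E. \<beta> u (chr D \<beta> u r s) e * chr1 \<beta> p q e u / \<beta> u e e)"
      by (rule slin_frame_expand[OF sf[OF u] E chr_in[OF u that(3,4)] chr1_lin3[OF u that(1,2)]])
    also have "\<dots> = (\<Sum>e\<in>E. chr1 \<beta> p q e u * chr1 \<beta> r s e u / \<beta> u e e)"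
      by (rule sum.cong) (use chr_eq[OF u that(3,4)] ED in auto)
    finally show ?thesis .
  qed
  have dchr: "dd (chr1 \<beta> p q w) r u = (d2 \<beta> r p q w u + d2 \<beta> r q p w u - d2 \<beta> r w p q u) / 2"
    if "p \<in> span D" "q \<in> span D" "r \<in> span D" for p q r
    unfolding d2_def chr1_def
    by (intro dd_eqI has_vector_derivative_divide has_vector_derivative_diff has_vector_derivative_add
        smooth_on_line[OF o _ u] d1_smooth that w)
  have "\<beta> u a1 w = dd (chr1 \<beta> y z w) x u - d1 \<beta> x (chr D \<beta> u y z) w u"
    unfolding a1_def by (rule chr_has_derivative(3)[OF u x y z w])
  moreover have "\<beta> u a2 w = dd (chr1 \<beta> x z w) y u - d1 \<beta> y (chr D \<beta> u x z) w u"
    unfolding a2_def by (rule chr_has_derivative(3)[OF u y x z w])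
  moreover have "\<beta> u a3 w = chr1 \<beta> x (chr D \<beta> u y z) w u" "\<beta> u a4 w = chr1 \<beta> y (chr D \<beta> u x z) w u"
    unfolding a3_def a4_def using chr_eq[OF u x c(1) w] chr_eq[OF u y c(2) w] by auto
  \<comment> \<open>In each identity the first summand on the right is the \<open>a3\<close> or
    \<open>a4\<close> term just computed, so one product of Christoffel symbols per sign
    survives.\<close>
  moreover note metric_compatible[OF u x c(1) w] metric_compatible[OF u y c(2) w]
  ultimately have "\<beta> u (K x) w = dd (chr1 \<beta> y z w) x u - dd (chr1 \<beta> x z w) y u
      + (chr1 \<beta> y w (chr D \<beta> u x z) u - chr1 \<beta> x w (chr D \<beta> u y z) u)"
    using 1 by simp
  then show "\<beta> u (K x) w = riem \<beta> E u x y z w"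
    unfolding dchr[OF y z x] dchr[OF x z y] G[OF y w x z] G[OF x w y z] riem_def
    by (simp add: sum_subtractf diff_divide_distrib)
qed

lemma ricci_riem:
  assumes u: "u \<in> W" and y: "y \<in> span D" and z: "z \<in> span D" and E: "frame (span D) (\<beta> u) E"
  shows "(\<Sum>b\<in>D. (dd (\<lambda>u. chr D \<beta> u y z) b u - dd (\<lambda>u. chr D \<beta> u b z) y u
      + chr D \<beta> u b (chr D \<beta> u y z) - chr D \<beta> u y (chr D \<beta> u b z)) \<bullet> b)
    = (\<Sum>e\<in>E. riem \<beta> E u e y z e / \<beta> u e e)"
proof -
  define K where "K x = dd (\<lambda>u. chr D \<beta> u y z) x u - dd (\<lambda>u. chr D \<beta> u x z) y u
      + chr D \<beta> u x (chr D \<beta> u y z) - chr D \<beta> u y (chr D \<beta> u x z)" for x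
  have ED: "E \<subseteq> span D" using E by (simp add: frame_def)
  have D: "D \<subseteq> Basis" using o by (simp add: oset_def)
  have Kin: "K x \<in> span D" and Kr: "w \<in> span D \<Longrightarrow> \<beta> u (K x) w = riem \<beta> E u x y z w"
    if "x \<in> span D" for x w
    unfolding K_def using curvature_riem[OF u that y z E] by auto
  have "(\<Sum>b\<in>D. K b \<bullet> b) = (\<Sum>e\<in>E. \<beta> u (K e) e / \<beta> u e e)"
  proof (rule frame_trace[OF sf[OF u] E D])
    show "K b \<in> span D" if "b \<in> D" for b by (rule Kin[OF span_base[OF that]])
    fix e assume "e \<in> E"
    then have e: "e \<in> span D" using ED by blast
    have "slin (span D) (\<lambda>x. riem \<beta> E u x y z e)" by (rule riem_lin[OF u ED y z e])
    then show "slin (span D) (\<lambda>x. \<beta> u (K x) e)"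
      unfolding slin_def using Kr[OF _ e] by (simp add: span_add span_scale)
  qed
  also have "\<dots> = (\<Sum>e\<in>E. riem \<beta> E u e y z e / \<beta> u e e)"
    by (rule sum.cong) (use Kr ED in auto)
  finally show ?thesis unfolding K_def .
qed

text \<open>Over an orthogonal frame the double trace involves only the values
  \<open>R(x,y,y,x)\<close>. From here on \<open>sec\<close> is therefore the only curvature
  quantity to be computed or transformed.\<close>

lemma trace_ricci:
  assumes u: "u \<in> W" and E: "frame (span D) (\<beta> u) E"
    and ric: "\<And>y z. y \<in> span D \<Longrightarrow> z \<in> span D \<Longrightarrow> ric y z = (\<Sum>e\<in>E. riem \<beta> E u e y z e / \<beta> u e e)"
  shows "(\<Sum>b\<in>D. sharp D (\<beta> u) (ric b) \<bullet> b) = scal \<beta> E u"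
proof -
  have ED: "E \<subseteq> span D" using E by (simp add: frame_def)
  have D: "D \<subseteq> Basis" using o by (simp add: oset_def)
  have "slin (span D) (\<lambda>z. \<Sum>e\<in>E. riem \<beta> E u e y z e / \<beta> u e e)" if "y \<in> span D" for y
    by (intro slin_sum_fun slin_divide riem_lin3[OF u ED _ that]) (use ED in auto)
  then have l2: "slin (span D) (ric y)" if "y \<in> span D" for y
    using that ric unfolding slin_def by (simp add: span_add span_scale)
  have "slin (span D) (\<lambda>y. \<Sum>e\<in>E. riem \<beta> E u e y z e / \<beta> u e e)" if "z \<in> span D" for z
    by (intro slin_sum_fun slin_divide riem_lin2[OF u ED _ that]) (use ED in auto)
  then have l1: "slin (span D) (\<lambda>y. ric y z)" if "z \<in> span D" for z
    using that ric unfolding slin_def by (simp add: span_add span_scale)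
  note s = sharp_props[OF pf[OF u] l2]
  have "(\<Sum>b\<in>D. sharp D (\<beta> u) (ric b) \<bullet> b) = (\<Sum>e\<in>E. \<beta> u (sharp D (\<beta> u) (ric e)) e / \<beta> u e e)"
  proof (rule frame_trace[OF sf[OF u] E D])
    show "sharp D (\<beta> u) (ric b) \<in> span D" if "b \<in> D" for b using s(1) span_base[OF that] .
    fix e assume "e \<in> E"
    then have e: "e \<in> span D" using ED by blast
    show "slin (span D) (\<lambda>v. \<beta> u (sharp D (\<beta> u) (ric v)) e)"
      using l1[OF e] unfolding slin_def using s(2)[OF _ e] by (simp add: span_add span_scale)
  qed
  also have "\<dots> = (\<Sum>y\<in>E. \<Sum>x\<in>E. sec \<beta> E u x y / (\<beta> u x x * \<beta> u y y))"
  proof (rule sum.cong)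
    fix y assume "y \<in> E"
    then have y: "y \<in> span D" using ED by blast
    have "ric y y = (\<Sum>x\<in>E. sec \<beta> E u x y / \<beta> u x x)"
      unfolding ric[OF y y] by (rule sum.cong) (use riem_sec[OF u _ y ED] ED in auto)
    then show "\<beta> u (sharp D (\<beta> u) (ric y)) y / \<beta> u y y = (\<Sum>x\<in>E. sec \<beta> E u x y / (\<beta> u x x * \<beta> u y y))"
      using s(2)[OF y y] by (simp add: sum_divide_distrib)
  qed simp
  also have "\<dots> = scal \<beta> E u" unfolding scal_def by (rule sum.swap)
  finally show ?thesis .
qed

end

section \<open>Invariance under changes of coordinates\<close>

text \<open>A product rule for inserting a moving vector \<open>A u\<close> into a linear slot.
  Expanding \<open>A u\<close> in the coordinate directions of \<open>D'\<close> reduces it to the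
  scalar product rule; the two summands differentiate the form and the inserted vector.\<close>

lemma dd_slot:
  fixes H :: "'f::euclidean_space \<Rightarrow> 'e::euclidean_space \<Rightarrow> real" and A :: "'f \<Rightarrow> 'e"
  assumes o: "oset D W" and D': "D' \<subseteq> Basis" and lin: "\<And>u. u \<in> W \<Longrightarrow> slin (span D') (H u)"
    and sm: "\<And>v. v \<in> span D' \<Longrightarrow> smooth_on D W (\<lambda>u. H u v)"
    and A: "smooth_on D W A" "\<And>u. u \<in> W \<Longrightarrow> A u \<in> span D'"
  shows "smooth_on D W (\<lambda>u. H u (A u))"
    and "u \<in> W \<Longrightarrow> x \<in> span D \<Longrightarrow> dd (\<lambda>u. H u (A u)) x u = dd (\<lambda>u'. H u' (A u)) x u + H u (dd A x u)"
proof -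
  have ex: "H u v = (\<Sum>b\<in>D'. (v \<bullet> b) * H u b)" if "u \<in> W" "v \<in> span D'" for u v
    by (rule slin_basis[OF D' lin[OF that(1)] that(2)])
  have s: "smooth_on D W (\<lambda>u. \<Sum>b\<in>D'. (A u \<bullet> b) * H u b)"
    by (intro smooth_on_sum smooth_on_mult smooth_on_bounded_linear[OF bounded_linear_inner_left] sm o A span_base)
  show "smooth_on D W (\<lambda>u. H u (A u))"
    by (rule smooth_on_cong[OF o s]) (use ex A in auto)
  assume u: "u \<in> W" and x: "x \<in> span D"
  have dA: "dd A x u \<in> span D'" by (rule dd_in_span[OF o smooth_on_ck[OF A(1)] u x D' A(2)])
  have "dd (\<lambda>u. H u (A u)) x u = dd (\<lambda>u. \<Sum>b\<in>D'. (A u \<bullet> b) * H u b) x u"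
    by (rule dd_cong[OF o u x]) (use ex A in auto)
  also have "\<dots> = (\<Sum>b\<in>D'. (A u \<bullet> b) * dd (\<lambda>u. H u b) x u + (dd A x u \<bullet> b) * H u b)"
  proof (rule dd_eqI, rule has_vector_derivative_sum)
    fix b assume b: "b \<in> D'"
    have "((\<lambda>t. A (u + t *\<^sub>R x) \<bullet> b) has_vector_derivative dd A x u \<bullet> b) (at 0)"
      by (rule bounded_linear.has_vector_derivative[OF bounded_linear_inner_left smooth_on_line[OF o A(1) u x]])
    from has_vector_derivative_mult[OF this smooth_on_line[OF o sm[OF span_base[OF b]] u x]]
    show "((\<lambda>t. A (u + t *\<^sub>R x) \<bullet> b * H (u + t *\<^sub>R x) b) has_vector_derivative
        A u \<bullet> b * dd (\<lambda>u. H u b) x u + dd A x u \<bullet> b * H u b) (at 0)"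
      by simp
  qed
  also have "\<dots> = dd (\<lambda>u'. H u' (A u)) x u + H u (dd A x u)"
  proof -
    have "dd (\<lambda>u'. H u' (A u)) x u = (\<Sum>b\<in>D'. (A u \<bullet> b) * dd (\<lambda>u. H u b) x u)"
      by (rule slin_basis[OF D' slin_dd_fun[OF o lin sm u x] A(2)[OF u]])
    then show ?thesis using ex[OF u dA] by (simp add: sum.distrib)
  qed
  finally show "dd (\<lambda>u. H u (A u)) x u = dd (\<lambda>u'. H u' (A u)) x u + H u (dd A x u)" .
qed

lemma dd_slot2:
  fixes H :: "'f::euclidean_space \<Rightarrow> 'e::euclidean_space \<Rightarrow> 'e \<Rightarrow> real" and A B :: "'f \<Rightarrow> 'e"
  assumes o: "oset D W" and D': "D' \<subseteq> Basis"
    and lin1: "\<And>u b. u \<in> W \<Longrightarrow> b \<in> span D' \<Longrightarrow> slin (span D') (\<lambda>a. H u a b)"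
    and lin2: "\<And>u a. u \<in> W \<Longrightarrow> a \<in> span D' \<Longrightarrow> slin (span D') (H u a)"
    and sm: "\<And>a b. a \<in> span D' \<Longrightarrow> b \<in> span D' \<Longrightarrow> smooth_on D W (\<lambda>u. H u a b)"
    and A: "smooth_on D W A" "\<And>u. u \<in> W \<Longrightarrow> A u \<in> span D'"
    and B: "smooth_on D W B" "\<And>u. u \<in> W \<Longrightarrow> B u \<in> span D'"
  shows "smooth_on D W (\<lambda>u. H u (A u) (B u))"
    and "u \<in> W \<Longrightarrow> x \<in> span D \<Longrightarrow> dd (\<lambda>u. H u (A u) (B u)) x u =
      dd (\<lambda>u'. H u' (A u) (B u)) x u + H u (dd A x u) (B u) + H u (A u) (dd B x u)"
proof -
  have s1: "smooth_on D W (\<lambda>u. H u (A u) b)" if "b \<in> span D'" for b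
    by (rule dd_slot(1)[OF o D' _ _ A, where H = "\<lambda>u a. H u a b"]) (use lin1 sm that in auto)
  show "smooth_on D W (\<lambda>u. H u (A u) (B u))"
    by (rule dd_slot(1)[OF o D' _ _ B, where H = "\<lambda>u. H u (A u)"]) (use lin2 s1 A in auto)
  assume u: "u \<in> W" and x: "x \<in> span D"
  have "dd (\<lambda>u. H u (A u) (B u)) x u = dd (\<lambda>u'. H u' (A u') (B u)) x u + H u (A u) (dd B x u)"
    by (rule dd_slot(2)[OF o D' _ _ B u x, where H = "\<lambda>u. H u (A u)"]) (use lin2 s1 A in auto)
  moreover have "dd (\<lambda>u'. H u' (A u') (B u)) x u = dd (\<lambda>u'. H u' (A u) (B u)) x u + H u (dd A x u) (B u)"
    by (rule dd_slot(2)[OF o D' _ _ A u x, where H = "\<lambda>u' a. H u' a (B u)"])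
      (use lin1 sm B(2)[OF u] in auto)
  ultimately show "dd (\<lambda>u. H u (A u) (B u)) x u =
      dd (\<lambda>u'. H u' (A u) (B u)) x u + H u (dd A x u) (B u) + H u (A u) (dd B x u)"
    by simp
qed

lemma dd_slot3:
  fixes H :: "'f::euclidean_space \<Rightarrow> 'e::euclidean_space \<Rightarrow> 'e \<Rightarrow> 'e \<Rightarrow> real" and A B C :: "'f \<Rightarrow> 'e"
  assumes o: "oset D W" and D': "D' \<subseteq> Basis"
    and lin1: "\<And>u b c. u \<in> W \<Longrightarrow> b \<in> span D' \<Longrightarrow> c \<in> span D' \<Longrightarrow> slin (span D') (\<lambda>a. H u a b c)"
    and lin2: "\<And>u a c. u \<in> W \<Longrightarrow> a \<in> span D' \<Longrightarrow> c \<in> span D' \<Longrightarrow> slin (span D') (\<lambda>b. H u a b c)"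
    and lin3: "\<And>u a b. u \<in> W \<Longrightarrow> a \<in> span D' \<Longrightarrow> b \<in> span D' \<Longrightarrow> slin (span D') (H u a b)"
    and sm: "\<And>a b c. a \<in> span D' \<Longrightarrow> b \<in> span D' \<Longrightarrow> c \<in> span D' \<Longrightarrow> smooth_on D W (\<lambda>u. H u a b c)"
    and A: "smooth_on D W A" "\<And>u. u \<in> W \<Longrightarrow> A u \<in> span D'"
    and B: "smooth_on D W B" "\<And>u. u \<in> W \<Longrightarrow> B u \<in> span D'"
    and C: "smooth_on D W C" "\<And>u. u \<in> W \<Longrightarrow> C u \<in> span D'"
    and u: "u \<in> W" and x: "x \<in> span D"
  shows "dd (\<lambda>u. H u (A u) (B u) (C u)) x u = dd (\<lambda>u'. H u' (A u) (B u) (C u)) x u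
      + H u (dd A x u) (B u) (C u) + H u (A u) (dd B x u) (C u) + H u (A u) (B u) (dd C x u)"
proof -
  have s2: "smooth_on D W (\<lambda>u. H u (A u) b c)" if "b \<in> span D'" "c \<in> span D'" for b c
    by (rule dd_slot(1)[OF o D' _ _ A, where H = "\<lambda>u a. H u a b c"]) (use lin1 sm that in auto)
  have "dd (\<lambda>u. H u (A u) (B u) (C u)) x u = dd (\<lambda>u'. H u' (A u') (B u) (C u)) x u
      + H u (A u) (dd B x u) (C u) + H u (A u) (B u) (dd C x u)"
    by (rule dd_slot2(2)[OF o D' _ _ _ B C u x, where H = "\<lambda>u. H u (A u)"])
      (use lin2 lin3 s2 A in auto)
  moreover have "dd (\<lambda>u'. H u' (A u') (B u) (C u)) x u = dd (\<lambda>u'. H u' (A u) (B u) (C u)) x u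
      + H u (dd A x u) (B u) (C u)"
    by (rule dd_slot(2)[OF o D' _ _ A u x, where H = "\<lambda>u' a. H u' a (B u) (C u)"])
      (use lin1 sm B(2)[OF u] C(2)[OF u] in auto)
  ultimately show ?thesis by simp
qed

text \<open>\<phi> is any smooth map between coordinate domains, possibly in different model spaces.
  Only the comparison of full curvature traces asks for a surjective differential.\<close>

locale pullback = lform D W \<beta> for D W :: "'e::euclidean_space set" and \<beta> +
  fixes D' W' :: "'f::euclidean_space set" and \<phi> :: "'f \<Rightarrow> 'e" and \<beta>' :: "'f \<Rightarrow> 'f \<Rightarrow> 'f \<Rightarrow> real"
  assumes o': "oset D' W'" and \<phi>: "smooth_on D' W' \<phi>" and im: "\<phi> ` W' \<subseteq> W"
    and pb: "u \<in> W' \<Longrightarrow> v \<in> span D' \<Longrightarrow> w \<in> span D' \<Longrightarrow> \<beta>' u v w = \<beta> (\<phi> u) (dd \<phi> v u) (dd \<phi> w u)"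
begin

abbreviation T where "T v u \<equiv> dd \<phi> v u"
abbreviation T2 where "T2 x v u \<equiv> dd (dd \<phi> v) x u"

lemma D: "D \<subseteq> Basis" using o by (simp add: oset_def)

lemma imW: "u \<in> W' \<Longrightarrow> \<phi> u \<in> W" using im by blast

lemma T_in: "u \<in> W' \<Longrightarrow> v \<in> span D' \<Longrightarrow> T v u \<in> span D"
  by (rule dd_smooth_in_span[OF o o' \<phi> im])

lemma T_smooth: "v \<in> span D' \<Longrightarrow> smooth_on D' W' (dd \<phi> v)"
  by (rule smooth_on_dd[OF o' \<phi>])

lemma T2_in: "u \<in> W' \<Longrightarrow> x \<in> span D' \<Longrightarrow> v \<in> span D' \<Longrightarrow> T2 x v u \<in> span D"
  by (rule dd_in_span[OF o' smooth_on_ck[OF T_smooth] _ _ D T_in])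

lemma T2_smooth: "v \<in> span D' \<Longrightarrow> x \<in> span D' \<Longrightarrow> smooth_on D' W' (dd (dd \<phi> v) x)"
  by (rule smooth_on_dd[OF o' T_smooth])

lemma T2_sym: "u \<in> W' \<Longrightarrow> x \<in> span D' \<Longrightarrow> v \<in> span D' \<Longrightarrow> T2 x v u = T2 v x u"
  by (rule dd_commute[OF o' \<phi>])

lemma T3_sym:
  "u \<in> W' \<Longrightarrow> x \<in> span D' \<Longrightarrow> y \<in> span D' \<Longrightarrow> v \<in> span D' \<Longrightarrow> dd (\<lambda>u. T2 y v u) x u = dd (\<lambda>u. T2 v y u) x u"
  by (rule dd_cong[OF o']) (auto intro: T2_sym)

lemma T3_commute:
  "u \<in> W' \<Longrightarrow> x \<in> span D' \<Longrightarrow> y \<in> span D' \<Longrightarrow> v \<in> span D' \<Longrightarrow> dd (dd (dd \<phi> v) y) x u = dd (dd (dd \<phi> v) x) y u"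
  by (rule dd_commute[OF o' T_smooth])

lemma T_lin: "u \<in> W' \<Longrightarrow> v \<in> span D' \<Longrightarrow> w \<in> span D' \<Longrightarrow> T (s *\<^sub>R v + t *\<^sub>R w) u = s *\<^sub>R T v u + t *\<^sub>R T w u"
  by (rule dd_linear[OF o' smooth_on_ck[OF \<phi>]])

lemma smooth_comp: "smooth_on D W f \<Longrightarrow> smooth_on D' W' (\<lambda>u. f (\<phi> u))"
  by (rule smooth_on_compose[OF o o' _ \<phi> im])

lemma dd_comp: "smooth_on D W f \<Longrightarrow> u \<in> W' \<Longrightarrow> x \<in> span D' \<Longrightarrow> dd (\<lambda>u. f (\<phi> u)) x u = dd f (T x u) (\<phi> u)"
  by (rule dd_compose[OF o o' _ \<phi> im])

lemma dd_beta:
  assumes A: "smooth_on D' W' A" "\<And>u. u \<in> W' \<Longrightarrow> A u \<in> span D"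
    and B: "smooth_on D' W' B" "\<And>u. u \<in> W' \<Longrightarrow> B u \<in> span D"
  shows "smooth_on D' W' (\<lambda>u. \<beta> (\<phi> u) (A u) (B u))"
    and "u \<in> W' \<Longrightarrow> x \<in> span D' \<Longrightarrow> dd (\<lambda>u. \<beta> (\<phi> u) (A u) (B u)) x u =
      d1 \<beta> (T x u) (A u) (B u) (\<phi> u) + \<beta> (\<phi> u) (dd A x u) (B u) + \<beta> (\<phi> u) (A u) (dd B x u)"
proof -
  have h: "\<And>u b. u \<in> W' \<Longrightarrow> b \<in> span D \<Longrightarrow> slin (span D) (\<lambda>a. \<beta> (\<phi> u) a b)"
    "\<And>u a. u \<in> W' \<Longrightarrow> a \<in> span D \<Longrightarrow> slin (span D) (\<beta> (\<phi> u) a)"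
    "\<And>a b. a \<in> span D \<Longrightarrow> b \<in> span D \<Longrightarrow> smooth_on D' W' (\<lambda>u. \<beta> (\<phi> u) a b)"
    using lin1 lin2 imW smooth_comp[OF sm] by auto
  show "smooth_on D' W' (\<lambda>u. \<beta> (\<phi> u) (A u) (B u))"
    by (rule dd_slot2(1)[OF o' D _ _ _ A B, where H = "\<lambda>u. \<beta> (\<phi> u)"]) (use h in auto)
  assume u: "u \<in> W'" and x: "x \<in> span D'"
  have "dd (\<lambda>u'. \<beta> (\<phi> u') (A u) (B u)) x u = d1 \<beta> (T x u) (A u) (B u) (\<phi> u)"
    unfolding d1_def by (rule dd_comp[OF sm[OF A(2)[OF u] B(2)[OF u]] u x])
  then show "dd (\<lambda>u. \<beta> (\<phi> u) (A u) (B u)) x u =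
      d1 \<beta> (T x u) (A u) (B u) (\<phi> u) + \<beta> (\<phi> u) (dd A x u) (B u) + \<beta> (\<phi> u) (A u) (dd B x u)"
    using dd_slot2(2)[OF o' D _ _ _ A B u x, where H = "\<lambda>u. \<beta> (\<phi> u)"] h by simp
qed

lemma dd_d1_beta:
  assumes A: "smooth_on D' W' A" "\<And>u. u \<in> W' \<Longrightarrow> A u \<in> span D"
    and B: "smooth_on D' W' B" "\<And>u. u \<in> W' \<Longrightarrow> B u \<in> span D"
    and C: "smooth_on D' W' C" "\<And>u. u \<in> W' \<Longrightarrow> C u \<in> span D"
    and u: "u \<in> W'" and x: "x \<in> span D'"
  shows "dd (\<lambda>u. d1 \<beta> (A u) (B u) (C u) (\<phi> u)) x u =
      d2 \<beta> (T x u) (A u) (B u) (C u) (\<phi> u) + d1 \<beta> (dd A x u) (B u) (C u) (\<phi> u)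
      + d1 \<beta> (A u) (dd B x u) (C u) (\<phi> u) + d1 \<beta> (A u) (B u) (dd C x u) (\<phi> u)"
proof -
  have h: "\<And>u b c. u \<in> W' \<Longrightarrow> b \<in> span D \<Longrightarrow> c \<in> span D \<Longrightarrow> slin (span D) (\<lambda>a. d1 \<beta> a b c (\<phi> u))"
    "\<And>u a c. u \<in> W' \<Longrightarrow> a \<in> span D \<Longrightarrow> c \<in> span D \<Longrightarrow> slin (span D) (\<lambda>b. d1 \<beta> a b c (\<phi> u))"
    "\<And>u a b. u \<in> W' \<Longrightarrow> a \<in> span D \<Longrightarrow> b \<in> span D \<Longrightarrow> slin (span D) (\<lambda>c. d1 \<beta> a b c (\<phi> u))"
    "\<And>a b c. a \<in> span D \<Longrightarrow> b \<in> span D \<Longrightarrow> c \<in> span D \<Longrightarrow> smooth_on D' W' (\<lambda>u. d1 \<beta> a b c (\<phi> u))"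
    using d1_lin_dir d1_lin1 d1_lin2 imW smooth_comp[OF d1_smooth] by auto
  have "dd (\<lambda>u'. d1 \<beta> (A u) (B u) (C u) (\<phi> u')) x u = d2 \<beta> (T x u) (A u) (B u) (C u) (\<phi> u)"
    unfolding d2_def by (rule dd_comp[OF d1_smooth u x]) (use A B C u in auto)
  then show ?thesis
    using dd_slot3[OF o' D _ _ _ _ A B C u x, where H = "\<lambda>u a b c. d1 \<beta> a b c (\<phi> u)"] h by simp
qed

lemma pb_smooth: "v \<in> span D' \<Longrightarrow> w \<in> span D' \<Longrightarrow> smooth_on D' W' (\<lambda>u. \<beta>' u v w)"
  by (rule smooth_on_cong[OF o' dd_beta(1)[OF T_smooth T_in T_smooth T_in]]) (use pb in auto)

lemma pb_symform: "u \<in> W' \<Longrightarrow> symform (span D') (\<beta>' u)"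
  unfolding symform_def slin_def
proof (intro conjI ballI allI)
  assume u: "u \<in> W'"
  show "\<beta>' u v w = \<beta>' u w v" if "v \<in> span D'" "w \<in> span D'" for v w
    using pb[OF u] that symform_sym[OF sf[OF imW[OF u]] T_in[OF u] T_in[OF u]] by simp
  show "\<beta>' u (s *\<^sub>R v1 + t *\<^sub>R v2) w = s * \<beta>' u v1 w + t * \<beta>' u v2 w"
    if "v1 \<in> span D'" "v2 \<in> span D'" "w \<in> span D'" for v1 v2 w s t
    using that u by (simp add: pb span_add span_scale T_lin slinD[OF lin1[OF imW[OF u] T_in]] T_in)
qed (simp add: subspace_span)

sublocale pb: lform D' W' \<beta>'
  by unfold_locales (use o' pb_smooth pb_symform in auto)

lemma pb_d1:
  assumes u: "u \<in> W'" and x: "x \<in> span D'" and v: "v \<in> span D'" and w: "w \<in> span D'"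
  shows "d1 \<beta>' x v w u = d1 \<beta> (T x u) (T v u) (T w u) (\<phi> u)
    + \<beta> (\<phi> u) (T2 x v u) (T w u) + \<beta> (\<phi> u) (T v u) (T2 x w u)"
proof -
  have "d1 \<beta>' x v w u = dd (\<lambda>u. \<beta> (\<phi> u) (T v u) (T w u)) x u"
    unfolding d1_def by (rule dd_cong[OF o' u x]) (rule pb[OF _ v w])
  also have "\<dots> = d1 \<beta> (T x u) (T v u) (T w u) (\<phi> u)
    + \<beta> (\<phi> u) (T2 x v u) (T w u) + \<beta> (\<phi> u) (T v u) (T2 x w u)"
    by (rule dd_beta(2)[OF T_smooth[OF v] T_in[OF _ v] T_smooth[OF w] T_in[OF _ w] u x])
  finally show ?thesis .
qed

lemma pb_d2:
  assumes u: "u \<in> W'" and y: "y \<in> span D'" and x: "x \<in> span D'" and v: "v \<in> span D'" and w: "w \<in> span D'"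
  shows "d2 \<beta>' y x v w u =
    d2 \<beta> (T y u) (T x u) (T v u) (T w u) (\<phi> u) + d1 \<beta> (T2 y x u) (T v u) (T w u) (\<phi> u)
    + d1 \<beta> (T x u) (T2 y v u) (T w u) (\<phi> u) + d1 \<beta> (T x u) (T v u) (T2 y w u) (\<phi> u)
    + (d1 \<beta> (T y u) (T2 x v u) (T w u) (\<phi> u) + \<beta> (\<phi> u) (dd (dd (dd \<phi> v) x) y u) (T w u)
      + \<beta> (\<phi> u) (T2 x v u) (T2 y w u))
    + (d1 \<beta> (T y u) (T v u) (T2 x w u) (\<phi> u) + \<beta> (\<phi> u) (T2 y v u) (T2 x w u)
      + \<beta> (\<phi> u) (T v u) (dd (dd (dd \<phi> w) x) y u))"
proof -
  define f1 where "f1 = (\<lambda>u. d1 \<beta> (T x u) (T v u) (T w u) (\<phi> u))"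
  define f2 where "f2 = (\<lambda>u. \<beta> (\<phi> u) (T2 x v u) (T w u))"
  define f3 where "f3 = (\<lambda>u. \<beta> (\<phi> u) (T v u) (T2 x w u))"
  have s2: "smooth_on D' W' f2"
    unfolding f2_def by (rule dd_beta(1)[OF T2_smooth[OF v x] T2_in[OF _ x v] T_smooth[OF w] T_in[OF _ w]])
  have s3: "smooth_on D' W' f3"
    unfolding f3_def by (rule dd_beta(1)[OF T_smooth[OF v] T_in[OF _ v] T2_smooth[OF w x] T2_in[OF _ x w]])
  have "smooth_on D' W' (\<lambda>u. d1 \<beta>' x v w u + (-1) * f2 u + (-1) * f3 u)"
    by (intro smooth_on_add smooth_on_mult smooth_on_const o' s2 s3 pb.d1_smooth x v w)
  then have s1: "smooth_on D' W' f1"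
    by (rule smooth_on_cong[OF o']) (use pb_d1[OF _ x v w] in \<open>simp add: f1_def f2_def f3_def\<close>)
  have "d2 \<beta>' y x v w u = dd (\<lambda>u. f1 u + f2 u + f3 u) y u"
    unfolding d2_def by (rule dd_cong[OF o' u y]) (simp add: pb_d1[OF _ x v w] f1_def f2_def f3_def)
  also have "\<dots> = dd f1 y u + dd f2 y u + dd f3 y u"
    by (rule dd_eqI) (intro has_vector_derivative_add smooth_on_line[OF o' _ u y] s1 s2 s3)
  also have "dd f1 y u = d2 \<beta> (T y u) (T x u) (T v u) (T w u) (\<phi> u) + d1 \<beta> (T2 y x u) (T v u) (T w u) (\<phi> u)
    + d1 \<beta> (T x u) (T2 y v u) (T w u) (\<phi> u) + d1 \<beta> (T x u) (T v u) (T2 y w u) (\<phi> u)"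
    unfolding f1_def
    by (rule dd_d1_beta[OF T_smooth[OF x] T_in[OF _ x] T_smooth[OF v] T_in[OF _ v] T_smooth[OF w] T_in[OF _ w] u y])
  also have "dd f2 y u = d1 \<beta> (T y u) (T2 x v u) (T w u) (\<phi> u) + \<beta> (\<phi> u) (dd (dd (dd \<phi> v) x) y u) (T w u)
      + \<beta> (\<phi> u) (T2 x v u) (T2 y w u)"
    unfolding f2_def
    by (rule dd_beta(2)[OF T2_smooth[OF v x] T2_in[OF _ x v] T_smooth[OF w] T_in[OF _ w] u y])
  also have "dd f3 y u = d1 \<beta> (T y u) (T v u) (T2 x w u) (\<phi> u) + \<beta> (\<phi> u) (T2 y v u) (T2 x w u)
      + \<beta> (\<phi> u) (T v u) (dd (dd (dd \<phi> w) x) y u)"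
    unfolding f3_def
    by (rule dd_beta(2)[OF T_smooth[OF v] T_in[OF _ v] T2_smooth[OF w x] T2_in[OF _ x w] u y])
  finally show ?thesis .
qed

text \<open>The transformation law of Christoffel symbols: the inhomogeneous term is the second
  derivative of \<phi>, paired with the image vector. The other second-derivative terms cancel in
  the Koszul combination because that derivative is symmetric.\<close>

lemma pb_chr1:
  assumes u: "u \<in> W'" and x: "x \<in> span D'" and v: "v \<in> span D'" and w: "w \<in> span D'"
  shows "chr1 \<beta>' x v w u = chr1 \<beta> (T x u) (T v u) (T w u) (\<phi> u) + \<beta> (\<phi> u) (T2 x v u) (T w u)"
proof -
  note s = symform_sym[OF sf[OF imW[OF u]]]
  show ?thesis
    unfolding chr1_def pb_d1[OF u x v w] pb_d1[OF u v x w] pb_d1[OF u w x v]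
    using T2_sym[OF u x v] T2_sym[OF u w x] T2_sym[OF u w v]
      s[OF T_in[OF u v] T2_in[OF u x w]] s[OF T_in[OF u x] T2_in[OF u v w]]
    by (simp add: field_simps)
qed

text \<open>Against an orthogonal frame, pairing a linear form with \<open>\<beta> u q\<close>
  evaluates the form at \<open>q\<close>. The cross terms created by the inhomogeneous part of
  \<open>pb_chr1\<close> thus become values of \<open>chr1\<close> at second derivatives of
  \<phi>.\<close>

lemma frame_pairing:
  assumes u: "u \<in> W" and E: "frame (span D) (\<beta> u) E" and f: "slin (span D) f" and g: "slin (span D) g"
    and p: "p \<in> span D" and q: "q \<in> span D"
  shows "(\<Sum>e\<in>E. (f e + \<beta> u p e) * (g e + \<beta> u q e) / \<beta> u e e)
    = (\<Sum>e\<in>E. f e * g e / \<beta> u e e) + f q + g p + \<beta> u p q"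
proof -
  have "f q = (\<Sum>e\<in>E. \<beta> u q e * f e / \<beta> u e e)" by (rule slin_frame_expand[OF sf[OF u] E q f])
  moreover have "g p = (\<Sum>e\<in>E. \<beta> u p e * g e / \<beta> u e e)" by (rule slin_frame_expand[OF sf[OF u] E p g])
  moreover have "\<beta> u p q = (\<Sum>e\<in>E. \<beta> u q e * \<beta> u p e / \<beta> u e e)"
    by (rule slin_frame_expand[OF sf[OF u] E q lin2[OF u p]])
  ultimately show ?thesis
    by (simp add: sum.distrib[symmetric] add_divide_distrib[symmetric] algebra_simps)
qed

text \<open>Tensoriality of curvature, checked term by term. The third derivatives of \<phi> cancel
  among the three \<open>d2\<close> terms after reordering, and the second derivatives cancel
  between the \<open>d2\<close> terms and the cross terms of \<open>frame_pairing\<close>.\<close>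

lemma pb_sec:
  assumes u: "u \<in> W'" and x: "x \<in> span D'" and y: "y \<in> span D'"
    and E: "E \<subseteq> span D'" and inj: "inj_on (\<lambda>v. T v u) E"
    and F: "frame (span D) (\<beta> (\<phi> u)) ((\<lambda>v. T v u) ` E)"
  shows "sec \<beta>' E u x y = sec \<beta> ((\<lambda>v. T v u) ` E) (\<phi> u) (T x u) (T y u)"
proof -
  let ?b = "\<beta> (\<phi> u)"
  let ?X = "T x u" and ?Y = "T y u" and ?xy = "T2 x y u" and ?xx = "T2 x x u" and ?yy = "T2 y y u"
  note W = imW[OF u]
  note X = T_in[OF u x] and Y = T_in[OF u y] and XY = T2_in[OF u x y] and XX = T2_in[OF u x x] and YY = T2_in[OF u y y]
  have bE: "\<beta>' u e e = ?b (T e u) (T e u)" if "e \<in> E" for e using pb[OF u] E that by blast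
  have S: "(\<Sum>e\<in>E. chr1 \<beta>' p q e u * chr1 \<beta>' r s e u / \<beta>' u e e)
     = (\<Sum>e\<in>(\<lambda>v. T v u) ` E. chr1 \<beta> (T p u) (T q u) e (\<phi> u) * chr1 \<beta> (T r u) (T s u) e (\<phi> u) / ?b e e)
       + chr1 \<beta> (T p u) (T q u) (T2 r s u) (\<phi> u) + chr1 \<beta> (T r u) (T s u) (T2 p q u) (\<phi> u)
       + ?b (T2 p q u) (T2 r s u)"
    if "p \<in> span D'" "q \<in> span D'" "r \<in> span D'" "s \<in> span D'" for p q r s
  proof -
    have "(\<Sum>e\<in>E. chr1 \<beta>' p q e u * chr1 \<beta>' r s e u / \<beta>' u e e)
      = (\<Sum>e\<in>(\<lambda>v. T v u) ` E. (chr1 \<beta> (T p u) (T q u) e (\<phi> u) + ?b (T2 p q u) e)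
          * (chr1 \<beta> (T r u) (T s u) e (\<phi> u) + ?b (T2 r s u) e) / ?b e e)"
      unfolding sum.reindex[OF inj] o_def
      by (rule sum.cong) (use pb_chr1[OF u that(1,2)] pb_chr1[OF u that(3,4)] E bE in auto)
    also have "\<dots> = (\<Sum>e\<in>(\<lambda>v. T v u) ` E. chr1 \<beta> (T p u) (T q u) e (\<phi> u) * chr1 \<beta> (T r u) (T s u) e (\<phi> u) / ?b e e)
       + chr1 \<beta> (T p u) (T q u) (T2 r s u) (\<phi> u) + chr1 \<beta> (T r u) (T s u) (T2 p q u) (\<phi> u)
       + ?b (T2 p q u) (T2 r s u)"
      by (rule frame_pairing[OF W F]) (use T_in[OF u] T2_in[OF u] chr1_lin3[OF W] that in auto)
    finally show ?thesis .
  qed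
  define Q where "Q p q r s = (\<Sum>e\<in>(\<lambda>v. T v u) ` E. chr1 \<beta> (T p u) (T q u) e (\<phi> u) * chr1 \<beta> (T r u) (T s u) e (\<phi> u) / ?b e e)"
    for p q r s
  have L: "sec \<beta>' E u x y = d2 \<beta>' x y x y u - d2 \<beta>' x x y y u / 2 - d2 \<beta>' y y x x u / 2
     + (\<Sum>e\<in>E. chr1 \<beta>' x y e u * chr1 \<beta>' x y e u / \<beta>' u e e) - (\<Sum>e\<in>E. chr1 \<beta>' x x e u * chr1 \<beta>' y y e u / \<beta>' u e e)"
    unfolding sec_def by (simp add: power2_eq_square sum_subtractf diff_divide_distrib)
  have R: "sec \<beta> ((\<lambda>v. T v u) ` E) (\<phi> u) ?X ?Y = d2 \<beta> ?X ?Y ?X ?Y (\<phi> u) - d2 \<beta> ?X ?X ?Y ?Y (\<phi> u) / 2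
      - d2 \<beta> ?Y ?Y ?X ?X (\<phi> u) / 2 + Q x y x y - Q x x y y"
    unfolding sec_def Q_def by (simp add: power2_eq_square sum_subtractf diff_divide_distrib)
  \<comment> \<open>Third derivatives of \<phi> are brought to one order of differentiation, so that
    the final comparison is linear in matching terms.\<close>
  have t: "dd (dd (dd \<phi> x) y) x u = dd (dd (dd \<phi> y) x) x u" "dd (dd (dd \<phi> x) y) y u = dd (dd (dd \<phi> y) y) x u"
    using T3_sym[OF u x y x] T3_sym[OF u y y x] T3_commute[OF u x y y] by auto
  have t2: "T2 y x u = ?xy" by (rule T2_sym[OF u y x])
  note sy = symform_sym[OF sf[OF W]]
  have b: "?b ?X (dd (dd (dd \<phi> y) y) x u) = ?b (dd (dd (dd \<phi> y) y) x u) ?X"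
    by (rule sy[OF X]) (rule dd_in_span[OF o' smooth_on_ck[OF T2_smooth[OF y y]] u x D T2_in[OF _ y y]])
  have b2: "?b ?Y (dd (dd (dd \<phi> y) x) x u) = ?b (dd (dd (dd \<phi> y) x) x u) ?Y"
    by (rule sy[OF Y]) (rule dd_in_span[OF o' smooth_on_ck[OF T2_smooth[OF y x]] u x D T2_in[OF _ x y]])
  note ds = d1_sym[OF W X X YY] d1_sym[OF W Y Y XX] d1_sym[OF W X Y XY] d1_sym[OF W Y X XY]
    d1_sym[OF W XY X Y] d1_sym[OF W X Y YY] d1_sym[OF W Y X XX] sy[OF XX YY] sy[OF X XX] sy[OF Y YY]
  show ?thesis
    unfolding L R S[OF x y x y] S[OF x x y y] pb_d2[OF u x y x y] pb_d2[OF u x x y y] pb_d2[OF u y y x x] Q_def[symmetric]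
    unfolding chr1_def t t2 b b2 using ds by argo
qed

text \<open>The pullback values \<open>\<beta>' u e e'\<close> are the products of the image
  vectors, so orthogonality and positive length pass to the images and also separate them.
  Surjectivity is what makes the images span.\<close>

lemma frame_pushforward:
  assumes u: "u \<in> W'" and E: "frame (span D') (\<beta>' u) E"
    and surj: "span D \<subseteq> (\<lambda>v. T v u) ` span D'"
  shows "inj_on (\<lambda>v. T v u) E" and "frame (span D) (\<beta> (\<phi> u)) ((\<lambda>v. T v u) ` E)"
proof -
  have ED: "E \<subseteq> span D'" and fin: "finite E" and sp: "span E = span D'" using E by (auto simp: frame_def)
  have bE: "\<beta> (\<phi> u) (T e u) (T e' u) = \<beta>' u e e'" if "e \<in> E" "e' \<in> E" for e e'
    using pb[OF u] that ED by (metis subsetD)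
  show "inj_on (\<lambda>v. T v u) E"
  proof (rule inj_onI, rule ccontr)
    fix e e' assume e: "e \<in> E" "e' \<in> E" "T e u = T e' u" "e \<noteq> e'"
    then have "\<beta>' u e e = \<beta>' u e e'" using bE by metis
    then show False using frame_pos[OF E e(1)] frame_orth[OF E e(1,2,4)] by simp
  qed
  have "(\<lambda>v. T v u) ` span D' \<subseteq> span ((\<lambda>v. T v u) ` E)"
  proof clarify
    fix w assume "w \<in> span D'"
    then have "w \<in> span E" using sp by simp
    then have "w \<in> span D' \<and> T w u \<in> span ((\<lambda>v. T v u) ` E)"
    proof (induction rule: span_induct_alt)
      case base
      have "T (0 *\<^sub>R 0 + 0 *\<^sub>R 0) u = 0 *\<^sub>R T 0 u + 0 *\<^sub>R T 0 u"
        by (rule T_lin[OF u span_zero span_zero])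
      then have "T 0 u = 0" by simp
      then show ?case by (simp add: span_zero)
    next
      case (step c e y)
      have e: "e \<in> span D'" using step ED by blast
      have "T (c *\<^sub>R e + 1 *\<^sub>R y) u = c *\<^sub>R T e u + 1 *\<^sub>R T y u"
        using step by (intro T_lin[OF u e]) auto
      then show ?case using step e by (simp add: span_add span_scale span_base)
    qed
    then show "T w u \<in> span ((\<lambda>v. T v u) ` E)" ..
  qed
  then have "span D \<subseteq> span ((\<lambda>v. T v u) ` E)" using surj by blast
  moreover have "(\<lambda>v. T v u) ` E \<subseteq> span D" using T_in[OF u] ED by blast
  ultimately show "frame (span D) (\<beta> (\<phi> u)) ((\<lambda>v. T v u) ` E)"
    unfolding frame_def
  proof (intro conjI ballI impI)
    assume *: "span D \<subseteq> span ((\<lambda>v. T v u) ` E)" "(\<lambda>v. T v u) ` E \<subseteq> span D"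
    show "span ((\<lambda>v. T v u) ` E) = span D" using * by (metis span_minimal subspace_span subset_antisym)
    show "0 < \<beta> (\<phi> u) e e" if "e \<in> (\<lambda>v. T v u) ` E" for e
      using that bE frame_pos[OF E] by auto
    show "\<beta> (\<phi> u) e e' = 0" if ee: "e \<in> (\<lambda>v. T v u) ` E" "e' \<in> (\<lambda>v. T v u) ` E" "e \<noteq> e'" for e e'
    proof -
      obtain v w where v: "v \<in> E" "e = T v u" and w: "w \<in> E" "e' = T w u" using ee by blast
      then have "v \<noteq> w" using ee(3) by blast
      then show ?thesis using bE[OF v(1) w(1)] frame_orth[OF E v(1) w(1)] v w by simp
    qed
  qed (use fin in auto)
qed

lemma pb_scal:
  assumes u: "u \<in> W'" and E: "frame (span D') (\<beta>' u) E"
    and surj: "span D \<subseteq> (\<lambda>v. T v u) ` span D'"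
  shows "scal \<beta>' E u = scal \<beta> ((\<lambda>v. T v u) ` E) (\<phi> u)"
proof -
  note F = frame_pushforward[OF assms]
  have ED: "E \<subseteq> span D'" using E by (auto simp: frame_def)
  have "sec \<beta>' E u x y / (\<beta>' u x x * \<beta>' u y y)
     = sec \<beta> ((\<lambda>v. T v u) ` E) (\<phi> u) (T x u) (T y u) / (\<beta> (\<phi> u) (T x u) (T x u) * \<beta> (\<phi> u) (T y u) (T y u))"
    if "x \<in> E" "y \<in> E" for x y
  proof -
    have "x \<in> span D'" "y \<in> span D'" using that ED by auto
    then show ?thesis using pb_sec[OF u _ _ ED F] pb[OF u] by simp
  qed
  then show ?thesis unfolding scal_def sum.reindex[OF F(1)] o_def by simp
qed

end

context lform
begin

lemmas zero_args = slin_zero[OF lin1 subspace_span] slin_zero[OF lin2 subspace_span]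
  slin_zero[OF d1_lin_dir subspace_span] slin_zero[OF d1_lin1 subspace_span] slin_zero[OF d1_lin2 subspace_span]
  slin_zero[OF d2_lin_dir subspace_span] slin_zero[OF d2_lin_dir2 subspace_span]
  slin_zero[OF d2_lin1 subspace_span] slin_zero[OF d2_lin2 subspace_span]

lemma sec_self: "sec \<beta> E u x x = 0"
  by (simp add: sec_def power2_eq_square)

lemma sec_sym:
  assumes "u \<in> W" "x \<in> span D" "y \<in> span D" "E \<subseteq> span D"
  shows "sec \<beta> E u x y = sec \<beta> E u y x"
proof -
  have "(\<Sum>e\<in>E. ((chr1 \<beta> x y e u)\<^sup>2 - chr1 \<beta> x x e u * chr1 \<beta> y y e u) / \<beta> u e e)
    = (\<Sum>e\<in>E. ((chr1 \<beta> y x e u)\<^sup>2 - chr1 \<beta> y y e u * chr1 \<beta> x x e u) / \<beta> u e e)"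
    by (rule sum.cong) (use assms chr1_sym[of u y x] in \<open>auto simp: mult.commute\<close>)
  then show ?thesis
    unfolding sec_def using d2_commute[of u y x y x] d2_sym[of u x y x y] assms by simp
qed

end

section \<open>The scalar curvature of the cohomogeneity one metric\<close>

definition xcoords :: "'e::euclidean_space set \<Rightarrow> (real \<times> real \<times> 'e) set" where
  "xcoords D = {(1, 0, 0), (0, 1, 0)} \<union> (\<lambda>b. (0, 0, b)) ` D"

lemma xcoords_Basis: "D \<subseteq> Basis \<Longrightarrow> xcoords D \<subseteq> Basis"
  by (auto simp: xcoords_def Basis_prod_def zero_prod_def image_iff)

lemma span_xcoords: "span (xcoords D) = {(x, s, y) | x s y. y \<in> span D}"
proof -
  have "subspace {(x::real, s::real, y) | x s y. y \<in> span D}"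
    unfolding subspace_def by (auto simp: zero_prod_def span_zero span_add span_scale)
  then have 1: "span (xcoords D) \<subseteq> {(x, s, y) | x s y. y \<in> span D}"
    by (intro span_minimal) (auto simp: xcoords_def span_base span_zero)
  have inc: "(0, 0, y) \<in> span (xcoords D)" if "y \<in> span D" for y
    using that
  proof (induction rule: span_induct_alt)
    case base
    then show ?case by (metis span_zero zero_prod_def)
  next
    case (step c b y)
    have "(0, 0, b) \<in> xcoords D" using step by (auto simp: xcoords_def)
    from span_add[OF span_scale[OF span_base[OF this]] step(2)]
    have "c *\<^sub>R (0, 0, b) + (0, 0, y) \<in> span (xcoords D)" .
    then show ?case by simp
  qed
  have "(x, s, y) \<in> span (xcoords D)" if "y \<in> span D" for x s y
  proof -
    have "x *\<^sub>R (1, 0, 0) + s *\<^sub>R (0, 1, 0) + (0, 0, y) \<in> span (xcoords D)"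
      by (intro span_add[OF span_add[OF span_scale[OF span_base] span_scale[OF span_base]] inc[OF that]])
        (auto simp: xcoords_def)
    then show ?thesis by simp
  qed
  with 1 show ?thesis by auto
qed

lemma oset_xcoords:
  assumes "oset D Y" "open I"
  shows "oset (xcoords D) (I \<times> UNIV \<times> Y)"
proof -
  obtain T where T: "open T" "Y = span D \<inter> T" using assms(1) unfolding oset_def openin_open by auto
  have "open (I \<times> (UNIV :: real set) \<times> T)" using assms(2) T by (intro open_Times) auto
  moreover have "I \<times> UNIV \<times> Y = span (xcoords D) \<inter> (I \<times> UNIV \<times> T)"
    unfolding span_xcoords T by auto
  ultimately show ?thesis
    using assms(1) xcoords_Basis unfolding oset_def openin_open by metis
qed

text \<open>A Riemannian model without complex structure: a circle connection \<alpha> over a base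
  metric affine in \<open>x\<close>. The Kaehler condition enters later, as a relation between the
  curvature of \<alpha> and \<open>G1\<close>.\<close>

locale cohom_one_metric = lform "xcoords D" "I \<times> UNIV \<times> Y" \<beta>
  for D Y :: "'e::euclidean_space set" and I :: "real set"
    and \<beta> :: "real \<times> real \<times> 'e \<Rightarrow> real \<times> real \<times> 'e \<Rightarrow> real \<times> real \<times> 'e \<Rightarrow> real" +
  fixes h h' h'' :: "real \<Rightarrow> real" and \<alpha> :: "'e \<Rightarrow> 'e \<Rightarrow> real" and G0 G1 :: "'e \<Rightarrow> 'e \<Rightarrow> 'e \<Rightarrow> real"
  assumes oY: "oset D Y" and oI: "open I"
    and h: "x \<in> I \<Longrightarrow> h x > 0"
    and h': "x \<in> I \<Longrightarrow> (h has_real_derivative h' x) (at x)"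
    and h'': "x \<in> I \<Longrightarrow> (h' has_real_derivative h'' x) (at x)"
    and \<alpha>: "v \<in> span D \<Longrightarrow> smooth_on D Y (\<lambda>y. \<alpha> y v)"
    and G0: "lform D Y G0" and G1: "lform D Y G1"
    and \<alpha>lin: "y \<in> Y \<Longrightarrow> slin (span D) (\<alpha> y)"
    and \<beta>: "x \<in> I \<Longrightarrow> y \<in> Y \<Longrightarrow> v \<in> span D \<Longrightarrow> w \<in> span D \<Longrightarrow>
      \<beta> (x, s, y) (\<xi>, r, v) (\<eta>, q, w) = \<xi> * \<eta> / h x + h x * ((r + \<alpha> y v) * (q + \<alpha> y w))
        + (x * G1 y v w + G0 y v w)"
begin

definition G where "G x y v w = x * G1 y v w + G0 y v w"

sublocale G0: lform D Y G0 by (rule G0)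
sublocale G1: lform D Y G1 by (rule G1)

lemma G_lform: "lform D Y (G x)"
proof
  show "oset D Y" by (rule oY)
  show "smooth_on D Y (\<lambda>u. G x u v w)" if "v \<in> span D" "w \<in> span D" for v w
    unfolding G_def by (intro smooth_on_add smooth_on_mult smooth_on_const oY G0.sm G1.sm that)
  show "symform (span D) (G x u)" if "u \<in> Y" for u
    using symform_sym[OF G0.sf[OF that]] symform_sym[OF G1.sf[OF that]]
    unfolding symform_def G_def
    by (auto intro!: slin_intros G0.lin1 G1.lin1 that)
qed

text \<open>\<open>A c v\<close> is the derivative of the component \<open>\<alpha> _ v\<close> in
  direction \<open>c\<close>, so \<open>A e f - A f e\<close> is the curvature
  \<open>d\<alpha>(e, f)\<close> of the connection.\<close>

definition A where "A c v y = dd (\<lambda>y. \<alpha> y v) c y"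
definition AA where "AA b c v y = dd (A c v) b y"

lemma A_line: "y \<in> Y \<Longrightarrow> c \<in> span D \<Longrightarrow> v \<in> span D \<Longrightarrow>
   ((\<lambda>t. \<alpha> (y + t *\<^sub>R c) v) has_real_derivative A c v y) (at 0)"
  unfolding A_def has_real_derivative_iff_has_vector_derivative by (rule smooth_on_line[OF oY \<alpha>])

lemma AA_line: "y \<in> Y \<Longrightarrow> b \<in> span D \<Longrightarrow> c \<in> span D \<Longrightarrow> v \<in> span D \<Longrightarrow>
   ((\<lambda>t. A c v (y + t *\<^sub>R b)) has_real_derivative AA b c v y) (at 0)"
  unfolding A_def AA_def has_real_derivative_iff_has_vector_derivative
  by (rule smooth_on_line[OF oY smooth_on_dd[OF oY \<alpha>]])

lemma A_zero: "y \<in> Y \<Longrightarrow> c \<in> span D \<Longrightarrow> A c 0 y = 0" "y \<in> Y \<Longrightarrow> v \<in> span D \<Longrightarrow> A 0 v y = 0"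
  unfolding A_def
  using slin_zero[OF slin_dd_fun[OF oY \<alpha>lin \<alpha>] subspace_span] slin_zero[OF slin_dd_dir[OF oY \<alpha>] subspace_span]
  by auto

lemma AA_zero_dir: "y \<in> Y \<Longrightarrow> c \<in> span D \<Longrightarrow> v \<in> span D \<Longrightarrow> AA 0 c v y = 0"
  unfolding AA_def A_def by (rule slin_zero[OF slin_dd_dir[OF oY smooth_on_dd[OF oY \<alpha>]] subspace_span])

lemma AA_zero:
  assumes "y \<in> Y" "b \<in> span D"
  shows "c \<in> span D \<Longrightarrow> AA b c 0 y = 0" "v \<in> span D \<Longrightarrow> AA b 0 v y = 0"
proof -
  have z: "dd (\<lambda>y. 0::real) b y = 0" by (rule dd_eqI) simp
  show "c \<in> span D \<Longrightarrow> AA b c 0 y = 0" "v \<in> span D \<Longrightarrow> AA b 0 v y = 0"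
    unfolding AA_def using dd_cong[OF oY assms] A_zero z by metis+
qed

lemma G_line:
  assumes "lform D Y g" "y \<in> Y" "c \<in> span D" "v \<in> span D" "w \<in> span D"
  shows "((\<lambda>t. g (y + t *\<^sub>R c) v w) has_real_derivative d1 g c v w y) (at 0)"
  unfolding d1_def has_real_derivative_iff_has_vector_derivative
  by (rule smooth_on_line[OF oY lform.sm[OF assms(1)]]) (use assms in auto)

lemma G_line2:
  assumes "lform D Y g" "y \<in> Y" "b \<in> span D" "c \<in> span D" "v \<in> span D" "w \<in> span D"
  shows "((\<lambda>t. d1 g c v w (y + t *\<^sub>R b)) has_real_derivative d2 g b c v w y) (at 0)"
  unfolding d2_def has_real_derivative_iff_has_vector_derivative
  by (rule smooth_on_line[OF oY lform.d1_smooth[OF assms(1)]]) (use assms in auto)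

lemma affine_line: "((\<lambda>t. x + t * p) has_real_derivative p) (at 0)" for x p :: real
  by (auto intro!: derivative_eq_intros)

lemma h_line: "x \<in> I \<Longrightarrow> ((\<lambda>t. h (x + t * p)) has_real_derivative h' x * p) (at 0)"
  using DERIV_chain2[OF _ affine_line[of x p], of h "h' x"] h' by simp

lemma h'_line: "x \<in> I \<Longrightarrow> ((\<lambda>t. h' (x + t * p)) has_real_derivative h'' x * p) (at 0)"
  using DERIV_chain2[OF _ affine_line[of x p], of h' "h'' x"] h'' by simp

lemma in_W: "x \<in> I \<Longrightarrow> y \<in> Y \<Longrightarrow> (x, s, y) \<in> I \<times> UNIV \<times> Y" by simp

lemma in_D: "v \<in> span D \<Longrightarrow> (\<xi>, r, v) \<in> span (xcoords D)" by (auto simp: span_xcoords)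

lemma beta_line_ev:
  assumes "x \<in> I" "y \<in> Y" "c \<in> span D"
  shows "\<forall>\<^sub>F t in nhds (0::real). x + t * p \<in> I \<and> y + t *\<^sub>R c \<in> Y"
  using oset_ev_line[OF o in_W[OF assms(1,2), of 0] in_D[OF assms(3), of p 0]] by simp

lemma d1_beta:
  assumes x: "x \<in> I" and y: "y \<in> Y" and c: "c \<in> span D" and v: "v \<in> span D" and w: "w \<in> span D"
  shows "d1 \<beta> (p, l, c) (\<xi>, r, v) (\<eta>, q, w) (x, s, y) =
    - p * h' x / (h x)\<^sup>2 * (\<xi> * \<eta>) + p * h' x * ((r + \<alpha> y v) * (q + \<alpha> y w))
    + h x * (A c v y * (q + \<alpha> y w) + (r + \<alpha> y v) * A c w y)
    + (p * G1 y v w + x * d1 G1 c v w y + d1 G0 c v w y)"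
  unfolding d1_def[of \<beta>]
proof (rule dd_eqI, rule has_vector_derivative_cong_nhds)
  show "\<forall>\<^sub>F t in nhds 0. \<xi> * \<eta> / h (x + t * p) + h (x + t * p) * ((r + \<alpha> (y + t *\<^sub>R c) v) * (q + \<alpha> (y + t *\<^sub>R c) w))
      + ((x + t * p) * G1 (y + t *\<^sub>R c) v w + G0 (y + t *\<^sub>R c) v w)
      = \<beta> ((x, s, y) + t *\<^sub>R (p, l, c)) (\<xi>, r, v) (\<eta>, q, w)"
    using beta_line_ev[OF x y c, of p] by eventually_elim (simp add: \<beta> v w)
  show "((\<lambda>t. \<xi> * \<eta> / h (x + t * p) + h (x + t * p) * ((r + \<alpha> (y + t *\<^sub>R c) v) * (q + \<alpha> (y + t *\<^sub>R c) w))
      + ((x + t * p) * G1 (y + t *\<^sub>R c) v w + G0 (y + t *\<^sub>R c) v w)) has_vector_derivative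
    (- p * h' x / (h x)\<^sup>2 * (\<xi> * \<eta>) + p * h' x * ((r + \<alpha> y v) * (q + \<alpha> y w))
    + h x * (A c v y * (q + \<alpha> y w) + (r + \<alpha> y v) * A c w y)
    + (p * G1 y v w + x * d1 G1 c v w y + d1 G0 c v w y))) (at 0)"
    unfolding has_real_derivative_iff_has_vector_derivative[symmetric]
    using h[OF x]
    by (auto intro!: derivative_eq_intros h_line[OF x] A_line[OF y c] v w G_line[OF G0 y c] G_line[OF G1 y c]
        simp: power2_eq_square algebra_simps)
qed

text \<open>The condition on \<open>k * p * \<xi> * \<eta>\<close> excludes the second
  \<open>x\<close>-derivative of \<open>1/h\<close>, which belongs to the component
  \<open>g(dx, dx)\<close> differentiated twice along \<open>x\<close>. No plane spanned by two
  different frame vectors produces it. Under the condition, either \<open>k = 0\<close> and the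
  corresponding term is constant along the line, or its coefficient is 0.\<close>

lemma d2_beta:
  assumes x: "x \<in> I" and y: "y \<in> Y" and b: "b \<in> span D" and c: "c \<in> span D"
    and v: "v \<in> span D" and w: "w \<in> span D" and z: "k * p * \<xi> * \<eta> = 0"
  shows "d2 \<beta> (k, m, b) (p, l, c) (\<xi>, r, v) (\<eta>, q, w) (x, s, y) =
    k * p * h'' x * ((r + \<alpha> y v) * (q + \<alpha> y w))
    + p * h' x * (A b v y * (q + \<alpha> y w) + (r + \<alpha> y v) * A b w y)
    + k * h' x * (A c v y * (q + \<alpha> y w) + (r + \<alpha> y v) * A c w y)
    + h x * (AA b c v y * (q + \<alpha> y w) + A c v y * A b w y + A b v y * A c w y + (r + \<alpha> y v) * AA b c w y)
    + (p * d1 G1 b v w y + k * d1 G1 c v w y + x * d2 G1 b c v w y + d2 G0 b c v w y)"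
  unfolding d2_def[of \<beta>]
proof (rule dd_eqI, rule has_vector_derivative_cong_nhds)
  let ?f = "\<lambda>t. - p * h' (x + t * k) / (h (x + t * k))\<^sup>2 * (\<xi> * \<eta>)
    + p * h' (x + t * k) * ((r + \<alpha> (y + t *\<^sub>R b) v) * (q + \<alpha> (y + t *\<^sub>R b) w))
    + h (x + t * k) * (A c v (y + t *\<^sub>R b) * (q + \<alpha> (y + t *\<^sub>R b) w) + (r + \<alpha> (y + t *\<^sub>R b) v) * A c w (y + t *\<^sub>R b))
    + (p * G1 (y + t *\<^sub>R b) v w + (x + t * k) * d1 G1 c v w (y + t *\<^sub>R b) + d1 G0 c v w (y + t *\<^sub>R b))"
  show "\<forall>\<^sub>F t in nhds 0. ?f t = d1 \<beta> (p, l, c) (\<xi>, r, v) (\<eta>, q, w) ((x, s, y) + t *\<^sub>R (k, m, b))"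
    using beta_line_ev[OF x y b, of k] by eventually_elim (simp add: d1_beta c v w)
  have first: "((\<lambda>t. - p * h' (x + t * k) / (h (x + t * k))\<^sup>2 * (\<xi> * \<eta>)) has_real_derivative 0) (at 0)"
  proof (cases "k = 0")
    case False
    then have "p * \<xi> * \<eta> = 0" using z by simp
    then have "(\<lambda>t. - p * h' (x + t * k) / (h (x + t * k))\<^sup>2 * (\<xi> * \<eta>)) = (\<lambda>t. 0)" by auto
    then show ?thesis by simp
  qed simp
  have rest: "((\<lambda>t. p * h' (x + t * k) * ((r + \<alpha> (y + t *\<^sub>R b) v) * (q + \<alpha> (y + t *\<^sub>R b) w))
    + h (x + t * k) * (A c v (y + t *\<^sub>R b) * (q + \<alpha> (y + t *\<^sub>R b) w) + (r + \<alpha> (y + t *\<^sub>R b) v) * A c w (y + t *\<^sub>R b))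
    + (p * G1 (y + t *\<^sub>R b) v w + (x + t * k) * d1 G1 c v w (y + t *\<^sub>R b) + d1 G0 c v w (y + t *\<^sub>R b)))
    has_real_derivative
    (k * p * h'' x * ((r + \<alpha> y v) * (q + \<alpha> y w))
    + p * h' x * (A b v y * (q + \<alpha> y w) + (r + \<alpha> y v) * A b w y)
    + k * h' x * (A c v y * (q + \<alpha> y w) + (r + \<alpha> y v) * A c w y)
    + h x * (AA b c v y * (q + \<alpha> y w) + A c v y * A b w y + A b v y * A c w y + (r + \<alpha> y v) * AA b c w y)
    + (p * d1 G1 b v w y + k * d1 G1 c v w y + x * d2 G1 b c v w y + d2 G0 b c v w y))) (at 0)"
    by (auto intro!: derivative_eq_intros h_line[OF x] h'_line[OF x] A_line[OF y b] AA_line[OF y b c] v w c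
        G_line[OF G1 y b] G_line2[OF G0 y b c] G_line2[OF G1 y b c] simp: algebra_simps)
  show "(?f has_vector_derivative
    (k * p * h'' x * ((r + \<alpha> y v) * (q + \<alpha> y w))
    + p * h' x * (A b v y * (q + \<alpha> y w) + (r + \<alpha> y v) * A b w y)
    + k * h' x * (A c v y * (q + \<alpha> y w) + (r + \<alpha> y v) * A c w y)
    + h x * (AA b c v y * (q + \<alpha> y w) + A c v y * A b w y + A b v y * A c w y + (r + \<alpha> y v) * AA b c w y)
    + (p * d1 G1 b v w y + k * d1 G1 c v w y + x * d2 G1 b c v w y + d2 G0 b c v w y))) (at 0)"
    unfolding has_real_derivative_iff_has_vector_derivative[symmetric]
    using DERIV_add[OF first rest] by (simp only: add.assoc add_0_left)
qed

lemma d1_G: "y \<in> Y \<Longrightarrow> c \<in> span D \<Longrightarrow> v \<in> span D \<Longrightarrow> w \<in> span D \<Longrightarrow>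
    d1 (G x) c v w y = x * d1 G1 c v w y + d1 G0 c v w y"
  unfolding d1_def G_def
  by (rule dd_eqI) (intro has_vector_derivative_add has_vector_derivative_mult_right smooth_on_line[OF oY] G0.sm G1.sm)

lemma d2_G: "y \<in> Y \<Longrightarrow> b \<in> span D \<Longrightarrow> c \<in> span D \<Longrightarrow> v \<in> span D \<Longrightarrow> w \<in> span D \<Longrightarrow>
    d2 (G x) b c v w y = x * d2 G1 b c v w y + d2 G0 b c v w y"
  unfolding d2_def
  by (rule trans[OF dd_cong[OF oY _ _ d1_G]], assumption+, rule dd_eqI)
    (intro has_vector_derivative_add has_vector_derivative_mult_right smooth_on_line[OF oY] G0.d1_smooth G1.d1_smooth)

text \<open>\<open>X e\<close> is the horizontal lift of \<open>e\<close> at this \<open>y\<close>: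
  the form \<open>ds + \<alpha>\<close> vanishes on it. Its entries are frozen, so it is a constant
  vector in the coordinates and is horizontal at the chosen point only; a frame at one point is all
  that \<open>scal\<close> asks for.\<close>

lemma xframe:
  assumes x: "x \<in> I" and y: "y \<in> Y" and E: "frame (span D) (G x y) E"
  defines "X \<equiv> \<lambda>e. (0, - \<alpha> y e, e)"
  shows "frame (span (xcoords D)) (\<beta> (x, s, y)) ({(1, 0, 0), (0, 1, 0)} \<union> X ` E)"
proof -
  have ED: "e \<in> span D" if "e \<in> E" for e using E that by (auto simp: frame_def)
  have fin: "finite E" and spE: "span E = span D" using E by (auto simp: frame_def)
  have a0: "\<alpha> y 0 = 0" by (rule slin_zero[OF \<alpha>lin[OF y] subspace_span])
  have g0: "G x y v 0 = 0" "G x y 0 v = 0" if "v \<in> span D" for v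
    using slin_zero[OF lform.lin1[OF G_lform y that] subspace_span] slin_zero[OF lform.lin2[OF G_lform y that] subspace_span]
    by auto
  have b: "\<beta> (x, s, y) (\<xi>, r, v) (\<eta>, q, w) = \<xi> * \<eta> / h x + h x * ((r + \<alpha> y v) * (q + \<alpha> y w)) + G x y v w"
    if "v \<in> span D" "w \<in> span D" for \<xi> r v \<eta> q w
    using \<beta>[OF x y that] by (simp add: G_def)
  let ?F = "{(1, 0, 0), (0, 1, 0)} \<union> X ` E"
  have sub: "?F \<subseteq> span (xcoords D)" using ED by (auto simp: X_def span_xcoords span_zero)
  have T: "(0, r, 0) \<in> span ?F" for r
  proof -
    have "r *\<^sub>R (0, 1, 0) \<in> span ?F" by (intro span_scale span_base) auto
    then show ?thesis by simp
  qed
  have lift: "(0, 0, v) \<in> span ?F" if "v \<in> span E" for v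
    using that
  proof (induction rule: span_induct_alt)
    case base
    then show ?case by (metis span_zero zero_prod_def)
  next
    case (step c e v)
    have "X e \<in> span ?F" using step by (intro span_base) auto
    then have "c *\<^sub>R X e + (0, c * \<alpha> y e, 0) + (0, 0, v) \<in> span ?F"
      using span_add[OF span_add[OF span_scale T] step(2)] by blast
    then show ?case by (simp add: X_def)
  qed
  have "(\<xi>, r, v) \<in> span ?F" if "v \<in> span D" for \<xi> r v
  proof -
    have "\<xi> *\<^sub>R (1, 0, 0) \<in> span ?F" by (intro span_scale span_base) auto
    then have "\<xi> *\<^sub>R (1, 0, 0) + (0, r, 0) + (0, 0, v) \<in> span ?F"
      using span_add[OF span_add[OF _ T] lift] that spE by blast
    then show ?thesis by simp
  qed
  then have "span (xcoords D) \<subseteq> span ?F" unfolding span_xcoords by auto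
  then have sp: "span ?F = span (xcoords D)" using sub by (metis span_minimal subspace_span subset_antisym)
  show ?thesis
    unfolding frame_def
  proof (intro conjI)
    show "\<forall>e\<in>?F. \<beta> (x, s, y) e e > 0"
      using h[OF x] frame_pos[OF E] ED by (auto simp: X_def b span_zero a0 g0)
    show "\<forall>e\<in>?F. \<forall>e'\<in>?F. e \<noteq> e' \<longrightarrow> \<beta> (x, s, y) e e' = 0"
      using frame_orth[OF E] ED by (auto simp: X_def b span_zero a0 g0)
  qed (use fin sub sp in auto)
qed

text \<open>Every plane occurs twice in the double sum over the frame. The planes (N, X) give
  \<open>h/2\<close> and the planes (X, X) give \<open>h/4\<close> times the sum of \<kappa>^2,
  hence 3/4. The planes (T, X) give \<open>h/2\<close> and the O'Neill term of the planes (X, X)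
  gives \<open>-3h/4\<close> times the square of \<open>d\<alpha>\<close>, hence -1/4. The plane (N,
  T) gives \<open>-h''\<close>, and (N, X) together with (T, X) give the term in \<open>h'\<close>.
  The remaining square of the sum of \<kappa> comes from how the slices of constant \<open>x\<close>
  bend.\<close>

theorem scal_cohom_one:
  assumes x: "x \<in> I" and y: "y \<in> Y" and E: "frame (span D) (G x y) E"
    and diag: "\<And>e f. e \<in> E \<Longrightarrow> f \<in> E \<Longrightarrow> e \<noteq> f \<Longrightarrow> G1 y e f = 0"
  defines "\<kappa> \<equiv> \<lambda>e. G1 y e e / G x y e e"
  shows "scal \<beta> ({(1, 0, 0), (0, 1, 0)} \<union> (\<lambda>e. (0, - \<alpha> y e, e)) ` E) (x, s, y)
    = scal (G x) E y - h'' x - h' x * (\<Sum>e\<in>E. \<kappa> e) + 3 / 4 * h x * (\<Sum>e\<in>E. (\<kappa> e)\<^sup>2)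
      - h x / 4 * (\<Sum>e\<in>E. \<Sum>f\<in>E. (A e f y - A f e y)\<^sup>2 / (G x y e e * G x y f f)) - h x / 4 * (\<Sum>e\<in>E. \<kappa> e)\<^sup>2"
proof -
  define X where "X e = (0::real, - \<alpha> y e, e)" for e
  define u where "u = (x, s, y)"
  define N where "N = (1::real, 0::real, 0::'e)"
  define T where "T = (0::real, 1::real, 0::'e)"
  have ED: "e \<in> span D" if "e \<in> E" for e using E that by (auto simp: frame_def)
  have fin: "finite E" using E by (auto simp: frame_def)
  interpret Gx: lform D Y "G x" by (rule G_lform)
  have a0: "\<alpha> y 0 = 0" by (rule slin_zero[OF \<alpha>lin[OF y] subspace_span])
  have zD: "0 \<in> span D" by (rule span_zero)
  note z0 = G1.zero_args[OF y] G0.zero_args[OF y] Gx.zero_args[OF y]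
  have b: "\<beta> u (\<xi>, r, v) (\<eta>, q, w) = \<xi> * \<eta> / h x + h x * ((r + \<alpha> y v) * (q + \<alpha> y w)) + G x y v w"
    if "v \<in> span D" "w \<in> span D" for \<xi> r v \<eta> q w
    using \<beta>[OF x y that] by (simp add: G_def u_def)
  have h0: "h x > 0" "h x \<noteq> 0" using h[OF x] by auto
  note bs = b N_def T_def X_def zD ED a0 z0
  note ds = A_zero[OF y] d1_beta[OF x y] N_def T_def X_def zD ED a0 z0 u_def
  note cs = chr1_def ds d1_G[OF y, symmetric]
  have lam: "\<beta> u N N = 1 / h x" "\<beta> u T T = h x" "e \<in> E \<Longrightarrow> \<beta> u (X e) (X e) = G x y e e" for e
    by (simp_all add: bs)
  have gE: "G1 y e f = (if e = f then G1 y e e else 0)" if "e \<in> E" "f \<in> E" for e f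
    using diag that by auto
  have C: "chr1 \<beta> N N N u = - h' x / (2 * (h x)\<^sup>2)" "chr1 \<beta> N N T u = 0" "chr1 \<beta> N T N u = 0"
     "chr1 \<beta> N T T u = h' x / 2" "chr1 \<beta> T T N u = - h' x / 2" "chr1 \<beta> T T T u = 0"
    by (simp_all add: cs)
  have C1: "chr1 \<beta> N N (X e) u = 0" "chr1 \<beta> N T (X e) u = 0" "chr1 \<beta> T T (X e) u = 0"
     "chr1 \<beta> N (X e) N u = 0" "chr1 \<beta> N (X e) T u = 0" "chr1 \<beta> T (X e) N u = 0" "chr1 \<beta> T (X e) T u = 0"
    if "e \<in> E" for e
    using that by (simp_all add: cs)
  have C2: "chr1 \<beta> N (X e) (X f) u = G1 y e f / 2" "chr1 \<beta> T (X e) (X f) u = h x * (A e f y - A f e y) / 2"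
     "chr1 \<beta> (X e) (X f) N u = - G1 y e f / 2" "chr1 \<beta> (X e) (X f) T u = h x * (A e f y + A f e y) / 2"
    if "e \<in> E" "f \<in> E" for e f
    using that by (simp_all add: cs algebra_simps)
  have C3: "chr1 \<beta> (X e) (X f) (X k) u = chr1 (G x) e f k y" if "e \<in> E" "f \<in> E" "k \<in> E" for e f k
    using that by (simp add: chr1_def ds d1_G[OF y])
  define ft where "ft f = f N + f T + (\<Sum>e\<in>E. f (X e))" for f :: "real \<times> real \<times> 'e \<Rightarrow> real"
  let ?E = "{(1, 0, 0), (0, 1, 0)} \<union> (\<lambda>e. (0, - \<alpha> y e, e)) ` E"
  have sumE: "(\<Sum>e\<in>?E. f e) = ft f" for f
  proof -
    have E': "?E = insert N (insert T (X ` E))" by (auto simp: N_def T_def X_def)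
    have "e \<noteq> 0" if "e \<in> E" for e
      using frame_pos[OF E that] slin_zero[OF Gx.lin1[OF y zD] subspace_span] by auto
    then have "N \<notin> insert T (X ` E)" "T \<notin> X ` E" by (auto simp: N_def T_def X_def)
    moreover have "inj_on X E" by (auto simp: inj_on_def X_def)
    ultimately show ?thesis
      unfolding E' ft_def using fin by (simp add: sum.reindex add.assoc)
  qed
  have EE: "?E \<subseteq> span (xcoords D)" using ED by (auto simp: span_xcoords zD)
  have uW: "u \<in> I \<times> UNIV \<times> Y" using x y by (simp add: u_def)
  have NTX: "N \<in> span (xcoords D)" "T \<in> span (xcoords D)" "e \<in> E \<Longrightarrow> X e \<in> span (xcoords D)" for e
    using ED by (auto simp: N_def T_def X_def span_xcoords zD)
  note es = d2_beta[OF x y] N_def T_def X_def zD ED a0 z0 u_def A_zero[OF y] AA_zero[OF y] AA_zero_dir[OF y]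
  have D2: "d2 \<beta> N T N T u = 0" "d2 \<beta> N N T T u = h'' x" "d2 \<beta> T T N N u = 0"
    by (simp_all add: es)
  have D3: "d2 \<beta> N (X e) N (X e) u = 0" "d2 \<beta> N N (X e) (X e) u = 0" "d2 \<beta> (X e) (X e) N N u = 0"
     "d2 \<beta> T (X e) T (X e) u = 0" "d2 \<beta> T T (X e) (X e) u = 0" "d2 \<beta> (X e) (X e) T T u = 0"
    if "e \<in> E" for e
    using that by (simp_all add: es)
  have D4: "d2 \<beta> (X e) (X f) (X e) (X f) u = d2 (G x) e f e f y + h x * (A f e y * A e f y + A e e y * A f f y)"
      "d2 \<beta> (X e) (X e) (X f) (X f) u = d2 (G x) e e f f y + h x * (2 * (A e f y)\<^sup>2)"
    if "e \<in> E" "f \<in> E" for e f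
    using that by (simp_all add: es d2_G[OF y] power2_eq_square)
  define l where "l e = G x y e e" for e
  have lp: "l e > 0" if "e \<in> E" for e using frame_pos[OF E that] by (simp add: l_def)
  define g where "g e = G1 y e e" for e
  define F where "F e f = (A e f y - A f e y)\<^sup>2" for e f
  have sNT: "sec \<beta> ?E u N T = - h'' x / 2"
    unfolding sec_def sumE ft_def
    by (simp add: D2 C C1 lam h0 power2_eq_square field_simps)
  have sNX: "sec \<beta> ?E u N (X e) = (g e)\<^sup>2 / (4 * l e) - h' x * g e / (4 * h x)" if e: "e \<in> E" for e
  proof -
    have "(\<Sum>f\<in>E. ((chr1 \<beta> N (X e) (X f) u)\<^sup>2 - chr1 \<beta> N N (X f) u * chr1 \<beta> (X e) (X e) (X f) u) / \<beta> u (X f) (X f))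
      = (\<Sum>f\<in>E. if e = f then (g e)\<^sup>2 / (4 * l e) else 0)"
    proof (rule sum.cong)
      fix f assume f: "f \<in> E"
      then show "((chr1 \<beta> N (X e) (X f) u)\<^sup>2 - chr1 \<beta> N N (X f) u * chr1 \<beta> (X e) (X e) (X f) u) / \<beta> u (X f) (X f)
          = (if e = f then (g e)\<^sup>2 / (4 * l e) else 0)"
        using e diag[OF e f] by (cases "e = f") (simp_all add: C1 C2 lam l_def g_def power_divide)
    qed simp
    then show ?thesis
      unfolding sec_def sumE ft_def using fin e h0
      by (simp add: D3 C C1 C2 lam g_def[symmetric] power2_eq_square field_simps)
  qed
  have sTX: "sec \<beta> ?E u T (X e) = (h x)\<^sup>2 / 4 * (\<Sum>f\<in>E. F e f / l f) - h x * h' x * g e / 4" if e: "e \<in> E" for e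
  proof -
    have "(\<Sum>f\<in>E. ((chr1 \<beta> T (X e) (X f) u)\<^sup>2 - chr1 \<beta> T T (X f) u * chr1 \<beta> (X e) (X e) (X f) u) / \<beta> u (X f) (X f))
      = (h x)\<^sup>2 / 4 * (\<Sum>f\<in>E. F e f / l f)"
      unfolding sum_distrib_left
      by (rule sum.cong) (use e in \<open>auto simp: C1 C2 lam l_def F_def power_divide power_mult_distrib\<close>)
    then show ?thesis
      unfolding sec_def sumE ft_def using e h0
      by (simp add: D3 C C1 C2 lam g_def[symmetric] power2_eq_square field_simps)
  qed
  have sXX: "sec \<beta> ?E u (X e) (X f) = sec (G x) E y e f - 3 / 4 * h x * F e f
      + h x / 4 * ((if e = f then (g e)\<^sup>2 else 0) - g e * g f)" if e: "e \<in> E" and f: "f \<in> E" for e f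
  proof -
    have "(\<Sum>k\<in>E. ((chr1 \<beta> (X e) (X f) (X k) u)\<^sup>2 - chr1 \<beta> (X e) (X e) (X k) u * chr1 \<beta> (X f) (X f) (X k) u) / \<beta> u (X k) (X k))
      = (\<Sum>k\<in>E. ((chr1 (G x) e f k y)\<^sup>2 - chr1 (G x) e e k y * chr1 (G x) f f k y) / G x y k k)"
      by (rule sum.cong) (use e f in \<open>auto simp: C3 lam\<close>)
    then show ?thesis
      unfolding sec_def sumE ft_def F_def using e f h0 gE[OF e f]
      by (simp add: D4 C C1 C2 lam g_def[symmetric] power2_eq_square field_simps)
  qed
  define \<sigma> where "\<sigma> a b = sec \<beta> ?E u a b / (\<beta> u a a * \<beta> u b b)" for a b
  have \<sigma>sym: "\<sigma> a b = \<sigma> b a" if "a \<in> span (xcoords D)" "b \<in> span (xcoords D)" for a b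
    unfolding \<sigma>_def using sec_sym[OF uW that EE] by (simp add: mult.commute)
  have \<sigma>0: "\<sigma> a a = 0" for a by (simp add: \<sigma>_def sec_self)
  have "scal \<beta> ?E u = ft (\<lambda>a. ft (\<sigma> a))"
    unfolding scal_def sumE \<sigma>_def ..
  also have "\<dots> = 2 * \<sigma> N T + 2 * (\<Sum>e\<in>E. \<sigma> N (X e)) + 2 * (\<Sum>e\<in>E. \<sigma> T (X e)) + (\<Sum>e\<in>E. \<Sum>f\<in>E. \<sigma> (X e) (X f))"
    using \<sigma>sym[OF NTX(2) NTX(1)] \<sigma>sym[OF NTX(3) NTX(1)] \<sigma>sym[OF NTX(3) NTX(2)]
    by (simp add: ft_def \<sigma>0 sum.distrib)
  also have "\<sigma> N T = - h'' x / 2" unfolding \<sigma>_def sNT lam(1,2) using h0 by simp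
  also have "(\<Sum>e\<in>E. \<sigma> N (X e)) = h x / 4 * (\<Sum>e\<in>E. (\<kappa> e)\<^sup>2) - h' x / 4 * (\<Sum>e\<in>E. \<kappa> e)"
    unfolding sum_distrib_left sum_subtractf[symmetric]
  proof (rule sum.cong)
    fix e assume e: "e \<in> E"
    then show "\<sigma> N (X e) = h x / 4 * (\<kappa> e)\<^sup>2 - h' x / 4 * \<kappa> e"
      using h0 lp[OF e] unfolding \<sigma>_def sNX[OF e] lam(1) lam(3)[OF e] \<kappa>_def l_def[symmetric] g_def[symmetric]
      by (simp add: field_simps power2_eq_square)
  qed simp
  also have "(\<Sum>e\<in>E. \<sigma> T (X e)) = h x / 4 * (\<Sum>e\<in>E. \<Sum>f\<in>E. F e f / (l e * l f)) - h' x / 4 * (\<Sum>e\<in>E. \<kappa> e)"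
    unfolding sum_distrib_left sum_subtractf[symmetric]
  proof (rule sum.cong)
    fix e assume e: "e \<in> E"
    have "(\<Sum>f\<in>E. h x / 4 * (F e f / (l e * l f))) = h x / 4 * (\<Sum>f\<in>E. F e f / l f) / l e"
      by (simp add: sum_distrib_left sum_divide_distrib field_simps)
    then show "\<sigma> T (X e) = (\<Sum>f\<in>E. h x / 4 * (F e f / (l e * l f))) - h' x / 4 * \<kappa> e"
      using h0 lp[OF e] unfolding \<sigma>_def sTX[OF e] lam(2) lam(3)[OF e] \<kappa>_def l_def[symmetric] g_def[symmetric]
      by (simp add: field_simps power2_eq_square)
  qed simp
  also have "(\<Sum>e\<in>E. \<Sum>f\<in>E. \<sigma> (X e) (X f)) = scal (G x) E y
      - 3 / 4 * h x * (\<Sum>e\<in>E. \<Sum>f\<in>E. F e f / (l e * l f))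
      + h x / 4 * (\<Sum>e\<in>E. (\<kappa> e)\<^sup>2) - h x / 4 * (\<Sum>e\<in>E. \<kappa> e)\<^sup>2"
  proof -
    have "\<sigma> (X e) (X f) = sec (G x) E y e f / (G x y e e * G x y f f) - 3 / 4 * h x * (F e f / (l e * l f))
        + (if e = f then h x / 4 * (\<kappa> e)\<^sup>2 else 0) - h x / 4 * (\<kappa> e * \<kappa> f)" if e: "e \<in> E" and f: "f \<in> E" for e f
      using lp[OF e] lp[OF f] unfolding \<sigma>_def sXX[OF e f] lam(3)[OF e] lam(3)[OF f] \<kappa>_def l_def[symmetric] g_def[symmetric]
      by (cases "e = f") (simp_all add: field_simps power2_eq_square)
    then have "(\<Sum>e\<in>E. \<Sum>f\<in>E. \<sigma> (X e) (X f)) = (\<Sum>e\<in>E. \<Sum>f\<in>E. sec (G x) E y e f / (G x y e e * G x y f f) - 3 / 4 * h x * (F e f / (l e * l f))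
        + (if e = f then h x / 4 * (\<kappa> e)\<^sup>2 else 0) - h x / 4 * (\<kappa> e * \<kappa> f))"
      by (intro sum.cong) auto
    also have "\<dots> = scal (G x) E y
      - 3 / 4 * h x * (\<Sum>e\<in>E. \<Sum>f\<in>E. F e f / (l e * l f))
      + h x / 4 * (\<Sum>e\<in>E. (\<kappa> e)\<^sup>2) - h x / 4 * (\<Sum>e\<in>E. \<kappa> e)\<^sup>2"
      using fin unfolding scal_def power2_eq_square[of "sum \<kappa> E"] sum_product
      by (simp add: sum.distrib sum_subtractf sum_distrib_left sum.delta')
    finally show ?thesis .
  qed
  finally show ?thesis
    unfolding u_def F_def l_def by argo
qed

end

section \<open>Smooth maps and tangent vectors\<close>

lemma oset_subopen:
  assumes "D \<subseteq> Basis" "\<And>u. u \<in> W \<Longrightarrow> \<exists>V. oset D V \<and> u \<in> V \<and> V \<subseteq> W"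
  shows "oset D W"
  using assms openin_subopen[of "top_of_set (span D)" W] unfolding oset_def by meson

text \<open>All that is needed of a manifold when maps are composed; the compatibility of the charts is not.\<close>

definition wmfd :: "('a, 'e::euclidean_space) mfd \<Rightarrow> bool" where
  "wmfd M \<longleftrightarrow> coords M \<subseteq> Basis \<and> pts M = (\<Union>c\<in>atlas M. fst c) \<and>
     (\<forall>c\<in>atlas M. openin (topo M) (fst c) \<and> inj_on (snd c) (fst c) \<and>
        (\<forall>W. openin (topo M) W \<longrightarrow> oset (coords M) (snd c ` (fst c \<inter> W))))"

lemma wmfdD:
  assumes "wmfd M"
  shows "coords M \<subseteq> Basis" "p \<in> pts M \<Longrightarrow> \<exists>c\<in>atlas M. p \<in> fst c"
    "c \<in> atlas M \<Longrightarrow> openin (topo M) (fst c)" "c \<in> atlas M \<Longrightarrow> inj_on (snd c) (fst c)"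
    "c \<in> atlas M \<Longrightarrow> openin (topo M) W \<Longrightarrow> oset (coords M) (snd c ` (fst c \<inter> W))"
    "c \<in> atlas M \<Longrightarrow> fst c \<subseteq> pts M"
  using assms unfolding wmfd_def by auto

lemma wmfd_cimg: "wmfd M \<Longrightarrow> c \<in> atlas M \<Longrightarrow> oset (coords M) (cimg c)"
  using wmfdD(5)[of M c "fst c"] wmfdD(3) by fastforce

lemma cinv_chart: "wmfd M \<Longrightarrow> c \<in> atlas M \<Longrightarrow> p \<in> fst c \<Longrightarrow> cinv c (snd c p) = p"
  using wmfdD(4) by (metis inv_into_f_f)

lemma chart_cinv: "u \<in> cimg c \<Longrightarrow> snd c (cinv c u) = u"
  by (rule f_inv_into_f)

lemma cinv_in: "u \<in> cimg c \<Longrightarrow> cinv c u \<in> fst c"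
  by (rule inv_into_into)

lemma smooth_manifold_wmfd:
  assumes "smooth_manifold M"
  shows "wmfd M"
  unfolding wmfd_def
proof (intro conjI ballI allI impI)
  show "coords M \<subseteq> Basis" "pts M = (\<Union>c\<in>atlas M. fst c)" using assms by (auto simp: smooth_manifold_def)
  fix c assume c: "c \<in> atlas M"
  show o: "openin (topo M) (fst c)" using assms c by (auto simp: smooth_manifold_def)
  have hom: "homeomorphic_map (subtopology (topo M) (fst c)) (top_of_set (cimg c)) (snd c)"
    and oi: "openin (top_of_set (span (coords M))) (cimg c)" using assms c by (auto simp: smooth_manifold_def)
  have "fst c \<subseteq> pts M" using o openin_subset by blast
  then show "inj_on (snd c) (fst c)"
    using homeomorphic_imp_injective_map[OF hom] by (simp add: topspace_subtopology Int_absorb1)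
  fix W assume W: "openin (topo M) W"
  have "openin (subtopology (topo M) (fst c)) (fst c \<inter> W)" using W by (auto simp: openin_subtopology)
  then have "openin (top_of_set (cimg c)) (snd c ` (fst c \<inter> W))"
    using homeomorphic_imp_open_map[OF hom] by (simp add: open_map_def)
  then show "oset (coords M) (snd c ` (fst c \<inter> W))"
    using openin_trans[OF _ oi] \<open>coords M \<subseteq> Basis\<close> by (simp add: oset_def)
qed

lemma smooth_manifold_compat:
  "smooth_manifold M \<Longrightarrow> c \<in> atlas M \<Longrightarrow> c' \<in> atlas M \<Longrightarrow>
    smooth_on (coords M) (snd c ` (fst c \<inter> fst c')) (snd c' \<circ> cinv c)"
  by (simp add: smooth_manifold_def)

section \<open>Parameter domains as manifolds with a single chart, and pushing vectors along
  parametrizations\<close>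

definition euc :: "'e::euclidean_space set \<Rightarrow> 'e set \<Rightarrow> ('e, 'e) mfd" where
  "euc D W = \<lparr>topo = top_of_set W, atlas = {(W, \<lambda>x. x)}, coords = D\<rparr>"

lemma euc_simps [simp]: "topo (euc D W) = top_of_set W" "atlas (euc D W) = {(W, \<lambda>x. x)}" "coords (euc D W) = D"
  by (simp_all add: euc_def)

lemma interval_mfd_euc: "interval_mfd I = euc Basis I"
  by (simp add: interval_mfd_def euc_def)

lemma wmfd_euc: "oset D W \<Longrightarrow> wmfd (euc D W)"
  unfolding wmfd_def by (auto simp: oset_def intro: openin_trans)

text \<open>Smoothness of a composite on the part of a chart that is mapped into a single chart of
  \<open>N\<close>, where the chain rule in coordinates applies. The composition results are glued
  from such pieces with \<open>smooth_on_local\<close>.\<close>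

lemma smooth_map_core:
  assumes M: "wmfd M" and N: "wmfd N" and f: "smooth_map M N f" and c: "c \<in> atlas M" and c': "c' \<in> atlas N"
    and V: "openin (topo N) V" and h: "smooth_on (coords N) (snd c' ` (fst c' \<inter> V)) (h \<circ> cinv c')"
  shows "oset (coords M) (snd c ` (fst c \<inter> f -` (fst c' \<inter> V)))"
    and "smooth_on (coords M) (snd c ` (fst c \<inter> f -` (fst c' \<inter> V))) (h \<circ> f \<circ> cinv c)"
proof -
  have "openin (topo M) {p \<in> pts M. f p \<in> fst c' \<inter> V}"
    using f wmfdD(3)[OF N c'] V by (intro openin_continuous_map_preimage[of _ "topo N"])
      (auto simp: smooth_map_def openin_Int)
  from wmfdD(5)[OF M c this]
  have o: "oset (coords M) (snd c ` (fst c \<inter> {p \<in> pts M. f p \<in> fst c' \<inter> V}))" .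
  have e: "fst c \<inter> {p \<in> pts M. f p \<in> fst c' \<inter> V} = fst c \<inter> f -` (fst c' \<inter> V)"
    using wmfdD(6)[OF M c] by auto
  show o': "oset (coords M) (snd c ` (fst c \<inter> f -` (fst c' \<inter> V)))" using o unfolding e .
  have "smooth_on (coords M) (snd c ` (fst c \<inter> f -` fst c')) (snd c' \<circ> f \<circ> cinv c)"
    using f c c' by (simp add: smooth_map_def)
  then have s: "smooth_on (coords M) (snd c ` (fst c \<inter> f -` (fst c' \<inter> V))) (snd c' \<circ> f \<circ> cinv c)"
    by (rule smooth_on_subset) auto
  have "smooth_on (coords M) (snd c ` (fst c \<inter> f -` (fst c' \<inter> V))) (\<lambda>u. (h \<circ> cinv c') ((snd c' \<circ> f \<circ> cinv c) u))"
    by (rule smooth_on_compose[OF wmfdD(5)[OF N c' V] o' h s])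
      (auto simp: cinv_chart[OF M c])
  then show "smooth_on (coords M) (snd c ` (fst c \<inter> f -` (fst c' \<inter> V))) (h \<circ> f \<circ> cinv c)"
    by (rule smooth_on_cong[OF o']) (auto simp: cinv_chart[OF M c] cinv_chart[OF N c'])
qed

lemma smooth_map_in: "smooth_map M N f \<Longrightarrow> p \<in> pts M \<Longrightarrow> f p \<in> pts N"
  unfolding smooth_map_def using continuous_map_image_subset_topspace by fastforce

lemma smooth_near_compose:
  assumes M: "wmfd M" and N: "wmfd N" and f: "smooth_map M N f" and p: "p \<in> pts M"
    and h: "smooth_near N (f p) h"
  shows "smooth_near M p (h \<circ> f)"
proof -
  obtain V where V: "openin (topo N) V" "f p \<in> V" "\<And>c. c \<in> atlas N \<Longrightarrow> smooth_on (coords N) (snd c ` (fst c \<inter> V)) (h \<circ> cinv c)"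
    using h by (auto simp: smooth_near_def)
  define W where "W = {q \<in> pts M. f q \<in> V}"
  have oW: "openin (topo M) W" unfolding W_def
    using f V by (intro openin_continuous_map_preimage[of _ "topo N"]) (auto simp: smooth_map_def)
  have "smooth_on (coords M) (snd c ` (fst c \<inter> W)) (h \<circ> f \<circ> cinv c)" if c: "c \<in> atlas M" for c
  proof (rule smooth_on_local[OF wmfdD(5)[OF M c oW]])
    fix u assume "u \<in> snd c ` (fst c \<inter> W)"
    then obtain q where q: "q \<in> fst c" "q \<in> W" "u = snd c q" by auto
    have "f q \<in> pts N" using V(1) openin_subset q(2) by (fastforce simp: W_def)
    then obtain c' where c': "c' \<in> atlas N" "f q \<in> fst c'" using wmfdD(2)[OF N] by blast
    note core = smooth_map_core[OF M N f c c'(1) V(1) V(3)[OF c'(1)]]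
    show "\<exists>V. oset (coords M) V \<and> u \<in> V \<and> smooth_on (coords M) (V \<inter> snd c ` (fst c \<inter> W)) (h \<circ> f \<circ> cinv c)"
      using core smooth_on_subset[OF core(2)] q c' by (intro exI[of _ "snd c ` (fst c \<inter> f -` (fst c' \<inter> V))"])
        (auto simp: W_def)
  qed
  then show ?thesis unfolding smooth_near_def using oW p V(2) by (auto simp: W_def)
qed

lemma smooth_map_compose:
  assumes M: "wmfd M" and N: "wmfd N" and Q: "wmfd Q" and f: "smooth_map M N f" and g: "smooth_map N Q g"
  shows "smooth_map M Q (g \<circ> f)"
  unfolding smooth_map_def
proof (intro conjI ballI)
  show "continuous_map (topo M) (topo Q) (g \<circ> f)"
    using f g by (auto simp: smooth_map_def intro: continuous_map_compose)
  fix c c'' assume c: "c \<in> atlas M" and c'': "c'' \<in> atlas Q"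
  define V where "V = {q \<in> pts N. g q \<in> fst c''}"
  have oV: "openin (topo N) V" unfolding V_def
    using g wmfdD(3)[OF Q c''] by (intro openin_continuous_map_preimage[of _ "topo Q"]) (auto simp: smooth_map_def)
  have "openin (topo M) {p \<in> pts M. f p \<in> V}"
    using f oV by (intro openin_continuous_map_preimage[of _ "topo N"]) (auto simp: smooth_map_def)
  then have "oset (coords M) (snd c ` (fst c \<inter> {p \<in> pts M. f p \<in> V}))" by (rule wmfdD(5)[OF M c])
  moreover have "fst c \<inter> {p \<in> pts M. f p \<in> V} = fst c \<inter> (g \<circ> f) -` fst c''"
    using wmfdD(6)[OF M c] smooth_map_in[OF f] by (auto simp: V_def)
  ultimately have o: "oset (coords M) (snd c ` (fst c \<inter> (g \<circ> f) -` fst c''))" by simp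
  have "smooth_on (coords M) (snd c ` (fst c \<inter> (g \<circ> f) -` fst c'')) ((snd c'' \<circ> g) \<circ> f \<circ> cinv c)"
  proof (rule smooth_on_local[OF o])
    fix u assume "u \<in> snd c ` (fst c \<inter> (g \<circ> f) -` fst c'')"
    then obtain q where q: "q \<in> fst c" "g (f q) \<in> fst c''" "u = snd c q" by auto
    have fq: "f q \<in> pts N" using smooth_map_in[OF f] wmfdD(6)[OF M c] q by blast
    then obtain c' where c': "c' \<in> atlas N" "f q \<in> fst c'" using wmfdD(2)[OF N] by blast
    have "smooth_on (coords N) (snd c' ` (fst c' \<inter> g -` fst c'')) (snd c'' \<circ> g \<circ> cinv c')"
      using g c' c'' by (simp add: smooth_map_def)
    then have "smooth_on (coords N) (snd c' ` (fst c' \<inter> V)) (snd c'' \<circ> g \<circ> cinv c')"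
      by (rule smooth_on_subset) (auto simp: V_def)
    note core = smooth_map_core[OF M N f c c'(1) oV this]
    show "\<exists>V. oset (coords M) V \<and> u \<in> V \<and>
        smooth_on (coords M) (V \<inter> snd c ` (fst c \<inter> (g \<circ> f) -` fst c'')) ((snd c'' \<circ> g) \<circ> f \<circ> cinv c)"
      using core smooth_on_subset[OF core(2)] q c' fq by (intro exI[of _ "snd c ` (fst c \<inter> f -` (fst c' \<inter> V))"])
        (auto simp: V_def)
  qed
  then show "smooth_on (coords M) (snd c ` (fst c \<inter> (g \<circ> f) -` fst c'')) (snd c'' \<circ> (g \<circ> f) \<circ> cinv c)"
    by (simp add: o_assoc)
qed

lemma push_compose:
  assumes "wmfd N" "wmfd Q" "smooth_map N Q g" "f p \<in> pts N"
  shows "push Q (g \<circ> f) p \<xi> = push Q g (f p) (push N f p \<xi>)"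
  unfolding push_def using smooth_near_compose[OF assms] by (auto simp: fun_eq_iff o_assoc)

definition pvec :: "'e::euclidean_space set \<Rightarrow> 'e set \<Rightarrow> 'e \<Rightarrow> 'e \<Rightarrow> 'e tv" where
  "pvec D W u v = coord_vec (euc D W) (W, \<lambda>x. x) u v"

lemma pvec_eq:
  assumes "oset D W" "u \<in> W" "v \<in> span D"
  shows "pvec D W u v f = (if smooth_near (euc D W) u f then dd f v u else 0)"
  unfolding pvec_def coord_vec_def
  using dd_cong[OF assms, of "f \<circ> inv_into W (\<lambda>x. x)" f] by auto

lemma smooth_map_euc_iff:
  assumes "oset D W" and "wmfd M"
  shows "smooth_map (euc D W) M F \<longleftrightarrow> continuous_map (top_of_set W) (topo M) F \<and>
     (\<forall>c\<in>atlas M. smooth_on D (W \<inter> F -` fst c) (snd c \<circ> F))"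
proof -
  have "smooth_on D (W \<inter> F -` fst c) (snd c \<circ> F \<circ> inv_into W (\<lambda>x. x)) \<longleftrightarrow> smooth_on D (W \<inter> F -` fst c) (snd c \<circ> F)"
    if "continuous_map (top_of_set W) (topo M) F" "c \<in> atlas M" for c
  proof -
    have "openin (top_of_set W) {u \<in> topspace (top_of_set W). F u \<in> fst c}"
      using that wmfdD(3)[OF assms(2)] by (intro openin_continuous_map_preimage[of _ "topo M"]) auto
    moreover have "{u \<in> topspace (top_of_set W). F u \<in> fst c} = W \<inter> F -` fst c" by auto
    ultimately have "openin (top_of_set W) (W \<inter> F -` fst c)" by simp
    then have o: "oset D (W \<inter> F -` fst c)" using assms(1) by (auto simp: oset_def intro: openin_trans)
    show ?thesis
      using smooth_on_cong[OF o, of "snd c \<circ> F \<circ> inv_into W (\<lambda>x. x)" "snd c \<circ> F"]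
        smooth_on_cong[OF o, of "snd c \<circ> F" "snd c \<circ> F \<circ> inv_into W (\<lambda>x. x)"]
      by auto
  qed
  then show ?thesis unfolding smooth_map_def by auto
qed

lemma smooth_map_euc_dom:
  assumes "oset D W" "wmfd M" "smooth_map (euc D W) M F" "openin (topo M) V"
  shows "oset D (W \<inter> F -` V)"
proof -
  have "openin (top_of_set W) {u \<in> topspace (top_of_set W). F u \<in> V}"
    using assms by (intro openin_continuous_map_preimage[of _ "topo M"]) (auto simp: smooth_map_def)
  moreover have "{u \<in> topspace (top_of_set W). F u \<in> V} = W \<inter> F -` V" by auto
  ultimately show ?thesis using assms by (auto simp: oset_def intro: openin_trans)
qed

lemma smooth_map_euc_chart:
  assumes "oset D W" "wmfd M" "smooth_map (euc D W) M F" "c \<in> atlas M"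
  shows "smooth_on D (W \<inter> F -` fst c) (snd c \<circ> F)"
  using assms smooth_map_euc_iff by blast

text \<open>The chain rule, tested on functions. A tangent vector is 0 on functions that are not
  smooth near its base point, so both the smooth case and the default case have to match.\<close>

lemma push_pvec:
  assumes o: "oset D W" and M: "wmfd M" and F: "smooth_map (euc D W) M F" and u: "u \<in> W"
    and c: "c \<in> atlas M" "F u \<in> fst c" and v: "v \<in> span D"
  shows "push M F u (pvec D W u v) = coord_vec M c (F u) (dd (snd c \<circ> F) v u)"
proof (rule ext)
  fix \<psi>
  show "push M F u (pvec D W u v) \<psi> = coord_vec M c (F u) (dd (snd c \<circ> F) v u) \<psi>"
  proof (cases "smooth_near M (F u) \<psi>")
    case True
    then obtain V where V: "openin (topo M) V" "F u \<in> V" "smooth_on (coords M) (snd c ` (fst c \<inter> V)) (\<psi> \<circ> cinv c)"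
      using c by (auto simp: smooth_near_def)
    have "smooth_near (euc D W) u (\<psi> \<circ> F)"
      using smooth_near_compose[OF wmfd_euc[OF o] M F _ True] u by simp
    then have "push M F u (pvec D W u v) \<psi> = dd (\<psi> \<circ> F) v u"
      using True by (simp add: push_def pvec_eq[OF o u v])
    also have "\<dots> = dd (\<lambda>u. (\<psi> \<circ> cinv c) ((snd c \<circ> F) u)) v u"
    proof (rule dd_cong[OF smooth_map_euc_dom[OF o M F openin_Int[OF wmfdD(3)[OF M c(1)] V(1)]]])
      show "u \<in> W \<inter> F -` (fst c \<inter> V)" using u c V by auto
      show "(\<psi> \<circ> F) x = (\<psi> \<circ> cinv c) ((snd c \<circ> F) x)" if "x \<in> W \<inter> F -` (fst c \<inter> V)" for x
        using that cinv_chart[OF M c(1)] by auto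
    qed fact
    also have "\<dots> = dd (\<psi> \<circ> cinv c) (dd (snd c \<circ> F) v u) ((snd c \<circ> F) u)"
    proof (rule dd_compose[OF wmfdD(5)[OF M c(1) V(1)]
        smooth_map_euc_dom[OF o M F openin_Int[OF wmfdD(3)[OF M c(1)] V(1)]] V(3) _ _ _ v])
      show "smooth_on D (W \<inter> F -` (fst c \<inter> V)) (snd c \<circ> F)"
        by (rule smooth_on_subset[OF smooth_map_euc_chart[OF o M F c(1)]]) auto
    qed (use u c V in auto)
    finally show ?thesis using True by (simp add: coord_vec_def)
  qed (simp add: push_def coord_vec_def)
qed

text \<open>Smoothness of an inverse chart seen in the other charts is exactly their compatibility;
  hence \<open>smooth_manifold\<close> is asked and not only \<open>wmfd\<close>.\<close>

lemma smooth_map_cinv: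
  assumes M: "smooth_manifold M" and c: "c \<in> atlas M" and V: "openin (topo M) V"
  shows "smooth_map (euc (coords M) (snd c ` (fst c \<inter> V))) M (cinv c)"
proof -
  have w: "wmfd M" by (rule smooth_manifold_wmfd[OF M])
  note o = wmfdD(5)[OF w c V]
  let ?W = "snd c ` (fst c \<inter> V)"
  have pre: "?W \<inter> cinv c -` U = snd c ` (fst c \<inter> (V \<inter> U))" for U
    using cinv_chart[OF w c] by (auto simp: image_iff)
  have pc: "openin (top_of_set ?W) (?W \<inter> cinv c -` U)" if "openin (topo M) U" for U
    unfolding pre
  proof (rule openin_subset_trans)
    show "openin (top_of_set (span (coords M))) (snd c ` (fst c \<inter> (V \<inter> U)))"
      using wmfdD(5)[OF w c openin_Int[OF V that]] by (simp add: oset_def)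
  qed (use oset_sub_span[OF o] in auto)
  have "continuous_map (top_of_set ?W) (topo M) (cinv c)"
    unfolding continuous_map_def
  proof (intro conjI allI impI)
    show "cinv c \<in> topspace (top_of_set ?W) \<rightarrow> pts M"
      using wmfdD(6)[OF w c] cinv_chart[OF w c] by auto
    fix U assume "openin (topo M) U"
    then have "openin (top_of_set ?W) (?W \<inter> cinv c -` U)" by (rule pc)
    moreover have "{x \<in> topspace (top_of_set ?W). cinv c x \<in> U} = ?W \<inter> cinv c -` U" by auto
    ultimately show "openin (top_of_set ?W) {x \<in> topspace (top_of_set ?W). cinv c x \<in> U}" by simp
  qed
  moreover have "smooth_on (coords M) (?W \<inter> cinv c -` fst c') (snd c' \<circ> cinv c)" if "c' \<in> atlas M" for c'
    unfolding pre by (rule smooth_on_subset[OF smooth_manifold_compat[OF M c that]]) auto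
  ultimately show ?thesis unfolding smooth_map_euc_iff[OF o w] by simp
qed

lemma smooth_map_cinv_cimg:
  assumes "smooth_manifold M" "c \<in> atlas M"
  shows "smooth_map (euc (coords M) (cimg c)) M (cinv c)"
  using smooth_map_cinv[OF assms wmfdD(3)[OF smooth_manifold_wmfd[OF assms(1)] assms(2)]] by simp

lemma coord_vec_push:
  assumes M: "smooth_manifold M" and c: "c \<in> atlas M" and u: "u \<in> cimg c" and v: "v \<in> span (coords M)"
  shows "coord_vec M c (cinv c u) v = push M (cinv c) u (pvec (coords M) (cimg c) u v)"
proof -
  have w: "wmfd M" by (rule smooth_manifold_wmfd[OF M])
  note o = wmfd_cimg[OF w c]
  have "push M (cinv c) u (pvec (coords M) (cimg c) u v) = coord_vec M c (cinv c u) (dd (snd c \<circ> cinv c) v u)"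
    by (rule push_pvec[OF o w smooth_map_cinv_cimg[OF M c] u c cinv_in[OF u] v])
  also have "dd (snd c \<circ> cinv c) v u = dd (\<lambda>x. x) v u"
    by (rule dd_cong[OF o u v]) (simp add: chart_cinv)
  also have "\<dots> = v" by (rule dd_eqI) (auto intro!: derivative_eq_intros)
  finally show ?thesis by simp
qed

lemma coord_vec_change:
  assumes M: "smooth_manifold M" and c: "c \<in> atlas M" "p \<in> fst c" and c': "c' \<in> atlas M" "p \<in> fst c'"
    and v: "v \<in> span (coords M)"
  obtains v' where "v' \<in> span (coords M)" "coord_vec M c p v = coord_vec M c' p v'"
proof -
  have w: "wmfd M" by (rule smooth_manifold_wmfd[OF M])
  have u: "snd c p \<in> cimg c" using c by auto
  have p: "cinv c (snd c p) = p" by (rule cinv_chart[OF w c])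
  note o = wmfd_cimg[OF w c(1)]
  note sm = smooth_map_cinv_cimg[OF M c(1)]
  have "coord_vec M c p v = coord_vec M c' p (dd (snd c' \<circ> cinv c) v (snd c p))"
    using push_pvec[OF o w sm u c'(1) _ v] coord_vec_push[OF M c(1) u v] c'(2) unfolding p by simp
  moreover have "dd (snd c' \<circ> cinv c) v (snd c p) \<in> span (coords M)"
    by (rule dd_smooth_in_span[OF wmfd_cimg[OF w c'(1)] smooth_map_euc_dom[OF o w sm wmfdD(3)[OF w c'(1)]]
        smooth_map_euc_chart[OF o w sm c'(1)] _ _ v]) (use u p c' in auto)
  ultimately show thesis using that by blast
qed

section \<open>Tangent vectors in a fixed chart\<close>

lemma coord_vec_in_tangent:
  "c \<in> atlas M \<Longrightarrow> p \<in> fst c \<Longrightarrow> v \<in> span (coords M) \<Longrightarrow> coord_vec M c p v \<in> tangent M p"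
  unfolding tangent_def by blast

text \<open>\<open>tangent\<close> collects coordinate vectors of all charts around the point; the
  change of coordinates shows that one chart already yields all of them.\<close>

lemma tangent_chart:
  assumes M: "smooth_manifold M" and c: "c \<in> atlas M" "p \<in> fst c"
  shows "tangent M p = coord_vec M c p ` span (coords M)"
proof
  show "tangent M p \<subseteq> coord_vec M c p ` span (coords M)"
  proof
    fix \<xi> assume "\<xi> \<in> tangent M p"
    then obtain c' v where c': "c' \<in> atlas M" "p \<in> fst c'" "v \<in> span (coords M)" "\<xi> = coord_vec M c' p v"
      by (auto simp: tangent_def)
    obtain v' where "v' \<in> span (coords M)" "coord_vec M c' p v = coord_vec M c p v'"
      using coord_vec_change[OF M c'(1,2) c c'(3)] by blast
    then show "\<xi> \<in> coord_vec M c p ` span (coords M)" using c'(4) by auto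
  qed
qed (use coord_vec_in_tangent[OF c] in blast)

text \<open>Coordinate functions have to qualify as smooth near the point, since otherwise a
  coordinate vector is 0 on them by convention and \<open>tcomp\<close> could not recover its
  components.\<close>

lemma smooth_near_coord:
  assumes M: "smooth_manifold M" and c: "c \<in> atlas M" "p \<in> fst c"
  shows "smooth_near M p (\<lambda>q. snd c q \<bullet> b)"
proof -
  have w: "wmfd M" by (rule smooth_manifold_wmfd[OF M])
  have "smooth_on (coords M) (snd c' ` (fst c' \<inter> fst c)) ((\<lambda>q. snd c q \<bullet> b) \<circ> cinv c')" if "c' \<in> atlas M" for c'
    using smooth_on_bounded_linear[OF bounded_linear_inner_left wmfdD(5)[OF w that wmfdD(3)[OF w c(1)]]
      smooth_manifold_compat[OF M that c(1)], of b] by (simp add: o_def)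
  then show ?thesis unfolding smooth_near_def using wmfdD(3)[OF w c(1)] c by blast
qed

lemma smooth_near_dd:
  assumes w: "wmfd M" and c: "c \<in> atlas M" "p \<in> fst c" and f: "smooth_near M p f"
  obtains V where "oset (coords M) V" "snd c p \<in> V" "smooth_on (coords M) V (f \<circ> cinv c)"
  using f c wmfdD(5)[OF w c(1)] unfolding smooth_near_def by blast

lemma coord_vec_linear:
  assumes w: "wmfd M" and c: "c \<in> atlas M" "p \<in> fst c" and v: "v \<in> span (coords M)" "v' \<in> span (coords M)"
  shows "coord_vec M c p (s *\<^sub>R v + t *\<^sub>R v') = tlin s (coord_vec M c p v) t (coord_vec M c p v')"
proof
  fix f
  show "coord_vec M c p (s *\<^sub>R v + t *\<^sub>R v') f = tlin s (coord_vec M c p v) t (coord_vec M c p v') f"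
  proof (cases "smooth_near M p f")
    case True
    then obtain V where V: "oset (coords M) V" "snd c p \<in> V" "smooth_on (coords M) V (f \<circ> cinv c)"
      using smooth_near_dd[OF w c] by blast
    show ?thesis using dd_linear[OF V(1) smooth_on_ck[OF V(3)] V(2) v, of s t] True
      by (simp add: coord_vec_def tlin_def)
  qed (simp add: coord_vec_def tlin_def)
qed

lemma tcomp_coord_vec:
  assumes M: "smooth_manifold M" and c: "c \<in> atlas M" "p \<in> fst c" and v: "v \<in> span (coords M)"
  shows "tcomp M c (coord_vec M c p v) = v"
proof -
  have w: "wmfd M" by (rule smooth_manifold_wmfd[OF M])
  have u: "snd c p \<in> cimg c" using c by auto
  have "coord_vec M c p v (\<lambda>q. snd c q \<bullet> b) = v \<bullet> b" for b
  proof -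
    have "dd ((\<lambda>q. snd c q \<bullet> b) \<circ> cinv c) v (snd c p) = dd (\<lambda>x. x \<bullet> b) v (snd c p)"
      by (rule dd_cong[OF wmfd_cimg[OF w c(1)] u v]) (simp add: chart_cinv)
    also have "\<dots> = v \<bullet> b"
      by (rule dd_eqI) (auto intro!: derivative_eq_intros simp: inner_add_left)
    finally show ?thesis using smooth_near_coord[OF M c] by (simp add: coord_vec_def)
  qed
  then show ?thesis unfolding tcomp_def using span_coords_sum[OF wmfdD(1)[OF w] v] by simp
qed

lemma coord_vec_tcomp:
  assumes M: "smooth_manifold M" and c: "c \<in> atlas M" "p \<in> fst c" and \<xi>: "\<xi> \<in> tangent M p"
  shows "coord_vec M c p (tcomp M c \<xi>) = \<xi>" "tcomp M c \<xi> \<in> span (coords M)"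
  using \<xi> tcomp_coord_vec[OF M c] unfolding tangent_chart[OF M c] by auto

lemma coord_vec_eq_iff:
  assumes "smooth_manifold M" "c \<in> atlas M" "p \<in> fst c" "v \<in> span (coords M)" "v' \<in> span (coords M)"
  shows "coord_vec M c p v = coord_vec M c p v' \<longleftrightarrow> v = v'"
  using tcomp_coord_vec[OF assms(1-3)] assms(4,5) by metis

lemma coord_vec_0:
  assumes "wmfd M" "c \<in> atlas M" "p \<in> fst c"
  shows "coord_vec M c p 0 = tzero"
  using coord_vec_linear[OF assms span_zero span_zero, of 0 0] by (simp add: tlin_def tzero_def)

lemma pvec_linear:
  assumes o: "oset D W" and u: "u \<in> W" and v: "v \<in> span D" "v' \<in> span D"
  shows "pvec D W u (s *\<^sub>R v + t *\<^sub>R v') = tlin s (pvec D W u v) t (pvec D W u v')"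
  unfolding pvec_def by (rule coord_vec_linear[OF wmfd_euc[OF o]]) (use u v in auto)

lemma push_tlin: "push N f p (tlin s \<xi> t \<eta>) = tlin s (push N f p \<xi>) t (push N f p \<eta>)"
  by (auto simp: push_def tlin_def)

lemma push_pvec_in_tangent:
  assumes o: "oset D W" and M: "wmfd M" and F: "smooth_map (euc D W) M F" and u: "u \<in> W" and v: "v \<in> span D"
  shows "push M F u (pvec D W u v) \<in> tangent M (F u)"
proof -
  have "F u \<in> pts M" using smooth_map_in[OF F] u by simp
  then obtain c where c: "c \<in> atlas M" "F u \<in> fst c" using wmfdD(2)[OF M] by blast
  have "dd (snd c \<circ> F) v u \<in> span (coords M)"
    by (rule dd_smooth_in_span[OF wmfd_cimg[OF M c(1)] smooth_map_euc_dom[OF o M F wmfdD(3)[OF M c(1)]]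
        smooth_map_euc_chart[OF o M F c(1)] _ _ v]) (use u c in auto)
  then show ?thesis using push_pvec[OF o M F u c v] coord_vec_in_tangent[OF c] by simp
qed

lemma push_pvec_cong:
  assumes o: "oset D W" and u: "u \<in> W" and v: "v \<in> span D" and eq: "\<And>u. u \<in> W \<Longrightarrow> F u = F' u"
  shows "push M F u (pvec D W u v) = push M F' u (pvec D W u v)"
proof -
  have *: "smooth_near (euc D W) u g'" if g: "smooth_near (euc D W) u g" and gg: "\<And>u. u \<in> W \<Longrightarrow> g u = g' u"
    for g g' :: "'a \<Rightarrow> real"
  proof -
    obtain V where V: "openin (top_of_set W) V" "u \<in> V" "smooth_on D (W \<inter> V) (g \<circ> inv_into W (\<lambda>x. x))"
      using g by (auto simp: smooth_near_def)
    have "oset D (W \<inter> V)" using V(1) o by (auto simp: oset_def intro: openin_trans)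
    from smooth_on_cong[OF this V(3), of "g' \<circ> inv_into W (\<lambda>x. x)"] gg
    show ?thesis using V(1,2) by (auto simp: smooth_near_def)
  qed
  have "pvec D W u v (\<psi> \<circ> F) = pvec D W u v (\<psi> \<circ> F')" for \<psi>
    unfolding pvec_eq[OF o u v] using *[of "\<psi> \<circ> F" "\<psi> \<circ> F'"] *[of "\<psi> \<circ> F'" "\<psi> \<circ> F"] eq
      dd_cong[OF o u v, of "\<psi> \<circ> F" "\<psi> \<circ> F'"] by auto
  then show ?thesis unfolding push_def using eq[OF u] by (auto simp: fun_eq_iff)
qed

lemma oset_Basis: "open I \<Longrightarrow> oset Basis I"
  unfolding oset_def span_Basis by (simp only: open_openin subtopology_UNIV order.refl simp_thms)

text \<open>\<open>velocity\<close> is defined by an ordinary derivative along the curve. Rewriting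
  it as the push of the unit vector makes it subject to the same composition rules as all other
  pushes.\<close>

lemma velocity_push:
  assumes I: "open I" and M: "wmfd M" and \<gamma>: "smooth_map (euc Basis I) M \<gamma>" and t: "t \<in> I"
  shows "velocity M \<gamma> t = push M \<gamma> t (pvec Basis I t 1)"
proof
  fix \<psi>
  have o: "oset Basis I" by (rule oset_Basis[OF I])
  have 1: "1 \<in> span (Basis :: real set)" by (simp only: span_Basis UNIV_I)
  show "velocity M \<gamma> t \<psi> = push M \<gamma> t (pvec Basis I t 1) \<psi>"
  proof (cases "smooth_near M (\<gamma> t) \<psi>")
    case True
    have s: "smooth_near (euc Basis I) t (\<psi> \<circ> \<gamma>)"
      using smooth_near_compose[OF wmfd_euc[OF o] M \<gamma> _ True] t by simp
    obtain V where V: "oset (Basis :: real set) V" "t \<in> V" "smooth_on Basis V (\<psi> \<circ> \<gamma> \<circ> inv_into I (\<lambda>x. x))"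
      using smooth_near_dd[OF wmfd_euc[OF o] _ _ s, of "(I, \<lambda>x. x)"] t by auto
    have "smooth_on Basis (V \<inter> I) (\<psi> \<circ> \<gamma>)"
      by (rule smooth_on_cong[OF oset_Int[OF V(1) o] smooth_on_subset[OF V(3)]]) auto
    from smooth_on_line[OF oset_Int[OF V(1) o] this _ 1, of t] V(2) t
    have "((\<lambda>r. (\<psi> \<circ> \<gamma>) (t + r)) has_vector_derivative dd (\<psi> \<circ> \<gamma>) 1 t) (at 0)" by simp
    then have "((\<lambda>r. \<psi> (\<gamma> r)) has_field_derivative dd (\<psi> \<circ> \<gamma>) 1 t) (at t)"
      using DERIV_shift[of "\<lambda>r. \<psi> (\<gamma> r)" "dd (\<psi> \<circ> \<gamma>) 1 t" 0 t]
      by (simp add: has_real_derivative_iff_has_vector_derivative add.commute)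
    then have "deriv (\<lambda>s. \<psi> (\<gamma> s)) t = dd (\<psi> \<circ> \<gamma>) 1 t" by (rule DERIV_imp_deriv)
    then show ?thesis using True s by (simp only: velocity_def push_def pvec_eq[OF o t 1] if_True)
  qed (simp add: velocity_def push_def)
qed

section \<open>Products of manifolds and maps into them\<close>

lemma span_prod_coords:
  "span ((\<lambda>b. (b, 0)) ` A \<union> (\<lambda>b. (0, b)) ` B) = span A \<times> span (B :: 'b::euclidean_space set)"
  for A :: "'a::euclidean_space set"
proof -
  have 1: "span ((\<lambda>b. (b, 0)) ` A) = (\<lambda>b. (b, 0 :: 'b)) ` span A"
    by (rule linear_span_image) (auto intro!: linearI)
  have 2: "span ((\<lambda>b. (0, b)) ` B) = (\<lambda>b. (0 :: 'a, b)) ` span B"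
    by (rule linear_span_image) (auto intro!: linearI)
  show ?thesis unfolding span_Un 1 2 by (auto simp: image_iff)
qed

lemma oset_Times:
  assumes "oset D W" "oset D' W'"
  shows "oset ((\<lambda>b. (b, 0)) ` D \<union> (\<lambda>b. (0, b)) ` D') (W \<times> W')"
proof -
  obtain T T' where T: "open T" "W = span D \<inter> T" "open T'" "W' = span D' \<inter> T'"
    using assms unfolding oset_def openin_open by auto
  have "W \<times> W' = (span D \<times> span D') \<inter> (T \<times> T')" using T by auto
  moreover have "(\<lambda>b. (b, 0)) ` D \<union> (\<lambda>b. (0, b)) ` D' \<subseteq> Basis"
    using assms by (auto simp: oset_def Basis_prod_def)
  ultimately show ?thesis
    unfolding oset_def openin_open span_prod_coords using open_Times[OF T(1,3)] by blast
qed

lemma smooth_on_Pair: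
  assumes "oset D W" "smooth_on D W f" "smooth_on D W g"
  shows "smooth_on D W (\<lambda>u. (f u, g u))"
proof -
  have 1: "bounded_linear (\<lambda>x. (x, 0))" by (rule bounded_linear_Pair[OF bounded_linear_ident bounded_linear_zero])
  have 2: "bounded_linear (\<lambda>x. (0, x))" by (rule bounded_linear_Pair[OF bounded_linear_zero bounded_linear_ident])
  have "smooth_on D W (\<lambda>u. (f u, 0) + (0, g u))"
    by (rule smooth_on_add[OF assms(1) smooth_on_bounded_linear[OF 1 assms(1,2)] smooth_on_bounded_linear[OF 2 assms(1,3)]])
  then show ?thesis by simp
qed

lemma prod_mfd_simps:
  "topo (prod_mfd M N) = prod_topology (topo M) (topo N)"
  "coords (prod_mfd M N) = (\<lambda>b. (b, 0)) ` coords M \<union> (\<lambda>b. (0, b)) ` coords N"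
  "pts (prod_mfd M N) = pts M \<times> pts N"
  by (simp_all add: prod_mfd_def)

lemma prod_atlas: "a \<in> atlas M \<Longrightarrow> b \<in> atlas N \<Longrightarrow> (fst a \<times> fst b, \<lambda>(p, q). (snd a p, snd b q)) \<in> atlas (prod_mfd M N)"
  by (simp add: prod_mfd_def del: split_paired_Ex) blast

lemma wmfd_prod:
  assumes M: "wmfd M" and N: "wmfd N"
  shows "wmfd (prod_mfd M N)"
  unfolding wmfd_def
proof (intro conjI ballI allI impI)
  show D: "coords (prod_mfd M N) \<subseteq> Basis"
    using wmfdD(1)[OF M] wmfdD(1)[OF N] by (auto simp: prod_mfd_def Basis_prod_def)
  show "pts (prod_mfd M N) = (\<Union>c\<in>atlas (prod_mfd M N). fst c)"
  proof (intro subset_antisym subsetI)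
    fix z assume "z \<in> pts (prod_mfd M N)"
    then have "fst z \<in> pts M" "snd z \<in> pts N" by (auto simp: prod_mfd_def)
    then obtain a b where ab: "a \<in> atlas M" "fst z \<in> fst a" "b \<in> atlas N" "snd z \<in> fst b"
      using wmfdD(2)[OF M] wmfdD(2)[OF N] by meson
    then show "z \<in> (\<Union>c\<in>atlas (prod_mfd M N). fst c)"
      using UN_I[OF prod_atlas[OF ab(1,3)], of z fst] by (simp add: mem_Times_iff)
  next
    fix z assume "z \<in> (\<Union>c\<in>atlas (prod_mfd M N). fst c)"
    then obtain a b where "a \<in> atlas M" "b \<in> atlas N" "z \<in> fst a \<times> fst b"
      by (auto simp: prod_mfd_def)
    then have "z \<in> pts M \<times> pts N" using wmfdD(6)[OF M] wmfdD(6)[OF N] by blast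
    then show "z \<in> pts (prod_mfd M N)" by (simp add: prod_mfd_def)
  qed
  fix c assume "c \<in> atlas (prod_mfd M N)"
  then obtain a b where ab: "a \<in> atlas M" "b \<in> atlas N" "c = (fst a \<times> fst b, \<lambda>(p, q). (snd a p, snd b q))"
    by (auto simp: prod_mfd_def)
  show "openin (topo (prod_mfd M N)) (fst c)"
    using ab wmfdD(3)[OF M] wmfdD(3)[OF N] by (simp add: prod_mfd_def openin_prod_Times_iff)
  show "inj_on (snd c) (fst c)"
    using ab wmfdD(4)[OF M] wmfdD(4)[OF N] by (auto simp: inj_on_def)
  fix W assume "openin (topo (prod_mfd M N)) W"
  then have W: "openin (prod_topology (topo M) (topo N)) W" by (simp add: prod_mfd_def)
  show "oset (coords (prod_mfd M N)) (snd c ` (fst c \<inter> W))"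
  proof (rule oset_subopen[OF D])
    fix u assume "u \<in> snd c ` (fst c \<inter> W)"
    then obtain p q where pq: "p \<in> fst a" "q \<in> fst b" "(p, q) \<in> W" "u = (snd a p, snd b q)"
      using ab(3) by auto
    obtain U V where UV: "openin (topo M) U" "openin (topo N) V" "p \<in> U" "q \<in> V" "U \<times> V \<subseteq> W"
      using W[unfolded openin_prod_topology_alt, rule_format, OF pq(3)] by blast
    show "\<exists>V. oset (coords (prod_mfd M N)) V \<and> u \<in> V \<and> V \<subseteq> snd c ` (fst c \<inter> W)"
    proof (intro exI conjI)
      show "oset (coords (prod_mfd M N)) (snd a ` (fst a \<inter> U) \<times> snd b ` (fst b \<inter> V))"
        using oset_Times[OF wmfdD(5)[OF M ab(1) UV(1)] wmfdD(5)[OF N ab(2) UV(2)]] by (simp add: prod_mfd_def)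
      show "u \<in> snd a ` (fst a \<inter> U) \<times> snd b ` (fst b \<inter> V)" using pq UV by auto
      show "snd a ` (fst a \<inter> U) \<times> snd b ` (fst b \<inter> V) \<subseteq> snd c ` (fst c \<inter> W)"
        using UV(5) by (force simp: ab(3))
    qed
  qed
qed

lemma smooth_map_Pair:
  assumes X: "oset D X" and M: "wmfd M" and N: "wmfd N"
    and f: "smooth_map (euc D X) M f" and g: "smooth_map (euc D X) N g"
  shows "smooth_map (euc D X) (prod_mfd M N) (\<lambda>x. (f x, g x))"
  unfolding smooth_map_euc_iff[OF X wmfd_prod[OF M N]]
proof (intro conjI ballI)
  show "continuous_map (top_of_set X) (topo (prod_mfd M N)) (\<lambda>x. (f x, g x))"
    using f g by (simp add: prod_mfd_simps continuous_map_paired smooth_map_def)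
  fix c assume "c \<in> atlas (prod_mfd M N)"
  then obtain a b where ab: "a \<in> atlas M" "b \<in> atlas N" "c = (fst a \<times> fst b, \<lambda>(p, q). (snd a p, snd b q))"
    by (auto simp: prod_mfd_def)
  have e: "X \<inter> (\<lambda>x. (f x, g x)) -` fst c = (X \<inter> f -` fst a) \<inter> (X \<inter> g -` fst b)" using ab by auto
  have o: "oset D ((X \<inter> f -` fst a) \<inter> (X \<inter> g -` fst b))"
    by (intro oset_Int smooth_map_euc_dom[OF X M f] smooth_map_euc_dom[OF X N g] wmfdD(3)[OF M] wmfdD(3)[OF N] ab)
  have "smooth_on D ((X \<inter> f -` fst a) \<inter> (X \<inter> g -` fst b)) (\<lambda>x. ((snd a \<circ> f) x, (snd b \<circ> g) x))"
    by (intro smooth_on_Pair[OF o] smooth_on_subset[OF smooth_map_euc_chart[OF X M f ab(1)]]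
        smooth_on_subset[OF smooth_map_euc_chart[OF X N g ab(2)]]) auto
  then show "smooth_on D (X \<inter> (\<lambda>x. (f x, g x)) -` fst c) (snd c \<circ> (\<lambda>x. (f x, g x)))"
    unfolding e by (simp add: ab(3) o_def)
qed

lemma smooth_map_euc_euc:
  assumes "oset D W" "oset D' W'" "smooth_on D W f" "f ` W \<subseteq> W'"
  shows "smooth_map (euc D W) (euc D' W') f"
  unfolding smooth_map_euc_iff[OF assms(1) wmfd_euc[OF assms(2)]]
proof (intro conjI ballI)
  show "continuous_map (top_of_set W) (topo (euc D' W')) f"
    unfolding euc_simps continuous_map_subtopology_eu using assms(4) smooth_on_continuous[OF assms(3)] by auto
  fix c assume "c \<in> atlas (euc D' W')"
  then have "c = (W', \<lambda>x. x)" by simp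
  then show "smooth_on D (W \<inter> f -` fst c) (snd c \<circ> f)"
    using smooth_on_subset[OF assms(3), of "W \<inter> f -` W'"] by (simp add: o_def)
qed

lemma smooth_map_bounded_linear:
  assumes "oset D W" "oset D' W'" "bounded_linear f" "f ` W \<subseteq> W'"
  shows "smooth_map (euc D W) (euc D' W') f"
  by (rule smooth_map_euc_euc[OF assms(1,2) _ assms(4)])
    (rule smooth_on_bounded_linear[OF assms(3,1) smooth_on_ident[OF assms(1)]])

lemma dd_bounded_linear: "bounded_linear f \<Longrightarrow> dd f v u = f v"
proof (rule dd_eqI)
  assume f: "bounded_linear f"
  have "((\<lambda>t. u + t *\<^sub>R v) has_vector_derivative v) (at 0)" by (auto intro!: derivative_eq_intros)
  then show "((\<lambda>t. f (u + t *\<^sub>R v)) has_vector_derivative f v) (at 0)"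
    by (rule bounded_linear.has_vector_derivative[OF f])
qed

lemma push_euc:
  assumes "oset D W" "oset D' W'" "smooth_map (euc D W) (euc D' W') f" "u \<in> W" "v \<in> span D"
  shows "push (euc D' W') f u (pvec D W u v) = pvec D' W' (f u) (dd f v u)"
proof -
  have "f u \<in> W'" using smooth_map_in[OF assms(3)] assms(4) by simp
  then show ?thesis
    using push_pvec[OF assms(1) wmfd_euc[OF assms(2)] assms(3,4) _ _ assms(5), of "(W', \<lambda>x. x)"]
    by (simp add: pvec_def o_def)
qed

lemma smooth_map_snd:
  assumes M: "wmfd M" and N: "smooth_manifold N"
  shows "smooth_map (prod_mfd M N) N snd"
  unfolding smooth_map_def
proof (intro conjI ballI)
  have w: "wmfd N" by (rule smooth_manifold_wmfd[OF N])
  show "continuous_map (topo (prod_mfd M N)) (topo N) snd"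
    by (simp add: prod_mfd_simps continuous_map_snd)
  fix c c' assume "c \<in> atlas (prod_mfd M N)" and c': "c' \<in> atlas N"
  then obtain a b where ab: "a \<in> atlas M" "b \<in> atlas N" "c = (fst a \<times> fst b, \<lambda>(p, q). (snd a p, snd b q))"
    by (auto simp: prod_mfd_def)
  have cP: "cinv c (snd a p, snd b q) = (p, q)" if "p \<in> fst a" "q \<in> fst b" for p q
    using cinv_chart[OF wmfd_prod[OF M w] \<open>c \<in> atlas (prod_mfd M N)\<close>, of "(p, q)"] that ab(3) by simp
  have im: "snd c ` (fst c \<inter> snd -` fst c') = cimg a \<times> snd b ` (fst b \<inter> fst c')"
    by (force simp: ab(3))
  have o: "oset (coords (prod_mfd M N)) (cimg a \<times> snd b ` (fst b \<inter> fst c'))"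
    unfolding prod_mfd_simps
    by (rule oset_Times[OF wmfd_cimg[OF M ab(1)] wmfdD(5)[OF w ab(2) wmfdD(3)[OF w c']]])
  have "smooth_on (coords (prod_mfd M N)) (cimg a \<times> snd b ` (fst b \<inter> fst c')) (\<lambda>u. (snd c' \<circ> cinv b) (snd u))"
    by (rule smooth_on_compose[OF wmfdD(5)[OF w ab(2) wmfdD(3)[OF w c']] o smooth_manifold_compat[OF N ab(2) c']
        smooth_on_bounded_linear[OF bounded_linear_snd o smooth_on_ident[OF o]]]) auto
  then show "smooth_on (coords (prod_mfd M N)) (snd c ` (fst c \<inter> snd -` fst c')) (snd c' \<circ> snd \<circ> cinv c)"
    unfolding im by (rule smooth_on_cong[OF o]) (auto simp: cP cinv_chart[OF w ab(2)])
qed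

text \<open>In \<open>cohom_one_form\<close> the number \<open>\<zeta> fst\<close> stands for
  \<open>dx(\<zeta>)\<close>. Tangent vectors vanish by convention on functions that are not smooth
  near the point, so this reading rests on \<open>fst\<close> being smooth.\<close>

lemma smooth_near_fst:
  assumes I: "open I" and N: "wmfd N" and p: "x \<in> I" "p \<in> pts N"
  shows "smooth_near (prod_mfd (interval_mfd I) N) (x, p) fst"
  unfolding smooth_near_def
proof (intro exI conjI ballI)
  have w: "wmfd (interval_mfd I)" unfolding interval_mfd_euc by (rule wmfd_euc[OF oset_Basis[OF I]])
  show "openin (topo (prod_mfd (interval_mfd I) N)) (pts (prod_mfd (interval_mfd I) N))" by simp
  show "(x, p) \<in> pts (prod_mfd (interval_mfd I) N)" using p by (simp add: prod_mfd_simps interval_mfd_euc)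
  fix c assume c: "c \<in> atlas (prod_mfd (interval_mfd I) N)"
  then obtain b where b: "b \<in> atlas N" "c = (I \<times> fst b, \<lambda>(p, q). (p, snd b q))"
    by (auto simp: prod_mfd_def interval_mfd_euc)
  note W = wmfd_prod[OF w N]
  note o = wmfdD(5)[OF W c, of "pts (prod_mfd (interval_mfd I) N)"]
  show "smooth_on (coords (prod_mfd (interval_mfd I) N)) (snd c ` (fst c \<inter> pts (prod_mfd (interval_mfd I) N))) (fst \<circ> cinv c)"
  proof (rule smooth_on_cong[OF o])
    show "smooth_on (coords (prod_mfd (interval_mfd I) N)) (snd c ` (fst c \<inter> pts (prod_mfd (interval_mfd I) N))) fst"
      by (rule smooth_on_bounded_linear[OF bounded_linear_fst o smooth_on_ident[OF o]]) auto
    fix u assume "u \<in> snd c ` (fst c \<inter> pts (prod_mfd (interval_mfd I) N))"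
    then obtain z where z: "z \<in> fst c" "u = snd c z" by blast
    then show "fst u = (fst \<circ> cinv c) u" using cinv_chart[OF W c z(1)] b(2) by auto
  qed simp
qed

section \<open>Metrics and forms in coordinates\<close>

lemma linear_on_tangentD:
  "linear_on_tangent T \<alpha> \<Longrightarrow> \<xi> \<in> T \<Longrightarrow> \<eta> \<in> T \<Longrightarrow> \<alpha> (tlin s \<xi> t \<eta>) = s * \<alpha> \<xi> + t * \<alpha> \<eta>"
  by (simp add: linear_on_tangent_def)

text \<open>Smoothness of tensors is defined for coordinate vectors only; linearity extends it to
  arbitrary constant vectors.\<close>

lemma smooth_on_form_components:
  assumes o: "oset D W" and D: "D' \<subseteq> Basis" and lin: "\<And>u. u \<in> W \<Longrightarrow> slin (span D') (\<lambda>v. F v u)"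
    and sm: "\<And>v. v \<in> D' \<Longrightarrow> smooth_on D W (F v)" and v: "v \<in> span D'"
  shows "smooth_on D W (F v)"
proof (rule smooth_on_cong[OF o])
  show "smooth_on D W (\<lambda>u. \<Sum>b\<in>D'. (v \<bullet> b) * F b u)"
    by (intro smooth_on_sum smooth_on_mult smooth_on_const o sm)
  show "(\<Sum>b\<in>D'. (v \<bullet> b) * F b u) = F v u" if "u \<in> W" for u
    by (rule slin_basis[OF D lin[OF that] v, symmetric])
qed

lemma sym2_lform:
  assumes M: "smooth_manifold M" and g: "smooth_sym2 M g" and c: "c \<in> atlas M"
  shows "lform (coords M) (cimg c) (comp2 M g c)"
proof -
  have w: "wmfd M" by (rule smooth_manifold_wmfd[OF M])
  note D = wmfdD(1)[OF w] and o = wmfd_cimg[OF w c]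
  have sf: "symform (span (coords M)) (comp2 M g c u)" if u: "u \<in> cimg c" for u
  proof -
    let ?p = "cinv c u"
    have p: "?p \<in> fst c" by (rule cinv_in[OF u])
    then have pM: "?p \<in> pts M" using wmfdD(6)[OF w c] by blast
    note t = coord_vec_in_tangent[OF c p]
    have sym: "g ?p \<xi> \<eta> = g ?p \<eta> \<xi>" and lin: "linear_on_tangent (tangent M ?p) (g ?p \<xi>)"
      if "\<xi> \<in> tangent M ?p" "\<eta> \<in> tangent M ?p" for \<xi> \<eta>
      using g pM that unfolding smooth_sym2_def by blast+
    have l: "slin (span (coords M)) (\<lambda>v. comp2 M g c u w v)" if "w \<in> span (coords M)" for w
      unfolding slin_def comp2_def Let_def
      by (simp add: coord_vec_linear[OF w c p] linear_on_tangentD[OF lin[OF t[OF that] t[OF that]]] t)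
    have "comp2 M g c u v w = comp2 M g c u w v" if "v \<in> span (coords M)" "w \<in> span (coords M)" for v w
      unfolding comp2_def Let_def by (rule sym) (use that t in auto)
    with l show ?thesis unfolding symform_def slin_def
      by (auto simp: subspace_span span_add span_scale)
  qed
  show ?thesis
  proof
    show "oset (coords M) (cimg c)" by (rule o)
    show "symform (span (coords M)) (comp2 M g c u)" if "u \<in> cimg c" for u by (rule sf[OF that])
    have 1: "smooth_on (coords M) (cimg c) (\<lambda>u. comp2 M g c u v w)" if "v \<in> coords M" "w \<in> span (coords M)" for v w
      by (rule smooth_on_form_components[OF o D, where F = "\<lambda>w u. comp2 M g c u v w"])
        (use symform_slin2[OF sf] that g c span_base in \<open>auto simp: smooth_sym2_def\<close>)
    show "smooth_on (coords M) (cimg c) (\<lambda>u. comp2 M g c u v w)" if "v \<in> span (coords M)" "w \<in> span (coords M)" for v w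
      by (rule smooth_on_form_components[OF o D, where F = "\<lambda>v u. comp2 M g c u v w"])
        (use symform_slin1[OF sf] that 1 in auto)
  qed
qed

lemma riemannian_lmetric:
  assumes g: "riemannian M g" and c: "c \<in> atlas M"
  shows "lmetric (coords M) (cimg c) (comp2 M g c)"
proof -
  have M: "smooth_manifold M" and s: "smooth_sym2 M g" using g by (auto simp: riemannian_def)
  have w: "wmfd M" by (rule smooth_manifold_wmfd[OF M])
  interpret lform "coords M" "cimg c" "comp2 M g c" by (rule sym2_lform[OF M s c])
  show ?thesis
  proof
    fix u v assume u: "u \<in> cimg c" and v: "v \<in> span (coords M)" "v \<noteq> 0"
    have p: "cinv c u \<in> fst c" by (rule cinv_in[OF u])
    have "coord_vec M c (cinv c u) v \<noteq> tzero"
      using coord_vec_eq_iff[OF M c p v(1) span_zero] v(2) coord_vec_0[OF w c p] by simp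
    then show "comp2 M g c u v v > 0"
      using g coord_vec_in_tangent[OF c p v(1)] p wmfdD(6)[OF w c]
      unfolding riemannian_def comp2_def Let_def by blast
  qed
qed

lemma chart_at_props:
  assumes "wmfd M" "p \<in> pts M"
  shows "chart_at M p \<in> atlas M" "p \<in> fst (chart_at M p)"
  using someI_ex[of "\<lambda>c. c \<in> atlas M \<and> p \<in> fst c"] wmfdD(2)[OF assms] unfolding chart_at_def by blast+

lemma ricci_comp_riem:
  assumes g: "riemannian M g" and c: "c \<in> atlas M" and u: "u \<in> cimg c"
    and E: "frame (span (coords M)) (comp2 M g c u) E" and y: "y \<in> span (coords M)" and z: "z \<in> span (coords M)"
  shows "ricci_comp M g c u y z = (\<Sum>e\<in>E. riem (comp2 M g c) E u e y z e / comp2 M g c u e e)"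
proof -
  interpret lmetric "coords M" "cimg c" "comp2 M g c" by (rule riemannian_lmetric[OF g c])
  have ch: "christoffel M g c = chr (coords M) (comp2 M g c)"
    by (intro ext) (rule christoffel_chr)
  show ?thesis
    unfolding ricci_comp_def curvature_def Let_def ch by (rule ricci_riem[OF u y z E])
qed

lemma ricci_coord:
  assumes g: "riemannian M g" and p: "p \<in> pts M" and y: "y \<in> span (coords M)"
  defines "c \<equiv> chart_at M p"
  assumes E: "frame (span (coords M)) (comp2 M g c (snd c p)) E"
  shows "ricci M g p (coord_vec M c p y) (coord_vec M c p y)
    = (\<Sum>e\<in>E. sec (comp2 M g c) E (snd c p) e y / comp2 M g c (snd c p) e e)"
proof -
  have M: "smooth_manifold M" using g by (simp add: riemannian_def)
  note c = chart_at_props[OF smooth_manifold_wmfd[OF M] p, folded c_def]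
  have u: "snd c p \<in> cimg c" using c by auto
  interpret lmetric "coords M" "cimg c" "comp2 M g c" by (rule riemannian_lmetric[OF g c(1)])
  have ED: "E \<subseteq> span (coords M)" using E by (simp add: frame_def)
  have "ricci M g p (coord_vec M c p y) (coord_vec M c p y) = ricci_comp M g c (snd c p) y y"
    unfolding ricci_def Let_def c_def[symmetric] tcomp_coord_vec[OF M c y] ..
  also have "\<dots> = (\<Sum>e\<in>E. riem (comp2 M g c) E (snd c p) e y y e / comp2 M g c (snd c p) e e)"
    by (rule ricci_comp_riem[OF g c(1) u E y y])
  also have "\<dots> = (\<Sum>e\<in>E. sec (comp2 M g c) E (snd c p) e y / comp2 M g c (snd c p) e e)"
    by (rule sum.cong) (use riem_sec[OF u _ y ED] ED in auto)
  finally show ?thesis .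
qed

lemma scalar_curvature_scal:
  assumes g: "riemannian M g" and p: "p \<in> pts M"
  defines "c \<equiv> chart_at M p"
  assumes E: "frame (span (coords M)) (comp2 M g c (snd c p)) E"
  shows "scalar_curvature M g p = scal (comp2 M g c) E (snd c p)"
proof -
  have M: "smooth_manifold M" using g by (simp add: riemannian_def)
  note c = chart_at_props[OF smooth_manifold_wmfd[OF M] p, folded c_def]
  have u: "snd c p \<in> cimg c" using c by auto
  interpret lmetric "coords M" "cimg c" "comp2 M g c" by (rule riemannian_lmetric[OF g c(1)])
  show ?thesis
    unfolding scalar_curvature_def Let_def c_def[symmetric]
    by (rule trace_ricci[OF u E ricci_comp_riem[OF g c(1) u E]])
qed

text \<open>The pullback of \<open>g\<close> along a parametrization, written with pushed vectors
  instead of chart components. No chart of \<open>M\<close> occurs in it, and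
  \<open>pbf_pullback\<close> matches it with the components in whichever chart is at hand.\<close>

definition pbf :: "('a, 'e::euclidean_space) mfd \<Rightarrow> 'a form2 \<Rightarrow> 'f::euclidean_space set \<Rightarrow> 'f set \<Rightarrow> ('f \<Rightarrow> 'a) \<Rightarrow> 'f \<Rightarrow> 'f \<Rightarrow> 'f \<Rightarrow> real" where
  "pbf M g D W F u v w = g (F u) (push M F u (pvec D W u v)) (push M F u (pvec D W u w))"

lemma pbf_pullback:
  assumes oW: "oset D W" and M: "smooth_manifold M" and g: "smooth_sym2 M g" and F: "smooth_map (euc D W) M F"
    and c: "c \<in> atlas M"
  shows "pullback (coords M) (cimg c) (comp2 M g c) D (W \<inter> F -` fst c) (snd c \<circ> F) (pbf M g D W F)"
proof -
  have w: "wmfd M" by (rule smooth_manifold_wmfd[OF M])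
  interpret lform "coords M" "cimg c" "comp2 M g c" by (rule sym2_lform[OF M g c])
  show ?thesis
  proof
    show "oset D (W \<inter> F -` fst c)" by (rule smooth_map_euc_dom[OF oW w F wmfdD(3)[OF w c]])
    show "smooth_on D (W \<inter> F -` fst c) (snd c \<circ> F)" by (rule smooth_map_euc_chart[OF oW w F c])
    show "(snd c \<circ> F) ` (W \<inter> F -` fst c) \<subseteq> cimg c" by auto
    show "pbf M g D W F u v v' = comp2 M g c ((snd c \<circ> F) u) (dd (snd c \<circ> F) v u) (dd (snd c \<circ> F) v' u)"
      if "u \<in> W \<inter> F -` fst c" "v \<in> span D" "v' \<in> span D" for u v v'
      using that push_pvec[OF oW w F _ c] cinv_chart[OF w c]
      by (simp add: pbf_def comp2_def Let_def)
  qed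
qed

lemma pbf_lform:
  assumes oW: "oset D W" and M: "smooth_manifold M" and g: "smooth_sym2 M g" and F: "smooth_map (euc D W) M F"
  shows "lform D W (pbf M g D W F)"
proof
  have w: "wmfd M" by (rule smooth_manifold_wmfd[OF M])
  have ex: "\<exists>c\<in>atlas M. F u \<in> fst c" if "u \<in> W" for u
    using smooth_map_in[OF F] wmfdD(2)[OF w] that by simp
  show "oset D W" by (rule oW)
  show "symform (span D) (pbf M g D W F u)" if "u \<in> W" for u
    using ex[OF that] pullback.pb_symform[OF pbf_pullback[OF oW M g F]] that by blast
  show "smooth_on D W (\<lambda>u. pbf M g D W F u v v')" if v: "v \<in> span D" "v' \<in> span D" for v v'
  proof (rule smooth_on_local[OF oW])
    fix u assume u: "u \<in> W"
    then obtain c where c: "c \<in> atlas M" "F u \<in> fst c" using ex by blast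
    interpret pullback "coords M" "cimg c" "comp2 M g c" D "W \<inter> F -` fst c" "snd c \<circ> F" "pbf M g D W F"
      by (rule pbf_pullback[OF oW M g F c(1)])
    have "(W \<inter> F -` fst c) \<inter> W = W \<inter> F -` fst c" by auto
    then show "\<exists>V. oset D V \<and> u \<in> V \<and> smooth_on D (V \<inter> W) (\<lambda>u. pbf M g D W F u v v')"
      using o' pb_smooth[OF v] u c by (intro exI[of _ "W \<inter> F -` fst c"]) auto
  qed
qed

text \<open>Composing \<open>F\<close> with the unspecified chart \<open>chart_at M (F u)\<close>
  gives a change of coordinates to which \<open>pb_scal\<close> applies. Scalar curvature can from
  now on be computed in any parametrization with surjective differential.\<close>

lemma pbf_scal:
  assumes oW: "oset D W" and g: "riemannian M g" and F: "smooth_map (euc D W) M F" and u: "u \<in> W"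
    and surj: "tangent M (F u) \<subseteq> (\<lambda>v. push M F u (pvec D W u v)) ` span D"
    and E: "frame (span D) (pbf M g D W F u) E"
  shows "scalar_curvature M g (F u) = scal (pbf M g D W F) E u"
proof -
  have M: "smooth_manifold M" and s: "smooth_sym2 M g" using g by (auto simp: riemannian_def)
  have w: "wmfd M" by (rule smooth_manifold_wmfd[OF M])
  have p: "F u \<in> pts M" using smooth_map_in[OF F] u by simp
  define c where "c = chart_at M (F u)"
  note c = chart_at_props[OF w p, folded c_def]
  interpret pullback "coords M" "cimg c" "comp2 M g c" D "W \<inter> F -` fst c" "snd c \<circ> F" "pbf M g D W F"
    by (rule pbf_pullback[OF oW M s F c(1)])
  have u': "u \<in> W \<inter> F -` fst c" using u c by auto
  have sj: "span (coords M) \<subseteq> (\<lambda>v. dd (snd c \<circ> F) v u) ` span D"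
  proof
    fix v assume v: "v \<in> span (coords M)"
    obtain v' where v': "v' \<in> span D" "coord_vec M c (F u) v = push M F u (pvec D W u v')"
      using surj coord_vec_in_tangent[OF c v] by blast
    have "coord_vec M c (F u) v = coord_vec M c (F u) (dd (snd c \<circ> F) v' u)"
      unfolding v'(2) by (rule push_pvec[OF oW w F u c v'(1)])
    then have "v = dd (snd c \<circ> F) v' u"
      using coord_vec_eq_iff[OF M c v T_in[OF u' v'(1)]] by simp
    then show "v \<in> (\<lambda>v. dd (snd c \<circ> F) v u) ` span D" using v'(1) by blast
  qed
  have "frame (span (coords M)) (comp2 M g c (snd c (F u))) ((\<lambda>v. dd (snd c \<circ> F) v u) ` E)"
    using frame_pushforward(2)[OF u' E sj] by simp
  from scalar_curvature_scal[OF g p this[unfolded c_def]] show ?thesis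
    using pb_scal[OF u' E sj] by (simp add: c_def)
qed

section \<open>Derivations, open submanifolds and slices of products\<close>

lemma tangent_cong:
  assumes w: "wmfd M" and \<xi>: "\<xi> \<in> tangent M p" and eq: "\<And>q. q \<in> pts M \<Longrightarrow> f q = f' q"
  shows "\<xi> f = \<xi> f'"
proof -
  obtain c v where c: "c \<in> atlas M" "p \<in> fst c" "v \<in> span (coords M)" "\<xi> = coord_vec M c p v"
    using \<xi> by (auto simp: tangent_def)
  have e: "(f \<circ> cinv c) u = (f' \<circ> cinv c) u" if "u \<in> cimg c" "c \<in> atlas M" for c u
    using eq wmfdD(6)[OF w that(2)] cinv_in[OF that(1)] by auto
  have *: "smooth_near M p g \<Longrightarrow> smooth_near M p g'" if "\<And>q. q \<in> pts M \<Longrightarrow> g q = g' q" for g g'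
    unfolding smooth_near_def
  proof (elim exE conjE, intro exI conjI ballI)
    fix W c assume W: "openin (topo M) W" "\<forall>c\<in>atlas M. smooth_on (coords M) (snd c ` (fst c \<inter> W)) (g \<circ> cinv c)" and c: "c \<in> atlas M"
    show "smooth_on (coords M) (snd c ` (fst c \<inter> W)) (g' \<circ> cinv c)"
      by (rule smooth_on_cong[OF wmfdD(5)[OF w c W(1)] W(2)[rule_format, OF c]])
        (use that wmfdD(6)[OF w c] cinv_chart[OF w c] in auto)
  qed
  have "dd (f \<circ> cinv c) v (snd c p) = dd (f' \<circ> cinv c) v (snd c p)"
    by (rule dd_cong[OF wmfd_cimg[OF w c(1)] _ c(3)]) (use c e in auto)
  then show ?thesis unfolding c(4) coord_vec_def using *[of f f'] *[of f' f] eq by auto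
qed

lemma push_in_tangent:
  assumes M: "smooth_manifold M" and N: "wmfd N" and f: "smooth_map M N f" and p: "p \<in> pts M" and \<xi>: "\<xi> \<in> tangent M p"
  shows "push N f p \<xi> \<in> tangent N (f p)"
proof -
  have w: "wmfd M" by (rule smooth_manifold_wmfd[OF M])
  obtain c where c: "c \<in> atlas M" "p \<in> fst c" using wmfdD(2)[OF w p] by blast
  obtain v where v: "v \<in> span (coords M)" "\<xi> = coord_vec M c p v"
    using \<xi> unfolding tangent_chart[OF M c] by blast
  have u: "snd c p \<in> cimg c" using c by auto
  note sm = smooth_map_cinv_cimg[OF M c(1)]
  have "\<xi> = push M (cinv c) (snd c p) (pvec (coords M) (cimg c) (snd c p) v)"
    using coord_vec_push[OF M c(1) u v(1)] cinv_chart[OF w c] v(2) by simp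
  then have "push N f p \<xi> = push N (f \<circ> cinv c) (snd c p) (pvec (coords M) (cimg c) (snd c p) v)"
    using push_compose[OF w N f, of "cinv c" "snd c p"] cinv_chart[OF w c] p by simp
  then show ?thesis
    using push_pvec_in_tangent[OF wmfd_cimg[OF w c(1)] N smooth_map_compose[OF wmfd_euc[OF wmfd_cimg[OF w c(1)]] w N sm f] u v(1)]
      cinv_chart[OF w c] by simp
qed

lemma push_ident:
  assumes w: "wmfd M" and \<xi>: "\<xi> \<in> tangent M p" and eq: "\<And>q. q \<in> pts M \<Longrightarrow> f q = q" and p: "p \<in> pts M"
  shows "push M f p \<xi> = \<xi>"
proof
  fix \<psi>
  obtain c v where c: "\<xi> = coord_vec M c p v" using \<xi> by (auto simp: tangent_def)
  have "\<xi> (\<psi> \<circ> f) = \<xi> \<psi>" by (rule tangent_cong[OF w \<xi>]) (simp add: eq)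
  then show "push M f p \<xi> \<psi> = \<xi> \<psi>" unfolding push_def eq[OF p] by (auto simp: c coord_vec_def)
qed

lemma open_sub_simps:
  "topo (open_sub M W) = subtopology (topo M) W" "coords (open_sub M W) = coords M"
  "atlas (open_sub M W) = (\<lambda>c. (fst c \<inter> W, snd c)) ` atlas M"
  by (simp_all add: open_sub_def)

lemma wmfd_open_sub:
  assumes M: "wmfd M" and W: "openin (topo M) W"
  shows "wmfd (open_sub M W)"
  unfolding wmfd_def open_sub_simps
proof (intro conjI ballI allI impI)
  show "coords M \<subseteq> Basis" by (rule wmfdD(1)[OF M])
  have "pts M = (\<Union>c\<in>atlas M. fst c)" using M by (simp add: wmfd_def)
  then show "topspace (subtopology (topo M) W) = (\<Union>c\<in>(\<lambda>c. (fst c \<inter> W, snd c)) ` atlas M. fst c)"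
    by (auto simp: topspace_subtopology)
  fix c assume "c \<in> (\<lambda>c. (fst c \<inter> W, snd c)) ` atlas M"
  then obtain c' where c': "c' \<in> atlas M" "c = (fst c' \<inter> W, snd c')" by blast
  show "openin (subtopology (topo M) W) (fst c)"
    using wmfdD(3)[OF M c'(1)] by (auto simp: c'(2) openin_subtopology)
  show "inj_on (snd c) (fst c)" using wmfdD(4)[OF M c'(1)] by (auto simp: c'(2) inj_on_def)
  fix U assume "openin (subtopology (topo M) W) U"
  then have "openin (topo M) U" using openin_trans_full W by blast
  moreover have "fst c' \<inter> W \<inter> U = fst c' \<inter> (W \<inter> U)" by blast
  ultimately show "oset (coords M) (snd c ` (fst c \<inter> U))"
    using wmfdD(5)[OF M c'(1) openin_Int[OF W]] by (simp add: c'(2))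
qed

lemma smooth_near_open_sub:
  assumes M: "wmfd M" and W: "openin (topo M) W" and f: "smooth_near (open_sub M W) p f"
  shows "smooth_near M p f"
proof -
  obtain U where U: "openin (subtopology (topo M) W) U" "p \<in> U"
      "\<And>c. c \<in> atlas M \<Longrightarrow> smooth_on (coords M) (snd c ` (fst c \<inter> W \<inter> U)) (f \<circ> inv_into (fst c \<inter> W) (snd c))"
    using f unfolding smooth_near_def open_sub_simps by auto
  have oU: "openin (topo M) U" using openin_trans_full U W by blast
  have UW: "U \<subseteq> W" using U(1) openin_subset by fastforce
  have "smooth_on (coords M) (snd c ` (fst c \<inter> U)) (f \<circ> cinv c)" if c: "c \<in> atlas M" for c
  proof (rule smooth_on_cong[OF wmfdD(5)[OF M c oU]])
    have "fst c \<inter> W \<inter> U = fst c \<inter> U" using UW by auto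
    then show "smooth_on (coords M) (snd c ` (fst c \<inter> U)) (f \<circ> inv_into (fst c \<inter> W) (snd c))" using U(3)[OF c] by simp
    fix u assume "u \<in> snd c ` (fst c \<inter> U)"
    then obtain q where q: "q \<in> fst c" "q \<in> U" "u = snd c q" by auto
    have "inj_on (snd c) (fst c \<inter> W)" using wmfdD(4)[OF M c] by (rule inj_on_subset) auto
    then show "(f \<circ> inv_into (fst c \<inter> W) (snd c)) u = (f \<circ> cinv c) u"
      using q UW cinv_chart[OF M c] by (auto simp: inv_into_f_f)
  qed
  then show ?thesis using oU U(2) unfolding smooth_near_def by blast
qed

lemma smooth_map_open_sub_target:
  assumes "smooth_map X (open_sub M W) f" "f ` pts X \<subseteq> W" "wmfd X"
  shows "smooth_map X M f"
  unfolding smooth_map_def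
proof (intro conjI ballI)
  show "continuous_map (topo X) (topo M) f"
    using assms(1) by (simp add: smooth_map_def open_sub_simps continuous_map_in_subtopology)
  fix c c' assume c: "c \<in> atlas X" "c' \<in> atlas M"
  have "(fst c' \<inter> W, snd c') \<in> atlas (open_sub M W)" using c by (auto simp: open_sub_simps)
  then have "smooth_on (coords X) (snd c ` (fst c \<inter> f -` (fst c' \<inter> W))) (snd c' \<circ> f \<circ> cinv c)"
    using assms(1) c unfolding smooth_map_def by fastforce
  moreover have "fst c \<inter> f -` (fst c' \<inter> W) = fst c \<inter> f -` fst c'" using assms(2) wmfdD(6)[OF assms(3) c(1)] by auto
  ultimately show "smooth_on (coords X) (snd c ` (fst c \<inter> f -` fst c')) (snd c' \<circ> f \<circ> cinv c)" by simp
qed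

lemma smooth_map_into_open_sub:
  assumes "smooth_map X M f" "f ` pts X \<subseteq> W" "wmfd X"
  shows "smooth_map X (open_sub M W) f"
  unfolding smooth_map_def
proof (intro conjI ballI)
  show "continuous_map (topo X) (topo (open_sub M W)) f"
    using assms(1,2) by (auto simp: smooth_map_def open_sub_simps continuous_map_in_subtopology)
  fix c c' assume c: "c \<in> atlas X" "c' \<in> atlas (open_sub M W)"
  then obtain c'' where c'': "c'' \<in> atlas M" "c' = (fst c'' \<inter> W, snd c'')" by (auto simp: open_sub_simps)
  have "fst c \<inter> f -` (fst c'' \<inter> W) = fst c \<inter> f -` fst c''" using assms(2) wmfdD(6)[OF assms(3) c(1)] by auto
  then show "smooth_on (coords X) (snd c ` (fst c \<inter> f -` fst c')) (snd c' \<circ> f \<circ> cinv c)"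
    using assms(1) c(1) c'' by (simp add: smooth_map_def)
qed

lemma smooth_map_Pair_const:
  assumes y: "y \<in> pts N" and P: "smooth_manifold P"
  shows "smooth_map P (prod_mfd N P) (\<lambda>p. (y, p))"
  unfolding smooth_map_def
proof (intro conjI ballI)
  have w: "wmfd P" by (rule smooth_manifold_wmfd[OF P])
  show "continuous_map (topo P) (topo (prod_mfd N P)) (\<lambda>p. (y, p))"
    using y by (auto simp: prod_mfd_simps continuous_map_paired)
  fix c c' assume c: "c \<in> atlas P" and "c' \<in> atlas (prod_mfd N P)"
  then obtain a b where b: "b \<in> atlas P" "c' = (fst a \<times> fst b, \<lambda>(p, q). (snd a p, snd b q))"
    by (auto simp: prod_mfd_def)
  have e: "fst c \<inter> (\<lambda>p. (y, p)) -` fst c' \<subseteq> fst c \<inter> fst b" using b by auto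
  note o = wmfdD(5)[OF w c wmfdD(3)[OF w b(1)]]
  have "smooth_on (coords P) (snd c ` (fst c \<inter> fst b)) (\<lambda>u. (snd a y, (snd b \<circ> cinv c) u))"
    by (rule smooth_on_Pair[OF o smooth_on_const[OF o] smooth_manifold_compat[OF P c b(1)]])
  then have "smooth_on (coords P) (snd c ` (fst c \<inter> (\<lambda>p. (y, p)) -` fst c')) (\<lambda>u. (snd a y, (snd b \<circ> cinv c) u))"
    by (rule smooth_on_subset) (use e in blast)
  then show "smooth_on (coords P) (snd c ` (fst c \<inter> (\<lambda>p. (y, p)) -` fst c')) (snd c' \<circ> (\<lambda>p. (y, p)) \<circ> cinv c)"
    by (simp add: b(2) o_def)
qed

lemma smooth_map_const_Pair:
  assumes "open I" "x \<in> I" "smooth_manifold P"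
  shows "smooth_map P (prod_mfd (interval_mfd I) P) (\<lambda>p. (x, p))"
  by (rule smooth_map_Pair_const) (use assms in \<open>simp_all add: interval_mfd_euc\<close>)

lemma scal_cong:
  assumes o: "oset D W" and u: "u \<in> W" and E: "E \<subseteq> span D"
    and eq: "\<And>u v w. u \<in> W \<Longrightarrow> v \<in> span D \<Longrightarrow> w \<in> span D \<Longrightarrow> \<beta> u v w = \<beta>' u v w"
  shows "scal \<beta> E u = scal \<beta>' E u"
proof -
  have 1: "d1 \<beta> x v w u = d1 \<beta>' x v w u" if "u \<in> W" "x \<in> span D" "v \<in> span D" "w \<in> span D" for x v w u
    unfolding d1_def by (rule dd_cong[OF o that(1,2) eq[OF _ that(3,4)]])
  have 2: "d2 \<beta> x y v w u = d2 \<beta>' x y v w u" if "x \<in> span D" "y \<in> span D" "v \<in> span D" "w \<in> span D" for x y v w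
    unfolding d2_def by (rule dd_cong[OF o u that(1) 1[OF _ that(2-4)]])
  have 3: "chr1 \<beta> v w y u = chr1 \<beta>' v w y u" if "v \<in> span D" "w \<in> span D" "y \<in> span D" for v w y
    unfolding chr1_def using 1[OF u] that by simp
  have "sec \<beta> E u x y = sec \<beta>' E u x y" if "x \<in> E" "y \<in> E" for x y
  proof -
    have xy: "x \<in> span D" "y \<in> span D" using that E by auto
    have "(\<Sum>e\<in>E. ((chr1 \<beta> x y e u)\<^sup>2 - chr1 \<beta> x x e u * chr1 \<beta> y y e u) / \<beta> u e e)
      = (\<Sum>e\<in>E. ((chr1 \<beta>' x y e u)\<^sup>2 - chr1 \<beta>' x x e u * chr1 \<beta>' y y e u) / \<beta>' u e e)"
      by (rule sum.cong) (use 3 xy E eq[OF u] in auto)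
    then show ?thesis unfolding sec_def using 2 xy by simp
  qed
  moreover have "\<beta> u x x = \<beta>' u x x" if "x \<in> E" for x using eq[OF u] that E by blast
  ultimately show ?thesis unfolding scal_def by simp
qed

text \<open>For an isometry the parametrization \<open>f \<circ> cinv c\<close> around
  \<open>f p\<close> pulls \<open>g\<close> back to the components of \<open>g\<close> in
  \<open>c\<close> itself, so both scalar curvatures are \<open>scal\<close> of the same functions
  with the same frame. The inverse map \<open>f'\<close> supplies surjectivity of the
  differential.\<close>

theorem scalar_curvature_isometry:
  assumes g: "riemannian M g" and f: "smooth_map M M f" and f': "smooth_map M M f'"
    and inv: "\<And>q. q \<in> pts M \<Longrightarrow> f (f' q) = q" and inv': "\<And>q. q \<in> pts M \<Longrightarrow> f' (f q) = q" and p: "p \<in> pts M"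
    and iso: "\<And>q \<xi> \<eta>. q \<in> pts M \<Longrightarrow> \<xi> \<in> tangent M q \<Longrightarrow> \<eta> \<in> tangent M q \<Longrightarrow>
       g (f q) (push M f q \<xi>) (push M f q \<eta>) = g q \<xi> \<eta>"
  shows "scalar_curvature M g (f p) = scalar_curvature M g p"
proof -
  have M: "smooth_manifold M" using g by (simp add: riemannian_def)
  have w: "wmfd M" by (rule smooth_manifold_wmfd[OF M])
  define c where "c = chart_at M p"
  note c = chart_at_props[OF w p, folded c_def]
  let ?W = "cimg c" and ?D = "coords M" and ?u = "snd c p"
  note o = wmfd_cimg[OF w c(1)] and sm = smooth_map_cinv_cimg[OF M c(1)]
  have u: "?u \<in> ?W" using c by auto
  have cu: "cinv c ?u = p" by (rule cinv_chart[OF w c])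
  have F: "smooth_map (euc ?D ?W) M (f \<circ> cinv c)" by (rule smooth_map_compose[OF wmfd_euc[OF o] w w sm f])
  have pc: "cinv c u \<in> pts M" if "u \<in> ?W" for u using cinv_in[OF that] wmfdD(6)[OF w c(1)] by blast
  have pF: "push M (f \<circ> cinv c) u (pvec ?D ?W u v) = push M f (cinv c u) (push M (cinv c) u (pvec ?D ?W u v))"
    if "u \<in> ?W" for u v by (rule push_compose[OF w w f, of "cinv c" u, OF pc[OF that]])
  have eq: "pbf M g ?D ?W (f \<circ> cinv c) u v v' = comp2 M g c u v v'"
    if "u \<in> ?W" "v \<in> span ?D" "v' \<in> span ?D" for u v v'
    unfolding pbf_def pF[OF that(1)] comp2_def Let_def o_apply coord_vec_push[OF M c(1) that(1,2)] coord_vec_push[OF M c(1) that(1,3)]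
    by (rule iso[OF pc[OF that(1)]]) (intro push_pvec_in_tangent[OF o w sm that(1)] that)+
  interpret lm: lmetric ?D ?W "comp2 M g c" by (rule riemannian_lmetric[OF g c(1)])
  obtain E where E: "frame (span ?D) (comp2 M g c ?u) E" using orthonormal_frame_exists[OF lm.pf[OF u]] by blast
  have ED: "E \<subseteq> span ?D" using E by (simp add: frame_def)
  have E': "frame (span ?D) (pbf M g ?D ?W (f \<circ> cinv c) ?u) E"
    using E eq[OF u] ED unfolding frame_def by (auto simp: subset_iff)
  have "tangent M (f p) \<subseteq> (\<lambda>v. push M (f \<circ> cinv c) ?u (pvec ?D ?W ?u v)) ` span ?D"
  proof
    fix \<xi> assume \<xi>: "\<xi> \<in> tangent M (f p)"
    have fp: "f p \<in> pts M" by (rule smooth_map_in[OF f p])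
    have "push M f' (f p) \<xi> \<in> tangent M p" using push_in_tangent[OF M w f' fp \<xi>] inv'[OF p] by simp
    then obtain v where v: "v \<in> span ?D" "push M f' (f p) \<xi> = coord_vec M c p v"
      unfolding tangent_chart[OF M c] by blast
    have "push M (f \<circ> cinv c) ?u (pvec ?D ?W ?u v) = push M f p (coord_vec M c p v)"
      unfolding pF[OF u] cu using coord_vec_push[OF M c(1) u v(1)] cu by simp
    also have "\<dots> = push M (f \<circ> f') (f p) \<xi>"
      unfolding v(2)[symmetric] using push_compose[OF w w f, of f' "f p" \<xi>] inv'[OF p] p by simp
    also have "\<dots> = \<xi>" by (rule push_ident[OF w \<xi> _ fp]) (simp add: inv)
    finally show "\<xi> \<in> (\<lambda>v. push M (f \<circ> cinv c) ?u (pvec ?D ?W ?u v)) ` span ?D" using v(1) by force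
  qed
  then have "scalar_curvature M g (f p) = scal (pbf M g ?D ?W (f \<circ> cinv c)) E ?u"
    using pbf_scal[OF o g F u _ E'] cu by simp
  also have "\<dots> = scal (comp2 M g c) E ?u" by (rule scal_cong[OF o u ED eq])
  also have "\<dots> = scalar_curvature M g p" using scalar_curvature_scal[OF g p E[unfolded c_def]] by (simp add: c_def)
  finally show ?thesis .
qed

section \<open>Closed two-forms under pullback, and the components of the Kaehler form\<close>

lemma slin_neg: "slin V f \<Longrightarrow> slin V (\<lambda>v. - f v)"
  by (simp add: slin_def algebra_simps)

text \<open>Exterior differentiation commutes with pullback: in the cyclic sum the terms with second
  derivatives of \<phi> cancel in pairs, since that derivative is symmetric and the form is
  antisymmetric.\<close>

lemma closed2_pullback:
  assumes oW: "oset D W" and M: "smooth_manifold M" and F: "smooth_map (euc D W) M F" and cl: "closed2 M \<omega>"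
    and lin: "\<And>c u w. c \<in> atlas M \<Longrightarrow> u \<in> cimg c \<Longrightarrow> w \<in> span (coords M) \<Longrightarrow> slin (span (coords M)) (\<lambda>v. comp2 M \<omega> c u v w)"
    and anti: "\<And>c u v w. c \<in> atlas M \<Longrightarrow> u \<in> cimg c \<Longrightarrow> v \<in> span (coords M) \<Longrightarrow> w \<in> span (coords M) \<Longrightarrow>
       comp2 M \<omega> c u v w = - comp2 M \<omega> c u w v"
    and sm: "\<And>c v w. c \<in> atlas M \<Longrightarrow> v \<in> span (coords M) \<Longrightarrow> w \<in> span (coords M) \<Longrightarrow>
       smooth_on (coords M) (cimg c) (\<lambda>u. comp2 M \<omega> c u v w)"
    and u: "u \<in> W" and x: "x \<in> span D" and y: "y \<in> span D" and z: "z \<in> span D"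
  shows "dd (\<lambda>u. pbf M \<omega> D W F u y z) x u + dd (\<lambda>u. pbf M \<omega> D W F u z x) y u + dd (\<lambda>u. pbf M \<omega> D W F u x y) z u = 0"
proof -
  have w: "wmfd M" by (rule smooth_manifold_wmfd[OF M])
  obtain c where c: "c \<in> atlas M" "F u \<in> fst c" using smooth_map_in[OF F] wmfdD(2)[OF w] u by fastforce
  define \<phi> where "\<phi> = snd c \<circ> F"
  let ?V = "W \<inter> F -` fst c" and ?D = "coords M"
  note oV = smooth_map_euc_dom[OF oW w F wmfdD(3)[OF w c(1)]]
  note oC = wmfd_cimg[OF w c(1)]
  have \<phi>: "smooth_on D ?V \<phi>" unfolding \<phi>_def by (rule smooth_map_euc_chart[OF oW w F c(1)])
  have im: "\<phi> ` ?V \<subseteq> cimg c" by (auto simp: \<phi>_def)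
  have uV: "u \<in> ?V" using u c by auto
  have Tin: "dd \<phi> v u \<in> span ?D" if "u \<in> ?V" "v \<in> span D" for u v
    by (rule dd_smooth_in_span[OF oC oV \<phi> im that])
  have Tsm: "smooth_on D ?V (dd \<phi> v)" if "v \<in> span D" for v by (rule smooth_on_dd[OF oV \<phi> that])
  have lin2: "slin (span ?D) (comp2 M \<omega> c q v)" if "q \<in> cimg c" "v \<in> span ?D" for q v
    using slin_neg[OF lin[OF c(1) that]] anti[OF c(1) that(1,2)] unfolding slin_def by (simp add: span_add span_scale)
  have pb: "pbf M \<omega> D W F u v v' = comp2 M \<omega> c (\<phi> u) (dd \<phi> v u) (dd \<phi> v' u)"
    if "u \<in> ?V" "v \<in> span D" "v' \<in> span D" for u v v'
    using that push_pvec[OF oW w F _ c(1)] cinv_chart[OF w c(1)] by (simp add: pbf_def comp2_def Let_def \<phi>_def)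
  have T2: "dd (dd \<phi> v) a u = dd (dd \<phi> a) v u" if "a \<in> span D" "v \<in> span D" for a v
    by (rule dd_commute[OF oV \<phi> uV that(2,1)])
  have T2in: "dd (dd \<phi> v) a u \<in> span ?D" if "a \<in> span D" "v \<in> span D" for a v
    by (rule dd_in_span[OF oV smooth_on_ck[OF Tsm[OF that(2)]] uV that(1) wmfdD(1)[OF w] Tin[OF _ that(2)]])
  have \<phi>u: "\<phi> u \<in> cimg c" using im uV by blast
  let ?\<omega> = "comp2 M \<omega> c (\<phi> u)"
  have d: "dd (\<lambda>u. pbf M \<omega> D W F u b e) a u = dd (\<lambda>q. comp2 M \<omega> c q (dd \<phi> b u) (dd \<phi> e u)) (dd \<phi> a u) (\<phi> u)
      + ?\<omega> (dd (dd \<phi> b) a u) (dd \<phi> e u) + ?\<omega> (dd \<phi> b u) (dd (dd \<phi> e) a u)"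
    if a: "a \<in> span D" and b: "b \<in> span D" and e: "e \<in> span D" for a b e
  proof -
    have "dd (\<lambda>u. pbf M \<omega> D W F u b e) a u = dd (\<lambda>u. comp2 M \<omega> c (\<phi> u) (dd \<phi> b u) (dd \<phi> e u)) a u"
      by (rule dd_cong[OF oV uV a]) (rule pb[OF _ b e])
    also have "\<dots> = dd (\<lambda>u'. comp2 M \<omega> c (\<phi> u') (dd \<phi> b u) (dd \<phi> e u)) a u
      + ?\<omega> (dd (dd \<phi> b) a u) (dd \<phi> e u) + ?\<omega> (dd \<phi> b u) (dd (dd \<phi> e) a u)"
    proof (rule dd_slot2(2)[OF oV wmfdD(1)[OF w] _ _ _ Tsm[OF b] Tin[OF _ b] Tsm[OF e] Tin[OF _ e] uV a,
        where H = "\<lambda>u. comp2 M \<omega> c (\<phi> u)"])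
      show "smooth_on D ?V (\<lambda>u. comp2 M \<omega> c (\<phi> u) p q)" if "p \<in> span ?D" "q \<in> span ?D" for p q
        by (rule smooth_on_compose[OF oC oV sm[OF c(1) that] \<phi> im])
      fix q assume "q \<in> ?V"
      then have q: "\<phi> q \<in> cimg c" using im by blast
      show "slin (span ?D) (\<lambda>a. comp2 M \<omega> c (\<phi> q) a b)" if "b \<in> span ?D" for b by (rule lin[OF c(1) q that])
      show "slin (span ?D) (comp2 M \<omega> c (\<phi> q) b)" if "b \<in> span ?D" for b by (rule lin2[OF q that])
    qed
    also have "dd (\<lambda>u'. comp2 M \<omega> c (\<phi> u') (dd \<phi> b u) (dd \<phi> e u)) a u
       = dd (\<lambda>q. comp2 M \<omega> c q (dd \<phi> b u) (dd \<phi> e u)) (dd \<phi> a u) (\<phi> u)"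
      by (rule dd_compose[OF oC oV sm[OF c(1) Tin[OF uV b] Tin[OF uV e]] \<phi> im uV a])
    finally show ?thesis .
  qed
  note A = anti[OF c(1) \<phi>u]
  have "dd (\<lambda>q. comp2 M \<omega> c q (dd \<phi> y u) (dd \<phi> z u)) (dd \<phi> x u) (\<phi> u)
      + dd (\<lambda>q. comp2 M \<omega> c q (dd \<phi> z u) (dd \<phi> x u)) (dd \<phi> y u) (\<phi> u)
      + dd (\<lambda>q. comp2 M \<omega> c q (dd \<phi> x u) (dd \<phi> y u)) (dd \<phi> z u) (\<phi> u) = 0"
    by (rule cl[unfolded closed2_def, rule_format, OF c(1) \<phi>u Tin[OF uV x] Tin[OF uV y] Tin[OF uV z]])
  then show ?thesis
    unfolding d[OF x y z] d[OF y z x] d[OF z x y]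
    using A[OF T2in[OF x y] Tin[OF uV z]] A[OF T2in[OF x z] Tin[OF uV y]] A[OF T2in[OF y z] Tin[OF uV x]]
    by (simp add: T2[OF y x] T2[OF z x] T2[OF z y])
qed

text \<open>Antisymmetry is \<open>g(Jv, w) = g(JJv, Jw) = -g(v, Jw)\<close>. These properties are
  the ones that \<open>closed2_pullback\<close> requires of a form.\<close>

lemma kaehler_form_components:
  assumes K: "kaehler M g J" and c: "c \<in> atlas M"
  shows "u \<in> cimg c \<Longrightarrow> w \<in> span (coords M) \<Longrightarrow> slin (span (coords M)) (\<lambda>v. comp2 M (kaehler_form g J) c u v w)"
    and "u \<in> cimg c \<Longrightarrow> v \<in> span (coords M) \<Longrightarrow> w \<in> span (coords M) \<Longrightarrow>
       comp2 M (kaehler_form g J) c u v w = - comp2 M (kaehler_form g J) c u w v"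
    and "v \<in> span (coords M) \<Longrightarrow> w \<in> span (coords M) \<Longrightarrow>
       smooth_on (coords M) (cimg c) (\<lambda>u. comp2 M (kaehler_form g J) c u v w)"
proof -
  have R: "riemannian M g" and C: "complex_structure M J"
    and herm: "\<And>p \<xi> \<eta>. p \<in> pts M \<Longrightarrow> \<xi> \<in> tangent M p \<Longrightarrow> \<eta> \<in> tangent M p \<Longrightarrow> g p (J p \<xi>) (J p \<eta>) = g p \<xi> \<eta>"
    using K by (auto simp: kaehler_def)
  have M: "smooth_manifold M" and s: "smooth_sym2 M g" and E: "smooth_endo M J"
    using R C by (auto simp: riemannian_def complex_structure_def)
  have w: "wmfd M" by (rule smooth_manifold_wmfd[OF M])
  note o = wmfd_cimg[OF w c] and D = wmfdD(1)[OF w]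
  let ?D = "coords M" and ?\<omega> = "kaehler_form g J"
  have p: "cinv c u \<in> fst c" "cinv c u \<in> pts M" if "u \<in> cimg c" for u
    using cinv_in[OF that] wmfdD(6)[OF w c] by auto
  have Jt: "J p \<xi> \<in> tangent M p" "J p (tlin a \<xi> b \<eta>) = tlin a (J p \<xi>) b (J p \<eta>)" "J p (J p \<xi>) = tlin (-1) \<xi> 0 \<xi>"
    if "p \<in> pts M" "\<xi> \<in> tangent M p" "\<eta> \<in> tangent M p" for p \<xi> \<eta> a b
    using E C that unfolding smooth_endo_def complex_structure_def by blast+
  have gs: "g p \<xi> \<eta> = g p \<eta> \<xi>" "linear_on_tangent (tangent M p) (g p \<xi>)"
    if "p \<in> pts M" "\<xi> \<in> tangent M p" "\<eta> \<in> tangent M p" for p \<xi> \<eta>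
    using s that unfolding smooth_sym2_def by blast+
  have cm: "comp2 M ?\<omega> c u v w = comp2 M g c u (compJ M J c u v) w" "compJ M J c u v \<in> span ?D"
    if "u \<in> cimg c" "v \<in> span ?D" for u v w
    using coord_vec_tcomp[OF M c p(1)[OF that(1)] Jt(1)[OF p(2)[OF that(1)] coord_vec_in_tangent[OF c p(1)[OF that(1)] that(2)]]]
      coord_vec_in_tangent[OF c p(1)[OF that(1)] that(2)]
    by (auto simp: comp2_def kaehler_form_def compJ_def Let_def)
  show l: "slin (span ?D) (\<lambda>v. comp2 M ?\<omega> c u v w)" if u: "u \<in> cimg c" and w': "w \<in> span ?D" for u w
    unfolding slin_def comp2_def Let_def kaehler_form_def
  proof (intro ballI allI)
    fix v v' a b assume v: "v \<in> span ?D" "v' \<in> span ?D"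
    let ?p = "cinv c u"
    note t = coord_vec_in_tangent[OF c p(1)[OF u] v(1)] coord_vec_in_tangent[OF c p(1)[OF u] v(2)]
      coord_vec_in_tangent[OF c p(1)[OF u] w']
    note pu = p(2)[OF u]
    have tJ: "tlin a (J ?p (coord_vec M c ?p v)) b (J ?p (coord_vec M c ?p v')) \<in> tangent M ?p"
      using Jt(1)[OF pu, of "coord_vec M c ?p (a *\<^sub>R v + b *\<^sub>R v')"] coord_vec_in_tangent[OF c p(1)[OF u], of "a *\<^sub>R v + b *\<^sub>R v'"]
        v Jt(2)[OF pu t(1,2)] coord_vec_linear[OF w c p(1)[OF u] v, of a b] by (simp add: span_add span_scale)
    show "g ?p (J ?p (coord_vec M c ?p (a *\<^sub>R v + b *\<^sub>R v'))) (coord_vec M c ?p w) =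
        a * g ?p (J ?p (coord_vec M c ?p v)) (coord_vec M c ?p w) + b * g ?p (J ?p (coord_vec M c ?p v')) (coord_vec M c ?p w)"
      unfolding coord_vec_linear[OF w c p(1)[OF u] v] Jt(2)[OF pu t(1,2)]
      using linear_on_tangentD[OF gs(2)[OF pu t(3) t(3)] Jt(1)[OF pu t(1) t(1)] Jt(1)[OF pu t(2) t(2)], of a b]
        gs(1)[OF pu tJ t(3)] gs(1)[OF pu Jt(1)[OF pu t(1) t(1)] t(3)] gs(1)[OF pu Jt(1)[OF pu t(2) t(2)] t(3)] by simp
  qed
  show anti: "comp2 M ?\<omega> c u v w = - comp2 M ?\<omega> c u w v" if u: "u \<in> cimg c" and v: "v \<in> span ?D" "w \<in> span ?D" for u v w
  proof -
    let ?p = "cinv c u" and ?v = "coord_vec M c (cinv c u) v" and ?w = "coord_vec M c (cinv c u) w"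
    note pu = p(2)[OF u]
    note t = coord_vec_in_tangent[OF c p(1)[OF u] v(1)] coord_vec_in_tangent[OF c p(1)[OF u] v(2)]
    note Jv = Jt(1)[OF pu t(1) t(1)] and Jw = Jt(1)[OF pu t(2) t(2)]
    have "g ?p (J ?p ?v) ?w = g ?p (J ?p (J ?p ?v)) (J ?p ?w)" using herm[OF pu Jv t(2)] by simp
    also have "\<dots> = g ?p (J ?p ?w) (tlin (-1) ?v 0 ?v)"
      using gs(1)[OF pu Jt(1)[OF pu Jv Jv] Jw] Jt(3)[OF pu t(1) t(1)] by simp
    also have "\<dots> = - g ?p (J ?p ?w) ?v"
      using linear_on_tangentD[OF gs(2)[OF pu Jw Jw] t(1) t(1), of "-1" 0] by simp
    finally show ?thesis by (simp add: comp2_def Let_def kaehler_form_def)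
  qed
  interpret lf: lform ?D "cimg c" "comp2 M g c" by (rule sym2_lform[OF M s c])
  have 1: "smooth_on ?D (cimg c) (\<lambda>u. comp2 M ?\<omega> c u v w)" if v: "v \<in> ?D" and w: "w \<in> span ?D" for v w
  proof (rule smooth_on_cong[OF o])
    show "smooth_on ?D (cimg c) (\<lambda>u. comp2 M g c u (compJ M J c u v) w)"
    proof (rule dd_slot(1)[OF o D, where H = "\<lambda>u a. comp2 M g c u a w"])
      show "smooth_on ?D (cimg c) (\<lambda>u. compJ M J c u v)" using E c v by (simp add: smooth_endo_def)
      show "compJ M J c u v \<in> span ?D" if "u \<in> cimg c" for u by (rule cm(2)[OF that span_base[OF v]])
    qed (rule lf.lin1 lf.sm; use w in simp)+
  qed (use cm(1) span_base[OF v] in auto)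
  show "smooth_on ?D (cimg c) (\<lambda>u. comp2 M ?\<omega> c u v w)" if "v \<in> span ?D" "w \<in> span ?D"
    by (rule smooth_on_form_components[OF o D, where F = "\<lambda>v u. comp2 M ?\<omega> c u v w"]) (use l 1 that in auto)
qed

lemma smooth_map_affine:
  assumes "oset D W" "oset D' W'" "bounded_linear L" "\<And>u. u \<in> W \<Longrightarrow> f u = L u + c" "\<And>u. u \<in> W \<Longrightarrow> f u \<in> W'"
  shows "smooth_map (euc D W) (euc D' W') f"
  by (rule smooth_map_euc_euc[OF assms(1,2)], rule smooth_on_cong[OF assms(1)],
      rule smooth_on_add[OF assms(1) smooth_on_bounded_linear[OF assms(3,1) smooth_on_ident[OF assms(1)]] smooth_on_const[OF assms(1)]])
    (use assms(4,5) in auto)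

lemma push_affine:
  assumes "oset D W" "oset D' W'" "bounded_linear L" "\<And>u. u \<in> W \<Longrightarrow> f u = L u + c" "\<And>u. u \<in> W \<Longrightarrow> f u \<in> W'"
    "u \<in> W" "v \<in> span D"
  shows "push (euc D' W') f u (pvec D W u v) = pvec D' W' (f u) (L v)"
proof -
  have "((\<lambda>t. L (u + t *\<^sub>R v) + c) has_vector_derivative L v) (at 0)"
    by (rule has_vector_derivative_eq_rhs[OF has_vector_derivative_add[OF
          bounded_linear.has_vector_derivative[OF assms(3), of "\<lambda>t. u + t *\<^sub>R v" v] has_vector_derivative_const]])
      (auto intro!: derivative_eq_intros)
  then have "dd (\<lambda>u. L u + c) v u = L v" by (rule dd_eqI)
  then have "dd f v u = L v" using dd_cong[OF assms(1,6,7), of f "\<lambda>u. L u + c"] assms(4) by simp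
  then show ?thesis using push_euc[OF assms(1,2) smooth_map_affine[OF assms(1-5)] assms(6,7)] by simp
qed

lemma real_in_span: "x \<in> span (Basis :: real set)"
  by (simp only: span_Basis UNIV_I)

lemma push_const:
  fixes N :: "('b, 'f::euclidean_space) mfd"
  assumes o: "oset D W" and u: "u \<in> W" and v: "v \<in> span D"
  shows "push N (\<lambda>_. q) u (pvec D W u v) = tzero"
proof
  fix \<psi> :: "'b \<Rightarrow> real"
  have "dd (\<lambda>_. \<psi> q) v u = 0" by (rule dd_eqI) (rule has_vector_derivative_const)
  then show "push N (\<lambda>_. q) u (pvec D W u v) \<psi> = tzero \<psi>"
    using pvec_eq[OF o u v] by (simp add: push_def tzero_def o_def)
qed

section \<open>The moment coordinates\<close>

locale kaehler_cohom_one =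
  fixes M :: "('a, 'n::euclidean_space) mfd" and g :: "'a form2" and J :: "'a endo"
    and I :: "real set" and P :: "('p, 'r::euclidean_space) mfd"
    and B :: "('q, 'e::euclidean_space) mfd" and \<Phi> :: "real \<times> 'p \<Rightarrow> 'a" and \<pi> :: "'p \<Rightarrow> 'q"
    and R :: "real \<Rightarrow> 'p \<Rightarrow> 'p" and \<tau> :: real and \<theta> :: "'p form1" and JB :: "'q endo"
    and m :: nat and d :: "nat \<Rightarrow> nat" and a b :: "nat \<Rightarrow> real" and gs :: "nat \<Rightarrow> 'q form2"
    and h :: "real \<Rightarrow> real"
  assumes K: "kaehler M g J"
    and CF: "cohom_one_form M g J I P B \<Phi> \<pi> R \<tau> \<theta> JB m d a b gs h"
begin

abbreviation "IP \<equiv> prod_mfd (interval_mfd I) P"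
abbreviation "M0 \<equiv> \<Phi> ` (I \<times> pts P)"
abbreviation "\<Phi>' \<equiv> inv_into (pts IP) \<Phi>"

lemma riem: "riemannian M g" and Jcs: "complex_structure M J"
  and herm: "p \<in> pts M \<Longrightarrow> \<xi> \<in> tangent M p \<Longrightarrow> \<eta> \<in> tangent M p \<Longrightarrow> g p (J p \<xi>) (J p \<eta>) = g p \<xi> \<eta>"
  and closed: "closed2 M (kaehler_form g J)"
  using K by (auto simp: kaehler_def)

lemma M: "smooth_manifold M" and gsym2: "smooth_sym2 M g"
  using riem by (auto simp: riemannian_def)

lemma oI: "open I" and I: "is_interval I" "I \<noteq> {}"
  and P: "smooth_manifold P" and B: "smooth_manifold B"
  and gssym2: "i \<in> {1..m} \<Longrightarrow> smooth_sym2 B (gs i)"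
  and even: "i \<in> {1..m} \<Longrightarrow> even (d i)"
  and hpos: "x \<in> I \<Longrightarrow> h x > 0"
  and Apos: "x \<in> I \<Longrightarrow> i \<in> {1..m} \<Longrightarrow> A_coef a b i x > 0"
  and M0: "openin (topo M) M0"
  and df: "diffeo IP (open_sub M M0) \<Phi>"
  and Pne: "pts P \<noteq> {}"
  using CF unfolding cohom_one_form_def circle_bundle_def Let_def by auto

lemma Rsm: "smooth_map (prod_mfd (interval_mfd UNIV) P) P (\<lambda>(s, p). R s p)"
  and R0: "p \<in> pts P \<Longrightarrow> R 0 p = p" and Radd: "p \<in> pts P \<Longrightarrow> R (s + t) p = R s (R t p)"
  and \<pi>sm: "smooth_map P B \<pi>" and \<pi>onto: "\<pi> ` pts P = pts B"
  and \<pi>R: "p \<in> pts P \<Longrightarrow> q \<in> pts P \<Longrightarrow> \<pi> p = \<pi> q \<longleftrightarrow> (\<exists>s. q = R s p)"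
  and sections: "c \<in> pts B \<Longrightarrow> \<exists>W \<sigma>. openin (topo B) W \<and> c \<in> W \<and> smooth_map (open_sub B W) P \<sigma> \<and> (\<forall>u\<in>W. \<pi> (\<sigma> u) = u)"
  using CF unfolding cohom_one_form_def circle_bundle_def by blast+

lemma \<theta>sm: "smooth_form1 P \<theta>" and \<theta>f: "p \<in> pts P \<Longrightarrow> \<theta> p (fibre_vec P R p) = 1"
  and \<theta>R: "p \<in> pts P \<Longrightarrow> \<xi> \<in> tangent P p \<Longrightarrow> \<theta> (R s p) (push P (R s) p \<xi>) = \<theta> p \<xi>"
  using CF unfolding cohom_one_form_def connection_form_def by blast+

lemma \<theta>lin: "p \<in> pts P \<Longrightarrow> linear_on_tangent (tangent P p) (\<theta> p)"
  using \<theta>sm by (simp add: smooth_form1_def)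

lemma gform:
  assumes "x \<in> I" "p \<in> pts P" "\<zeta> \<in> tangent IP (x, p)" "\<eta> \<in> tangent IP (x, p)"
  shows "g (\<Phi> (x, p)) (push M \<Phi> (x, p) \<zeta>) (push M \<Phi> (x, p) \<eta>) = \<zeta> fst * \<eta> fst / h x
     + h x * (\<theta> p (push P snd (x, p) \<zeta>) * \<theta> p (push P snd (x, p) \<eta>))
     + base_metric m a b gs x (\<pi> p) (push B \<pi> p (push P snd (x, p) \<zeta>)) (push B \<pi> p (push P snd (x, p) \<eta>))"
  using CF assms unfolding cohom_one_form_def Let_def by blast

lemma Jx:
  assumes "x \<in> I" "p \<in> pts P"
  shows "J (\<Phi> (x, p)) (velocity M (\<lambda>s. \<Phi> (s, p)) x) = (\<lambda>f. velocity M (\<lambda>s. \<Phi> (x, R s p)) 0 f / h x)"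
  using CF assms unfolding cohom_one_form_def Let_def by blast

lemma Jhor:
  assumes "x \<in> I" "p \<in> pts P" "\<xi> \<in> tangent P p" "\<theta> p \<xi> = 0"
  obtains \<eta> where "\<eta> \<in> tangent P p" "\<theta> p \<eta> = 0" "push B \<pi> p \<eta> = JB (\<pi> p) (push B \<pi> p \<xi>)"
    "J (\<Phi> (x, p)) (push M (\<lambda>p. \<Phi> (x, p)) p \<xi>) = push M (\<lambda>p. \<Phi> (x, p)) p \<eta>"
  using CF assms unfolding cohom_one_form_def Let_def by blast

lemma wM: "wmfd M" and wP: "wmfd P" and wB: "wmfd B"
  using M P B by (auto intro: smooth_manifold_wmfd)

lemma wIP: "wmfd IP"
  unfolding interval_mfd_euc by (rule wmfd_prod[OF wmfd_euc[OF oset_Basis[OF oI]] wP])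

lemma ptsIP: "pts IP = I \<times> pts P"
  by (simp add: prod_mfd_simps interval_mfd_euc)

lemma M0sub: "M0 \<subseteq> pts M" using M0 openin_subset by blast

lemma \<Phi>sm: "smooth_map IP M \<Phi>"
  by (rule smooth_map_open_sub_target[OF _ _ wIP]) (use df ptsIP in \<open>auto simp: diffeo_def\<close>)

lemma \<Phi>'sm: "smooth_map (open_sub M M0) IP \<Phi>'"
  using df by (simp add: diffeo_def)

lemma \<Phi>'\<Phi>: "z \<in> pts IP \<Longrightarrow> \<Phi>' (\<Phi> z) = z"
  using df by (auto simp: diffeo_def bij_betw_def inv_into_f_f)

lemma \<Phi>\<Phi>': "p \<in> M0 \<Longrightarrow> \<Phi> (\<Phi>' p) = p" "p \<in> M0 \<Longrightarrow> \<Phi>' p \<in> pts IP"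
  using f_inv_into_f[of p \<Phi> "pts IP"] inv_into_into[of p \<Phi> "pts IP"] ptsIP by auto

lemma smooth_near_\<Phi>':
  assumes z: "z \<in> pts IP" and f: "smooth_near IP z f"
  shows "smooth_near M (\<Phi> z) (f \<circ> \<Phi>')"
proof (rule smooth_near_open_sub[OF wM M0 smooth_near_compose[OF wmfd_open_sub[OF wM M0] wIP \<Phi>'sm]])
  show "\<Phi> z \<in> pts (open_sub M M0)" using z M0sub by (auto simp: open_sub_simps ptsIP)
  show "smooth_near IP (\<Phi>' (\<Phi> z)) f" using f \<Phi>'\<Phi>[OF z] by simp
qed

lemma Rsm1: "smooth_map P P (R s)"
proof -
  have "smooth_map P P ((\<lambda>(s, p). R s p) \<circ> (\<lambda>p. (s, p)))"
    by (rule smooth_map_compose[OF wP _ wP smooth_map_const_Pair[OF open_UNIV UNIV_I P] Rsm])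
      (unfold interval_mfd_euc, rule wmfd_prod[OF wmfd_euc[OF oset_Basis[OF open_UNIV]] wP])
  then show ?thesis by (simp add: o_def)
qed

lemma Rin: "p \<in> pts P \<Longrightarrow> R s p \<in> pts P"
  using smooth_map_in[OF Rsm1] .

lemma sndsm: "smooth_map IP P snd"
  unfolding interval_mfd_euc by (rule smooth_map_snd[OF wmfd_euc[OF oset_Basis[OF oI]] P])

end

text \<open>
  \<open>F\<close> parametrizes an open part of \<open>B\<close> and \<open>\<sigma>\<close> lifts it to \<open>P\<close>.  In the coordinates \<open>(x, s, y)\<close> of the map
  \<open>\<psi>\<close> below, \<open>\<theta>\<close> is \<open>ds + \<alpha>\<close> and the metric is \<open>dx\<^sup>2/h + h (ds + \<alpha>)\<^sup>2 + x G1 + G0\<close>.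
\<close>

locale base_param = kaehler_cohom_one M g J I P B \<Phi> \<pi> R \<tau> \<theta> JB m d a b gs h
  for M :: "('a, 'n::euclidean_space) mfd" and g :: "'a form2" and J :: "'a endo"
    and I :: "real set" and P :: "('p, 'r::euclidean_space) mfd"
    and B :: "('q, 'e::euclidean_space) mfd" and \<Phi> :: "real \<times> 'p \<Rightarrow> 'a" and \<pi> :: "'p \<Rightarrow> 'q"
    and R :: "real \<Rightarrow> 'p \<Rightarrow> 'p" and \<tau> :: real and \<theta> :: "'p form1" and JB :: "'q endo"
    and m :: nat and d :: "nat \<Rightarrow> nat" and a b :: "nat \<Rightarrow> real" and gs :: "nat \<Rightarrow> 'q form2"
    and h :: "real \<Rightarrow> real" +
  fixes D Y :: "'f::euclidean_space set" and F :: "'f \<Rightarrow> 'q" and \<sigma> :: "'f \<Rightarrow> 'p"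
  assumes oY: "oset D Y" and F: "smooth_map (euc D Y) B F" and \<sigma>: "smooth_map (euc D Y) P \<sigma>"
    and \<pi>\<sigma>: "y \<in> Y \<Longrightarrow> \<pi> (\<sigma> y) = F y"
    and Fsurj: "y \<in> Y \<Longrightarrow> tangent B (F y) \<subseteq> (\<lambda>v. push B F y (pvec D Y y v)) ` span D"
    and Finj: "y \<in> Y \<Longrightarrow> v \<in> span D \<Longrightarrow> push B F y (pvec D Y y v) = tzero \<Longrightarrow> v = 0"
begin

abbreviation "DX \<equiv> xcoords D"
abbreviation "W \<equiv> I \<times> UNIV \<times> Y"
text \<open>The local trivialization of the circle bundle by the section \<sigma> and the flow. The
  time \<open>s\<close> runs through the whole real line, so \<rho> is periodic in \<open>s\<close>
  and not injective; curvature is local, and a surjective differential suffices.\<close>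

definition \<rho> :: "real \<times> real \<times> 'f \<Rightarrow> 'p" where "\<rho> u = R (fst (snd u)) (\<sigma> (snd (snd u)))"
definition "k u = (fst u, \<rho> u)"
definition "\<psi> u = \<Phi> (k u)"
definition "svec u V = pvec DX W u V"
definition "bvec y v = push B F y (pvec D Y y v)"
definition "\<alpha> y v = \<theta> (\<sigma> y) (push P \<sigma> y (pvec D Y y v))"

lemma oW: "oset DX W" by (rule oset_xcoords[OF oY oI])

lemma \<sigma>in: "y \<in> Y \<Longrightarrow> \<sigma> y \<in> pts P" using smooth_map_in[OF \<sigma>] by simp

lemma Fin: "y \<in> Y \<Longrightarrow> F y \<in> pts B" using smooth_map_in[OF F] by simp

lemma DX_iff: "(\<xi>, r, v) \<in> span DX \<longleftrightarrow> v \<in> span D" by (auto simp: span_xcoords)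

lemma bl: "bounded_linear (fst :: real \<times> real \<times> 'f \<Rightarrow> _)" "bounded_linear (\<lambda>u :: real \<times> real \<times> 'f. fst (snd u))"
   "bounded_linear (\<lambda>u :: real \<times> real \<times> 'f. snd (snd u))"
  by (auto intro!: bounded_linear_intros)

lemma ysm: "smooth_map (euc DX W) (euc D Y) (\<lambda>u. snd (snd u))"
  by (rule smooth_map_bounded_linear[OF oW oY bl(3)]) auto

lemma \<rho>sm: "smooth_map (euc DX W) P \<rho>"
proof -
  note oU = oset_Basis[OF open_UNIV]
  have 1: "smooth_map (euc DX W) (euc Basis UNIV) (\<lambda>u. fst (snd u))"
    by (rule smooth_map_bounded_linear[OF oW oU bl(2)]) auto
  have 2: "smooth_map (euc DX W) P (\<sigma> \<circ> (\<lambda>u. snd (snd u)))"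
    by (rule smooth_map_compose[OF wmfd_euc[OF oW] wmfd_euc[OF oY] wP ysm \<sigma>])
  have "smooth_map (euc DX W) P ((\<lambda>(s, p). R s p) \<circ> (\<lambda>u. (fst (snd u), (\<sigma> \<circ> (\<lambda>u. snd (snd u))) u)))"
    by (rule smooth_map_compose[OF wmfd_euc[OF oW] _ wP smooth_map_Pair[OF oW wmfd_euc[OF oU] wP 1 2]])
      (use Rsm wmfd_prod[OF wmfd_euc[OF oU] wP] in \<open>simp_all only: interval_mfd_euc\<close>)
  then show ?thesis
    by (rule back_subst[where P = "smooth_map (euc DX W) P"]) (auto simp: \<rho>_def)
qed

lemma \<rho>in: "u \<in> W \<Longrightarrow> \<rho> u \<in> pts P" using smooth_map_in[OF \<rho>sm] by simp

lemma ksm: "smooth_map (euc DX W) IP k"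
proof -
  have "smooth_map (euc DX W) (euc Basis I) fst"
    by (rule smooth_map_bounded_linear[OF oW oset_Basis[OF oI] bl(1)]) auto
  from smooth_map_Pair[OF oW wmfd_euc[OF oset_Basis[OF oI]] wP this \<rho>sm]
  have "smooth_map (euc DX W) (prod_mfd (euc Basis I) P) (\<lambda>u. (fst u, \<rho> u))" .
  then have "smooth_map (euc DX W) IP (\<lambda>u. (fst u, \<rho> u))" by (simp only: interval_mfd_euc)
  then show ?thesis
    by (rule back_subst[where P = "smooth_map (euc DX W) IP"]) (auto simp: k_def)
qed

lemma kin: "u \<in> W \<Longrightarrow> k u \<in> pts IP" using smooth_map_in[OF ksm] by simp

lemma \<psi>_comp: "\<psi> = \<Phi> \<circ> k" by (auto simp: \<psi>_def)

lemma \<psi>sm: "smooth_map (euc DX W) M \<psi>"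
  unfolding \<psi>_comp by (rule smooth_map_compose[OF wmfd_euc[OF oW] wIP wM ksm \<Phi>sm])

lemma \<psi>in: "u \<in> W \<Longrightarrow> \<psi> u \<in> pts M" using smooth_map_in[OF \<psi>sm] by simp

lemma \<zeta>:
  assumes u: "u \<in> W" and V: "V \<in> span DX"
  shows "push M \<psi> u (svec u V) = push M \<Phi> (k u) (push IP k u (svec u V))"
    and "push IP k u (svec u V) \<in> tangent IP (k u)"
    and "push P snd (k u) (push IP k u (svec u V)) = push P \<rho> u (svec u V)"
    and "push IP k u (svec u V) fst = fst V"
    and "push P \<rho> u (svec u V) \<in> tangent P (\<rho> u)"
proof -
  show "push M \<psi> u (svec u V) = push M \<Phi> (k u) (push IP k u (svec u V))"
    unfolding \<psi>_comp by (rule push_compose[where f = k, OF wIP wM \<Phi>sm kin[OF u]])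
  show "push IP k u (svec u V) \<in> tangent IP (k u)"
    unfolding svec_def by (rule push_pvec_in_tangent[OF oW wIP ksm u V])
  have "snd \<circ> k = \<rho>" by (auto simp: k_def)
  then show "push P snd (k u) (push IP k u (svec u V)) = push P \<rho> u (svec u V)"
    using push_compose[where f = k and p = u, OF wIP wP sndsm kin[OF u], of "svec u V"] by simp
  show "push P \<rho> u (svec u V) \<in> tangent P (\<rho> u)"
    unfolding svec_def by (rule push_pvec_in_tangent[OF oW wP \<rho>sm u V])
  have sn: "smooth_near IP (k u) fst"
    using smooth_near_fst[OF oI wP, of "fst u" "\<rho> u"] u \<rho>in[OF u] by (auto simp: k_def)
  have fk: "fst \<circ> k = fst" by (auto simp: k_def)
  have "smooth_near (euc DX W) u (fst \<circ> k)"
    by (rule smooth_near_compose[OF wmfd_euc[OF oW] wIP ksm _ sn]) (use u in simp)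
  then show "push IP k u (svec u V) fst = fst V"
    using sn pvec_eq[OF oW u V, of "fst \<circ> k"] dd_bounded_linear[OF bl(1)] by (simp add: push_def svec_def fk)
qed

lemma svec_lin: "u \<in> W \<Longrightarrow> V \<in> span DX \<Longrightarrow> V' \<in> span DX \<Longrightarrow> svec u (s *\<^sub>R V + t *\<^sub>R V') = tlin s (svec u V) t (svec u V')"
  unfolding svec_def by (rule pvec_linear[OF oW])

lemma bvec_lin: "y \<in> Y \<Longrightarrow> v \<in> span D \<Longrightarrow> v' \<in> span D \<Longrightarrow> bvec y (s *\<^sub>R v + t *\<^sub>R v') = tlin s (bvec y v) t (bvec y v')"
  unfolding bvec_def by (simp add: pvec_linear[OF oY] push_tlin)

lemma bvec_in: "y \<in> Y \<Longrightarrow> v \<in> span D \<Longrightarrow> bvec y v \<in> tangent B (F y)"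
  unfolding bvec_def by (rule push_pvec_in_tangent[OF oY wB F])

lemma \<alpha>_lin: "y \<in> Y \<Longrightarrow> slin (span D) (\<alpha> y)"
  unfolding slin_def \<alpha>_def
  using linear_on_tangentD[OF \<theta>lin[OF \<sigma>in]] push_pvec_in_tangent[OF oY wP \<sigma>]
  by (simp add: pvec_linear[OF oY] push_tlin)

lemma push_embed:
  assumes x: "x \<in> I" and y: "y \<in> Y" and N: "wmfd N" and f: "smooth_map (euc DX W) N f"
  shows "push N (\<lambda>x'. f (x', s, y)) x (pvec Basis I x 1) = push N f (x, s, y) (svec (x, s, y) (1, 0, 0))"
    and "push N (\<lambda>s'. f (x, s', y)) s (pvec Basis UNIV s 1) = push N f (x, s, y) (svec (x, s, y) (0, 1, 0))"
    and "v \<in> span D \<Longrightarrow> push N (\<lambda>y'. f (x, s, y')) y (pvec D Y y v) = push N f (x, s, y) (svec (x, s, y) (0, 0, v))"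
    and "v \<in> span D \<Longrightarrow> push N (\<lambda>u. f (x, snd u)) (x, s, y) (svec (x, s, y) (0, r, v)) = push N f (x, s, y) (svec (x, s, y) (0, r, v))"
proof -
  note oBI = oset_Basis[OF oI] and oBU = oset_Basis[OF open_UNIV]
  have one: "(1::real) \<in> span Basis" by (simp only: span_Basis UNIV_I)
  have bl': "bounded_linear (\<lambda>x'. (x', 0::real, 0::'f))" "bounded_linear (\<lambda>s'. (0::real, s', 0::'f))"
    "bounded_linear (\<lambda>y'. (0::real, 0::real, y'::'f))" "bounded_linear (\<lambda>u. (0::real, snd u :: real \<times> 'f))"
    by (auto intro!: bounded_linear_Pair bounded_linear_ident bounded_linear_zero bounded_linear_snd)
  note pc = push_compose[OF wmfd_euc[OF oW] N f]
  show "push N (\<lambda>x'. f (x', s, y)) x (pvec Basis I x 1) = push N f (x, s, y) (svec (x, s, y) (1, 0, 0))"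
    using pc[of "\<lambda>x'. (x', s, y)" x] push_affine[OF oBI oW bl'(1), of "\<lambda>x'. (x', s, y)" "(0, s, y)" x 1] x y one
    by (simp add: o_def svec_def)
  show "push N (\<lambda>s'. f (x, s', y)) s (pvec Basis UNIV s 1) = push N f (x, s, y) (svec (x, s, y) (0, 1, 0))"
    using pc[of "\<lambda>s'. (x, s', y)" s] push_affine[OF oBU oW bl'(2), of "\<lambda>s'. (x, s', y)" "(x, 0, y)" s 1] x y one
    by (simp add: o_def svec_def)
  show "push N (\<lambda>y'. f (x, s, y')) y (pvec D Y y v) = push N f (x, s, y) (svec (x, s, y) (0, 0, v))" if "v \<in> span D"
    using pc[of "\<lambda>y'. (x, s, y')" y] push_affine[OF oY oW bl'(3), of "\<lambda>y'. (x, s, y')" "(x, s, 0)" y v] x y that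
    by (simp add: o_def svec_def)
  show "push N (\<lambda>u. f (x, snd u)) (x, s, y) (svec (x, s, y) (0, r, v)) = push N f (x, s, y) (svec (x, s, y) (0, r, v))" if "v \<in> span D"
    using pc[of "\<lambda>u. (x, snd u)" "(x, s, y)"] push_affine[OF oW oW bl'(4), of "\<lambda>u. (x, snd u)" "(x, 0)" "(x, s, y)" "(0, r, v)"] x y that
    by (auto simp add: o_def svec_def DX_iff)
qed

end

lemma tlin_simps: "tlin 0 \<xi> 1 \<eta> = \<eta>" "tlin 1 \<xi> 0 \<eta> = \<xi>" "tlin s tzero 1 \<eta> = \<eta>"
  by (auto simp: tlin_def tzero_def)

context base_param
begin

lemma push_shift:
  assumes x: "x \<in> I" and y: "y \<in> Y" and N: "wmfd N" and f: "smooth_map (euc DX W) N f"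
  shows "velocity N (\<lambda>s'. f (x, s' + s, y)) 0 = push N f (x, s, y) (svec (x, s, y) (0, 1, 0))"
    and "velocity N (\<lambda>x'. f (x', s, y)) x = push N f (x, s, y) (svec (x, s, y) (1, 0, 0))"
proof -
  note oBI = oset_Basis[OF oI] and oBU = oset_Basis[OF open_UNIV]
  have one: "(1::real) \<in> span Basis" by (simp only: span_Basis UNIV_I)
  have bl1: "bounded_linear (\<lambda>s'. (0::real, s'::real, 0::'f))" and bl2: "bounded_linear (\<lambda>x'. (x'::real, 0::real, 0::'f))"
    by (intro bounded_linear_Pair bounded_linear_ident bounded_linear_zero)+
  have s1: "smooth_map (euc Basis UNIV) (euc DX W) (\<lambda>s'. (x, s' + s, y))"
    by (rule smooth_map_affine[OF oBU oW bl1, where c = "(x, s, y)"]) (use x y in auto)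
  have s2: "smooth_map (euc Basis I) (euc DX W) (\<lambda>x'. (x', s, y))"
    by (rule smooth_map_affine[OF oBI oW bl2, where c = "(0, s, y)"]) (use x y in auto)
  have "velocity N (f \<circ> (\<lambda>s'. (x, s' + s, y))) 0 = push N (f \<circ> (\<lambda>s'. (x, s' + s, y))) 0 (pvec Basis UNIV 0 1)"
    by (rule velocity_push[OF open_UNIV N smooth_map_compose[OF wmfd_euc[OF oBU] wmfd_euc[OF oW] N s1 f]]) simp
  also have "\<dots> = push N f (x, s, y) (svec (x, s, y) (0, 1, 0))"
    using push_compose[OF wmfd_euc[OF oW] N f, of "\<lambda>s'. (x, s' + s, y)" 0]
      push_affine[OF oBU oW bl1, of "\<lambda>s'. (x, s' + s, y)" "(x, s, y)" 0 1] x y one by (simp add: svec_def)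
  finally show "velocity N (\<lambda>s'. f (x, s' + s, y)) 0 = push N f (x, s, y) (svec (x, s, y) (0, 1, 0))"
    by (simp add: o_def)
  have "velocity N (f \<circ> (\<lambda>x'. (x', s, y))) x = push N (f \<circ> (\<lambda>x'. (x', s, y))) x (pvec Basis I x 1)"
    by (rule velocity_push[OF oI N smooth_map_compose[OF wmfd_euc[OF oBI] wmfd_euc[OF oW] N s2 f] x])
  then show "velocity N (\<lambda>x'. f (x', s, y)) x = push N f (x, s, y) (svec (x, s, y) (1, 0, 0))"
    using push_embed(1)[OF x y N f, of s] by (simp add: o_def)
qed

lemma svec_decomp:
  assumes "u \<in> W" "v \<in> span D"
  shows "svec u (\<xi>, r, v) = tlin \<xi> (svec u (1, 0, 0)) 1 (tlin r (svec u (0, 1, 0)) 1 (svec u (0, 0, v)))"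
proof -
  have "svec u (0, r, v) = svec u (r *\<^sub>R (0, 1, 0) + 1 *\<^sub>R (0, 0, v))" by simp
  also have "\<dots> = tlin r (svec u (0, 1, 0)) 1 (svec u (0, 0, v))"
    by (rule svec_lin[OF assms(1)]) (simp_all add: DX_iff assms span_zero)
  finally have 1: "svec u (0, r, v) = tlin r (svec u (0, 1, 0)) 1 (svec u (0, 0, v))" .
  have "svec u (\<xi>, r, v) = svec u (\<xi> *\<^sub>R (1, 0, 0) + 1 *\<^sub>R (0, r, v))" by simp
  also have "\<dots> = tlin \<xi> (svec u (1, 0, 0)) 1 (svec u (0, r, v))"
    by (rule svec_lin[OF assms(1)]) (simp_all add: DX_iff assms span_zero)
  finally show ?thesis unfolding 1 .
qed

text \<open>\<theta> is invariant under the flow, so its value on the lifted base direction does not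
  depend on \<open>s\<close> and is the value at the section, \<open>\<alpha> y v\<close>. The fibre
  direction contributes \<open>r\<close> by the normalisation of \<theta> on the generator.\<close>

lemma \<theta>_svec:
  assumes x: "x \<in> I" and y: "y \<in> Y" and v: "v \<in> span D"
  shows "\<theta> (\<rho> (x, s, y)) (push P \<rho> (x, s, y) (svec (x, s, y) (\<xi>, r, v))) = r + \<alpha> y v"
proof -
  let ?u = "(x, s, y)" and ?p = "R s (\<sigma> y)"
  have u: "?u \<in> W" using x y by simp
  have \<rho>u: "\<rho> ?u = ?p" by (simp add: \<rho>_def)
  have pP: "?p \<in> pts P" using Rin \<sigma>in[OF y] .
  have N: "push P \<rho> ?u (svec ?u (1, 0, 0)) = tzero"
    using push_embed(1)[OF x y wP \<rho>sm, of s] push_const[OF oset_Basis[OF oI] x real_in_span, of P ?p 1]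
    by (simp add: \<rho>_def)
  have T: "push P \<rho> ?u (svec ?u (0, 1, 0)) = fibre_vec P R ?p"
    using push_shift(1)[OF x y wP \<rho>sm, of s] Radd[OF \<sigma>in[OF y]] by (simp add: \<rho>_def fibre_vec_def)
  have X: "push P \<rho> ?u (svec ?u (0, 0, v)) = push P (R s) (\<sigma> y) (push P \<sigma> y (pvec D Y y v))"
    using push_embed(3)[OF x y wP \<rho>sm v, of s] push_compose[OF wP wP Rsm1, of \<sigma> y s] \<sigma>in[OF y]
    by (simp add: \<rho>_def o_def)
  have t\<sigma>: "push P \<sigma> y (pvec D Y y v) \<in> tangent P (\<sigma> y)" by (rule push_pvec_in_tangent[OF oY wP \<sigma> y v])
  have t: "push P \<rho> ?u (svec ?u (0, 1, 0)) \<in> tangent P ?p" "push P \<rho> ?u (svec ?u (0, 0, v)) \<in> tangent P ?p"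
    using \<zeta>(5)[OF u, of "(0, 1, 0)"] \<zeta>(5)[OF u, of "(0, 0, v)"] v by (auto simp: DX_iff span_zero \<rho>u)
  have "push P \<rho> ?u (svec ?u (\<xi>, r, v)) = tlin r (push P \<rho> ?u (svec ?u (0, 1, 0))) 1 (push P \<rho> ?u (svec ?u (0, 0, v)))"
    unfolding svec_decomp[OF u v, of \<xi> r] push_tlin N tlin_simps ..
  then have "\<theta> ?p (push P \<rho> ?u (svec ?u (\<xi>, r, v))) = r * \<theta> ?p (fibre_vec P R ?p) + 1 * \<theta> ?p (push P \<rho> ?u (svec ?u (0, 0, v)))"
    using linear_on_tangentD[OF \<theta>lin[OF pP] t] by (simp only: T)
  also have "\<dots> = r + \<alpha> y v"
    using \<theta>f[OF pP] \<theta>R[OF \<sigma>in[OF y] t\<sigma>] by (simp add: X \<alpha>_def)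
  finally show ?thesis unfolding \<rho>u .
qed

lemma \<pi>_svec:
  assumes x: "x \<in> I" and y: "y \<in> Y" and v: "v \<in> span D"
  shows "\<pi> (\<rho> (x, s, y)) = F y"
    and "push B \<pi> (\<rho> (x, s, y)) (push P \<rho> (x, s, y) (svec (x, s, y) (\<xi>, r, v))) = bvec y v"
proof -
  let ?u = "(x, s, y)"
  have u: "?u \<in> W" using x y by simp
  have V: "(\<xi>, r, v) \<in> span DX" using v by (simp add: DX_iff)
  have pr: "\<pi> (\<rho> u) = F (snd (snd u))" if "u \<in> W" for u
  proof -
    have y: "snd (snd u) \<in> Y" using that by auto
    have "\<pi> (\<sigma> (snd (snd u))) = \<pi> (\<rho> u)"
      using \<pi>R[OF \<sigma>in[OF y] \<rho>in[OF that]] by (auto simp: \<rho>_def)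
    then show ?thesis using \<pi>\<sigma>[OF y] by simp
  qed
  from pr[OF u] show "\<pi> (\<rho> ?u) = F y" by simp
  have "push B \<pi> (\<rho> ?u) (push P \<rho> ?u (svec ?u (\<xi>, r, v))) = push B (\<pi> \<circ> \<rho>) ?u (svec ?u (\<xi>, r, v))"
    by (rule push_compose[OF wP wB \<pi>sm, of \<rho> ?u, OF \<rho>in[OF u], symmetric])
  also have "\<dots> = push B (F \<circ> (\<lambda>u. snd (snd u))) ?u (svec ?u (\<xi>, r, v))"
    unfolding svec_def by (rule push_pvec_cong[OF oW u V]) (simp add: pr)
  also have "\<dots> = push B F y (push (euc D Y) (\<lambda>u. snd (snd u)) ?u (svec ?u (\<xi>, r, v)))"
    using push_compose[OF wmfd_euc[OF oY] wB F, of "\<lambda>u. snd (snd u)" ?u] y by simp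
  also have "push (euc D Y) (\<lambda>u. snd (snd u)) ?u (svec ?u (\<xi>, r, v)) = pvec D Y y v"
    using push_euc[OF oW oY ysm u V] dd_bounded_linear[OF bl(3)] by (simp add: svec_def)
  finally show "push B \<pi> (\<rho> ?u) (push P \<rho> ?u (svec ?u (\<xi>, r, v))) = bvec y v" by (simp add: bvec_def)
qed

definition "\<beta> = pbf M g DX W \<psi>"
definition "Gm i = pbf B (gs i) D Y F"
definition "G1 y v w = (\<Sum>i=1..m. b i * Gm i y v w)"
definition "G0 y v w = (\<Sum>i=1..m. a i * Gm i y v w)"

lemma base_metric_bvec: "base_metric m a b gs x (F y) (bvec y v) (bvec y w) = x * G1 y v w + G0 y v w"
  by (simp add: base_metric_def A_coef_def G1_def G0_def Gm_def pbf_def bvec_def sum_distrib_left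
      sum.distrib[symmetric] algebra_simps)

lemma \<beta>_eq:
  assumes x: "x \<in> I" and y: "y \<in> Y" and v: "v \<in> span D" and w: "w \<in> span D"
  shows "\<beta> (x, s, y) (\<xi>, r, v) (\<eta>, q, w) = \<xi> * \<eta> / h x + h x * ((r + \<alpha> y v) * (q + \<alpha> y w)) + (x * G1 y v w + G0 y v w)"
proof -
  let ?u = "(x, s, y)"
  have u: "?u \<in> W" using x y by simp
  have V: "(\<xi>, r, v) \<in> span DX" "(\<eta>, q, w) \<in> span DX" using v w by (auto simp: DX_iff)
  have ku: "k ?u = (x, \<rho> ?u)" by (simp add: k_def)
  have "\<beta> ?u (\<xi>, r, v) (\<eta>, q, w) = g (\<psi> ?u) (push M \<psi> ?u (svec ?u (\<xi>, r, v))) (push M \<psi> ?u (svec ?u (\<eta>, q, w)))"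
    by (simp add: \<beta>_def pbf_def svec_def)
  also have "\<dots> = \<xi> * \<eta> / h x + h x * ((r + \<alpha> y v) * (q + \<alpha> y w)) + base_metric m a b gs x (F y) (bvec y v) (bvec y w)"
    unfolding \<zeta>(1)[OF u V(1)] \<zeta>(1)[OF u V(2)] \<psi>_def
    using gform[OF x \<rho>in[OF u], of "push IP k ?u (svec ?u (\<xi>, r, v))" "push IP k ?u (svec ?u (\<eta>, q, w))"]
      \<zeta>(2-4)[OF u V(1)] \<zeta>(2-4)[OF u V(2)] \<theta>_svec[OF x y v] \<theta>_svec[OF x y w] \<pi>_svec[OF x y v] \<pi>_svec[OF x y w]
    by (simp add: ku)
  finally show ?thesis unfolding base_metric_bvec .
qed

lemma \<beta>_lform: "lform DX W \<beta>"
  unfolding \<beta>_def by (rule pbf_lform[OF oW M gsym2 \<psi>sm])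

lemma Gm_lform: "i \<in> {1..m} \<Longrightarrow> lform D Y (Gm i)"
  unfolding Gm_def by (rule pbf_lform[OF oY B gssym2 F])

lemma sum_lform:
  assumes "\<And>i. i \<in> A \<Longrightarrow> lform D Y (f i)"
  shows "lform D Y (\<lambda>y v w. \<Sum>i\<in>A. c i * f i y v w)"
proof
  show "oset D Y" by (rule oY)
  show "smooth_on D Y (\<lambda>u. \<Sum>i\<in>A. c i * f i u v w)" if "v \<in> span D" "w \<in> span D" for v w
    by (intro smooth_on_sum smooth_on_mult smooth_on_const oY lform.sm[OF assms] that)
  show "symform (span D) (\<lambda>v w. \<Sum>i\<in>A. c i * f i u v w)" if u: "u \<in> Y" for u
    unfolding symform_def
    by (auto intro!: slin_intros lform.lin1[OF assms u] sum.cong symform_sym[OF lform.sf[OF assms u]] simp: subspace_span)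
qed

lemma G1_lform: "lform D Y G1" and G0_lform: "lform D Y G0"
  unfolding G1_def G0_def by (intro sum_lform Gm_lform; assumption)+

end

section \<open>Tangent vectors under the orbit parametrization \<Phi>\<close>

lemma tangent_tlin:
  assumes M: "smooth_manifold M" and p: "p \<in> pts M" and t: "\<xi> \<in> tangent M p" "\<eta> \<in> tangent M p"
  shows "tlin s \<xi> t \<eta> \<in> tangent M p"
proof -
  have w: "wmfd M" by (rule smooth_manifold_wmfd[OF M])
  obtain c where c: "c \<in> atlas M" "p \<in> fst c" using wmfdD(2)[OF w p] by blast
  obtain v v' where v: "v \<in> span (coords M)" "\<xi> = coord_vec M c p v" "v' \<in> span (coords M)" "\<eta> = coord_vec M c p v'"
    using t unfolding tangent_chart[OF M c] by blast
  show ?thesis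
    unfolding v(2,4) coord_vec_linear[OF w c v(1,3), symmetric]
    by (rule coord_vec_in_tangent[OF c]) (use v in \<open>auto intro: span_add span_scale\<close>)
qed

lemma tangent_const:
  assumes "wmfd M" "\<xi> \<in> tangent M p"
  shows "\<xi> (\<lambda>_. q) = 0"
proof -
  have "dd (\<lambda>_. q) v u = 0" for v u :: 'b by (rule dd_eqI) (rule has_vector_derivative_const)
  then show ?thesis using assms(2) by (auto simp: tangent_def coord_vec_def o_def)
qed

context kaehler_cohom_one
begin

lemma g_nonzero: "p \<in> pts M \<Longrightarrow> \<xi> \<in> tangent M p \<Longrightarrow> g p \<xi> \<xi> = 0 \<Longrightarrow> \<xi> = tzero"
  using riem unfolding riemannian_def by (metis less_irrefl)

lemma g_lin: "p \<in> pts M \<Longrightarrow> \<xi> \<in> tangent M p \<Longrightarrow> linear_on_tangent (tangent M p) (g p \<xi>)"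
  and g_sym: "p \<in> pts M \<Longrightarrow> \<xi> \<in> tangent M p \<Longrightarrow> \<eta> \<in> tangent M p \<Longrightarrow> g p \<xi> \<eta> = g p \<eta> \<xi>"
  using gsym2 unfolding smooth_sym2_def by blast+

lemma g_lin1:
  assumes "p \<in> pts M" "\<xi> \<in> tangent M p" "\<xi>' \<in> tangent M p" "\<eta> \<in> tangent M p"
  shows "g p (tlin s \<xi> t \<xi>') \<eta> = s * g p \<xi> \<eta> + t * g p \<xi>' \<eta>"
  using linear_on_tangentD[OF g_lin[OF assms(1,4)] assms(2,3)] g_sym[OF assms(1) _ assms(4)]
    tangent_tlin[OF M assms(1-3)] assms(2,3) by simp

lemma J_in: "p \<in> pts M \<Longrightarrow> \<xi> \<in> tangent M p \<Longrightarrow> J p \<xi> \<in> tangent M p"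
  and J_lin: "p \<in> pts M \<Longrightarrow> \<xi> \<in> tangent M p \<Longrightarrow> \<eta> \<in> tangent M p \<Longrightarrow> J p (tlin s \<xi> t \<eta>) = tlin s (J p \<xi>) t (J p \<eta>)"
  and JJ: "p \<in> pts M \<Longrightarrow> \<xi> \<in> tangent M p \<Longrightarrow> J p (J p \<xi>) = tlin (-1) \<xi> 0 \<xi>"
  using Jcs unfolding complex_structure_def smooth_endo_def by blast+

lemma g_J_anti:
  assumes p: "p \<in> pts M" and t: "\<xi> \<in> tangent M p" "\<eta> \<in> tangent M p"
  shows "g p (J p \<xi>) \<eta> = - g p (J p \<eta>) \<xi>"
proof -
  have "g p (J p \<xi>) \<eta> = g p (J p (J p \<xi>)) (J p \<eta>)" using herm[OF p J_in[OF p t(1)] t(2)] by simp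
  also have "\<dots> = - g p \<xi> (J p \<eta>)" unfolding JJ[OF p t(1)] g_lin1[OF p t(1,1) J_in[OF p t(2)]] by simp
  also have "\<dots> = - g p (J p \<eta>) \<xi>" using g_sym[OF p t(1) J_in[OF p t(2)]] by simp
  finally show ?thesis .
qed

text \<open>Every test function near \<open>z\<close> is the pullback under \<Phi> of one on
  \<open>M\<close>, namely its composite with the inverse of \<Phi>; a vector killed by the push
  therefore kills all test functions.\<close>

lemma push_\<Phi>_inj:
  assumes z: "z \<in> pts IP" and \<zeta>: "\<zeta> \<in> tangent IP z" and 0: "push M \<Phi> z \<zeta> = tzero"
  shows "\<zeta> = tzero"
proof
  fix f
  show "\<zeta> f = tzero f"
  proof (cases "smooth_near IP z f")
    case True
    have "\<zeta> f = \<zeta> (f \<circ> \<Phi>' \<circ> \<Phi>)" by (rule tangent_cong[OF wIP \<zeta>]) (simp add: \<Phi>'\<Phi>)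
    also have "\<dots> = push M \<Phi> z \<zeta> (f \<circ> \<Phi>')" using smooth_near_\<Phi>'[OF z True] by (simp add: push_def)
    finally show ?thesis using 0 by (simp add: tzero_def)
  next
    case False
    then show ?thesis using \<zeta> by (auto simp: tangent_def coord_vec_def tzero_def)
  qed
qed

text \<open>\<open>IP\<close> is available as \<open>wmfd\<close> only, so
  \<open>tangent IP z\<close> is not known to be covered by one chart, nor is
  \<open>push_in_tangent\<close> applicable with source \<open>IP\<close>. Hence the preimage is
  given in a prescribed chart \<open>cc\<close>, together with the fact that its projection is
  tangent to \<open>P\<close>.\<close>

lemma push_\<Phi>_surj:
  assumes z: "z \<in> pts IP" and \<xi>: "\<xi> \<in> tangent M (\<Phi> z)" and cc: "cc \<in> atlas IP" "z \<in> fst cc"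
  obtains v where "v \<in> span (coords IP)" "push M \<Phi> z (coord_vec IP cc z v) = \<xi>"
    "push P snd z (coord_vec IP cc z v) \<in> tangent P (snd z)"
proof -
  have p: "\<Phi> z \<in> M0" using z by (simp add: ptsIP)
  then have pM: "\<Phi> z \<in> pts M" using M0sub by blast
  obtain c where c: "c \<in> atlas M" "\<Phi> z \<in> fst c" using wmfdD(2)[OF wM pM] by blast
  obtain v where v: "v \<in> span (coords M)" "\<xi> = coord_vec M c (\<Phi> z) v"
    using \<xi> unfolding tangent_chart[OF M c] by blast
  let ?U = "snd c ` (fst c \<inter> M0)" and ?u = "snd c (\<Phi> z)"
  note oU = wmfdD(5)[OF wM c(1) M0]
  note sc = smooth_map_cinv[OF M c(1) M0]
  have u: "?u \<in> ?U" using c p by blast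
  have cu: "cinv c ?u = \<Phi> z" by (rule cinv_chart[OF wM c])
  have inM0: "cinv c w \<in> M0" if "w \<in> ?U" for w using that cinv_chart[OF wM c(1)] by auto
  have "smooth_map (euc (coords M) ?U) (open_sub M M0) (cinv c)"
    by (rule smooth_map_into_open_sub[OF sc _ wmfd_euc[OF oU]]) (use inM0 in auto)
  then have G: "smooth_map (euc (coords M) ?U) IP (\<Phi>' \<circ> cinv c)"
    by (rule smooth_map_compose[OF wmfd_euc[OF oU] wmfd_open_sub[OF wM M0] wIP _ \<Phi>'sm])
  have Gu: "(\<Phi>' \<circ> cinv c) ?u = z" using \<Phi>'\<Phi>[OF z] cu by simp
  let ?p = "pvec (coords M) ?U ?u v"
  define v' where "v' = dd (snd cc \<circ> (\<Phi>' \<circ> cinv c)) v ?u"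
  have eq: "push IP (\<Phi>' \<circ> cinv c) ?u ?p = coord_vec IP cc z v'"
    unfolding v'_def using push_pvec[OF oU wIP G u cc(1) _ v(1)] cc(2) Gu by simp
  have "v' \<in> span (coords IP)" unfolding v'_def
    by (rule dd_smooth_in_span[OF wmfd_cimg[OF wIP cc(1)] smooth_map_euc_dom[OF oU wIP G wmfdD(3)[OF wIP cc(1)]]
        smooth_map_euc_chart[OF oU wIP G cc(1)] _ _ v(1)]) (use u cc Gu in auto)
  moreover have "push M \<Phi> z (coord_vec IP cc z v') = \<xi>"
  proof -
    have "push M \<Phi> z (push IP (\<Phi>' \<circ> cinv c) ?u ?p) = push M (\<Phi> \<circ> (\<Phi>' \<circ> cinv c)) ?u ?p"
      using push_compose[OF wIP wM \<Phi>sm, of "\<Phi>' \<circ> cinv c" ?u ?p] z Gu by simp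
    also have "\<dots> = push M (cinv c) ?u ?p"
      by (rule push_pvec_cong[OF oU u v(1)]) (use \<Phi>\<Phi>'(1) inM0 in auto)
    also have "\<dots> = coord_vec M c (\<Phi> z) (dd (snd c \<circ> cinv c) v ?u)"
      using push_pvec[OF oU wM sc u c(1) _ v(1)] c(2) cu by simp
    also have "dd (snd c \<circ> cinv c) v ?u = dd (\<lambda>x. x) v ?u"
      by (rule dd_cong[OF oU u v(1)]) (auto simp: cinv_chart[OF wM c(1)])
    also have "\<dots> = v" by (rule dd_bounded_linear[OF bounded_linear_ident])
    finally show ?thesis unfolding eq v(2) .
  qed
  moreover have "push P snd z (coord_vec IP cc z v') \<in> tangent P (snd z)"
  proof -
    have "push P snd z (push IP (\<Phi>' \<circ> cinv c) ?u ?p) = push P (snd \<circ> (\<Phi>' \<circ> cinv c)) ?u ?p"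
      using push_compose[OF wIP wP sndsm, of "\<Phi>' \<circ> cinv c" ?u ?p] z Gu by simp
    also have "\<dots> \<in> tangent P ((snd \<circ> (\<Phi>' \<circ> cinv c)) ?u)"
      by (rule push_pvec_in_tangent[OF oU wP smooth_map_compose[OF wmfd_euc[OF oU] wIP wP G sndsm] u v(1)])
    finally show ?thesis unfolding eq using Gu by simp
  qed
  ultimately show thesis using that by blast
qed

lemma gs_tzero:
  assumes "i \<in> {1..m}" "q \<in> pts B"
  shows "gs i q tzero tzero = 0"
proof -
  obtain c where c: "c \<in> atlas B" "q \<in> fst c" using wmfdD(2)[OF wB assms(2)] by blast
  have t: "tzero \<in> tangent B q" using coord_vec_in_tangent[OF c span_zero] coord_vec_0[OF wB c] by simp
  then have "linear_on_tangent (tangent B q) (gs i q tzero)"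
    using gssym2[OF assms(1)] assms(2) unfolding smooth_sym2_def by blast
  from linear_on_tangentD[OF this t t, of 0 0] show ?thesis by (simp add: tlin_def tzero_def)
qed

end

context base_param
begin

text \<open>Subtracting a suitable image vector leaves a vector on which \<open>dx\<close>, \<open>\<theta>\<close> and \<open>d\<pi>\<close> vanish; it has length 0.\<close>

lemma \<psi>_surj:
  assumes u: "u \<in> W"
  shows "tangent M (\<psi> u) \<subseteq> (\<lambda>V. push M \<psi> u (pvec DX W u V)) ` span DX"
proof
  fix \<xi> assume \<xi>: "\<xi> \<in> tangent M (\<psi> u)"
  obtain x s y where xsy: "u = (x, s, y)" by (cases u) auto
  have x: "x \<in> I" and y: "y \<in> Y" using u xsy by auto
  let ?z = "k u"
  have z: "?z \<in> pts IP" by (rule kin[OF u])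
  have zx: "?z = (x, \<rho> u)" by (simp add: k_def xsy)
  obtain cc where cc: "cc \<in> atlas IP" "?z \<in> fst cc" using wmfdD(2)[OF wIP z] by blast
  obtain v where v: "v \<in> span (coords IP)" "push M \<Phi> ?z (coord_vec IP cc ?z v) = \<xi>"
      "push P snd ?z (coord_vec IP cc ?z v) \<in> tangent P (snd ?z)"
    by (rule push_\<Phi>_surj[OF z \<xi>[unfolded \<psi>_def] cc])
  define \<zeta> where "\<zeta> = coord_vec IP cc ?z v"
  let ?\<zeta>P = "push P snd ?z \<zeta>"
  have \<zeta>P: "?\<zeta>P \<in> tangent P (\<rho> u)" using v(3) by (simp add: \<zeta>_def zx)
  have "push B \<pi> (\<rho> u) ?\<zeta>P \<in> tangent B (F y)"
    using push_in_tangent[OF P wB \<pi>sm \<rho>in[OF u] \<zeta>P] \<pi>_svec(1)[OF x y span_zero, of s] by (simp add: xsy)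
  then obtain v0 where v0: "v0 \<in> span D" "push B \<pi> (\<rho> u) ?\<zeta>P = bvec y v0" using Fsurj[OF y] by (auto simp: bvec_def)
  \<comment> \<open>The entries are chosen so that the image of \<open>V\<close> has the same
    \<open>dx\<close>, \<theta> and differential of \<pi> as \<zeta>; by
    \<open>\<theta>_svec\<close>, \<theta> adds \<open>\<alpha> y v0\<close> to the middle entry,
    which is therefore subtracted.\<close>
  define V where "V = (\<zeta> fst, \<theta> (\<rho> u) ?\<zeta>P - \<alpha> y v0, v0)"
  have V: "V \<in> span DX" by (simp add: V_def DX_iff v0)
  define \<zeta>' where "\<zeta>' = push IP k u (svec u V)"
  define v' where "v' = dd (snd cc \<circ> k) V u"
  have \<zeta>': "\<zeta>' = coord_vec IP cc ?z v'"
    unfolding \<zeta>'_def svec_def v'_def by (rule push_pvec[OF oW wIP ksm u cc V])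
  have v': "v' \<in> span (coords IP)" unfolding v'_def
    by (rule dd_smooth_in_span[OF wmfd_cimg[OF wIP cc(1)] smooth_map_euc_dom[OF oW wIP ksm wmfdD(3)[OF wIP cc(1)]]
        smooth_map_euc_chart[OF oW wIP ksm cc(1)] _ _ V]) (use u cc in auto)
  define \<delta> where "\<delta> = tlin 1 \<zeta> (-1) \<zeta>'"
  have \<delta>: "\<delta> \<in> tangent IP ?z"
    unfolding \<delta>_def \<zeta>_def \<zeta>' coord_vec_linear[OF wIP cc v(1) v', symmetric]
    by (rule coord_vec_in_tangent[OF cc]) (use v v' in \<open>intro span_add span_scale; simp\<close>)
  note Z = \<zeta>(2-5)[OF u V, folded \<zeta>'_def]
  have "\<delta> fst = 0" using Z(3) by (simp add: \<delta>_def tlin_def V_def)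
  moreover have P\<delta>: "push P snd ?z \<delta> = tlin 1 ?\<zeta>P (-1) (push P \<rho> u (svec u V))"
    unfolding \<delta>_def push_tlin Z(2) ..
  have "\<theta> (\<rho> u) (push P snd ?z \<delta>) = 0"
    unfolding P\<delta> using linear_on_tangentD[OF \<theta>lin[OF \<rho>in[OF u]] \<zeta>P Z(4)] \<theta>_svec[OF x y v0(1), of s "\<zeta> fst" "\<theta> (\<rho> u) ?\<zeta>P - \<alpha> y v0"]
    by (simp add: xsy V_def)
  moreover have "push B \<pi> (\<rho> u) (push P snd ?z \<delta>) = tzero"
    unfolding P\<delta> push_tlin v0(2) using \<pi>_svec(2)[OF x y v0(1), of s "\<zeta> fst" "\<theta> (\<rho> u) ?\<zeta>P - \<alpha> y v0"]
    by (simp add: xsy V_def tlin_def tzero_def)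
  moreover have "base_metric m a b gs x (\<pi> (\<rho> u)) tzero tzero = 0"
    unfolding base_metric_def by (intro sum.neutral ballI) (use gs_tzero smooth_map_in[OF \<pi>sm \<rho>in[OF u]] in simp)
  ultimately have g0: "g (\<psi> u) (push M \<Phi> ?z \<delta>) (push M \<Phi> ?z \<delta>) = 0"
    using gform[OF x \<rho>in[OF u], of \<delta> \<delta>] \<delta> by (simp add: zx \<psi>_def)
  have pM: "\<psi> u \<in> pts M" by (rule \<psi>in[OF u])
  have e: "push M \<Phi> ?z \<delta> = tlin 1 \<xi> (-1) (push M \<psi> u (svec u V))"
    unfolding \<delta>_def push_tlin \<zeta>(1)[OF u V] \<zeta>'_def[symmetric] using v(2) by (simp add: \<zeta>_def)
  have t: "push M \<psi> u (svec u V) \<in> tangent M (\<psi> u)"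
    unfolding svec_def by (rule push_pvec_in_tangent[OF oW wM \<psi>sm u V])
  have "push M \<Phi> ?z \<delta> = tzero"
    by (rule g_nonzero[OF pM _ g0]) (unfold e, rule tangent_tlin[OF M pM \<xi> t])
  then have "\<xi> = push M \<psi> u (svec u V)" unfolding e by (auto simp: tlin_def tzero_def fun_eq_iff)
  then show "\<xi> \<in> (\<lambda>V. push M \<psi> u (pvec DX W u V)) ` span DX" using V by (auto simp: svec_def)
qed

text \<open>The horizontal lift of \<open>v\<close> has square length exactly
  \<open>G\<^sub>x(v, v)\<close> in \<open>g\<close>. It is nonzero because \<Phi> has injective
  differential and the lift projects to a nonzero vector of the base.\<close>

lemma G_pos:
  assumes x: "x \<in> I" and y: "y \<in> Y" and v: "v \<in> span D" "v \<noteq> 0"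
  shows "x * G1 y v v + G0 y v v > 0"
proof -
  let ?u = "(x, 0, y)" and ?V = "(0, - \<alpha> y v, v)"
  have u: "?u \<in> W" and V: "?V \<in> span DX" using x y v by (auto simp: DX_iff)
  have t: "push M \<psi> ?u (svec ?u ?V) \<in> tangent M (\<psi> ?u)"
    unfolding svec_def by (rule push_pvec_in_tangent[OF oW wM \<psi>sm u V])
  have eq: "g (\<psi> ?u) (push M \<psi> ?u (svec ?u ?V)) (push M \<psi> ?u (svec ?u ?V)) = x * G1 y v v + G0 y v v"
    using \<beta>_eq[OF x y v(1) v(1), of 0 0 "- \<alpha> y v" 0 "- \<alpha> y v"] by (simp add: \<beta>_def pbf_def svec_def)
  have "push M \<psi> ?u (svec ?u ?V) \<noteq> tzero"
  proof
    assume 0: "push M \<psi> ?u (svec ?u ?V) = tzero"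
    have "push IP k ?u (svec ?u ?V) = tzero"
      by (rule push_\<Phi>_inj[OF kin[OF u] \<zeta>(2)[OF u V]]) (use 0 \<zeta>(1)[OF u V] in simp)
    then have "push B \<pi> (\<rho> ?u) (push P snd (k ?u) tzero) = bvec y v"
      using \<zeta>(3)[OF u V] \<pi>_svec(2)[OF x y v(1)] by simp
    then have "bvec y v = tzero" by (auto simp: push_def tzero_def)
    then show False using Finj[OF y v(1)] v(2) by (simp add: bvec_def)
  qed
  then show ?thesis using riem t \<psi>in[OF u] eq unfolding riemannian_def by metis
qed

lemma push_\<Phi>x:
  assumes x: "x \<in> I" and p: "p \<in> pts P" and \<eta>: "\<eta> \<in> tangent P p"
  shows "push M (\<lambda>p. \<Phi> (x, p)) p \<eta> = push M \<Phi> (x, p) (push IP (\<lambda>p. (x, p)) p \<eta>)"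
    and "push IP (\<lambda>p. (x, p)) p \<eta> \<in> tangent IP (x, p)"
    and "push IP (\<lambda>p. (x, p)) p \<eta> fst = 0"
    and "push P snd (x, p) (push IP (\<lambda>p. (x, p)) p \<eta>) = \<eta>"
proof -
  note s = smooth_map_const_Pair[OF oI x P]
  have z: "(x, p) \<in> pts IP" using x p by (simp add: ptsIP)
  show "push M (\<lambda>p. \<Phi> (x, p)) p \<eta> = push M \<Phi> (x, p) (push IP (\<lambda>p. (x, p)) p \<eta>)"
    using push_compose[OF wIP wM \<Phi>sm, of "\<lambda>p. (x, p)" p \<eta>] z by (simp add: o_def)
  show "push IP (\<lambda>p. (x, p)) p \<eta> \<in> tangent IP (x, p)" by (rule push_in_tangent[OF P wIP s p \<eta>])
  show "push IP (\<lambda>p. (x, p)) p \<eta> fst = 0"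
    using tangent_const[OF wP \<eta>] by (simp add: push_def o_def)
  have "push P (snd \<circ> (\<lambda>p. (x, p))) p \<eta> = \<eta>" by (rule push_ident[OF wP \<eta> _ p]) simp
  then show "push P snd (x, p) (push IP (\<lambda>p. (x, p)) p \<eta>) = \<eta>"
    using push_compose[OF wIP wP sndsm, of "\<lambda>p. (x, p)" p \<eta>] z by simp
qed

end

section \<open>The complex structure and the curvature of the connection\<close>

lemma smooth_on_affine:
  "oset D W \<Longrightarrow> bounded_linear L \<Longrightarrow> smooth_on D W (\<lambda>u. L u + c)"
  by (rule smooth_on_add[OF _ smooth_on_bounded_linear[OF _ _ smooth_on_ident] smooth_on_const])

lemma smooth_on_real_derivative:
  fixes f :: "real \<Rightarrow> real"
  assumes "open I" "smooth_on Basis I f" "x \<in> I"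
  shows "(f has_real_derivative dd f 1 x) (at x)"
proof -
  have "((\<lambda>t. f (x + t *\<^sub>R 1)) has_vector_derivative dd f 1 x) (at 0)"
    by (rule smooth_on_line[OF oset_Basis[OF assms(1)] assms(2,3) real_in_span])
  then show ?thesis
    using DERIV_shift[of f "dd f 1 x" 0 x] by (simp add: has_real_derivative_iff_has_vector_derivative add.commute)
qed

context base_param
begin

lemma \<alpha>_zero: "y \<in> Y \<Longrightarrow> \<alpha> y 0 = 0"
  by (rule slin_zero[OF \<alpha>_lin subspace_span])

lemma G_zero: "y \<in> Y \<Longrightarrow> v \<in> span D \<Longrightarrow> x * G1 y 0 v + G0 y 0 v = 0"
   "y \<in> Y \<Longrightarrow> v \<in> span D \<Longrightarrow> x * G1 y v 0 + G0 y v 0 = 0"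
  by (simp_all add: lform.zero_args[OF G1_lform] lform.zero_args[OF G0_lform])

text \<open>\<open>h\<close> is the square length of the fibre direction along an
  \<open>x\<close>-line, hence a restriction of a smooth component of \<open>g\<close>.\<close>

lemma h_smooth:
  assumes y: "y \<in> Y"
  shows "smooth_on Basis I h"
proof -
  let ?T = "(0, 1, 0) :: real \<times> real \<times> 'f"
  note oBI = oset_Basis[OF oI]
  have T: "?T \<in> span DX" by (simp add: DX_iff span_zero)
  have bl: "bounded_linear (\<lambda>x. (x::real, 0::real, 0::'f))"
    by (intro bounded_linear_Pair bounded_linear_ident bounded_linear_zero)
  have s: "smooth_on Basis I (\<lambda>x. (x, 0::real, y))"
    by (rule smooth_on_cong[OF oBI smooth_on_affine[OF oBI bl, of "(0, 0, y)"]]) simp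
  have "smooth_on Basis I (\<lambda>x. \<beta> (x, 0, y) ?T ?T)"
    by (rule smooth_on_compose[OF oW oBI lform.sm[OF \<beta>_lform T T] s]) (use y in auto)
  then show ?thesis
    by (rule smooth_on_cong[OF oBI])
      (simp add: \<beta>_eq y span_zero \<alpha>_zero G_zero)
qed

text \<open>\<open>h x * \<alpha> y v\<close> is the product under \<open>g\<close> of the fibre
  direction with the base direction \<open>v\<close>; fixing \<open>x\<close> and dividing by
  \<open>h x\<close> leaves \<alpha>.\<close>

lemma \<alpha>_smooth:
  assumes v: "v \<in> span D"
  shows "smooth_on D Y (\<lambda>y. \<alpha> y v)"
proof -
  obtain x where x: "x \<in> I" using I(2) by blast
  let ?T = "(0, 1, 0) :: real \<times> real \<times> 'f"
  have T: "?T \<in> span DX" "(0, 0, v) \<in> span DX" using v by (simp_all add: DX_iff span_zero)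
  have bl: "bounded_linear (\<lambda>y. (0::real, 0::real, y::'f))"
    by (intro bounded_linear_Pair bounded_linear_ident bounded_linear_zero)
  have s: "smooth_on D Y (\<lambda>y. (x, 0::real, y))"
    by (rule smooth_on_cong[OF oY smooth_on_affine[OF oY bl, of "(x, 0, 0)"]]) simp
  have "smooth_on D Y (\<lambda>y. \<beta> (x, 0, y) ?T (0, 0, v))"
    by (rule smooth_on_compose[OF oW oY lform.sm[OF \<beta>_lform T] s]) (use x in auto)
  then have "smooth_on D Y (\<lambda>y. 1 / h x * \<beta> (x, 0, y) ?T (0, 0, v))"
    by (intro smooth_on_mult smooth_on_const oY)
  then show ?thesis
    by (rule smooth_on_cong[OF oY])
      (use hpos[OF x] in \<open>simp add: \<beta>_eq x v span_zero \<alpha>_zero G_zero\<close>)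
qed

lemma h_derivs:
  assumes y: "y \<in> Y" and x: "x \<in> I"
  shows "(h has_real_derivative dd h 1 x) (at x)" "(dd h 1 has_real_derivative dd (dd h 1) 1 x) (at x)"
  using smooth_on_real_derivative[OF oI h_smooth[OF y] x]
    smooth_on_real_derivative[OF oI smooth_on_dd[OF oset_Basis[OF oI] h_smooth[OF y] real_in_span] x] .

lemma cohom_one_metric:
  assumes y: "y \<in> Y"
  shows "cohom_one_metric D Y I \<beta> h (dd h 1) (dd (dd h 1) 1) \<alpha> G0 G1"
  unfolding cohom_one_metric_def cohom_one_metric_axioms_def
  using \<beta>_lform oY oI hpos h_derivs[OF y] \<alpha>_smooth G0_lform G1_lform \<alpha>_lin \<beta>_eq by (intro conjI) blast+

definition "jj y v = (SOME w. w \<in> span D \<and> bvec y w = JB (F y) (bvec y v))"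

lemma JBcs: "complex_structure B JB"
  using CF by (simp add: cohom_one_form_def)

lemma jj:
  assumes "y \<in> Y" "v \<in> span D"
  shows "jj y v \<in> span D" "bvec y (jj y v) = JB (F y) (bvec y v)"
proof -
  have "JB (F y) (bvec y v) \<in> tangent B (F y)"
    using JBcs bvec_in[OF assms] Fin[OF assms(1)] unfolding complex_structure_def smooth_endo_def by blast
  then have "\<exists>w. w \<in> span D \<and> bvec y w = JB (F y) (bvec y v)"
    using Fsurj[OF assms(1)] by (force simp: bvec_def)
  then show "jj y v \<in> span D" "bvec y (jj y v) = JB (F y) (bvec y v)"
    unfolding jj_def using someI_ex[of "\<lambda>w. w \<in> span D \<and> bvec y w = JB (F y) (bvec y v)"] by blast+
qed

definition "mvec u V = push M \<psi> u (svec u V)"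

lemma mvec_in: "u \<in> W \<Longrightarrow> V \<in> span DX \<Longrightarrow> mvec u V \<in> tangent M (\<psi> u)"
  unfolding mvec_def svec_def by (rule push_pvec_in_tangent[OF oW wM \<psi>sm])

lemma mvec_lin: "u \<in> W \<Longrightarrow> V \<in> span DX \<Longrightarrow> V' \<in> span DX \<Longrightarrow> mvec u (s *\<^sub>R V + t *\<^sub>R V') = tlin s (mvec u V) t (mvec u V')"
  unfolding mvec_def by (simp add: svec_lin push_tlin)

lemma g_mvec: "g (\<psi> u) (mvec u V) (mvec u V') = \<beta> u V V'"
  by (simp add: \<beta>_def pbf_def mvec_def svec_def)

lemma J_mvec_N:
  assumes x: "x \<in> I" and y: "y \<in> Y"
  shows "J (\<psi> (x, s, y)) (mvec (x, s, y) (1, 0, 0)) = mvec (x, s, y) (0, 1 / h x, 0)"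
proof -
  let ?u = "(x, s, y)"
  have u: "?u \<in> W" using x y by simp
  have "velocity M (\<lambda>s'. \<Phi> (x, R s' (\<rho> ?u))) 0 = mvec ?u (0, 1, 0)"
    using push_shift(1)[OF x y wM \<psi>sm, of s] Radd[OF \<sigma>in[OF y]] by (simp add: \<psi>_def k_def \<rho>_def mvec_def)
  moreover have "velocity M (\<lambda>x'. \<Phi> (x', \<rho> ?u)) x = mvec ?u (1, 0, 0)"
    using push_shift(2)[OF x y wM \<psi>sm, of s] by (simp add: \<psi>_def k_def \<rho>_def mvec_def)
  moreover have "mvec ?u (0, 1 / h x, 0) = tlin (1 / h x) (mvec ?u (0, 1, 0)) 0 (mvec ?u (0, 1, 0))"
    using mvec_lin[OF u, of "(0, 1, 0)" "(0, 1, 0)" "1 / h x" 0] by (simp add: DX_iff span_zero)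
  ultimately show ?thesis
    using Jx[OF x \<rho>in[OF u]] by (simp add: \<psi>_def k_def tlin_def)
qed

lemma J_mvec_T:
  assumes x: "x \<in> I" and y: "y \<in> Y"
  shows "J (\<psi> (x, s, y)) (mvec (x, s, y) (0, 1, 0)) = mvec (x, s, y) (- h x, 0, 0)"
proof -
  let ?u = "(x, s, y)"
  have u: "?u \<in> W" using x y by simp
  have D: "(1, 0, 0) \<in> span DX" "(0, 1 / h x, 0) \<in> span DX" by (simp_all add: DX_iff span_zero)
  have "mvec ?u (0, 1, 0) = tlin (h x) (mvec ?u (0, 1 / h x, 0)) 0 (mvec ?u (0, 1 / h x, 0))"
    using mvec_lin[OF u D(2) D(2), of "h x" 0] hpos[OF x] by simp
  also have "mvec ?u (0, 1 / h x, 0) = J (\<psi> ?u) (mvec ?u (1, 0, 0))" by (rule J_mvec_N[OF x y, symmetric])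
  finally have "J (\<psi> ?u) (mvec ?u (0, 1, 0)) = tlin (h x) (tlin (-1) (mvec ?u (1, 0, 0)) 0 (mvec ?u (1, 0, 0))) 0
      (tlin (-1) (mvec ?u (1, 0, 0)) 0 (mvec ?u (1, 0, 0)))"
    using J_lin[OF \<psi>in[OF u] J_in J_in, OF \<psi>in[OF u] mvec_in[OF u D(1)] \<psi>in[OF u] mvec_in[OF u D(1)]]
      JJ[OF \<psi>in[OF u] mvec_in[OF u D(1)]] by simp
  also have "\<dots> = mvec ?u (- h x, 0, 0)"
    using mvec_lin[OF u D(1) D(1), of "- h x" 0] by (simp add: tlin_def)
  finally show ?thesis .
qed

lemma \<Phi>xsm: "x \<in> I \<Longrightarrow> smooth_map P M (\<lambda>p. \<Phi> (x, p))"
  using smooth_map_compose[OF wP wIP wM smooth_map_const_Pair[OF oI _ P] \<Phi>sm] by (simp add: o_def)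

text \<open>\<open>Jhor\<close> yields some horizontal vector over the rotated base vector. On its
  difference from the horizontal lift of \<open>jj y v\<close> the forms \<open>dx\<close> and
  \<theta> and the differential of \<pi> vanish, so the difference has length 0 in \<open>g\<close>
  and is zero.\<close>

lemma J_mvec_X:
  assumes x: "x \<in> I" and y: "y \<in> Y" and v: "v \<in> span D"
  shows "J (\<psi> (x, s, y)) (mvec (x, s, y) (0, - \<alpha> y v, v)) = mvec (x, s, y) (0, - \<alpha> y (jj y v), jj y v)"
proof -
  let ?u = "(x, s, y)"
  let ?p = "\<rho> ?u"
  have u: "?u \<in> W" using x y by simp
  have p: "?p \<in> pts P" by (rule \<rho>in[OF u])
  have \<psi>u: "\<psi> ?u = \<Phi> (x, ?p)" by (simp add: \<psi>_def k_def)
  define \<xi> where "\<xi> w = push P \<rho> ?u (svec ?u (0, - \<alpha> y w, w))" for w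
  have \<xi>: "\<xi> w \<in> tangent P ?p" "\<theta> ?p (\<xi> w) = 0" "push B \<pi> ?p (\<xi> w) = bvec y w"
      "mvec ?u (0, - \<alpha> y w, w) = push M (\<lambda>p. \<Phi> (x, p)) ?p (\<xi> w)" if w: "w \<in> span D" for w
  proof -
    have V: "(0, - \<alpha> y w, w) \<in> span DX" using w by (simp add: DX_iff)
    show "\<xi> w \<in> tangent P ?p" unfolding \<xi>_def by (rule \<zeta>(5)[OF u V])
    show "\<theta> ?p (\<xi> w) = 0" unfolding \<xi>_def \<theta>_svec[OF x y w] by simp
    show "push B \<pi> ?p (\<xi> w) = bvec y w" unfolding \<xi>_def by (rule \<pi>_svec(2)[OF x y w])
    have "mvec ?u (0, - \<alpha> y w, w) = push M (\<lambda>u. \<psi> (x, snd u)) ?u (svec ?u (0, - \<alpha> y w, w))"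
      unfolding mvec_def by (rule push_embed(4)[OF x y wM \<psi>sm w, symmetric])
    also have "(\<lambda>u. \<psi> (x, snd u)) = (\<lambda>p. \<Phi> (x, p)) \<circ> \<rho>" by (auto simp: \<psi>_def k_def \<rho>_def)
    also have "push M \<dots> ?u (svec ?u (0, - \<alpha> y w, w)) = push M (\<lambda>p. \<Phi> (x, p)) ?p (\<xi> w)"
      unfolding \<xi>_def by (rule push_compose[where f = \<rho>, OF wP wM \<Phi>xsm[OF x] p])
    finally show "mvec ?u (0, - \<alpha> y w, w) = push M (\<lambda>p. \<Phi> (x, p)) ?p (\<xi> w)" .
  qed
  note w = jj[OF y v]
  have bF: "\<pi> ?p = F y" by (rule \<pi>_svec(1)[OF x y v])
  obtain \<eta> where \<eta>: "\<eta> \<in> tangent P ?p" "\<theta> ?p \<eta> = 0" "push B \<pi> ?p \<eta> = JB (\<pi> ?p) (push B \<pi> ?p (\<xi> v))"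
    "J (\<Phi> (x, ?p)) (push M (\<lambda>p. \<Phi> (x, p)) ?p (\<xi> v)) = push M (\<lambda>p. \<Phi> (x, p)) ?p \<eta>"
    by (rule Jhor[OF x p \<xi>(1,2)[OF v]])
  define \<delta> where "\<delta> = tlin 1 \<eta> (-1) (\<xi> (jj y v))"
  have \<delta>: "\<delta> \<in> tangent P ?p" unfolding \<delta>_def by (rule tangent_tlin[OF P p \<eta>(1) \<xi>(1)[OF w(1)]])
  have \<theta>\<delta>: "\<theta> ?p \<delta> = 0"
    unfolding \<delta>_def using linear_on_tangentD[OF \<theta>lin[OF p] \<eta>(1) \<xi>(1)[OF w(1)]] \<eta>(2) \<xi>(2)[OF w(1)] by simp
  have \<pi>\<delta>: "push B \<pi> ?p \<delta> = tzero"
    unfolding \<delta>_def push_tlin \<eta>(3) \<xi>(3)[OF v] \<xi>(3)[OF w(1)] bF w(2) by (simp add: tlin_def tzero_def)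
  have m: "push M (\<lambda>p. \<Phi> (x, p)) ?p \<delta> = tlin 1 (J (\<psi> ?u) (mvec ?u (0, - \<alpha> y v, v))) (-1) (mvec ?u (0, - \<alpha> y (jj y v), jj y v))"
    unfolding \<delta>_def push_tlin \<xi>(4)[OF v] \<xi>(4)[OF w(1)] \<psi>u \<eta>(4) ..
  note px = push_\<Phi>x[OF x p \<delta>]
  have "base_metric m a b gs x (\<pi> ?p) tzero tzero = 0"
    unfolding base_metric_def by (intro sum.neutral ballI) (use gs_tzero smooth_map_in[OF \<pi>sm p] in simp)
  then have g0: "g (\<Phi> (x, ?p)) (push M (\<lambda>p. \<Phi> (x, p)) ?p \<delta>) (push M (\<lambda>p. \<Phi> (x, p)) ?p \<delta>) = 0"
    using gform[OF x p px(2) px(2)] by (simp add: px \<theta>\<delta> \<pi>\<delta>)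
  have "push M (\<lambda>p. \<Phi> (x, p)) ?p \<delta> = tzero"
    by (rule g_nonzero[OF _ push_in_tangent[OF P wM \<Phi>xsm[OF x] p \<delta>] g0]) (use \<psi>in[OF u] \<psi>u in simp)
  then show ?thesis unfolding m by (auto simp: tlin_def tzero_def fun_eq_iff)
qed

end

text \<open>A form \<open>c\<close> diagonal in the frame satisfies
  \<open>c (j e) f = b (j e) f * \<kappa>\<^sub>f\<close> with the ratio of \<open>c\<close> to
  \<open>b\<close> at \<open>f\<close> as factor. Summing the squares over \<open>e\<close> leaves
  the square length of \<open>j f\<close>, which equals that of \<open>f\<close>. For
  \<open>c = G1\<close> the left side is the norm of \<open>d\<alpha>\<close>.\<close>

lemma frame_hermitian_trace:
  assumes bf: "symform V b" and cf: "symform V c" and E: "frame V b E"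
    and diag: "\<And>e f. e \<in> E \<Longrightarrow> f \<in> E \<Longrightarrow> e \<noteq> f \<Longrightarrow> c e f = 0"
    and jV: "\<And>v. v \<in> V \<Longrightarrow> j v \<in> V"
    and herm: "\<And>v w. v \<in> V \<Longrightarrow> w \<in> V \<Longrightarrow> b (j v) (j w) = b v w"
    and anti: "\<And>v w. v \<in> V \<Longrightarrow> w \<in> V \<Longrightarrow> b (j v) w = - b (j w) v"
  shows "(\<Sum>e\<in>E. \<Sum>f\<in>E. (c (j e) f)\<^sup>2 / (b e e * b f f)) = (\<Sum>f\<in>E. (c f f / b f f)\<^sup>2)"
proof -
  have EV: "e \<in> V" if "e \<in> E" for e by (rule frame_in[OF E that])
  have fin: "finite E" using E by (simp add: frame_def)
  have c: "c (j e) f = b (j e) f * (c f f / b f f)" if e: "e \<in> E" and f: "f \<in> E" for e f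
  proof -
    have "c (j e) f = (\<Sum>k\<in>E. b (j e) k * c k f / b k k)"
      by (rule slin_frame_expand[OF bf E jV[OF EV[OF e]] symform_slin1[OF cf EV[OF f]]])
    also have "\<dots> = (\<Sum>k\<in>E. if k = f then b (j e) f * (c f f / b f f) else 0)"
      by (rule sum.cong) (use diag f in auto)
    finally show ?thesis using fin f by simp
  qed
  have t: "(\<Sum>e\<in>E. (b (j e) f)\<^sup>2 / b e e) = b f f" if f: "f \<in> E" for f
  proof -
    have "b f f = b (j f) (j f)" using herm EV f by simp
    also have "\<dots> = (\<Sum>e\<in>E. b (j f) e * b (j f) e / b e e)"
      by (rule slin_frame_expand[OF bf E jV[OF EV[OF f]] symform_slin2[OF bf jV[OF EV[OF f]]]])
    also have "\<dots> = (\<Sum>e\<in>E. (b (j e) f)\<^sup>2 / b e e)"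
    proof (rule sum.cong)
      fix e assume e: "e \<in> E"
      show "b (j f) e * b (j f) e / b e e = (b (j e) f)\<^sup>2 / b e e"
        unfolding anti[OF EV[OF f] EV[OF e]] by (simp add: power2_eq_square)
    qed simp
    finally show ?thesis by simp
  qed
  have "(\<Sum>e\<in>E. \<Sum>f\<in>E. (c (j e) f)\<^sup>2 / (b e e * b f f)) = (\<Sum>f\<in>E. \<Sum>e\<in>E. (c (j e) f)\<^sup>2 / (b e e * b f f))"
    by (rule sum.swap)
  also have "\<dots> = (\<Sum>f\<in>E. (c f f / b f f)\<^sup>2 / b f f * (\<Sum>e\<in>E. (b (j e) f)\<^sup>2 / b e e))"
    unfolding sum_distrib_left by (intro sum.cong refl) (simp add: c power_mult_distrib mult_ac power_divide)
  also have "\<dots> = (\<Sum>f\<in>E. (c f f / b f f)\<^sup>2)"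
    by (rule sum.cong) (use t frame_pos[OF E] in \<open>auto simp: less_imp_neq[symmetric]\<close>)
  finally show ?thesis .
qed

section \<open>The Kaehler form in the moment coordinates, and the curvature of the
  connection\<close>

context base_param
begin

definition "\<Omega> = pbf M (kaehler_form g J) DX W \<psi>"

lemma \<Omega>_eq: "\<Omega> u V V' = g (\<psi> u) (J (\<psi> u) (mvec u V)) (mvec u V')"
  by (simp add: \<Omega>_def pbf_def mvec_def svec_def kaehler_form_def)

lemma \<Omega>_anti: "u \<in> W \<Longrightarrow> V \<in> span DX \<Longrightarrow> V' \<in> span DX \<Longrightarrow> \<Omega> u V V' = - \<Omega> u V' V"
  unfolding \<Omega>_eq by (rule g_J_anti[OF \<psi>in mvec_in mvec_in])

lemma \<Omega>_N:
  assumes x: "x \<in> I" and y: "y \<in> Y" and v: "v \<in> span D"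
  shows "\<Omega> (x, s, y) (1, 0, 0) (0, 0, v) = \<alpha> y v"
  unfolding \<Omega>_eq J_mvec_N[OF x y] g_mvec
  using hpos[OF x] by (simp add: \<beta>_eq x y v span_zero \<alpha>_zero G_zero)

lemma \<Omega>_X:
  assumes x: "x \<in> I" and y: "y \<in> Y" and v: "v \<in> span D" and w: "w \<in> span D"
  shows "\<Omega> (x, s, y) (0, 0, v) (0, 0, w) = x * G1 y (jj y v) w + G0 y (jj y v) w"
proof -
  let ?u = "(x, s, y)"
  have u: "?u \<in> W" using x y by simp
  have D: "(0, - \<alpha> y v, v) \<in> span DX" "(0, 1, 0) \<in> span DX" "(0, 0, w) \<in> span DX"
    using v w by (simp_all add: DX_iff span_zero)
  have "mvec ?u (0, 0, v) = tlin 1 (mvec ?u (0, - \<alpha> y v, v)) (\<alpha> y v) (mvec ?u (0, 1, 0))"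
    using mvec_lin[OF u D(1,2), of 1 "\<alpha> y v"] by simp
  then have "\<Omega> ?u (0, 0, v) (0, 0, w) = \<Omega> ?u (0, - \<alpha> y v, v) (0, 0, w) + \<alpha> y v * \<Omega> ?u (0, 1, 0) (0, 0, w)"
    unfolding \<Omega>_eq using g_lin1[OF \<psi>in[OF u] J_in[OF \<psi>in[OF u] mvec_in[OF u D(1)]] J_in[OF \<psi>in[OF u] mvec_in[OF u D(2)]] mvec_in[OF u D(3)], of 1 "\<alpha> y v"]
    by (simp add: J_lin[OF \<psi>in[OF u] mvec_in[OF u D(1)] mvec_in[OF u D(2)]])
  also have "\<Omega> ?u (0, 1, 0) (0, 0, w) = 0"
    unfolding \<Omega>_eq J_mvec_T[OF x y] g_mvec by (simp add: \<beta>_eq x y w span_zero \<alpha>_zero G_zero)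
  also have "\<Omega> ?u (0, - \<alpha> y v, v) (0, 0, w) = x * G1 y (jj y v) w + G0 y (jj y v) w"
    unfolding \<Omega>_eq J_mvec_X[OF x y v] g_mvec by (simp add: \<beta>_eq x y w jj[OF y v])
  finally show ?thesis by simp
qed

text \<open>The \<open>(\<partial>\<^sub>x, v, w)\<close> component of \<open>d\<omega> = 0\<close>: the \<open>x\<close>-derivative of \<open>\<omega>(v, w)\<close> balances \<open>d\<alpha>(v, w)\<close>.\<close>

lemma curvature_of_\<alpha>:
  assumes y: "y \<in> Y" and v: "v \<in> span D" and w: "w \<in> span D"
  shows "dd (\<lambda>y. \<alpha> y w) v y - dd (\<lambda>y. \<alpha> y v) w y = G1 y (jj y v) w"
proof -
  obtain x where x: "x \<in> I" using I(2) by blast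
  let ?u = "(x, 0, y)"
  have u: "?u \<in> W" using x y by simp
  have D: "(1, 0, 0) \<in> span DX" "(0, 0, v) \<in> span DX" "(0, 0, w) \<in> span DX"
    using v w by (simp_all add: DX_iff span_zero)
  have "dd (\<lambda>u. \<Omega> u (0, 0, v) (0, 0, w)) (1, 0, 0) ?u = G1 y (jj y v) w"
  proof (rule dd_eqI, rule has_vector_derivative_cong_nhds)
    show "\<forall>\<^sub>F t in nhds 0. (x + t) * G1 y (jj y v) w + G0 y (jj y v) w = \<Omega> (?u + t *\<^sub>R (1, 0, 0)) (0, 0, v) (0, 0, w)"
      using oset_ev_line[OF oW u D(1)] by eventually_elim (simp add: \<Omega>_X y v w)
    show "((\<lambda>t. (x + t) * G1 y (jj y v) w + G0 y (jj y v) w) has_vector_derivative G1 y (jj y v) w) (at 0)"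
      unfolding has_real_derivative_iff_has_vector_derivative[symmetric] by (auto intro!: derivative_eq_intros)
  qed
  moreover have d: "dd (\<lambda>u. \<Omega> u (1, 0, 0) (0, 0, w)) (0, 0, v) ?u = dd (\<lambda>y. \<alpha> y w) v y"
    if v: "v \<in> span D" and w: "w \<in> span D" for v w
  proof (rule dd_eqI, rule has_vector_derivative_cong_nhds)
    have "(0, 0, v) \<in> span DX" using v by (simp add: DX_iff)
    from oset_ev_line[OF oW u this]
    show "\<forall>\<^sub>F t in nhds 0. \<alpha> (y + t *\<^sub>R v) w = \<Omega> (?u + t *\<^sub>R (0, 0, v)) (1, 0, 0) (0, 0, w)"
      by eventually_elim (simp add: \<Omega>_N w)
  qed (rule smooth_on_line[OF oY \<alpha>_smooth[OF w] y v])
  moreover have "dd (\<lambda>u. \<Omega> u (0, 0, w) (1, 0, 0)) (0, 0, v) ?u = - dd (\<lambda>y. \<alpha> y w) v y"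
  proof (rule dd_eqI, rule has_vector_derivative_cong_nhds)
    from oset_ev_line[OF oW u D(2)]
    show "\<forall>\<^sub>F t in nhds 0. - \<alpha> (y + t *\<^sub>R v) w = \<Omega> (?u + t *\<^sub>R (0, 0, v)) (0, 0, w) (1, 0, 0)"
      by eventually_elim (subst \<Omega>_anti[OF _ D(3,1)], simp_all add: \<Omega>_N w)
  qed (rule has_vector_derivative_minus[OF smooth_on_line[OF oY \<alpha>_smooth[OF w] y v]])
  moreover have "dd (\<lambda>u. \<Omega> u (0, 0, v) (0, 0, w)) (1, 0, 0) ?u + dd (\<lambda>u. \<Omega> u (0, 0, w) (1, 0, 0)) (0, 0, v) ?u
      + dd (\<lambda>u. \<Omega> u (1, 0, 0) (0, 0, v)) (0, 0, w) ?u = 0"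
    unfolding \<Omega>_def
    by (rule closed2_pullback[OF oW M \<psi>sm closed _ _ _ u D]) (fact kaehler_form_components[OF K])+
  ultimately show ?thesis using d[OF w v] by simp
qed

lemma Gx_symform: "y \<in> Y \<Longrightarrow> symform (span D) (\<lambda>v w. x * G1 y v w + G0 y v w)"
  using symform_sym[OF lform.sf[OF G1_lform]] symform_sym[OF lform.sf[OF G0_lform]]
  unfolding symform_def by (auto intro!: slin_intros lform.lin1[OF G1_lform] lform.lin1[OF G0_lform] simp: subspace_span)

lemma Gx_hermitian:
  assumes x: "x \<in> I" and y: "y \<in> Y" and v: "v \<in> span D" and w: "w \<in> span D"
  shows "x * G1 y (jj y v) (jj y w) + G0 y (jj y v) (jj y w) = x * G1 y v w + G0 y v w"
    and "x * G1 y (jj y v) w + G0 y (jj y v) w = - (x * G1 y (jj y w) v + G0 y (jj y w) v)"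
proof -
  let ?u = "(x, 0, y)"
  have u: "?u \<in> W" using x y by simp
  have D: "(0, a, v) \<in> span DX" "(0, a, w) \<in> span DX" for a
    using v w by (simp_all add: DX_iff)
  show "x * G1 y (jj y v) w + G0 y (jj y v) w = - (x * G1 y (jj y w) v + G0 y (jj y w) v)"
    using \<Omega>_anti[OF u D(1)[of 0] D(2)[of 0]] unfolding \<Omega>_X[OF x y v w] \<Omega>_X[OF x y w v] .
  have "\<beta> ?u (0, - \<alpha> y (jj y v), jj y v) (0, - \<alpha> y (jj y w), jj y w) = \<beta> ?u (0, - \<alpha> y v, v) (0, - \<alpha> y w, w)"
    using herm[OF \<psi>in[OF u] mvec_in[OF u D(1)[of "- \<alpha> y v"]] mvec_in[OF u D(2)[of "- \<alpha> y w"]]]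
    unfolding J_mvec_X[OF x y v] J_mvec_X[OF x y w] g_mvec .
  then show "x * G1 y (jj y v) (jj y w) + G0 y (jj y v) (jj y w) = x * G1 y v w + G0 y v w"
    by (simp add: \<beta>_eq x y v w jj[OF y])
qed

text \<open>By \<open>curvature_of_\<alpha>\<close> and the trace identity the square of
  \<open>d\<alpha>\<close> is the sum of \<kappa>^2, so the coefficients 3/4 and -1/4 of
  \<open>scal_cohom_one\<close> merge into 1/2.\<close>

theorem scalar_curvature_local:
  assumes x: "x \<in> I" and y: "y \<in> Y"
    and E: "frame (span D) (\<lambda>v w. x * G1 y v w + G0 y v w) E"
    and diag: "\<And>e f. e \<in> E \<Longrightarrow> f \<in> E \<Longrightarrow> e \<noteq> f \<Longrightarrow> G1 y e f = 0"
  defines "\<kappa> \<equiv> \<lambda>e. G1 y e e / (x * G1 y e e + G0 y e e)"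
  shows "scalar_curvature M g (\<Phi> (x, \<sigma> y)) = scal (\<lambda>y v w. x * G1 y v w + G0 y v w) E y
      - dd (dd h 1) 1 x - dd h 1 x * (\<Sum>e\<in>E. \<kappa> e) + h x / 2 * (\<Sum>e\<in>E. (\<kappa> e)\<^sup>2) - h x / 4 * (\<Sum>e\<in>E. \<kappa> e)\<^sup>2"
proof -
  interpret C: cohom_one_metric D Y I \<beta> h "dd h 1" "dd (dd h 1) 1" \<alpha> G0 G1 by (rule cohom_one_metric[OF y])
  have G: "C.G x = (\<lambda>y v w. x * G1 y v w + G0 y v w)" by (intro ext) (rule C.G_def)
  have E': "frame (span D) (C.G x y) E" using E by (simp only: G)
  let ?E = "{(1, 0, 0), (0, 1, 0)} \<union> (\<lambda>e. (0, - \<alpha> y e, e)) ` E"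
  have u: "(x, 0, y) \<in> W" using x y by simp
  have "\<psi> (x, 0, y) = \<Phi> (x, \<sigma> y)" using R0[OF \<sigma>in[OF y]] by (simp add: \<psi>_def k_def \<rho>_def)
  then have "scalar_curvature M g (\<Phi> (x, \<sigma> y)) = scal \<beta> ?E (x, 0, y)"
    using pbf_scal[OF oW riem \<psi>sm u \<psi>_surj[OF u] C.xframe[OF x y E', of 0, unfolded \<beta>_def]] by (simp add: \<beta>_def)
  also have "\<dots> = scal (C.G x) E y - dd (dd h 1) 1 x - dd h 1 x * (\<Sum>e\<in>E. \<kappa> e) + 3 / 4 * h x * (\<Sum>e\<in>E. (\<kappa> e)\<^sup>2)
      - h x / 4 * (\<Sum>e\<in>E. \<Sum>f\<in>E. (C.A e f y - C.A f e y)\<^sup>2 / (C.G x y e e * C.G x y f f)) - h x / 4 * (\<Sum>e\<in>E. \<kappa> e)\<^sup>2"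
    unfolding \<kappa>_def using C.scal_cohom_one[OF x y E' diag, of 0] by (simp add: C.G_def)
  also have "(\<Sum>e\<in>E. \<Sum>f\<in>E. (C.A e f y - C.A f e y)\<^sup>2 / (C.G x y e e * C.G x y f f))
      = (\<Sum>e\<in>E. \<Sum>f\<in>E. (G1 y (jj y e) f)\<^sup>2 / (C.G x y e e * C.G x y f f))"
    by (intro sum.cong refl) (use curvature_of_\<alpha>[OF y] frame_in[OF E] in \<open>simp add: C.A_def\<close>)
  also have "\<dots> = (\<Sum>e\<in>E. (\<kappa> e)\<^sup>2)"
    unfolding \<kappa>_def C.G_def
    by (rule frame_hermitian_trace[where b = "\<lambda>v w. x * G1 y v w + G0 y v w" and c = "G1 y" and j = "jj y",
          OF Gx_symform[OF y] lform.sf[OF G1_lform y] E diag jj(1)[OF y] Gx_hermitian[OF x y]])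
  finally show ?thesis unfolding G by argo
qed

end

section \<open>The scalar curvature as a function of the moment coordinate\<close>

lemma smooth_map_euc_restrict:
  assumes "smooth_map (euc D W) M F" "oset D W" "oset D W'" "W' \<subseteq> W" "wmfd M"
  shows "smooth_map (euc D W') M F"
proof -
  have "smooth_map (euc D W') (euc D W) (\<lambda>x. x)"
    by (rule smooth_map_bounded_linear[OF assms(3,2) bounded_linear_ident]) (use assms(4) in auto)
  from smooth_map_compose[OF wmfd_euc[OF assms(3)] wmfd_euc[OF assms(2)] assms(5) this assms(1)]
  show ?thesis by (simp add: o_def)
qed

lemma push_pvec_restrict:
  assumes F: "smooth_map (euc D W) M F" and o: "oset D W" "oset D W'" "W' \<subseteq> W" and M: "wmfd M" and u: "u \<in> W'" and v: "v \<in> span D"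
  shows "push M F u (pvec D W' u v) = push M F u (pvec D W u v)"
proof -
  have uW: "u \<in> W" using u o by blast
  obtain c where c: "c \<in> atlas M" "F u \<in> fst c" using smooth_map_in[OF F] wmfdD(2)[OF M] uW by fastforce
  show ?thesis
    unfolding push_pvec[OF o(2) M smooth_map_euc_restrict[OF F o M] u c v] push_pvec[OF o(1) M F uW c v] ..
qed

context kaehler_cohom_one
begin

text \<open>The local formula with the ratio \<open>b j / A_coef a b j x\<close> counted
  \<open>d j\<close> times and the scalar curvature of the base metric replaced by the sum of the
  \<open>d j / A_coef a b j x\<close>.\<close>

definition "Sc x = (\<Sum>j=1..m. real (d j) / A_coef a b j x) - dd (dd h 1) 1 x
  - dd h 1 x * (\<Sum>j=1..m. real (d j) * (b j / A_coef a b j x))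
  + h x / 2 * (\<Sum>j=1..m. real (d j) * (b j / A_coef a b j x)\<^sup>2)
  - h x / 4 * (\<Sum>j=1..m. real (d j) * (b j / A_coef a b j x))\<^sup>2"

text \<open>A local section of the bundle meets the fibre of \<open>p\<close> at some point, in
  general another one; translating the section by the flow makes it pass through \<open>p\<close>.
  The parameter domain shrinks to where the section lives.\<close>

lemma base_param_through:
  fixes D Y :: "'f::euclidean_space set" and F :: "'f \<Rightarrow> 'q"
  assumes oY: "oset D Y" and F: "smooth_map (euc D Y) B F" and y0: "y0 \<in> Y" and p: "p \<in> pts P" "\<pi> p = F y0"
    and surj: "\<And>y. y \<in> Y \<Longrightarrow> tangent B (F y) \<subseteq> (\<lambda>v. push B F y (pvec D Y y v)) ` span D"
    and inj: "\<And>y v. y \<in> Y \<Longrightarrow> v \<in> span D \<Longrightarrow> push B F y (pvec D Y y v) = tzero \<Longrightarrow> v = 0"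
  obtains Y' \<sigma> where "base_param M g J I P B \<Phi> \<pi> R \<tau> \<theta> JB m d a b gs h D Y' F \<sigma>" "y0 \<in> Y'" "Y' \<subseteq> Y" "\<sigma> y0 = p"
proof -
  have Fy: "F y0 \<in> pts B" using smooth_map_in[OF F] y0 by simp
  obtain W \<sigma>0 where W: "openin (topo B) W" "F y0 \<in> W" "smooth_map (open_sub B W) P \<sigma>0" "\<And>u. u \<in> W \<Longrightarrow> \<pi> (\<sigma>0 u) = u"
    using sections[OF Fy] by blast
  have WB: "W \<subseteq> pts B" using W(1) openin_subset by blast
  have \<sigma>0: "\<sigma>0 u \<in> pts P" if "u \<in> W" for u
    using smooth_map_in[OF W(3)] that WB by (auto simp: open_sub_simps)
  \<comment> \<open>The flow time from the section to \<open>p\<close>, available because two points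
    over the same base point lie on one circle orbit.\<close>
  obtain s where s: "p = R s (\<sigma>0 (F y0))"
    using \<pi>R[OF \<sigma>0[OF W(2)] p(1)] W(4)[OF W(2)] p(2) by auto
  define Y' where "Y' = Y \<inter> F -` W"
  have oY': "oset D Y'" unfolding Y'_def by (rule smooth_map_euc_dom[OF oY wB F W(1)])
  have sub: "Y' \<subseteq> Y" by (auto simp: Y'_def)
  have F': "smooth_map (euc D Y') B F" by (rule smooth_map_euc_restrict[OF F oY oY' sub wB])
  have "smooth_map (euc D Y') (open_sub B W) F"
    by (rule smooth_map_into_open_sub[OF F' _ wmfd_euc[OF oY']]) (auto simp: Y'_def)
  then have "smooth_map (euc D Y') P (\<sigma>0 \<circ> F)"
    by (rule smooth_map_compose[OF wmfd_euc[OF oY'] wmfd_open_sub[OF wB W(1)] wP _ W(3)])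
  then have \<sigma>: "smooth_map (euc D Y') P (R s \<circ> (\<sigma>0 \<circ> F))"
    by (rule smooth_map_compose[OF wmfd_euc[OF oY'] wP wP _ Rsm1])
  have "base_param M g J I P B \<Phi> \<pi> R \<tau> \<theta> JB m d a b gs h D Y' F (R s \<circ> (\<sigma>0 \<circ> F))"
  proof (unfold_locales)
    show "\<pi> ((R s \<circ> (\<sigma>0 \<circ> F)) y) = F y" if "y \<in> Y'" for y
    proof -
      have y: "F y \<in> W" using that by (simp add: Y'_def)
      have "\<pi> (\<sigma>0 (F y)) = \<pi> (R s (\<sigma>0 (F y)))" using \<pi>R[OF \<sigma>0[OF y] Rin[OF \<sigma>0[OF y]]] by blast
      then show ?thesis using W(4)[OF y] by simp
    qed
    show "tangent B (F y) \<subseteq> (\<lambda>v. push B F y (pvec D Y' y v)) ` span D" if "y \<in> Y'" for y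
      using surj[of y] that sub push_pvec_restrict[OF F oY oY' sub wB that] by (auto simp: subset_iff image_iff)
    show "v = 0" if "y \<in> Y'" "v \<in> span D" "push B F y (pvec D Y' y v) = tzero" for y v
      using inj[of y v] that sub push_pvec_restrict[OF F oY oY' sub wB that(1,2)] by auto
  qed (rule oY' F' \<sigma>)+
  then show thesis by (rule that) (use y0 W(2) sub s in \<open>auto simp: Y'_def\<close>)
qed

lemma base_param_chart:
  assumes c: "c \<in> atlas B" and y0: "y0 \<in> cimg c" and p: "p \<in> pts P" "\<pi> p = cinv c y0"
  obtains Y' \<sigma> where "base_param M g J I P B \<Phi> \<pi> R \<tau> \<theta> JB m d a b gs h (coords B) Y' (cinv c) \<sigma>" "y0 \<in> Y'" "Y' \<subseteq> cimg c" "\<sigma> y0 = p"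
proof (rule base_param_through[OF wmfd_cimg[OF wB c] smooth_map_cinv_cimg[OF B c] y0 p])
  note pu = coord_vec_push[OF B c, symmetric]
  fix y assume y: "y \<in> cimg c"
  show "tangent B (cinv c y) \<subseteq> (\<lambda>v. push B (cinv c) y (pvec (coords B) (cimg c) y v)) ` span (coords B)"
    unfolding tangent_chart[OF B c cinv_in[OF y]] using pu[OF y] by (auto simp: image_iff)
  show "v = 0" if "v \<in> span (coords B)" "push B (cinv c) y (pvec (coords B) (cimg c) y v) = tzero" for v
    using that(2) coord_vec_0[OF wB c cinv_in[OF y]] coord_vec_eq_iff[OF B c cinv_in[OF y] that(1) span_zero]
    unfolding pu[OF y that(1)] by simp
qed (rule that; assumption)

end

context base_param
begin

text \<open>\<open>G1\<close> and \<open>G0\<close> are combinations of the tensors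
  \<open>Gm k\<close> with coefficients \<open>b k\<close> and \<open>a k\<close>. Vectors that are
  orthonormal for their own tensor and null for the others diagonalize both at once, which gives the
  ratios \<kappa> and the hypothesis \<open>diag\<close> of the local formula.\<close>

lemma adapted_frame:
  assumes x: "x \<in> I" and y: "y \<in> Y" and fin: "\<And>i. i \<in> {1..m} \<Longrightarrow> finite (E i)" and sp: "span (\<Union>i\<in>{1..m}. E i) = span D"
    and dj: "disjoint_family_on E {1..m}"
    and on: "\<And>i j k e f. i \<in> {1..m} \<Longrightarrow> j \<in> {1..m} \<Longrightarrow> k \<in> {1..m} \<Longrightarrow> e \<in> E i \<Longrightarrow> f \<in> E j \<Longrightarrow>
       Gm k y e f = (if e = f \<and> k = i then 1 else 0)"
  shows "frame (span D) (\<lambda>v w. x * G1 y v w + G0 y v w) (\<Union>i\<in>{1..m}. E i)"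
    and "i \<in> {1..m} \<Longrightarrow> j \<in> {1..m} \<Longrightarrow> e \<in> E i \<Longrightarrow> f \<in> E j \<Longrightarrow> G1 y e f = (if e = f then b i else 0)"
    and "i \<in> {1..m} \<Longrightarrow> j \<in> {1..m} \<Longrightarrow> e \<in> E i \<Longrightarrow> f \<in> E j \<Longrightarrow> x * G1 y e f + G0 y e f = (if e = f then A_coef a b i x else 0)"
proof -
  have *: "(\<Sum>k=1..m. c k * Gm k y e f) = (if e = f then c i else 0)"
    if "i \<in> {1..m}" "j \<in> {1..m}" "e \<in> E i" "f \<in> E j" for i j e f and c :: "nat \<Rightarrow> real"
  proof -
    have "(\<Sum>k=1..m. c k * Gm k y e f) = (\<Sum>k=1..m. if k = i then (if e = f then c i else 0) else 0)"
      by (rule sum.cong) (use on that in auto)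
    then show ?thesis using that by simp
  qed
  show G1: "G1 y e f = (if e = f then b i else 0)" if "i \<in> {1..m}" "j \<in> {1..m}" "e \<in> E i" "f \<in> E j" for i j e f
    unfolding G1_def by (rule *[OF that])
  have G0: "G0 y e f = (if e = f then a i else 0)" if "i \<in> {1..m}" "j \<in> {1..m}" "e \<in> E i" "f \<in> E j" for i j e f
    unfolding G0_def by (rule *[OF that])
  show G: "x * G1 y e f + G0 y e f = (if e = f then A_coef a b i x else 0)"
    if "i \<in> {1..m}" "j \<in> {1..m}" "e \<in> E i" "f \<in> E j" for i j e f
    unfolding G1[OF that] G0[OF that] by (simp add: A_coef_def)
  show "frame (span D) (\<lambda>v w. x * G1 y v w + G0 y v w) (\<Union>i\<in>{1..m}. E i)"
    unfolding frame_def
  proof (intro conjI ballI impI)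
    show "(\<Union>i\<in>{1..m}. E i) \<subseteq> span D" unfolding sp[symmetric] by (rule span_superset)
    fix e assume "e \<in> (\<Union>i\<in>{1..m}. E i)"
    then obtain i where i: "i \<in> {1..m}" "e \<in> E i" by blast
    then show "x * G1 y e e + G0 y e e > 0" using G[OF i(1) i(1) i(2) i(2)] Apos[OF x i(1)] by simp
    fix f assume "f \<in> (\<Union>i\<in>{1..m}. E i)" and ef: "e \<noteq> f"
    then obtain j where j: "j \<in> {1..m}" "f \<in> E j" by blast
    then show "x * G1 y e f + G0 y e f = 0" using G[OF i(1) j(1) i(2) j(2)] ef by simp
  qed (use fin sp in auto)
qed

theorem scalar_curvature_Sc:
  assumes x: "x \<in> I" and y: "y \<in> Y" and fin: "\<And>i. i \<in> {1..m} \<Longrightarrow> finite (E i)" and sp: "span (\<Union>i\<in>{1..m}. E i) = span D"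
    and dj: "disjoint_family_on E {1..m}"
    and on: "\<And>i j k e f. i \<in> {1..m} \<Longrightarrow> j \<in> {1..m} \<Longrightarrow> k \<in> {1..m} \<Longrightarrow> e \<in> E i \<Longrightarrow> f \<in> E j \<Longrightarrow>
       Gm k y e f = (if e = f \<and> k = i then 1 else 0)"
    and card: "\<And>i. i \<in> {1..m} \<Longrightarrow> card (E i) = d i"
    and sc: "scal (\<lambda>y v w. x * G1 y v w + G0 y v w) (\<Union>i\<in>{1..m}. E i) y = (\<Sum>j=1..m. real (d j) / A_coef a b j x)"
  shows "scalar_curvature M g (\<Phi> (x, \<sigma> y)) = Sc x"
proof -
  let ?E = "\<Union>i\<in>{1..m}. E i"
  let ?k = "\<lambda>e. G1 y e e / (x * G1 y e e + G0 y e e)"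
  have F1: "frame (span D) (\<lambda>v w. x * G1 y v w + G0 y v w) ?E"
    by (rule adapted_frame(1)[where E = E, OF x y fin sp dj]) (assumption, (rule on; assumption))
  have F2: "G1 y e f = (if e = f then b i else 0)" if "i \<in> {1..m}" "j \<in> {1..m}" "e \<in> E i" "f \<in> E j" for i j e f
    by (rule adapted_frame(2)[where E = E, OF x y fin sp dj _ that]) (assumption, (rule on; assumption))
  have F3: "x * G1 y e f + G0 y e f = (if e = f then A_coef a b i x else 0)" if "i \<in> {1..m}" "j \<in> {1..m}" "e \<in> E i" "f \<in> E j" for i j e f
    by (rule adapted_frame(3)[where E = E, OF x y fin sp dj _ that]) (assumption, (rule on; assumption))
  have sum: "(\<Sum>e\<in>?E. f e) = (\<Sum>j=1..m. real (d j) * c j)" if "\<And>i e. i \<in> {1..m} \<Longrightarrow> e \<in> E i \<Longrightarrow> f e = c i" for f :: "'f \<Rightarrow> real" and c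
  proof -
    have "(\<Sum>e\<in>?E. f e) = (\<Sum>j=1..m. \<Sum>e\<in>E j. f e)"
      by (rule sum.UNION_disjoint) (use fin dj in \<open>auto simp: disjoint_family_on_def\<close>)
    also have "\<dots> = (\<Sum>j=1..m. real (d j) * c j)"
      by (rule sum.cong) (use that card in auto)
    finally show ?thesis .
  qed
  have k: "?k e = b i / A_coef a b i x" if "i \<in> {1..m}" "e \<in> E i" for i e
    using F2[OF that(1,1) that(2,2)] F3[OF that(1,1) that(2,2)] by simp
  have diag: "G1 y e f = 0" if "e \<in> ?E" "f \<in> ?E" "e \<noteq> f" for e f
    using that F2 by auto
  have L: "scalar_curvature M g (\<Phi> (x, \<sigma> y)) = scal (\<lambda>y v w. x * G1 y v w + G0 y v w) ?E y
      - dd (dd h 1) 1 x - dd h 1 x * (\<Sum>e\<in>?E. ?k e) + h x / 2 * (\<Sum>e\<in>?E. (?k e)\<^sup>2) - h x / 4 * (\<Sum>e\<in>?E. ?k e)\<^sup>2"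
    by (rule scalar_curvature_local[OF x y F1]) (rule diag)
  show ?thesis
    unfolding L sc Sc_def
    using sum[of ?k "\<lambda>i. b i / A_coef a b i x", OF k] sum[of "\<lambda>e. (?k e)\<^sup>2" "\<lambda>i. (b i / A_coef a b i x)\<^sup>2"] k by simp
qed

end

text \<open>The witnesses are \<open>h p\<close> for the outer integral and its derivative for the
  inner one; a definite choice of the two constants of integration. With \<open>p' = p q / 2\<close>
  and \<open>q' = - r\<close> one finds
  \<open>(h p)'' / p = h'' + h' q + h (q^2 / 4 - r / 2)\<close>, which are the terms by which
  \<open>S\<close> falls short of the sum of the \<open>d j / (b j * x + a j)\<close>.\<close>

lemma scalar_curvature_ode:
  fixes d :: "nat \<Rightarrow> nat" and a b :: "nat \<Rightarrow> real" and h h1 h2 :: "real \<Rightarrow> real"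
  assumes h1: "\<And>x. x \<in> I \<Longrightarrow> (h has_real_derivative h1 x) (at x)"
    and h2: "\<And>x. x \<in> I \<Longrightarrow> (h1 has_real_derivative h2 x) (at x)"
    and pos: "\<And>x j. x \<in> I \<Longrightarrow> j \<in> {1..m} \<Longrightarrow> b j * x + a j > 0"
    and S: "\<And>x. x \<in> I \<Longrightarrow> S x = (\<Sum>j=1..m. real (d j) / (b j * x + a j)) - h2 x
      - h1 x * (\<Sum>j=1..m. real (d j) * (b j / (b j * x + a j)))
      + h x / 2 * (\<Sum>j=1..m. real (d j) * (b j / (b j * x + a j))\<^sup>2)
      - h x / 4 * (\<Sum>j=1..m. real (d j) * (b j / (b j * x + a j)))\<^sup>2"
  shows "\<exists>F\<^sub>1 F\<^sub>2. \<forall>x\<in>I.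
       (F\<^sub>1 has_real_derivative ((\<Sum>j=1..m. real (d j) / (b j * x + a j)) - S x)
            * (\<Prod>j=1..m. (b j * x + a j) powr (real (d j) / 2))) (at x) \<and>
       (F\<^sub>2 has_real_derivative F\<^sub>1 x) (at x) \<and>
       h x = 1 / (\<Prod>j=1..m. (b j * x + a j) powr (real (d j) / 2)) * F\<^sub>2 x"
proof -
  define p where "p x = (\<Prod>j=1..m. (b j * x + a j) powr (real (d j) / 2))" for x
  define q where "q x = (\<Sum>j=1..m. real (d j) * (b j / (b j * x + a j)))" for x
  define r where "r x = (\<Sum>j=1..m. real (d j) * (b j / (b j * x + a j))\<^sup>2)" for x
  have p0: "p x > 0" if "x \<in> I" for x
    unfolding p_def
  proof (rule prod_pos)
    show "(b j * x + a j) powr (real (d j) / 2) > 0" if "j \<in> {1..m}" for j using pos[OF \<open>x \<in> I\<close> that] by simp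
  qed
  have dp: "(p has_real_derivative p x * (q x / 2)) (at x)" if x: "x \<in> I" for x
  proof -
    have "(p has_real_derivative p x * (\<Sum>j=1..m. ((b j * x + a j) powr (real (d j) / 2) * (real (d j) / 2 * (b j / (b j * x + a j)))) / (b j * x + a j) powr (real (d j) / 2))) (at x)"
      unfolding p_def
    proof (rule has_field_derivative_prod')
      fix j assume j: "j \<in> {1..m}"
      show "(b j * x + a j) powr (real (d j) / 2) \<noteq> 0" using pos[OF x j] by simp
      show "((\<lambda>x. (b j * x + a j) powr (real (d j) / 2)) has_real_derivative
          (b j * x + a j) powr (real (d j) / 2) * (real (d j) / 2 * (b j / (b j * x + a j)))) (at x)"
      proof -
        have "((\<lambda>x. b j * x + a j) has_real_derivative b j) (at x)" by (auto intro!: derivative_eq_intros)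
        from DERIV_fun_powr[OF this pos[OF x j], of "real (d j) / 2"] show ?thesis
          using pos[OF x j] by (simp add: powr_diff mult_ac)
      qed
    qed
    also have "(\<Sum>j=1..m. ((b j * x + a j) powr (real (d j) / 2) * (real (d j) / 2 * (b j / (b j * x + a j)))) / (b j * x + a j) powr (real (d j) / 2))
        = q x / 2"
      unfolding q_def sum_divide_distrib
    proof (rule sum.cong)
      fix j assume j: "j \<in> {1..m}"
      then show "(b j * x + a j) powr (real (d j) / 2) * (real (d j) / 2 * (b j / (b j * x + a j))) / (b j * x + a j) powr (real (d j) / 2)
         = real (d j) * (b j / (b j * x + a j)) / 2" using pos[OF x j] by simp
    qed simp
    finally show ?thesis .
  qed
  have dq: "(q has_real_derivative - r x) (at x)" if x: "x \<in> I" for x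
  proof -
    have "(q has_real_derivative (\<Sum>j=1..m. - (real (d j) * (b j / (b j * x + a j))\<^sup>2))) (at x)"
      unfolding q_def
    proof (rule DERIV_sum)
      fix j assume j: "j \<in> {1..m}"
      show "((\<lambda>x. real (d j) * (b j / (b j * x + a j))) has_real_derivative - (real (d j) * (b j / (b j * x + a j))\<^sup>2)) (at x)"
        using pos[OF x j] by (auto intro!: derivative_eq_intros simp: power2_eq_square)
    qed
    then show ?thesis by (simp add: r_def sum_negf)
  qed
  have "((\<lambda>x. h x * p x) has_real_derivative h1 x * p x + h x * (p x * (q x / 2))) (at x)" if x: "x \<in> I" for x
    by (rule derivative_eq_intros h1[OF x] dp[OF x] refl)+ simp
  moreover have "((\<lambda>x. h1 x * p x + h x * (p x * (q x / 2))) has_real_derivative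
      ((\<Sum>j=1..m. real (d j) / (b j * x + a j)) - S x) * p x) (at x)" if x: "x \<in> I" for x
    unfolding S[OF x] q_def[symmetric] r_def[symmetric]
    by (rule DERIV_cong[OF DERIV_add[OF DERIV_mult[OF h2[OF x] dp[OF x]]
          DERIV_mult[OF h1[OF x] DERIV_mult[OF dp[OF x] DERIV_cdivide[OF dq[OF x], of 2]]]]])
      (simp add: field_simps power2_eq_square)
  moreover have "h x = 1 / p x * (h x * p x)" if "x \<in> I" for x using p0[OF that] by simp
  ultimately show ?thesis unfolding p_def[symmetric] by blast
qed

section \<open>Construction One\<close>

lemma frame_independent:
  assumes sf: "symform V b" and E: "frame V b E"
  shows "independent E" "card E = dim V"
proof -
  have fin: "finite E" and EV: "E \<subseteq> V" and sp: "span E = V" using E by (auto simp: frame_def)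
  have "c e = 0" if z: "(\<Sum>e\<in>E. c e *\<^sub>R e) = 0" and e: "e \<in> E" for c e
  proof -
    have "b (\<Sum>e\<in>E. c e *\<^sub>R e) e = c e * b e e"
      by (rule orthogonal_coefficient[OF sf fin EV _ e]) (use frame_orth[OF E] e in auto)
    moreover have "b 0 e = 0"
      by (rule slin_zero[OF symform_slin1[OF sf]]) (use sf e EV in \<open>auto simp: symform_def\<close>)
    ultimately show ?thesis using z frame_pos[OF E e] by simp
  qed
  then show i: "independent E" by (rule independent_if_scalars_zero[OF fin])
  show "card E = dim V" using dim_span_eq_card_independent[OF i] sp by simp
qed

text \<open>\<open>L\<close> is linear on \<open>span D\<close> only. Extending it linearly from the
  coordinate directions gives a globally linear map that agrees with it there, and the usual
  dimension theorem applies to that map.\<close>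

lemma dim_image_on_span:
  fixes L :: "'e::euclidean_space \<Rightarrow> 'f::euclidean_space"
  assumes D: "D \<subseteq> Basis" and lin: "\<And>v w s t. v \<in> span D \<Longrightarrow> w \<in> span D \<Longrightarrow> L (s *\<^sub>R v + t *\<^sub>R w) = s *\<^sub>R L v + t *\<^sub>R L w"
    and U: "subspace U" "U \<subseteq> span D" and inj: "\<And>v. v \<in> U \<Longrightarrow> L v = 0 \<Longrightarrow> v = 0"
  shows "subspace (L ` U)" "dim (L ` U) = dim U"
proof -
  define L' where "L' u = (\<Sum>b\<in>D. (u \<bullet> b) *\<^sub>R L b)" for u
  have l: "linear L'"
    unfolding L'_def by (intro linearI) (simp_all add: inner_add_left scaleR_add_left sum.distrib scaleR_sum_right)
  have fin: "finite D" by (rule finite_coords[OF D])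
  have sum: "L (\<Sum>b\<in>A. c b *\<^sub>R b) = (\<Sum>b\<in>A. c b *\<^sub>R L b)" if "finite A" "A \<subseteq> D" for c A
    using that
  proof (induction A rule: finite_induct)
    case empty
    then show ?case using lin[OF span_zero span_zero, of 0 0] by simp
  next
    case (insert b A)
    then have "b \<in> span D" "(\<Sum>b\<in>A. c b *\<^sub>R b) \<in> span D"
      by (auto intro!: span_base span_sum span_scale)
    from lin[OF this, of "c b" 1] show ?case using insert by simp
  qed
  have eq: "L' u = L u" if "u \<in> span D" for u
    unfolding L'_def sum[OF fin order.refl, symmetric] using span_coords_sum[OF D that] by simp
  then have im: "L ` U = L' ` U" using U(2) by (auto simp: image_iff subset_iff)
  show "subspace (L ` U)" unfolding im by (rule linear_subspace_image[OF l U(1)])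
  have "inj_on L' U"
  proof (rule inj_onI)
    fix u v assume uv: "u \<in> U" "v \<in> U" "L' u = L' v"
    then have "u - v \<in> U" using subspace_diff[OF U(1)] by blast
    moreover have "L' (u - v) = 0" using uv(3) linear_diff[OF l] by simp
    ultimately show "u = v" using inj[of "u - v"] eq[of "u - v"] U(2) by auto
  qed
  then show "dim (L ` U) = dim U"
    unfolding im using U(1) by (intro dim_image_eq[OF l]) (simp add: span_eq_iff[THEN iffD2])
qed

context base_param
begin

lemma fibre_vec_vertical:
  assumes y: "y \<in> Y"
  shows "push B \<pi> (\<sigma> y) (fibre_vec P R (\<sigma> y)) = tzero"
proof -
  obtain x where x: "x \<in> I" using I(2) by blast
  have "push P \<rho> (x, 0, y) (svec (x, 0, y) (0, 1, 0)) = fibre_vec P R (\<sigma> y)"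
    using push_shift(1)[OF x y wP \<rho>sm, of 0] by (simp add: \<rho>_def fibre_vec_def)
  then have "push B \<pi> (\<sigma> y) (fibre_vec P R (\<sigma> y)) = bvec y 0"
    using \<pi>_svec(2)[OF x y span_zero, of 0 0 1] R0[OF \<sigma>in[OF y]] by (simp add: \<rho>_def)
  also have "\<dots> = tzero" using bvec_lin[OF y span_zero span_zero, of 0 0] by (simp add: tlin_def tzero_def)
  finally show ?thesis .
qed

lemma \<pi>_lift:
  assumes y: "y \<in> Y" and v: "v \<in> span D"
  obtains \<xi> where "\<xi> \<in> tangent P (\<sigma> y)" "push B \<pi> (\<sigma> y) \<xi> = bvec y v"
proof -
  obtain x where x: "x \<in> I" using I(2) by blast
  have u: "(x, 0, y) \<in> W" and V: "(0, 0, v) \<in> span DX" using x y v by (simp_all add: DX_iff)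
  show thesis
    using that[of "push P \<rho> (x, 0, y) (svec (x, 0, y) (0, 0, v))"] \<zeta>(5)[OF u V] \<pi>_svec(2)[OF x y v, of 0 0 0]
      R0[OF \<sigma>in[OF y]] by (simp add: \<rho>_def)
qed

end

context kaehler_cohom_one
begin

text \<open>Positive definiteness is inherited from \<open>g\<close> through horizontal lifts
  (\<open>G_pos\<close>), using a section through a point over \<open>q\<close>. It makes the Ricci
  tensor of the base metric accessible by frames.\<close>

lemma base_metric_riemannian:
  assumes x: "x \<in> I"
  shows "riemannian B (base_metric m a b gs x)"
  unfolding riemannian_def
proof (intro conjI ballI impI)
  show "smooth_manifold B" by (rule B)
  show "smooth_sym2 B (base_metric m a b gs x)"
    unfolding smooth_sym2_def
  proof (intro conjI ballI)
    fix q \<xi> assume q: "q \<in> pts B" "\<xi> \<in> tangent B q"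
    have l: "linear_on_tangent (tangent B q) (gs i q \<xi>)" "\<eta> \<in> tangent B q \<Longrightarrow> gs i q \<xi> \<eta> = gs i q \<eta> \<xi>" if "i \<in> {1..m}" for i \<eta>
      using gssym2[OF that] q unfolding smooth_sym2_def by blast+
    show "linear_on_tangent (tangent B q) (base_metric m a b gs x q \<xi>)"
      unfolding linear_on_tangent_def base_metric_def
    proof (intro ballI allI)
      fix \<eta> \<eta>' s t assume t: "\<eta> \<in> tangent B q" "\<eta>' \<in> tangent B q"
      have "(\<Sum>i=1..m. A_coef a b i x * gs i q \<xi> (tlin s \<eta> t \<eta>')) = (\<Sum>i=1..m. s * (A_coef a b i x * gs i q \<xi> \<eta>) + t * (A_coef a b i x * gs i q \<xi> \<eta>'))"
        by (rule sum.cong) (use linear_on_tangentD[OF l(1) t] in \<open>auto simp: algebra_simps\<close>)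
      then show "(\<Sum>i=1..m. A_coef a b i x * gs i q \<xi> (tlin s \<eta> t \<eta>')) =
          s * (\<Sum>i=1..m. A_coef a b i x * gs i q \<xi> \<eta>) + t * (\<Sum>i=1..m. A_coef a b i x * gs i q \<xi> \<eta>')"
        by (simp add: sum.distrib sum_distrib_left)
    qed
    show "base_metric m a b gs x q \<xi> \<eta> = base_metric m a b gs x q \<eta> \<xi>" if "\<eta> \<in> tangent B q" for \<eta>
      unfolding base_metric_def by (rule sum.cong) (use l(2) that in auto)
  next
    fix c v w assume c: "c \<in> atlas B" and v: "v \<in> coords B" "w \<in> coords B"
    show "smooth_on (coords B) (cimg c) (\<lambda>u. comp2 B (base_metric m a b gs x) c u v w)"
      unfolding comp2_def Let_def base_metric_def
      by (intro smooth_on_sum smooth_on_mult smooth_on_const wmfd_cimg[OF wB c])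
        (use gssym2 c v in \<open>simp add: smooth_sym2_def comp2_def Let_def\<close>)
  qed
  fix q \<xi> assume q: "q \<in> pts B" and \<xi>: "\<xi> \<in> tangent B q" "\<xi> \<noteq> tzero"
  obtain c where c: "c \<in> atlas B" "q \<in> fst c" using wmfdD(2)[OF wB q] by blast
  obtain v where v: "v \<in> span (coords B)" "\<xi> = coord_vec B c q v" using \<xi> unfolding tangent_chart[OF B c] by blast
  have v0: "v \<noteq> 0" using \<xi>(2) v(2) coord_vec_0[OF wB c] by auto
  let ?y = "snd c q"
  have y: "?y \<in> cimg c" "cinv c ?y = q" using c cinv_chart[OF wB c] by auto
  obtain p where p: "p \<in> pts P" "\<pi> p = cinv c ?y" using \<pi>onto q y by (metis imageE)
  obtain Y' \<sigma> where bp: "base_param M g J I P B \<Phi> \<pi> R \<tau> \<theta> JB m d a b gs h (coords B) Y' (cinv c) \<sigma>" "?y \<in> Y'" "Y' \<subseteq> cimg c"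
    by (rule base_param_chart[OF c(1) y(1) p])
  interpret bp: base_param M g J I P B \<Phi> \<pi> R \<tau> \<theta> JB m d a b gs h "coords B" Y' "cinv c" \<sigma> by (rule bp(1))
  have "bp.bvec ?y v = \<xi>"
    unfolding bp.bvec_def push_pvec_restrict[OF smooth_map_cinv_cimg[OF B c(1)] wmfd_cimg[OF wB c(1)] bp.oY bp(3) wB bp(2) v(1)]
      coord_vec_push[OF B c(1) y(1) v(1), symmetric] y(2) v(2) ..
  then show "base_metric m a b gs x q \<xi> \<xi> > 0"
    using bp.G_pos[OF x bp(2) v(1) v0] bp.base_metric_bvec[of x ?y v v] y(2) by simp
qed

end

lemma frame_cong:
  assumes E: "frame V b E" and eq: "\<And>v w. v \<in> V \<Longrightarrow> w \<in> V \<Longrightarrow> b v w = b' v w"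
  shows "frame V b' E"
  using E eq[OF frame_in[OF E] frame_in[OF E]] unfolding frame_def by (simp add: subset_iff)

context kaehler_cohom_one
begin

text \<open>The spaces \<open>pp i\<close> project to pairwise orthogonal subspaces
  \<open>V i\<close> of the base, which together span since only the fibre direction is lost.
  Orthonormal frames of the \<open>V i\<close> form an adapted frame. On such a vector the Ricci
  tensor of the base metric is 1, while its square length is \<open>A_coef a b i x\<close>, so it
  contributes the quotient to the scalar curvature.\<close>

theorem scalar_curvature_adapted_decomposition:
  assumes x: "x \<in> I" and p: "p \<in> pts P"
    and sub: "\<And>i. i \<in> {1..m} \<Longrightarrow> tsubspace (tangent P p) (pp i)"
    and dec: "\<And>\<xi>. \<xi> \<in> tangent P p \<Longrightarrow> \<exists>s w. (\<forall>i\<in>{1..m}. w i \<in> pp i) \<and> \<xi> = (\<lambda>f. s * fibre_vec P R p f + (\<Sum>i=1..m. w i f))"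
    and dim: "\<And>i. i \<in> {1..m} \<Longrightarrow> tdim P p (pp i) = d i"
    and pos: "\<And>i \<xi>. i \<in> {1..m} \<Longrightarrow> \<xi> \<in> pp i \<Longrightarrow> \<xi> \<noteq> tzero \<Longrightarrow> gs i (\<pi> p) (push B \<pi> p \<xi>) (push B \<pi> p \<xi>) > 0"
    and orth: "\<And>i j \<xi> \<eta>. i \<in> {1..m} \<Longrightarrow> j \<in> {1..m} \<Longrightarrow> j \<noteq> i \<Longrightarrow> \<xi> \<in> pp j \<Longrightarrow> \<eta> \<in> tangent B (\<pi> p) \<Longrightarrow> gs i (\<pi> p) (push B \<pi> p \<xi>) \<eta> = 0"
    and ric: "\<And>i \<xi>. i \<in> {1..m} \<Longrightarrow> \<xi> \<in> pp i \<Longrightarrow> gs i (\<pi> p) (push B \<pi> p \<xi>) (push B \<pi> p \<xi>) = 1 \<Longrightarrow>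
       ricci B (base_metric m a b gs x) (\<pi> p) (push B \<pi> p \<xi>) (push B \<pi> p \<xi>) = 1"
  shows "scalar_curvature M g (\<Phi> (x, p)) = Sc x"
proof -
  let ?q = "\<pi> p" and ?D = "coords B" and ?D\<pi> = "push B \<pi> p"
  have q: "?q \<in> pts B" by (rule smooth_map_in[OF \<pi>sm p])
  \<comment> \<open>\<open>ricci\<close> is evaluated in this particular chart, so the
    parametrization of the base has to use the same one.\<close>
  define c where "c = chart_at B ?q"
  note c = chart_at_props[OF wB q, folded c_def]
  let ?y = "snd c ?q"
  have y: "?y \<in> cimg c" and cy: "cinv c ?y = ?q" using c cinv_chart[OF wB c] by auto
  obtain Y' \<sigma> where bp: "base_param M g J I P B \<Phi> \<pi> R \<tau> \<theta> JB m d a b gs h ?D Y' (cinv c) \<sigma>" "?y \<in> Y'" "Y' \<subseteq> cimg c" "\<sigma> ?y = p"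
    by (rule base_param_chart[OF c(1) y p cy[symmetric]])
  interpret bp: base_param M g J I P B \<Phi> \<pi> R \<tau> \<theta> JB m d a b gs h ?D Y' "cinv c" \<sigma> by (rule bp(1))
  have bv: "bp.bvec z v = coord_vec B c (cinv c z) v" if "z \<in> Y'" "v \<in> span ?D" for z v
    using push_pvec_restrict[OF smooth_map_cinv_cimg[OF B c(1)] wmfd_cimg[OF wB c(1)] bp.oY bp(3) wB that]
      coord_vec_push[OF B c(1) _ that(2), of z] that(1) bp(3) by (auto simp: bp.bvec_def)
  have bvy: "bp.bvec ?y v = coord_vec B c ?q v" if "v \<in> span ?D" for v using bv[OF bp(2) that] cy by simp
  have Gm: "bp.Gm i ?y v w = gs i ?q (coord_vec B c ?q v) (coord_vec B c ?q w)" if "v \<in> span ?D" "w \<in> span ?D" for i v w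
    using bvy that by (simp add: bp.Gm_def pbf_def bp.bvec_def cy)
  have Gx: "x * bp.G1 z v w + bp.G0 z v w = comp2 B (base_metric m a b gs x) c z v w" if "z \<in> Y'" "v \<in> span ?D" "w \<in> span ?D" for z v w
    unfolding bp.base_metric_bvec[symmetric] using that by (simp add: bv comp2_def Let_def)
  define cP where "cP = chart_at P p"
  note cP = chart_at_props[OF wP p, folded cP_def]
  define U where "U i = tcomp P cP ` pp i" for i
  define L where "L u = tcomp B c (?D\<pi> (coord_vec P cP p u))" for u
  have ppT: "\<xi> \<in> tangent P p" if "\<xi> \<in> pp i" "i \<in> {1..m}" for \<xi> i using sub[OF that(2)] that(1) by (auto simp: tsubspace_def)
  have D\<pi>: "?D\<pi> \<xi> \<in> tangent B ?q" if "\<xi> \<in> tangent P p" for \<xi> by (rule push_in_tangent[OF P wB \<pi>sm p that])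
  have tl: "tcomp B c (tlin s \<xi> t \<eta>) = s *\<^sub>R tcomp B c \<xi> + t *\<^sub>R tcomp B c \<eta>" for s t and \<xi> \<eta> :: "'q tv"
    by (simp add: tcomp_def tlin_def scaleR_add_left sum.distrib scaleR_sum_right)
  have t0: "tcomp B c tzero = 0" by (simp add: tcomp_def tzero_def)
  have Llin: "L (s *\<^sub>R v + t *\<^sub>R w) = s *\<^sub>R L v + t *\<^sub>R L w" if "v \<in> span (coords P)" "w \<in> span (coords P)" for s t v w
    unfolding L_def coord_vec_linear[OF wP cP that] push_tlin tl ..
  have LU: "L (tcomp P cP \<xi>) = tcomp B c (?D\<pi> \<xi>)" "coord_vec B c ?q (tcomp B c (?D\<pi> \<xi>)) = ?D\<pi> \<xi>"
     "tcomp B c (?D\<pi> \<xi>) \<in> span ?D" if "\<xi> \<in> tangent P p" for \<xi>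
    using coord_vec_tcomp[OF P cP that] coord_vec_tcomp[OF B c D\<pi>[OF that]] by (simp_all add: L_def)
  have Vi: "L ` U i = (\<lambda>\<xi>. tcomp B c (?D\<pi> \<xi>)) ` pp i" if "i \<in> {1..m}" for i
    unfolding U_def image_image using LU(1) ppT[OF _ that] by (intro image_cong) auto
  have Us: "subspace (U i)" "U i \<subseteq> span (coords P)" if i: "i \<in> {1..m}" for i
  proof -
    have lin: "tcomp P cP (tlin s \<xi> t \<eta>) = s *\<^sub>R tcomp P cP \<xi> + t *\<^sub>R tcomp P cP \<eta>" for s t and \<xi> \<eta> :: "'p tv"
      by (simp add: tcomp_def tlin_def scaleR_add_left sum.distrib scaleR_sum_right)
    have 0: "tzero \<in> pp i" and l: "\<xi> \<in> pp i \<Longrightarrow> \<eta> \<in> pp i \<Longrightarrow> tlin s \<xi> t \<eta> \<in> pp i" for \<xi> \<eta> s t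
      using sub[OF i] by (auto simp: tsubspace_def)
    show "subspace (U i)"
      unfolding subspace_def U_def
    proof (intro conjI ballI allI)
      have "tcomp P cP tzero = 0" by (simp add: tcomp_def tzero_def)
      then show "0 \<in> tcomp P cP ` pp i" using 0 by (metis imageI)
      fix u assume "u \<in> tcomp P cP ` pp i"
      then obtain \<xi> where \<xi>: "\<xi> \<in> pp i" "u = tcomp P cP \<xi>" by blast
      show "s *\<^sub>R u \<in> tcomp P cP ` pp i" for s
        using lin[of s \<xi> 0 \<xi>] l[OF \<xi>(1) \<xi>(1), of s 0] \<xi>(2) by (simp add: image_iff) metis
      fix w assume "w \<in> tcomp P cP ` pp i"
      then obtain \<eta> where \<eta>: "\<eta> \<in> pp i" "w = tcomp P cP \<eta>" by blast
      show "u + w \<in> tcomp P cP ` pp i"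
        using lin[of 1 \<xi> 1 \<eta>] l[OF \<xi>(1) \<eta>(1), of 1 1] \<xi>(2) \<eta>(2) by (simp add: image_iff) metis
    qed
    show "U i \<subseteq> span (coords P)" using coord_vec_tcomp(2)[OF P cP] ppT[OF _ i] by (auto simp: U_def)
  qed
  \<comment> \<open>A vector of \<open>pp i\<close> that projects to 0 has background length 0, so
    positivity of \<open>gs i\<close> on \<open>pp i\<close> forces it to vanish; hence the
    projection keeps the dimension \<open>d i\<close>.\<close>
  have inj: "v = 0" if i: "i \<in> {1..m}" and v: "v \<in> U i" "L v = 0" for i v
  proof -
    obtain \<xi> where \<xi>: "\<xi> \<in> pp i" "v = tcomp P cP \<xi>" using v(1) by (auto simp: U_def)
    have "?D\<pi> \<xi> = tzero" using LU(1,2)[OF ppT[OF \<xi>(1) i]] v(2) \<xi>(2) coord_vec_0[OF wB c] by simp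
    then have "\<xi> = tzero" using pos[OF i \<xi>(1)] gs_tzero[OF i q] by auto
    then show ?thesis using \<xi>(2) by (simp add: tcomp_def tzero_def)
  qed
  define V where "V i = L ` U i" for i
  have Vsub: "subspace (V i)" if i: "i \<in> {1..m}" for i
    unfolding V_def by (rule dim_image_on_span(1)[OF wmfdD(1)[OF wP] Llin Us[OF i] inj[OF i]])
  have Vdim: "dim (V i) = d i" if i: "i \<in> {1..m}" for i
  proof -
    have "dim (V i) = dim (U i)"
      unfolding V_def by (rule dim_image_on_span(2)[OF wmfdD(1)[OF wP] Llin Us[OF i] inj[OF i]])
    then show ?thesis using dim[OF i] by (simp only: U_def tdim_def cP_def)
  qed
  have Vin: "\<exists>\<xi>\<in>pp i. coord_vec B c ?q v = ?D\<pi> \<xi>" "v \<in> span ?D" if v: "v \<in> V i" and i: "i \<in> {1..m}" for v i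
  proof -
    obtain \<xi> where \<xi>: "\<xi> \<in> pp i" "v = tcomp B c (?D\<pi> \<xi>)" using v unfolding V_def Vi[OF i] by blast
    note L' = LU(2,3)[OF ppT[OF \<xi>(1) i]]
    show "v \<in> span ?D" unfolding \<xi>(2) by (rule L'(2))
    show "\<exists>\<xi>\<in>pp i. coord_vec B c ?q v = ?D\<pi> \<xi>" unfolding \<xi>(2) by (rule bexI[where x = \<xi>]) (rule L'(1), rule \<xi>(1))
  qed
  have Gsf: "symform (span ?D) (bp.Gm i ?y)" if "i \<in> {1..m}" for i by (rule lform.sf[OF bp.Gm_lform[OF that] bp(2)])
  have Gij: "bp.Gm i ?y v w = 0" "bp.Gm i ?y w v = 0" if ij: "i \<in> {1..m}" "j \<in> {1..m}" "j \<noteq> i" and v: "v \<in> V j" and w: "w \<in> span ?D" for i j v w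
  proof -
    obtain \<xi> where "\<xi> \<in> pp j" "coord_vec B c ?q v = ?D\<pi> \<xi>" using Vin(1)[OF v ij(2)] by blast
    then show 1: "bp.Gm i ?y v w = 0"
      unfolding Gm[OF Vin(2)[OF v ij(2)] w] using orth[OF ij] coord_vec_in_tangent[OF c w] by simp
    then show "bp.Gm i ?y w v = 0" using symform_sym[OF Gsf[OF ij(1)] w Vin(2)[OF v ij(2)]] by simp
  qed
  have pf: "posform (V i) (bp.Gm i ?y)" if i: "i \<in> {1..m}" for i
    unfolding posform_def symform_def
  proof (intro conjI ballI impI)
    show "subspace (V i)" by (rule Vsub[OF i])
    show "slin (V i) (\<lambda>v. bp.Gm i ?y v w)" if "w \<in> V i" for w
      using symform_slin1[OF Gsf[OF i] Vin(2)[OF that i]] Vin(2)[OF _ i] by (simp add: slin_def)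
    show "bp.Gm i ?y v w = bp.Gm i ?y w v" if "v \<in> V i" "w \<in> V i" for v w
      by (rule symform_sym[OF Gsf[OF i] Vin(2)[OF that(1) i] Vin(2)[OF that(2) i]])
    fix v assume v: "v \<in> V i" "v \<noteq> 0"
    obtain \<xi> where \<xi>: "\<xi> \<in> pp i" "coord_vec B c ?q v = ?D\<pi> \<xi>" using Vin(1)[OF v(1) i] by blast
    have vD: "v \<in> span ?D" by (rule Vin(2)[OF v(1) i])
    have "coord_vec B c ?q v \<noteq> tzero"
      using coord_vec_eq_iff[OF B c vD span_zero] v(2) coord_vec_0[OF wB c] by simp
    then have "\<xi> \<noteq> tzero" using \<xi>(2) by (auto simp: push_def tzero_def)
    then show "bp.Gm i ?y v v > 0" unfolding Gm[OF vD vD] \<xi>(2) by (rule pos[OF i \<xi>(1)])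
  qed
  have "\<exists>E. frame (V i) (bp.Gm i ?y) E \<and> (\<forall>e\<in>E. bp.Gm i ?y e e = 1)" if i: "i \<in> {1..m}" for i
    by (rule orthonormal_frame_exists[OF pf[OF i]]) blast
  then obtain E where "\<forall>i\<in>{1..m}. frame (V i) (bp.Gm i ?y) (E i) \<and> (\<forall>e\<in>E i. bp.Gm i ?y e e = 1)" by metis
  then have E: "frame (V i) (bp.Gm i ?y) (E i)" and E1: "e \<in> E i \<Longrightarrow> bp.Gm i ?y e e = 1" if "i \<in> {1..m}" for i e
    using that by blast+
  have EV: "e \<in> V i" "e \<in> span ?D" if "e \<in> E i" "i \<in> {1..m}" for e i
    using frame_in[OF E[OF that(2)] that(1)] Vin(2)[OF _ that(2)] by auto
  have fin: "finite (E i)" if "i \<in> {1..m}" for i using E[OF that] by (simp add: frame_def)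
  have ne: "e \<noteq> f" if "i \<in> {1..m}" "j \<in> {1..m}" "i \<noteq> j" "e \<in> E i" "f \<in> E j" for i j e f
    using Gij(1)[OF that(1,2) that(3)[symmetric] EV(1)[OF that(5,2)] EV(2)[OF that(4,1)]] E1[OF that(1,4)] by auto
  have on: "bp.Gm k ?y e f = (if e = f \<and> k = i then 1 else 0)"
    if i: "i \<in> {1..m}" and j: "j \<in> {1..m}" and k: "k \<in> {1..m}" and e: "e \<in> E i" and f: "f \<in> E j" for i j k e f
  proof (cases "k = i")
    case False
    then show ?thesis using Gij(1)[OF k i _ EV(1)[OF e i] EV(2)[OF f j]] by simp
  next
    case True
    show ?thesis
    proof (cases "j = i")
      case False
      then show ?thesis using Gij(2)[OF i j False EV(1)[OF f j] EV(2)[OF e i]] ne[OF i j _ e f] True by simp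
    next
      case True
      then show ?thesis using E1[OF i e] frame_orth[OF E[OF i] e] f \<open>k = i\<close> by auto
    qed
  qed
  have dj: "disjoint_family_on E {1..m}" unfolding disjoint_family_on_def using ne by blast
  have card: "card (E i) = d i" if i: "i \<in> {1..m}" for i
    using frame_independent(2)[OF _ E[OF i]] pf[OF i] Vdim[OF i] by (simp add: posform_def)
  have sp: "span (\<Union>i\<in>{1..m}. E i) = span ?D"
  proof
    show "span (\<Union>i\<in>{1..m}. E i) \<subseteq> span ?D" by (rule span_minimal) (use EV(2) in \<open>auto simp: subspace_span\<close>)
    show "span ?D \<subseteq> span (\<Union>i\<in>{1..m}. E i)"
    proof
      fix v assume v: "v \<in> span ?D"
      obtain \<xi> where \<xi>: "\<xi> \<in> tangent P p" "?D\<pi> \<xi> = coord_vec B c ?q v"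
        using bp.\<pi>_lift[OF bp(2) v] bvy[OF v] bp(4) by metis
      obtain s w where w: "\<And>i. i \<in> {1..m} \<Longrightarrow> w i \<in> pp i" "\<xi> = (\<lambda>f. s * fibre_vec P R p f + (\<Sum>i=1..m. w i f))"
        using dec[OF \<xi>(1)] by blast
      have "?D\<pi> \<xi> = (\<lambda>\<psi>. s * ?D\<pi> (fibre_vec P R p) \<psi> + (\<Sum>i=1..m. ?D\<pi> (w i) \<psi>))"
        unfolding w(2) by (auto simp: push_def)
      also have "\<dots> = (\<lambda>\<psi>. \<Sum>i=1..m. ?D\<pi> (w i) \<psi>)"
        using bp.fibre_vec_vertical[OF bp(2)] bp(4) by (simp add: tzero_def)
      finally have "v = tcomp B c (\<lambda>\<psi>. \<Sum>i=1..m. ?D\<pi> (w i) \<psi>)"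
        using \<xi>(2) tcomp_coord_vec[OF B c v] by simp
      also have "\<dots> = (\<Sum>i=1..m. tcomp B c (?D\<pi> (w i)))"
        unfolding tcomp_def scaleR_sum_left by (rule sum.swap)
      also have "\<dots> \<in> span (\<Union>i\<in>{1..m}. E i)"
      proof (rule span_sum)
        fix i assume i: "i \<in> {1..m}"
        have "tcomp B c (?D\<pi> (w i)) \<in> V i" unfolding V_def Vi[OF i] using w(1)[OF i] by blast
        also have "V i = span (E i)" using E[OF i] by (simp add: frame_def)
        also have "\<dots> \<subseteq> span (\<Union>i\<in>{1..m}. E i)" by (rule span_mono) (use i in blast)
        finally show "tcomp B c (?D\<pi> (w i)) \<in> span (\<Union>i\<in>{1..m}. E i)" .
      qed
      finally show "v \<in> span (\<Union>i\<in>{1..m}. E i)" .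
    qed
  qed
  let ?E = "\<Union>i\<in>{1..m}. E i" and ?bm = "base_metric m a b gs x"
  have ED: "?E \<subseteq> span ?D" using EV(2) by auto
  have af: "frame (span ?D) (\<lambda>v w. x * bp.G1 ?y v w + bp.G0 ?y v w) ?E"
    by (rule bp.adapted_frame(1)[where E = E, OF x bp(2) fin sp dj]) (assumption, (rule on; assumption))
  have af3: "x * bp.G1 ?y e e + bp.G0 ?y e e = A_coef a b i x" if "i \<in> {1..m}" "e \<in> E i" for i e
  proof -
    have "x * bp.G1 ?y e e + bp.G0 ?y e e = (if e = e then A_coef a b i x else 0)"
      by (rule bp.adapted_frame(3)[where E = E, OF x bp(2) fin sp dj _ that(1,1,2,2)]) (assumption, (rule on; assumption))
    then show ?thesis by simp
  qed
  have fr: "frame (span ?D) (comp2 B ?bm c ?y) ?E"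
    by (rule frame_cong[OF af Gx[OF bp(2)]])
  have "scal (\<lambda>y v w. x * bp.G1 y v w + bp.G0 y v w) ?E ?y = scal (comp2 B ?bm c) ?E ?y"
    by (rule scal_cong[OF bp.oY bp(2) ED Gx])
  also have "\<dots> = (\<Sum>e\<in>?E. (\<Sum>f\<in>?E. sec (comp2 B ?bm c) ?E ?y f e / comp2 B ?bm c ?y f f) / comp2 B ?bm c ?y e e)"
    unfolding scal_def sum_divide_distrib by (subst sum.swap) simp
  also have "\<dots> = (\<Sum>j=1..m. \<Sum>e\<in>E j. (\<Sum>f\<in>?E. sec (comp2 B ?bm c) ?E ?y f e / comp2 B ?bm c ?y f f) / comp2 B ?bm c ?y e e)"
    by (rule sum.UNION_disjoint) (use fin dj in \<open>auto simp: disjoint_family_on_def\<close>)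
  \<comment> \<open>The inner sum over \<open>f\<close> is the Ricci tensor at the background unit
    vector \<open>e\<close>, equal to 1 by hypothesis.\<close>
  also have "\<dots> = (\<Sum>j=1..m. \<Sum>e\<in>E j. 1 / A_coef a b j x)"
  proof (intro sum.cong refl)
    fix j e assume j: "j \<in> {1..m}" and e: "e \<in> E j"
    have eD: "e \<in> span ?D" by (rule EV(2)[OF e j])
    obtain \<xi> where \<xi>: "\<xi> \<in> pp j" "coord_vec B c ?q e = ?D\<pi> \<xi>" using Vin(1)[OF EV(1)[OF e j] j] by blast
    have "ricci B ?bm ?q (coord_vec B c ?q e) (coord_vec B c ?q e) = 1"
      unfolding \<xi>(2) by (rule ric[OF j \<xi>(1)]) (use E1[OF j e] in \<open>simp add: Gm[OF eD eD] \<xi>(2)\<close>)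
    then have "(\<Sum>f\<in>?E. sec (comp2 B ?bm c) ?E ?y f e / comp2 B ?bm c ?y f f) = 1"
      using ricci_coord[OF base_metric_riemannian[OF x] q eD fr[unfolded c_def]] by (simp add: c_def)
    moreover have "comp2 B ?bm c ?y e e = A_coef a b j x" using af3[OF j e] Gx[OF bp(2) eD eD] by simp
    ultimately show "(\<Sum>f\<in>?E. sec (comp2 B ?bm c) ?E ?y f e / comp2 B ?bm c ?y f f) / comp2 B ?bm c ?y e e = 1 / A_coef a b j x"
      by simp
  qed
  also have "\<dots> = (\<Sum>j=1..m. real (d j) / A_coef a b j x)" using card by simp
  finally have sc: "scal (\<lambda>y v w. x * bp.G1 y v w + bp.G0 y v w) ?E ?y = (\<Sum>j=1..m. real (d j) / A_coef a b j x)" .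
  have "scalar_curvature M g (\<Phi> (x, \<sigma> ?y)) = Sc x"
    by (rule bp.scalar_curvature_Sc[where E = E, OF x bp(2) fin sp dj _ card sc]) (assumption, (rule on; assumption), assumption)
  then show ?thesis by (simp add: bp(4))
qed

end

context kaehler_cohom_one
begin

text \<open>At the base point of \<open>G/K\<close> the isotropy decomposition is an adapted
  decomposition. Any other point of the same orbit is its image under an element of
  \<open>G\<close>, which acts by isometries of \<open>M\<close>.\<close>

theorem scalar_curvature_construction_one:
  assumes C: "construction_one M g J I P B \<Phi> \<pi> R \<tau> \<theta> m d a b gs G N act \<mu> K L ch qP qB pp"
    and x: "x \<in> I" and p: "p \<in> pts P"
  shows "scalar_curvature M g (\<Phi> (x, p)) = Sc x"
proof -
  let ?o = "qP \<one>\<^bsub>G\<^esub>" and ?oB = "qB \<one>\<^bsub>G\<^esub>"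
  note C' = C[unfolded construction_one_def Let_def]
  from C' have LG: "lie_group G N" by (elim conjE)
  from C' have IA: "isometric_action G N M g act" by (elim conjE)
  from C' have HP: "homogeneous_quotient G N K P qP" by (elim conjE)
  from C' have ID: "isotropy_decomposition K (\<lambda>k. push P (ltrans G qP k) ?o) (tangent P ?o) (fibre_vec P R ?o) m pp"
    by (elim conjE)
  from C' have "\<forall>x\<in>I. isotropy G act (\<Phi> (x, ?o)) = K \<and>
        L = {y \<in> carrier G. \<forall>X\<in>lie_alg G N. coad G N y (\<mu> (\<Phi> (x, ?o))) X = \<mu> (\<Phi> (x, ?o)) X} \<and>
        (\<forall>y\<in>carrier G. \<forall>p\<in>pts P. \<Phi> (x, ltrans G qP y p) = act y (\<Phi> (x, p)))" by (elim conjE)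
  then have eqv: "\<Phi> (x, ltrans G qP y p) = act y (\<Phi> (x, p))" if "y \<in> carrier G" "p \<in> pts P" for y p
    using x that by blast
  from C' have "\<forall>y\<in>carrier G. \<pi> (qP y) = qB y \<and>
        (\<forall>l\<in>L. \<forall>s. ch l = cis (2 * pi * s / \<tau>) \<longrightarrow> R s (qP y) = qP (y \<otimes>\<^bsub>G\<^esub> l))" by (elim conjE)
  then have \<pi>q: "\<pi> (qP y) = qB y" if "y \<in> carrier G" for y using that by blast
  from C' have pr: "\<forall>i\<in>{1..m}. tdim P ?o (pp i) = d i \<and>
      (\<forall>Y\<in>pp i. Y \<noteq> tzero \<longrightarrow> gs i ?oB (push B \<pi> ?o Y) (push B \<pi> ?o Y) > 0) \<and>
      (\<forall>j\<in>{1..m}. j \<noteq> i \<longrightarrow> (\<forall>Y\<in>pp j. \<forall>\<eta>\<in>tangent B ?oB. gs i ?oB (push B \<pi> ?o Y) \<eta> = 0)) \<and>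
      (\<forall>x\<in>I. \<forall>Y\<in>pp i. gs i ?oB (push B \<pi> ?o Y) (push B \<pi> ?o Y) = 1 \<longrightarrow>
         ricci B (base_metric m a b gs x) ?oB (push B \<pi> ?o Y) (push B \<pi> ?o Y) = 1)" by (elim conjE)
  have G: "group G" and N: "smooth_manifold N" and ptsN: "pts N = carrier G" using LG by (auto simp: lie_group_def)
  interpret G: group G by (rule G)
  have qPim: "qP ` carrier G = pts P"
    and qPeq: "\<And>y z. y \<in> carrier G \<Longrightarrow> z \<in> carrier G \<Longrightarrow> qP y = qP z \<longleftrightarrow> inv\<^bsub>G\<^esub> y \<otimes>\<^bsub>G\<^esub> z \<in> K"
    using HP by (auto simp: homogeneous_quotient_def)
  have oP: "?o \<in> pts P" using qPim by blast
  have \<pi>o: "\<pi> ?o = qB \<one>\<^bsub>G\<^esub>" by (rule \<pi>q) simp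
  note ID' = ID[unfolded isotropy_decomposition_def]
  from ID' have ID1: "\<forall>i\<in>{1..m}. tsubspace (tangent P ?o) (pp i) \<and> irreducible_rep K (\<lambda>k. push P (ltrans G qP k) ?o) (pp i) \<and>
     (\<exists>k\<in>K. \<exists>\<xi>\<in>pp i. push P (ltrans G qP k) ?o \<xi> \<noteq> \<xi>)" by (elim conjE)
  from ID' have ID2: "\<forall>\<xi>\<in>tangent P ?o. \<exists>!sw. snd sw \<in> Pi\<^sub>E {1..m} pp \<and>
     \<xi> = (\<lambda>f. fst sw * fibre_vec P R ?o f + (\<Sum>i=1..m. snd sw i f))" by (elim conjE)
  have base: "scalar_curvature M g (\<Phi> (x, ?o)) = Sc x"
  proof (rule scalar_curvature_adapted_decomposition[where pp = pp, OF x oP])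
    show "tsubspace (tangent P ?o) (pp i)" if "i \<in> {1..m}" for i
      by (rule conjunct1[OF bspec[OF ID1 that]])
    show "\<exists>s w. (\<forall>i\<in>{1..m}. w i \<in> pp i) \<and> \<xi> = (\<lambda>f. s * fibre_vec P R ?o f + (\<Sum>i=1..m. w i f))"
      if \<xi>: "\<xi> \<in> tangent P ?o" for \<xi>
    proof -
      obtain sw where sw: "snd sw \<in> Pi\<^sub>E {1..m} pp" "\<xi> = (\<lambda>f. fst sw * fibre_vec P R ?o f + (\<Sum>i=1..m. snd sw i f))"
        using ex1_implies_ex[OF bspec[OF ID2 \<xi>]] by (elim exE conjE)
      then show ?thesis by (intro exI[of _ "fst sw"] exI[of _ "snd sw"]) auto
    qed
    fix i assume i: "i \<in> {1..m}"
    note pri = bspec[OF pr i]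
    show "tdim P ?o (pp i) = d i" by (rule conjunct1[OF pri])
    fix \<xi>
    show "0 < gs i (\<pi> ?o) (push B \<pi> ?o \<xi>) (push B \<pi> ?o \<xi>)" if "\<xi> \<in> pp i" "\<xi> \<noteq> tzero"
      unfolding \<pi>o using pri that by simp
    show "gs i (\<pi> ?o) (push B \<pi> ?o \<xi>) \<eta> = 0" if "j \<in> {1..m}" "j \<noteq> i" "\<xi> \<in> pp j" "\<eta> \<in> tangent B (\<pi> ?o)" for j \<eta>
      using pri that unfolding \<pi>o by simp
    show "ricci B (base_metric m a b gs x) (\<pi> ?o) (push B \<pi> ?o \<xi>) (push B \<pi> ?o \<xi>) = 1"
      if "\<xi> \<in> pp i" "gs i (\<pi> ?o) (push B \<pi> ?o \<xi>) (push B \<pi> ?o \<xi>) = 1"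
      using pri that x unfolding \<pi>o by simp
  qed
  obtain y where y: "y \<in> carrier G" "p = qP y" using p qPim by blast
  have "ltrans G qP y ?o = p"
  proof -
    \<comment> \<open>\<open>ltrans\<close> represents a coset by \<open>inv_into\<close>, so the
      base point is represented by some element of \<open>K\<close> and not necessarily by the
      identity. Multiplying \<open>y\<close> by it on the right does not change the coset.\<close>
    let ?k = "inv_into (carrier G) qP ?o"
    have k: "?k \<in> carrier G" "qP ?k = ?o" using inv_into_into[of ?o qP "carrier G"] f_inv_into_f[of ?o qP "carrier G"] by auto
    have "inv\<^bsub>G\<^esub> ?k \<in> K" using qPeq[OF k(1) G.one_closed] k by simp
    moreover have "inv\<^bsub>G\<^esub> (y \<otimes>\<^bsub>G\<^esub> ?k) \<otimes>\<^bsub>G\<^esub> y = inv\<^bsub>G\<^esub> ?k"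
      using k y by (simp add: G.inv_mult_group G.m_assoc)
    ultimately show ?thesis using qPeq[of "y \<otimes>\<^bsub>G\<^esub> ?k" y] k y by (simp add: ltrans_def)
  qed
  then have \<Phi>p: "\<Phi> (x, p) = act y (\<Phi> (x, ?o))" using eqv[OF y(1) oP] by simp
  have act: "smooth_map M M (act z)" if z: "z \<in> carrier G" for z
  proof -
    have "smooth_map M M ((\<lambda>(x, p). act x p) \<circ> (\<lambda>p. (z, p)))"
      by (rule smooth_map_compose[OF wM wmfd_prod[OF smooth_manifold_wmfd[OF N] wM] wM smooth_map_Pair_const[OF _ M]])
        (use IA z ptsN in \<open>auto simp: isometric_action_def\<close>)
    then show ?thesis by (simp add: o_def)
  qed
  have actinv: "act z (act (inv\<^bsub>G\<^esub> z) q) = q" "act (inv\<^bsub>G\<^esub> z) (act z q) = q" if "z \<in> carrier G" "q \<in> pts M" for z q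
  proof -
    have "act (z \<otimes>\<^bsub>G\<^esub> inv\<^bsub>G\<^esub> z) q = act z (act (inv\<^bsub>G\<^esub> z) q)" "act (inv\<^bsub>G\<^esub> z \<otimes>\<^bsub>G\<^esub> z) q = act (inv\<^bsub>G\<^esub> z) (act z q)" "act \<one>\<^bsub>G\<^esub> q = q"
      using IA that unfolding isometric_action_def by (blast intro: G.inv_closed)+
    then show "act z (act (inv\<^bsub>G\<^esub> z) q) = q" "act (inv\<^bsub>G\<^esub> z) (act z q) = q" using that by simp_all
  qed
  have \<Phi>o: "\<Phi> (x, ?o) \<in> pts M" using M0sub x oP by blast
  have "scalar_curvature M g (act y (\<Phi> (x, ?o))) = scalar_curvature M g (\<Phi> (x, ?o))"
    by (rule scalar_curvature_isometry[OF riem act[OF y(1)] act[OF G.inv_closed[OF y(1)]] actinv(1)[OF y(1)] actinv(2)[OF y(1)] \<Phi>o])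
      (use IA y(1) in \<open>auto simp: isometric_action_def\<close>)
  then show ?thesis unfolding \<Phi>p base .
qed

end

section \<open>Construction Two\<close>

locale coord_blocks =
  fixes A :: "'i set" and C :: "'i \<Rightarrow> 'e::euclidean_space set"
  assumes finA: "finite A" and CB: "i \<in> A \<Longrightarrow> C i \<subseteq> Basis" and disjC: "disjoint_family_on C A"
begin

definition Pj :: "'i \<Rightarrow> 'e \<Rightarrow> 'e" where "Pj i u = (\<Sum>b\<in>C i. (u \<bullet> b) *\<^sub>R b)"

abbreviation "D \<equiv> \<Union>i\<in>A. C i"

lemma DB: "D \<subseteq> Basis" using CB by blast

lemma Pj_bl: "bounded_linear (Pj i)"
  unfolding Pj_def
  by (intro bounded_linear_sum bounded_linear_scaleR_const bounded_linear_inner_left bounded_linear_ident)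

lemma Pj_add: "Pj i (u + t *\<^sub>R v) = Pj i u + t *\<^sub>R Pj i v"
  using Pj_bl[THEN bounded_linear.linear] by (simp add: linear_add linear_scale)

lemma Pj_in: "Pj i u \<in> span (C i)"
  unfolding Pj_def by (intro span_sum span_scale span_base)

lemma Pj_id: "i \<in> A \<Longrightarrow> v \<in> span (C i) \<Longrightarrow> Pj i v = v"
  unfolding Pj_def using span_coords_sum[OF CB] by simp

lemma Pj_other:
  assumes "i \<in> A" "j \<in> A" "i \<noteq> j" "v \<in> span (C j)"
  shows "Pj i v = 0"
  using assms(4)
proof (induction rule: span_induct_alt)
  case base
  then show ?case by (simp add: Pj_def)
next
  case (step t b v)
  have "b \<bullet> b' = 0" if "b' \<in> C i" for b'
    using that step(1) disjC assms(1-3) CB[OF assms(1)] CB[OF assms(2)]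
    by (intro inner_not_same_Basis) (auto simp: disjoint_family_on_def)
  then have "Pj i b = 0" unfolding Pj_def by (intro sum.neutral) simp
  then show ?case using Pj_add[of i v t b] step(2) by (simp add: add.commute)
qed

lemma Pj_sum:
  assumes "v \<in> span D"
  shows "(\<Sum>i\<in>A. Pj i v) = v"
proof -
  have "finite (C i)" if "i \<in> A" for i by (rule finite_coords[OF CB[OF that]])
  then have "(\<Sum>i\<in>A. Pj i v) = (\<Sum>b\<in>D. (v \<bullet> b) *\<^sub>R b)"
    unfolding Pj_def by (intro sum.UNION_disjoint[symmetric])
      (use finA disjC in \<open>auto simp: disjoint_family_on_def\<close>)
  then show ?thesis using span_coords_sum[OF DB assms] by simp
qed

lemma span_block: "i \<in> A \<Longrightarrow> span (C i) \<subseteq> span D"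
  by (rule span_mono) blast

lemma oset_blocks:
  assumes W: "\<And>i. i \<in> A \<Longrightarrow> oset (C i) (W i)"
  shows "oset D {u \<in> span D. \<forall>i\<in>A. Pj i u \<in> W i}"
proof -
  have "\<forall>i\<in>A. \<exists>T. open T \<and> W i = span (C i) \<inter> T" using W by (auto simp: oset_def openin_open)
  then obtain T where T: "\<And>i. i \<in> A \<Longrightarrow> open (T i) \<and> W i = span (C i) \<inter> T i" by metis
  have "{u \<in> span D. \<forall>i\<in>A. Pj i u \<in> W i} = span D \<inter> (\<Inter>i\<in>A. Pj i -` T i)"
    using T Pj_in by blast
  moreover have "open (\<Inter>i\<in>A. Pj i -` T i)"
    using T finA by (intro open_INT ballI open_vimage) (auto intro: linear_continuous_on Pj_bl)
  ultimately show ?thesis using DB by (auto simp: oset_def openin_open)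
qed

definition block_sum :: "('i \<Rightarrow> real) \<Rightarrow> ('i \<Rightarrow> 'e \<Rightarrow> 'e \<Rightarrow> 'e \<Rightarrow> real) \<Rightarrow> 'e \<Rightarrow> 'e \<Rightarrow> 'e \<Rightarrow> real" where
  "block_sum a gm u v w = (\<Sum>k\<in>A. a k * gm k (Pj k u) (Pj k v) (Pj k w))"

context
  fixes a :: "'i \<Rightarrow> real" and W :: "'i \<Rightarrow> 'e set" and gm :: "'i \<Rightarrow> 'e \<Rightarrow> 'e \<Rightarrow> 'e \<Rightarrow> real" and E :: "'i \<Rightarrow> 'e set" and y :: 'e
  assumes a: "\<And>i. i \<in> A \<Longrightarrow> a i > 0" and gm: "\<And>i. i \<in> A \<Longrightarrow> lform (C i) (W i) (gm i)"
    and y: "y \<in> span D" "\<And>i. i \<in> A \<Longrightarrow> Pj i y \<in> W i"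
    and E: "\<And>i. i \<in> A \<Longrightarrow> frame (span (C i)) (gm i (Pj i y)) (E i)"
begin

abbreviation "Gb \<equiv> block_sum a gm"

lemma d1_Gb:
  assumes u: "\<And>i. i \<in> A \<Longrightarrow> Pj i u \<in> W i"
  shows "d1 Gb x v w u = (\<Sum>k\<in>A. a k * d1 (gm k) (Pj k x) (Pj k v) (Pj k w) (Pj k u))"
  unfolding d1_def block_sum_def
proof (rule dd_eqI, rule has_vector_derivative_sum)
  fix k assume k: "k \<in> A"
  show "((\<lambda>t. a k * gm k (Pj k (u + t *\<^sub>R x)) (Pj k v) (Pj k w)) has_vector_derivative
     a k * dd (\<lambda>z. gm k z (Pj k v) (Pj k w)) (Pj k x) (Pj k u)) (at 0)"
    unfolding Pj_add
    by (intro has_vector_derivative_mult_right smooth_on_line[OF lform.o[OF gm[OF k]] lform.sm[OF gm[OF k]] u[OF k]] Pj_in)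
qed

lemma d2_Gb:
  assumes x: "x \<in> span D"
  shows "d2 Gb x x' v w y = (\<Sum>k\<in>A. a k * d2 (gm k) (Pj k x) (Pj k x') (Pj k v) (Pj k w) (Pj k y))"
proof -
  have "d2 Gb x x' v w y = dd (\<lambda>u. \<Sum>k\<in>A. a k * d1 (gm k) (Pj k x') (Pj k v) (Pj k w) (Pj k u)) x y"
    unfolding d2_def
    by (rule dd_cong[OF oset_blocks[of W] _ x d1_Gb]) (use lform.o[OF gm] y in auto)
  also have "\<dots> = (\<Sum>k\<in>A. a k * d2 (gm k) (Pj k x) (Pj k x') (Pj k v) (Pj k w) (Pj k y))"
    unfolding d2_def
  proof (rule dd_eqI, rule has_vector_derivative_sum)
    fix k assume k: "k \<in> A"
    show "((\<lambda>t. a k * d1 (gm k) (Pj k x') (Pj k v) (Pj k w) (Pj k (y + t *\<^sub>R x))) has_vector_derivative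
       a k * dd (d1 (gm k) (Pj k x') (Pj k v) (Pj k w)) (Pj k x) (Pj k y)) (at 0)"
      unfolding Pj_add
      by (intro has_vector_derivative_mult_right smooth_on_line[OF lform.o[OF gm[OF k]] lform.d1_smooth[OF gm[OF k]] y(2)[OF k]] Pj_in)
  qed
  finally show ?thesis .
qed

lemma ED: "i \<in> A \<Longrightarrow> e \<in> E i \<Longrightarrow> e \<in> span (C i)"
  using frame_in[OF E] .

lemma Pj_E: "i \<in> A \<Longrightarrow> k \<in> A \<Longrightarrow> e \<in> E i \<Longrightarrow> Pj k e = (if k = i then e else 0)"
  using Pj_id[OF _ ED] Pj_other[OF _ _ _ ED] by auto

lemma single_block:
  assumes "i \<in> A" "\<And>k. k \<in> A \<Longrightarrow> k \<noteq> i \<Longrightarrow> f k = 0"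
  shows "(\<Sum>k\<in>A. f k) = (f i :: real)"
  using sum.mono_neutral_left[OF finA, of "{i}" f] assms by auto

text \<open>Each summand sees only the components in its own block. If the three vectors do not all
  belong to one block, every summand has a zero in some slot.\<close>

lemma d1_block:
  assumes i: "i \<in> A" "j \<in> A" "l \<in> A" and e: "e \<in> E i" "f \<in> E j" "g \<in> E l"
  shows "d1 Gb e f g y = (if i = j \<and> j = l then a i * d1 (gm i) e f g (Pj i y) else 0)"
proof -
  have z: "d1 (gm k) (Pj k e) (Pj k f) (Pj k g) (Pj k y) = 0" if k: "k \<in> A" and ne: "k \<noteq> i \<or> k \<noteq> j \<or> k \<noteq> l" for k
  proof -
    interpret k: lform "C k" "W k" "gm k" by (rule gm[OF k])
    have "Pj k e = 0 \<or> Pj k f = 0 \<or> Pj k g = 0"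
      using ne Pj_E[OF i(1) k e(1)] Pj_E[OF i(2) k e(2)] Pj_E[OF i(3) k e(3)] by auto
    then show ?thesis by (elim disjE) (simp_all add: k.zero_args[OF y(2)[OF k]] Pj_in)
  qed
  let ?T = "\<lambda>k. a k * d1 (gm k) (Pj k e) (Pj k f) (Pj k g) (Pj k y)"
  have s: "d1 Gb e f g y = sum ?T A" by (rule d1_Gb[OF y(2)])
  show ?thesis
  proof (cases "i = j \<and> j = l")
    case True
    then have "f \<in> E i" "g \<in> E i" using e by auto
    then have p: "Pj i e = e" "Pj i f = f" "Pj i g = g" using Pj_E[OF i(1,1)] e(1) by simp_all
    have "sum ?T A = ?T i"
    proof (rule single_block[OF i(1), of ?T])
      show "?T k = 0" if "k \<in> A" "k \<noteq> i" for k using z[OF that(1) disjI1[OF that(2)]] by simp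
    qed
    then show ?thesis unfolding s p using True by simp
  next
    case False
    have "sum ?T A = 0"
    proof (rule sum.neutral, rule ballI)
      fix k assume k: "k \<in> A"
      have "k \<noteq> i \<or> k \<noteq> j \<or> k \<noteq> l" using False by blast
      then show "?T k = 0" using z[OF k] by simp
    qed
    then show ?thesis unfolding s if_not_P[OF False] .
  qed
qed

lemma d2_block:
  assumes i: "i \<in> A" "j \<in> A" and e: "e \<in> E i" "f \<in> E j"
  shows "d2 Gb e f e f y = (if i = j then a i * d2 (gm i) e f e f (Pj i y) else 0)"
    and "d2 Gb e e f f y = (if i = j then a i * d2 (gm i) e e f f (Pj i y) else 0)"
proof -
  have z: "d2 (gm k) (Pj k e) (Pj k f) (Pj k e) (Pj k f) (Pj k y) = 0" "d2 (gm k) (Pj k e) (Pj k e) (Pj k f) (Pj k f) (Pj k y) = 0"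
    if k: "k \<in> A" and ne: "k \<noteq> i \<or> k \<noteq> j" for k
  proof -
    interpret k: lform "C k" "W k" "gm k" by (rule gm[OF k])
    have "Pj k e = 0 \<or> Pj k f = 0"
      using ne Pj_E[OF i(1) k e(1)] Pj_E[OF i(2) k e(2)] by auto
    then consider "Pj k e = 0" | "Pj k f = 0" by blast
    then show "d2 (gm k) (Pj k e) (Pj k f) (Pj k e) (Pj k f) (Pj k y) = 0" "d2 (gm k) (Pj k e) (Pj k e) (Pj k f) (Pj k f) (Pj k y) = 0"
      by (cases; simp only: k.zero_args[OF y(2)[OF k]] Pj_in span_zero)+
  qed
  let ?S = "\<lambda>k. a k * d2 (gm k) (Pj k e) (Pj k f) (Pj k e) (Pj k f) (Pj k y)"
  let ?T = "\<lambda>k. a k * d2 (gm k) (Pj k e) (Pj k e) (Pj k f) (Pj k f) (Pj k y)"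
  have eD: "e \<in> span D" using ED[OF i(1) e(1)] span_block[OF i(1)] by blast
  have s: "d2 Gb e f e f y = sum ?S A" "d2 Gb e e f f y = sum ?T A" by (rule d2_Gb[OF eD])+
  have n: "?S k = 0" "?T k = 0" if "k \<in> A" "k \<noteq> i" for k using z[OF that(1) disjI1[OF that(2)]] by simp_all
  have t: "sum ?S A = ?S i" "sum ?T A = ?T i"
    by (rule single_block[OF i(1), of ?S], rule n(1), assumption+) (rule single_block[OF i(1), of ?T], rule n(2), assumption+)
  have p: "Pj i e = e" using Pj_E[OF i(1,1) e(1)] by simp
  have r: "?S i = (if i = j then a i * d2 (gm i) e f e f (Pj i y) else 0)" "?T i = (if i = j then a i * d2 (gm i) e e f f (Pj i y) else 0)"
    using z[OF i(1)] Pj_E[OF i(2,1) e(2)] by (auto simp: p)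
  show "d2 Gb e f e f y = (if i = j then a i * d2 (gm i) e f e f (Pj i y) else 0)"
    "d2 Gb e e f f y = (if i = j then a i * d2 (gm i) e e f f (Pj i y) else 0)"
    unfolding s t by (rule r)+
qed

lemma chr1_block:
  assumes "i \<in> A" "j \<in> A" "l \<in> A" "e \<in> E i" "f \<in> E j" "g \<in> E l"
  shows "chr1 Gb e f g y = (if i = j \<and> j = l then a i * chr1 (gm i) e f g (Pj i y) else 0)"
  unfolding chr1_def
    d1_block[OF assms(1-6)] d1_block[OF assms(2,1,3,5,4,6)] d1_block[OF assms(3,1,2,6,4,5)]
  by (auto simp: right_diff_distrib distrib_left)

lemma E_disj: "i \<in> A \<Longrightarrow> j \<in> A \<Longrightarrow> i \<noteq> j \<Longrightarrow> E i \<inter> E j = {}"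
proof (rule ccontr)
  assume ij: "i \<in> A" "j \<in> A" "i \<noteq> j" and "E i \<inter> E j \<noteq> {}"
  then obtain e where e: "e \<in> E i" "e \<in> E j" by blast
  have "e = 0" using Pj_E[OF ij(1,1) e(1)] Pj_E[OF ij(2,1) e(2)] ij(3) by simp
  then show False
    using frame_pos[OF E[OF ij(1)] e(1)] lform.zero_args[OF gm[OF ij(1)] y(2)[OF ij(1)] span_zero] by simp
qed

lemma Gb_E:
  assumes "i \<in> A" "e \<in> E i"
  shows "Gb y e e = a i * gm i (Pj i y) e e"
proof -
  let ?T = "\<lambda>k. a k * gm k (Pj k y) (Pj k e) (Pj k e)"
  have "sum ?T A = ?T i"
    by (rule single_block[OF assms(1), of ?T])
      (use Pj_E[OF assms(1) _ assms(2)] lform.zero_args[OF gm y(2) span_zero] in simp)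
  then show ?thesis using Pj_E[OF assms(1,1,2)] by (simp add: block_sum_def)
qed

lemma finE: "i \<in> A \<Longrightarrow> finite (E i)"
  using E by (simp add: frame_def)

lemma sum_E: "(\<Sum>g\<in>(\<Union>i\<in>A. E i). f g) = (\<Sum>i\<in>A. \<Sum>g\<in>E i. f g :: real)"
  by (rule sum.UNION_disjoint) (use finA finE E_disj in auto)

text \<open>Planes spanned by vectors of different blocks are flat. Within a block a constant factor
  \<open>a i\<close> multiplies the second derivatives once, and the quadratic terms twice with one
  division by a length, so \<open>sec\<close> scales by \<open>a i\<close>.\<close>

lemma sec_block:
  assumes i: "i \<in> A" "j \<in> A" and e: "e \<in> E i" "f \<in> E j"
  shows "sec Gb (\<Union>i\<in>A. E i) y e f = (if i = j then a i * sec (gm i) (E i) (Pj i y) e f else 0)"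
proof -
  let ?q = "\<lambda>g. ((chr1 Gb e f g y)\<^sup>2 - chr1 Gb e e g y * chr1 Gb f f g y) / Gb y g g"
  let ?r = "\<lambda>g. ((chr1 (gm i) e f g (Pj i y))\<^sup>2 - chr1 (gm i) e e g (Pj i y) * chr1 (gm i) f f g (Pj i y)) / gm i (Pj i y) g g"
  have q: "?q g = (if i = j \<and> j = l then a i * ?r g else 0)" if l: "l \<in> A" "g \<in> E l" for l g
  proof -
    have "((a i * p)\<^sup>2 - a i * q * (a i * r)) / (a i * s) = a i * ((p\<^sup>2 - q * r) / s)" for p q r s
    proof -
      have "(a i * p)\<^sup>2 - a i * q * (a i * r) = a i * (a i * (p\<^sup>2 - q * r))" by (simp add: power2_eq_square algebra_simps)
      then show ?thesis using a[OF i(1)] by simp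
    qed
    then show ?thesis
      unfolding chr1_block[OF i l(1) e l(2)] chr1_block[OF i(1,1) l(1) e(1,1) l(2)] chr1_block[OF i(2,2) l(1) e(2,2) l(2)] Gb_E[OF l]
      by auto
  qed
  have "(\<Sum>g\<in>(\<Union>i\<in>A. E i). ?q g) = (\<Sum>l\<in>A. \<Sum>g\<in>E l. if i = j \<and> j = l then a i * ?r g else 0)"
    unfolding sum_E by (intro sum.cong refl q)
  also have "\<dots> = (\<Sum>l\<in>A. if l = i then (if i = j then a i * (\<Sum>g\<in>E i. ?r g) else 0) else 0)"
    by (intro sum.cong refl) (auto simp: sum_distrib_left)
  also have "\<dots> = (if i = j then a i * (\<Sum>g\<in>E i. ?r g) else 0)" using finA i(1) by simp
  finally show ?thesis
    unfolding sec_def using d2_block[OF i e] d2_block[OF i(2,1) e(2,1)] by (auto simp: algebra_simps)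
qed

text \<open>\<open>sec\<close> carries one factor \<open>a i\<close> and the two square lengths in
  the denominator carry one each, which leaves \<open>1 / a i\<close>.\<close>

lemma scal_block: "scal Gb (\<Union>i\<in>A. E i) y = (\<Sum>i\<in>A. scal (gm i) (E i) (Pj i y) / a i)"
  unfolding scal_def sum_E
proof (rule sum.cong)
  fix i assume i: "i \<in> A"
  have "(\<Sum>e\<in>E i. \<Sum>j\<in>A. \<Sum>f\<in>E j. sec Gb (\<Union>i\<in>A. E i) y e f / (Gb y e e * Gb y f f))
      = (\<Sum>e\<in>E i. \<Sum>j\<in>A. if j = i then (\<Sum>f\<in>E i. sec (gm i) (E i) (Pj i y) e f / (gm i (Pj i y) e e * gm i (Pj i y) f f)) / a i else 0)"
    using i a[OF i] unfolding sum_divide_distrib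
    by (intro sum.cong refl) (auto simp: sec_block Gb_E intro!: sum.neutral sum.cong)
  also have "\<dots> = (\<Sum>e\<in>E i. \<Sum>f\<in>E i. sec (gm i) (E i) (Pj i y) e f / (gm i (Pj i y) e e * gm i (Pj i y) f f)) / a i"
    using finA i by (simp add: sum_divide_distrib)
  finally show "(\<Sum>e\<in>E i. \<Sum>j\<in>A. \<Sum>f\<in>E j. sec Gb (\<Union>i\<in>A. E i) y e f / (Gb y e e * Gb y f f))
      = (\<Sum>e\<in>E i. \<Sum>f\<in>E i. sec (gm i) (E i) (Pj i y) e f / (gm i (Pj i y) e e * gm i (Pj i y) f f)) / a i" .
qed simp

end

end

context coord_blocks
begin

lemma Pj_of_sum:
  assumes w: "\<And>j. j \<in> A \<Longrightarrow> w j \<in> span (C j)" and i: "i \<in> A"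
  shows "Pj i (\<Sum>j\<in>A. w j) = w i"
proof -
  have "Pj i (\<Sum>j\<in>A. w j) = (\<Sum>j\<in>A. Pj i (w j))"
    by (rule linear_sum[OF bounded_linear.linear[OF Pj_bl]])
  also have "\<dots> = (\<Sum>j\<in>A. if j = i then w i else 0)"
    by (rule sum.cong) (use Pj_other[OF i _ _ w] Pj_id[OF i w[OF i]] in auto)
  finally show ?thesis using finA i by simp
qed

end

section \<open>Parametrizations of the base adapted to its product structure\<close>

locale product_splitting =
  fixes B :: "('q, 'e::euclidean_space) mfd" and A :: "'i set" and Ms :: "'i \<Rightarrow> ('b, 'f::euclidean_space) mfd"
    and pr :: "'i \<Rightarrow> 'q \<Rightarrow> 'b"
  assumes Bm: "smooth_manifold B" and Afin: "finite A" and Msm: "i \<in> A \<Longrightarrow> smooth_manifold (Ms i)"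
    and disj: "disjoint_family_on (\<lambda>i. coords (Ms i)) A"
    and dfB: "diffeo B (Prod_mfd A Ms) (\<lambda>q. \<lambda>i\<in>A. pr i q)"
begin

lemma wMs: "i \<in> A \<Longrightarrow> wmfd (Ms i)" using Msm smooth_manifold_wmfd by blast

sublocale coord_blocks A "\<lambda>i. coords (Ms i)"
  by unfold_locales (rule Afin wmfdD(1)[OF wMs] disj; assumption?)+

abbreviation "\<kappa> \<equiv> (\<lambda>q. \<lambda>i\<in>A. pr i q)"
abbreviation "PM \<equiv> Prod_mfd A Ms"
definition "pchart c = (\<Pi>\<^sub>E i\<in>A. fst (c i), \<lambda>q. \<Sum>i\<in>A. snd (c i) (q i))"
definition "pdom c = {u \<in> span D. \<forall>i\<in>A. Pj i u \<in> cimg (c i)}"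
text \<open>A parametrization of \<open>B\<close> by a product of charts of the factors. The charts
  in \<open>atlas B\<close> have no relation to the splitting, and only in these coordinates is the
  base metric a sum over blocks.\<close>

definition "F c u = inv_into (pts B) \<kappa> (\<lambda>i\<in>A. cinv (c i) (Pj i u))"

lemma wBm: "wmfd B" by (rule smooth_manifold_wmfd[OF Bm])

lemma PM_simps: "topo PM = product_topology (\<lambda>i. topo (Ms i)) A" "coords PM = D"
  by (simp_all add: Prod_mfd_def)

lemma ptsPM: "pts PM = (\<Pi>\<^sub>E i\<in>A. pts (Ms i))"
  by (simp add: PM_simps)

lemma pchart: "(\<And>i. i \<in> A \<Longrightarrow> c i \<in> atlas (Ms i)) \<Longrightarrow> pchart c \<in> atlas PM"
  by (auto simp: Prod_mfd_def pchart_def)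

lemma \<kappa>sm: "smooth_map B PM \<kappa>" and \<kappa>'sm: "smooth_map PM B (inv_into (pts B) \<kappa>)" and \<kappa>bij: "bij_betw \<kappa> (pts B) (pts PM)"
  using dfB by (auto simp: diffeo_def)

lemma chart_span:
  assumes "i \<in> A" "c \<in> atlas (Ms i)" "q \<in> fst c"
  shows "snd c q \<in> span (coords (Ms i))"
  using oset_sub_span[OF wmfd_cimg[OF wMs[OF assms(1)] assms(2)]] assms(3) by blast

lemma pchart_open:
  assumes "\<And>i. i \<in> A \<Longrightarrow> c i \<in> atlas (Ms i)"
  shows "openin (topo PM) (fst (pchart c))"
  unfolding PM_simps pchart_def fst_conv using assms wmfdD(3)[OF wMs]
  by (auto simp: openin_PiE_gen Afin)

lemma Pj_pchart:
  assumes "\<And>i. i \<in> A \<Longrightarrow> c i \<in> atlas (Ms i)" "\<And>i. i \<in> A \<Longrightarrow> q i \<in> fst (c i)" "i \<in> A"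
  shows "Pj i (snd (pchart c) q) = snd (c i) (q i)"
  unfolding pchart_def snd_conv by (rule Pj_of_sum[OF chart_span]) (use assms in auto)

text \<open>The diffeomorphism gives smoothness of the sum of all chart components; the block
  projection \<open>Pj i\<close> extracts the component that belongs to \<open>pr i\<close>.\<close>

lemma pr_sm:
  assumes i: "i \<in> A"
  shows "smooth_map B (Ms i) (pr i)"
  unfolding smooth_map_def
proof (intro conjI ballI)
  have "continuous_map (topo B) (topo (Ms i)) ((\<lambda>q. q i) \<circ> \<kappa>)"
    using \<kappa>sm i by (intro continuous_map_compose[of _ "topo PM"])
      (auto simp: smooth_map_def PM_simps intro: continuous_map_product_projection)
  then show cont: "continuous_map (topo B) (topo (Ms i)) (pr i)" using i by (simp add: o_def)
  fix c c' assume c: "c \<in> atlas B" and c': "c' \<in> atlas (Ms i)"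
  let ?U = "snd c ` (fst c \<inter> pr i -` fst c')"
  have "openin (topo B) {q \<in> pts B. pr i q \<in> fst c'}"
    by (rule openin_continuous_map_preimage[OF cont wmfdD(3)[OF wMs[OF i] c']])
  from wmfdD(5)[OF wBm c this]
  have "oset (coords B) (snd c ` (fst c \<inter> {q \<in> pts B. pr i q \<in> fst c'}))" .
  moreover have "fst c \<inter> {q \<in> pts B. pr i q \<in> fst c'} = fst c \<inter> pr i -` fst c'" using wmfdD(6)[OF wBm c] by auto
  ultimately have oU: "oset (coords B) ?U" by simp
  show "smooth_on (coords B) ?U (snd c' \<circ> pr i \<circ> cinv c)"
  proof (rule smooth_on_local[OF oU])
    fix u assume "u \<in> ?U"
    then obtain q where q: "q \<in> fst c" "pr i q \<in> fst c'" "u = snd c q" by auto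
    have qB: "q \<in> pts B" using wmfdD(6)[OF wBm c] q(1) by blast
    have \<kappa>q: "\<kappa> q \<in> pts PM" by (rule smooth_map_in[OF \<kappa>sm qB])
    have "\<forall>j\<in>A. \<exists>a\<in>atlas (Ms j). pr j q \<in> fst a"
    proof
      fix j assume j: "j \<in> A"
      then have "pr j q \<in> pts (Ms j)" using \<kappa>q by (auto simp: ptsPM PiE_iff)
      then show "\<exists>a\<in>atlas (Ms j). pr j q \<in> fst a" by (rule wmfdD(2)[OF wMs[OF j]])
    qed
    then obtain k where k: "\<And>j. j \<in> A \<Longrightarrow> k j \<in> atlas (Ms j) \<and> pr j q \<in> fst (k j)" by metis
    \<comment> \<open>Only the chart of the \<open>i\<close>-th factor is prescribed; any charts
      around the remaining components complete it to a product chart.\<close>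
    define cc where "cc = k(i := c')"
    have cc: "cc j \<in> atlas (Ms j)" "pr j q \<in> fst (cc j)" if "j \<in> A" for j using k[OF that] c' q(2) by (auto simp: cc_def)
    have cci: "cc i = c'" by (simp add: cc_def)
    let ?V = "snd c ` (fst c \<inter> \<kappa> -` fst (pchart cc))"
    have "openin (topo B) {q \<in> pts B. \<kappa> q \<in> fst (pchart cc)}"
      using \<kappa>sm pchart_open[of cc] cc by (intro openin_continuous_map_preimage[of _ "topo PM"]) (auto simp: smooth_map_def)
    from wmfdD(5)[OF wBm c this]
    have "oset (coords B) (snd c ` (fst c \<inter> {q \<in> pts B. \<kappa> q \<in> fst (pchart cc)}))" .
    moreover have "fst c \<inter> {q \<in> pts B. \<kappa> q \<in> fst (pchart cc)} = fst c \<inter> \<kappa> -` fst (pchart cc)" using wmfdD(6)[OF wBm c] by auto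
    ultimately have oV: "oset (coords B) ?V" by simp
    have "smooth_on (coords B) ?V (snd (pchart cc) \<circ> \<kappa> \<circ> cinv c)"
      using \<kappa>sm c pchart[of cc] cc by (auto simp: smooth_map_def)
    then have "smooth_on (coords B) ?V (\<lambda>u. Pj i ((snd (pchart cc) \<circ> \<kappa> \<circ> cinv c) u))"
      by (rule smooth_on_bounded_linear[OF Pj_bl oV])
    then have "smooth_on (coords B) ?V (snd c' \<circ> pr i \<circ> cinv c)"
    proof (rule smooth_on_cong[OF oV])
      fix v assume "v \<in> ?V"
      then obtain r where r: "r \<in> fst c" "\<kappa> r \<in> fst (pchart cc)" "v = snd c r" by auto
      have "Pj i (snd (pchart cc) (\<kappa> r)) = snd (cc i) (\<kappa> r i)"
        by (rule Pj_pchart[OF cc(1) _ i]) (use r(2) in \<open>auto simp: pchart_def PiE_iff\<close>)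
      then show "Pj i ((snd (pchart cc) \<circ> \<kappa> \<circ> cinv c) v) = (snd c' \<circ> pr i \<circ> cinv c) v"
        using r cinv_chart[OF wBm c] i by (simp add: cci)
    qed
    moreover have "u \<in> ?V" using q cc(2) by (auto simp: pchart_def)
    ultimately show "\<exists>V. oset (coords B) V \<and> u \<in> V \<and> smooth_on (coords B) (V \<inter> ?U) (snd c' \<circ> pr i \<circ> cinv c)"
      using oV smooth_on_subset[of "coords B" ?V "snd c' \<circ> pr i \<circ> cinv c" "?V \<inter> ?U"] by (intro exI[of _ ?V]) auto
  qed
qed

context
  fixes c :: "'i \<Rightarrow> ('b, 'f) chart"
  assumes c: "\<And>i. i \<in> A \<Longrightarrow> c i \<in> atlas (Ms i)"
begin

lemma oset_dom: "oset D (pdom c)"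
  unfolding pdom_def by (rule oset_blocks) (rule wmfd_cimg[OF wMs c])

lemma H_in:
  assumes "u \<in> pdom c"
  shows "(\<lambda>i\<in>A. cinv (c i) (Pj i u)) \<in> fst (pchart c)" "(\<lambda>i\<in>A. cinv (c i) (Pj i u)) \<in> pts PM"
     "snd (pchart c) (\<lambda>i\<in>A. cinv (c i) (Pj i u)) = u"
proof -
  have u: "Pj i u \<in> cimg (c i)" if "i \<in> A" for i using assms that by (simp add: pdom_def)
  show "(\<lambda>i\<in>A. cinv (c i) (Pj i u)) \<in> fst (pchart c)" using cinv_in[OF u] by (auto simp: pchart_def)
  show "(\<lambda>i\<in>A. cinv (c i) (Pj i u)) \<in> pts PM" using cinv_in[OF u] wmfdD(6)[OF wMs c] by (auto simp: ptsPM)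
  have "snd (pchart c) (\<lambda>i\<in>A. cinv (c i) (Pj i u)) = (\<Sum>i\<in>A. Pj i u)"
    unfolding pchart_def snd_conv by (rule sum.cong) (use chart_cinv[OF u] in auto)
  then show "snd (pchart c) (\<lambda>i\<in>A. cinv (c i) (Pj i u)) = u" using Pj_sum assms by (simp add: pdom_def)
qed

lemma F_in: "u \<in> pdom c \<Longrightarrow> F c u \<in> pts B"
  unfolding F_def using \<kappa>bij H_in(2) by (intro inv_into_into) (auto simp: bij_betw_def)

lemma pr_F:
  assumes "u \<in> pdom c" "i \<in> A"
  shows "pr i (F c u) = cinv (c i) (Pj i u)"
proof -
  have "\<kappa> (F c u) = (\<lambda>i\<in>A. cinv (c i) (Pj i u))"
    unfolding F_def by (rule f_inv_into_f) (use H_in(2)[OF assms(1)] in \<open>simp only: bij_betw_imp_surj_on[OF \<kappa>bij]\<close>)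
  from fun_cong[OF this, of i] show ?thesis using assms(2) by simp
qed

lemma F_chart:
  assumes q: "q \<in> pts B" "\<And>i. i \<in> A \<Longrightarrow> pr i q \<in> fst (c i)"
  shows "snd (pchart c) (\<kappa> q) \<in> pdom c" "F c (snd (pchart c) (\<kappa> q)) = q"
    "i \<in> A \<Longrightarrow> Pj i (snd (pchart c) (\<kappa> q)) = snd (c i) (pr i q)"
proof -
  show P: "Pj i (snd (pchart c) (\<kappa> q)) = snd (c i) (pr i q)" if "i \<in> A" for i
    using Pj_pchart[OF c, of "\<kappa> q" i] q(2) that by auto
  have "snd (pchart c) (\<kappa> q) \<in> span D"
    unfolding pchart_def snd_conv
  proof (rule span_sum)
    fix i assume i: "i \<in> A"
    show "snd (c i) (\<kappa> q i) \<in> span D" using chart_span[OF i c[OF i] q(2)[OF i]] span_block[OF i] i by auto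
  qed
  then show "snd (pchart c) (\<kappa> q) \<in> pdom c" using P q(2) by (auto simp: pdom_def)
  have "(\<lambda>i\<in>A. cinv (c i) (Pj i (snd (pchart c) (\<kappa> q)))) = \<kappa> q"
    by (rule restrict_ext) (use P cinv_chart[OF wMs c] q(2) in auto)
  then show "F c (snd (pchart c) (\<kappa> q)) = q"
    unfolding F_def using \<kappa>bij q(1) by (auto simp: bij_betw_def intro!: inv_into_f_f)
qed

lemma F_sm: "smooth_map (euc D (pdom c)) B (F c)"
  unfolding smooth_map_euc_iff[OF oset_dom wBm]
proof (intro conjI ballI)
  have "continuous_map (top_of_set (pdom c)) (topo PM) (\<lambda>u. \<lambda>i\<in>A. cinv (c i) (Pj i u))"
    unfolding PM_simps continuous_map_componentwise
  proof (intro conjI ballI)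
    show "(\<lambda>u. \<lambda>i\<in>A. cinv (c i) (Pj i u)) ` topspace (top_of_set (pdom c)) \<subseteq> extensional A" by auto
    fix i assume i: "i \<in> A"
    have 1: "continuous_map (top_of_set (pdom c)) (top_of_set (cimg (c i))) (Pj i)"
      using i by (auto simp: pdom_def intro: linear_continuous_on Pj_bl)
    have 2: "continuous_map (top_of_set (cimg (c i))) (topo (Ms i)) (cinv (c i))"
      using smooth_map_cinv_cimg[OF Msm[OF i] c[OF i]] by (simp add: smooth_map_def)
    show "continuous_map (top_of_set (pdom c)) (topo (Ms i)) (\<lambda>u. (\<lambda>i\<in>A. cinv (c i) (Pj i u)) i)"
      using continuous_map_compose[OF 1 2] i by (simp add: o_def)
  qed
  then have "continuous_map (top_of_set (pdom c)) (topo B) (inv_into (pts B) \<kappa> \<circ> (\<lambda>u. \<lambda>i\<in>A. cinv (c i) (Pj i u)))"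
    by (rule continuous_map_compose) (use \<kappa>'sm in \<open>simp add: smooth_map_def\<close>)
  moreover have "inv_into (pts B) \<kappa> \<circ> (\<lambda>u. \<lambda>i\<in>A. cinv (c i) (Pj i u)) = F c" by (auto simp: F_def)
  ultimately show cont: "continuous_map (top_of_set (pdom c)) (topo B) (F c)" by simp
  fix c' assume c': "c' \<in> atlas B"
  let ?U = "pdom c \<inter> F c -` fst c'"
  have "openin (top_of_set (pdom c)) {u \<in> topspace (top_of_set (pdom c)). F c u \<in> fst c'}"
    by (rule openin_continuous_map_preimage[OF cont wmfdD(3)[OF wBm c']])
  moreover have "{u \<in> topspace (top_of_set (pdom c)). F c u \<in> fst c'} = ?U" by auto
  ultimately have oU: "oset D ?U" using oset_dom by (auto simp: oset_def intro: openin_trans)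
  \<comment> \<open>The product chart is inverted by hand: its value is a sum of vectors in disjoint
    coordinate blocks, which determines the summands and hence, chart by chart, the point.\<close>
  have inj: "cinv (pchart c) (snd (pchart c) q) = q" if q: "q \<in> fst (pchart c)" for q
  proof (rule inv_into_f_f[OF _ q], rule inj_onI)
    fix r s assume rs: "r \<in> fst (pchart c)" "s \<in> fst (pchart c)" "snd (pchart c) r = snd (pchart c) s"
    show "r = s"
    proof (rule extensionalityI[of _ A])
      fix i assume i: "i \<in> A"
      have "snd (c i) (r i) = snd (c i) (s i)"
        using Pj_pchart[OF c _ i, of r] Pj_pchart[OF c _ i, of s] rs by (auto simp: pchart_def PiE_iff)
      then show "r i = s i" using wmfdD(4)[OF wMs[OF i] c[OF i]] rs(1,2) i by (auto simp: pchart_def PiE_iff inj_on_def)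
    qed (use rs in \<open>auto simp: pchart_def PiE_iff\<close>)
  qed
  have "smooth_on D (snd (pchart c) ` (fst (pchart c) \<inter> inv_into (pts B) \<kappa> -` fst c')) (snd c' \<circ> inv_into (pts B) \<kappa> \<circ> cinv (pchart c))"
    using \<kappa>'sm pchart[OF c] c' unfolding smooth_map_def PM_simps(2) by blast
  moreover have sub: "?U \<subseteq> snd (pchart c) ` (fst (pchart c) \<inter> inv_into (pts B) \<kappa> -` fst c')"
  proof
    fix u assume u: "u \<in> ?U"
    then have u': "u \<in> pdom c" by blast
    show "u \<in> snd (pchart c) ` (fst (pchart c) \<inter> inv_into (pts B) \<kappa> -` fst c')"
    proof (rule image_eqI)
      show "u = snd (pchart c) (\<lambda>i\<in>A. cinv (c i) (Pj i u))" by (rule H_in(3)[OF u', symmetric])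
      show "(\<lambda>i\<in>A. cinv (c i) (Pj i u)) \<in> fst (pchart c) \<inter> inv_into (pts B) \<kappa> -` fst c'"
        using H_in(1)[OF u'] u unfolding F_def by blast
    qed
  qed
  ultimately have "smooth_on D ?U (snd c' \<circ> inv_into (pts B) \<kappa> \<circ> cinv (pchart c))" by (rule smooth_on_subset)
  then show "smooth_on D ?U (snd c' \<circ> F c)"
  proof (rule smooth_on_cong[OF oU])
    fix u assume "u \<in> ?U"
    then have u: "u \<in> pdom c" by blast
    have "cinv (pchart c) u = (\<lambda>i\<in>A. cinv (c i) (Pj i u))" using inj[OF H_in(1)[OF u]] H_in(3)[OF u] by simp
    then show "(snd c' \<circ> inv_into (pts B) \<kappa> \<circ> cinv (pchart c)) u = (snd c' \<circ> F c) u" by (simp add: F_def)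
  qed
qed

lemma push_pr:
  assumes y: "y \<in> pdom c" and v: "v \<in> span D" and i: "i \<in> A"
  shows "push (Ms i) (pr i) (F c y) (push B (F c) y (pvec D (pdom c) y v)) = coord_vec (Ms i) (c i) (pr i (F c y)) (Pj i v)"
proof -
  have oi: "oset (coords (Ms i)) (cimg (c i))" by (rule wmfd_cimg[OF wMs[OF i] c[OF i]])
  have sm: "smooth_map (euc D (pdom c)) (euc (coords (Ms i)) (cimg (c i))) (Pj i)"
    by (rule smooth_map_bounded_linear[OF oset_dom oi Pj_bl]) (use i in \<open>auto simp: pdom_def\<close>)
  have Py: "Pj i y \<in> cimg (c i)" using y i by (simp add: pdom_def)
  have "push (Ms i) (pr i) (F c y) (push B (F c) y (pvec D (pdom c) y v)) = push (Ms i) (pr i \<circ> F c) y (pvec D (pdom c) y v)"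
    by (rule push_compose[OF wBm wMs[OF i] pr_sm[OF i], of "F c" y, OF F_in[OF y], symmetric])
  also have "\<dots> = push (Ms i) (cinv (c i) \<circ> Pj i) y (pvec D (pdom c) y v)"
    by (rule push_pvec_cong[OF oset_dom y v]) (simp add: pr_F[OF _ i])
  also have "\<dots> = push (Ms i) (cinv (c i)) (Pj i y) (push (euc (coords (Ms i)) (cimg (c i))) (Pj i) y (pvec D (pdom c) y v))"
    by (rule push_compose[OF wmfd_euc[OF oi] wMs[OF i] smooth_map_cinv_cimg[OF Msm[OF i] c[OF i]], of "Pj i" y]) (use Py in simp)
  also have "push (euc (coords (Ms i)) (cimg (c i))) (Pj i) y (pvec D (pdom c) y v) = pvec (coords (Ms i)) (cimg (c i)) (Pj i y) (Pj i v)"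
    using push_euc[OF oset_dom oi sm y v] dd_bounded_linear[OF Pj_bl] by simp
  also have "push (Ms i) (cinv (c i)) (Pj i y) \<dots> = coord_vec (Ms i) (c i) (pr i (F c y)) (Pj i v)"
    unfolding pr_F[OF y i] by (rule coord_vec_push[OF Msm[OF i] c[OF i] Py Pj_in, symmetric])
  finally show ?thesis .
qed

lemma F_inj:
  assumes y: "y \<in> pdom c" and v: "v \<in> span D" and 0: "push B (F c) y (pvec D (pdom c) y v) = tzero"
  shows "v = 0"
proof -
  have "Pj i v = 0" if i: "i \<in> A" for i
  proof -
    have p: "pr i (F c y) \<in> fst (c i)" unfolding pr_F[OF y i] using y i by (intro cinv_in) (simp add: pdom_def)
    have "coord_vec (Ms i) (c i) (pr i (F c y)) (Pj i v) = tzero"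
      unfolding push_pr[OF y v i, symmetric] 0 by (auto simp: push_def tzero_def)
    then show ?thesis
      using coord_vec_eq_iff[OF Msm[OF i] c[OF i] p Pj_in span_zero] coord_vec_0[OF wMs[OF i] c[OF i] p] by simp
  qed
  then show ?thesis using Pj_sum[OF v] by simp
qed

text \<open>In a chart of \<open>B\<close> the map \<open>K\<close> is a local right inverse of
  \<open>F c\<close> with values in the parameter domain. A tangent vector of the base is therefore
  the push under \<open>F c\<close> of its image under the derivative of \<open>K\<close>.\<close>

lemma F_surj:
  assumes y: "y \<in> pdom c"
  shows "tangent B (F c y) \<subseteq> (\<lambda>v. push B (F c) y (pvec D (pdom c) y v)) ` span D"
proof
  fix \<xi> assume \<xi>: "\<xi> \<in> tangent B (F c y)"
  obtain b where b: "b \<in> atlas B" "F c y \<in> fst b" using wmfdD(2)[OF wBm F_in[OF y]] by blast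
  obtain v where v: "v \<in> span (coords B)" "\<xi> = coord_vec B b (F c y) v" using \<xi> unfolding tangent_chart[OF Bm b] by blast
  let ?O = "{q \<in> pts B. \<kappa> q \<in> fst (pchart c)}"
  let ?U = "snd b ` (fst b \<inter> ?O)" and ?u = "snd b (F c y)"
  have O: "openin (topo B) ?O"
    using \<kappa>sm pchart_open[of c] c by (intro openin_continuous_map_preimage[of _ "topo PM"]) (auto simp: smooth_map_def)
  note oU = wmfdD(5)[OF wBm b(1) O] and sc = smooth_map_cinv[OF Bm b(1) O]
  have \<kappa>y: "\<kappa> (F c y) = (\<lambda>i\<in>A. cinv (c i) (Pj i y))" by (rule restrict_ext) (simp add: pr_F[OF y])
  have yO: "F c y \<in> ?O" using F_in[OF y] H_in(1)[OF y] by (simp only: \<kappa>y mem_Collect_eq simp_thms)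
  have u: "?u \<in> ?U" using b yO by blast
  have cu: "cinv b ?u = F c y" by (rule cinv_chart[OF wBm b])
  define K where "K = snd (pchart c) \<circ> \<kappa> \<circ> cinv b"
  have inO: "cinv b w \<in> ?O" if "w \<in> ?U" for w using that cinv_chart[OF wBm b(1)] by auto
  have KO: "K w \<in> pdom c" "F c (K w) = cinv b w" if w: "w \<in> ?U" for w
  proof -
    have q: "cinv b w \<in> pts B" "\<And>i. i \<in> A \<Longrightarrow> pr i (cinv b w) \<in> fst (c i)"
      using inO[OF w] by (auto simp: pchart_def PiE_iff)
    show "K w \<in> pdom c" "F c (K w) = cinv b w" using F_chart(1,2)[OF q] by (simp_all add: K_def)
  qed
  have Ku: "K ?u = y" using H_in(3)[OF y] by (simp add: K_def cu \<kappa>y del: restrict_apply)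
  have "smooth_on (coords B) (snd b ` (fst b \<inter> \<kappa> -` fst (pchart c))) (snd (pchart c) \<circ> \<kappa> \<circ> cinv b)"
    using \<kappa>sm pchart[OF c] b(1) unfolding smooth_map_def by blast
  then have Ksm: "smooth_on (coords B) ?U K" unfolding K_def by (rule smooth_on_subset) auto
  have Kmap: "smooth_map (euc (coords B) ?U) (euc D (pdom c)) K"
    by (rule smooth_map_euc_euc[OF oU oset_dom Ksm]) (use KO in auto)
  let ?p = "pvec (coords B) ?U ?u v"
  have "\<xi> = push B (cinv b) ?u ?p"
  proof -
    have "push B (cinv b) ?u ?p = coord_vec B b (F c y) (dd (snd b \<circ> cinv b) v ?u)"
      using push_pvec[OF oU wBm sc u b(1) _ v(1)] b(2) cu by simp
    also have "dd (snd b \<circ> cinv b) v ?u = dd (\<lambda>x. x) v ?u"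
      by (rule dd_cong[OF oU u v(1)]) (auto simp: cinv_chart[OF wBm b(1)])
    also have "\<dots> = v" by (rule dd_bounded_linear[OF bounded_linear_ident])
    finally show ?thesis using v(2) by (rule trans[OF _ sym, rotated])
  qed
  also have "\<dots> = push B (F c \<circ> K) ?u ?p"
    by (rule push_pvec_cong[OF oU u v(1)]) (simp only: o_apply KO(2))
  also have "\<dots> = push B (F c) y (push (euc D (pdom c)) K ?u ?p)"
    using push_compose[OF wmfd_euc[OF oset_dom] wBm F_sm, of K ?u ?p] y by (simp only: Ku) simp
  also have "push (euc D (pdom c)) K ?u ?p = pvec D (pdom c) y (dd K v ?u)"
    using push_euc[OF oU oset_dom Kmap u v(1)] by (simp only: Ku)
  finally have "\<xi> = push B (F c) y (pvec D (pdom c) y (dd K v ?u))" .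
  moreover have "dd K v ?u \<in> span D"
    by (rule dd_smooth_in_span[OF oset_dom oU Ksm _ u v(1)]) (use KO in auto)
  ultimately show "\<xi> \<in> (\<lambda>v. push B (F c) y (pvec D (pdom c) y v)) ` span D" by blast
qed

end

end

section \<open>Einstein factors, and the two constructions combined\<close>

context kaehler_cohom_one
begin

text \<open>In product coordinates the base metric is \<open>block_sum\<close> with factors
  \<open>A_coef a b i x\<close>. Since the Ricci tensor of each factor equals its metric, a factor
  has scalar curvature \<open>d i\<close>, and \<open>scal_block\<close> divides it by its
  scale.\<close>

theorem scalar_curvature_construction_two:
  fixes Ms :: "nat \<Rightarrow> ('b, 'f::euclidean_space) mfd" and gM :: "nat \<Rightarrow> 'b form2" and JM :: "nat \<Rightarrow> 'b endo"
  assumes C: "construction_two P B \<pi> \<theta> JB m d b gs Ms gM JM pr" and x: "x \<in> I" and p: "p \<in> pts P"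
  shows "scalar_curvature M g (\<Phi> (x, p)) = Sc x"
proof -
  \<comment> \<open>Otherwise the simplifier would rewrite the index set \<open>{1..m}\<close>,
    which occurs in the parameters of the interpreted locale, and its facts would no longer
    match.\<close>
  note One_nat_def [simp del]
  let ?A = "{1..m}"
  note C' = C[unfolded construction_two_def]
  from C' have KE: "\<forall>i\<in>?A. kaehler (Ms i) (gM i) (JM i) \<and> compact_space (topo (Ms i)) \<and> mdim (Ms i) = d i \<and>
        (\<forall>p\<in>pts (Ms i). \<forall>\<xi>\<in>tangent (Ms i) p. \<forall>\<eta>\<in>tangent (Ms i) p. ricci (Ms i) (gM i) p \<xi> \<eta> = gM i p \<xi> \<eta>)"
    by (elim conjE)
  from C' have dj: "disjoint_family_on (\<lambda>i. coords (Ms i)) ?A" by (elim conjE)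
  from C' have df: "diffeo B (Prod_mfd ?A Ms) (\<lambda>q. \<lambda>i\<in>?A. pr i q)" by (elim conjE)
  from C' have gsM: "\<forall>i\<in>?A. \<forall>q\<in>pts B. \<forall>\<xi>\<in>tangent B q.
        push (Ms i) (pr i) q (JB q \<xi>) = JM i (pr i q) (push (Ms i) (pr i) q \<xi>) \<and>
        (\<forall>\<eta>\<in>tangent B q. gs i q \<xi> \<eta> = gM i (pr i q) (push (Ms i) (pr i) q \<xi>) (push (Ms i) (pr i) q \<eta>))"
    by (elim conjE)
  have rM: "riemannian (Ms i) (gM i)" if "i \<in> ?A" for i using KE that by (simp add: kaehler_def)
  have Mi: "smooth_manifold (Ms i)" if "i \<in> ?A" for i using rM[OF that] by (simp add: riemannian_def)
  interpret PS: product_splitting B ?A Ms pr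
    by unfold_locales (rule B dj df Mi finite_atLeastAtMost; assumption?)+
  let ?D = "\<Union>i\<in>?A. coords (Ms i)"
  let ?q = "\<pi> p"
  have q: "?q \<in> pts B" by (rule smooth_map_in[OF \<pi>sm p])
  \<comment> \<open>The Einstein condition is evaluated by \<open>ricci\<close> in the chart
    \<open>chart_at\<close>, so the product parametrization is built from these charts.\<close>
  define c where "c i = chart_at (Ms i) (pr i ?q)" for i
  have prq: "pr i ?q \<in> pts (Ms i)" if "i \<in> ?A" for i by (rule smooth_map_in[OF PS.pr_sm[OF that] q])
  have c: "c i \<in> atlas (Ms i)" "pr i ?q \<in> fst (c i)" if "i \<in> ?A" for i
    using chart_at_props[OF PS.wMs[OF that] prq[OF that]] by (simp_all add: c_def)
  define y where "y = snd (PS.pchart c) (\<lambda>i\<in>?A. pr i ?q)"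
  have y: "y \<in> PS.pdom c" "PS.F c y = ?q" and Py: "i \<in> ?A \<Longrightarrow> PS.Pj i y = snd (c i) (pr i ?q)" for i
    unfolding y_def by (rule PS.F_chart[OF c(1) q c(2)]; assumption)+
  obtain Y' \<sigma> where bp: "base_param M g J I P B \<Phi> \<pi> R \<tau> \<theta> JB m d a b gs h ?D Y' (PS.F c) \<sigma>" "y \<in> Y'" "Y' \<subseteq> PS.pdom c" "\<sigma> y = p"
    by (rule base_param_through[OF PS.oset_dom[OF c(1)] PS.F_sm[OF c(1)] y(1) p y(2)[symmetric]
          PS.F_surj[OF c(1)] PS.F_inj[OF c(1)]])
  interpret bp: base_param M g J I P B \<Phi> \<pi> R \<tau> \<theta> JB m d a b gs h ?D Y' "PS.F c" \<sigma> by (rule bp(1))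
  have odom: "oset ?D (PS.pdom c)" by (rule PS.oset_dom) (rule c(1))
  have Fsm: "smooth_map (euc ?D (PS.pdom c)) B (PS.F c)" by (rule PS.F_sm) (rule c(1))
  have prF: "pr i (PS.F c z) = cinv (c i) (PS.Pj i z)" if "z \<in> PS.pdom c" "i \<in> ?A" for i z
    by (rule PS.pr_F[OF _ that]) (rule c(1))
  have ppr: "push (Ms i) (pr i) (PS.F c z) (push B (PS.F c) z (pvec ?D (PS.pdom c) z v)) = coord_vec (Ms i) (c i) (pr i (PS.F c z)) (PS.Pj i v)"
    if "z \<in> PS.pdom c" "v \<in> span ?D" "i \<in> ?A" for i z v
    by (rule PS.push_pr[OF _ that]) (rule c(1))
  define gm where "gm i = comp2 (Ms i) (gM i) (c i)" for i
  have lm: "lmetric (coords (Ms i)) (cimg (c i)) (gm i)" if "i \<in> ?A" for i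
    unfolding gm_def by (rule riemannian_lmetric[OF rM[OF that] c(1)[OF that]])
  then have lf: "lform (coords (Ms i)) (cimg (c i)) (gm i)" if "i \<in> ?A" for i using that lmetric.axioms(1) by blast
  have Pdom: "PS.Pj i z \<in> cimg (c i)" if "z \<in> Y'" "i \<in> ?A" for z i using that bp(3) by (auto simp: PS.pdom_def)
  have yD: "y \<in> span ?D" using y(1) by (simp add: PS.pdom_def)
  have Gm: "bp.Gm i z v w = gm i (PS.Pj i z) (PS.Pj i v) (PS.Pj i w)"
    if i: "i \<in> ?A" and z: "z \<in> Y'" and v: "v \<in> span ?D" and w: "w \<in> span ?D" for i z v w
  proof -
    have zd: "z \<in> PS.pdom c" using z bp(3) by blast
    have pz: "PS.F c z \<in> pts B" by (rule PS.F_in[OF _ zd]) (rule c(1))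
    have b: "push (Ms i) (pr i) (PS.F c z) (bp.bvec z u) = coord_vec (Ms i) (c i) (cinv (c i) (PS.Pj i z)) (PS.Pj i u)"
      if u: "u \<in> span ?D" for u
      unfolding bp.bvec_def push_pvec_restrict[OF Fsm odom bp.oY bp(3) wB z u]
      using ppr[OF zd u i] prF[OF zd i] by simp
    have "bp.Gm i z v w = gs i (PS.F c z) (bp.bvec z v) (bp.bvec z w)"
      by (simp add: bp.Gm_def pbf_def bp.bvec_def)
    also have "\<dots> = gM i (pr i (PS.F c z)) (push (Ms i) (pr i) (PS.F c z) (bp.bvec z v)) (push (Ms i) (pr i) (PS.F c z) (bp.bvec z w))"
      using gsM i pz bp.bvec_in[OF z v] bp.bvec_in[OF z w] by blast
    also have "\<dots> = gm i (PS.Pj i z) (PS.Pj i v) (PS.Pj i w)"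
      unfolding b[OF v] b[OF w] prF[OF zd i] by (simp add: gm_def comp2_def Let_def)
    finally show ?thesis .
  qed
  have "\<exists>E. frame (span (coords (Ms i))) (gm i (PS.Pj i y)) E \<and> (\<forall>e\<in>E. gm i (PS.Pj i y) e e = 1)" if i: "i \<in> ?A" for i
    by (rule orthonormal_frame_exists[OF lmetric.pf[OF lm[OF i] Pdom[OF bp(2) i]]]) blast
  then obtain E where "\<forall>i\<in>?A. frame (span (coords (Ms i))) (gm i (PS.Pj i y)) (E i) \<and> (\<forall>e\<in>E i. gm i (PS.Pj i y) e e = 1)" by metis
  then have E: "frame (span (coords (Ms i))) (gm i (PS.Pj i y)) (E i)" and E1: "e \<in> E i \<Longrightarrow> gm i (PS.Pj i y) e e = 1" if "i \<in> ?A" for i e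
    using that by blast+
  have Ax: "A_coef a b i x > 0" if "i \<in> ?A" for i by (rule Apos[OF x that])
  note bl = Ax lf yD Pdom[OF bp(2)] E
  have ED: "e \<in> span ?D" if "i \<in> ?A" "e \<in> E i" for i e using frame_in[OF E] that PS.span_block by blast
  have fin: "finite (E i)" if "i \<in> ?A" for i using E[OF that] by (simp add: frame_def)
  have Edj: "E i \<inter> E j = {}" if "i \<in> ?A" "j \<in> ?A" "i \<noteq> j" for i j
    by (rule PS.E_disj[OF bl that])
  then have djE: "disjoint_family_on E ?A" unfolding disjoint_family_on_def by blast
  have PE: "PS.Pj k e = (if k = i then e else 0)" if "i \<in> ?A" "k \<in> ?A" "e \<in> E i" for i k e
    by (rule PS.Pj_E[OF bl that])
  have on: "bp.Gm k y e f = (if e = f \<and> k = i then 1 else 0)"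
    if i: "i \<in> ?A" and j: "j \<in> ?A" and k: "k \<in> ?A" and e: "e \<in> E i" and f: "f \<in> E j" for i j k e f
  proof -
    have z: "gm k (PS.Pj k y) 0 v = 0" "gm k (PS.Pj k y) v 0 = 0" if "v \<in> span (coords (Ms k))" for v
      using lform.zero_args[OF lf[OF k] Pdom[OF bp(2) k]] that by auto
    have G: "bp.Gm k y e f = gm k (PS.Pj k y) (if k = i then e else 0) (if k = j then f else 0)"
      unfolding Gm[OF k bp(2) ED[OF i e] ED[OF j f]] PE[OF i k e] PE[OF j k f] ..
    show ?thesis
    proof (cases "k = i")
      case False
      then show ?thesis unfolding G using z frame_in[OF E[OF j] f] by (auto simp: span_zero)
    next
      case ki: True
      show ?thesis
      proof (cases "j = i")
        case True
        then show ?thesis unfolding G using ki E1[OF i e] frame_orth[OF E[OF i] e] f by auto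
      next
        case False
        then have "e \<noteq> f" using Edj[OF i j] e f by blast
        then show ?thesis unfolding G using ki False z frame_in[OF E[OF i] e] by auto
      qed
    qed
  qed
  have sp: "span (\<Union>i\<in>?A. E i) = span ?D"
  proof
    show "span (\<Union>i\<in>?A. E i) \<subseteq> span ?D" by (rule span_minimal) (use ED in \<open>auto simp: subspace_span\<close>)
    show "span ?D \<subseteq> span (\<Union>i\<in>?A. E i)"
    proof (rule span_minimal)
      show "?D \<subseteq> span (\<Union>i\<in>?A. E i)"
      proof
        fix v assume "v \<in> ?D"
        then obtain i where i: "i \<in> ?A" "v \<in> coords (Ms i)" by blast
        then have "v \<in> span (E i)" using E[OF i(1)] span_base[of v] by (simp add: frame_def)
        moreover have "span (E i) \<subseteq> span (\<Union>i\<in>?A. E i)" by (rule span_mono) (use i(1) in blast)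
        ultimately show "v \<in> span (\<Union>i\<in>?A. E i)" by blast
      qed
    qed (rule subspace_span)
  qed
  have card: "card (E i) = d i" if i: "i \<in> ?A" for i
  proof -
    have sf: "symform (span (coords (Ms i))) (gm i (PS.Pj i y))" by (rule lform.sf[OF lf[OF i] Pdom[OF bp(2) i]])
    have ind: "independent (coords (Ms i))"
      using independent_mono[OF independent_Basis] wmfdD(1)[OF PS.wMs[OF i]] by blast
    have "card (E i) = dim (span (coords (Ms i)))" by (rule frame_independent(2)[OF sf E[OF i]])
    also have "\<dots> = card (coords (Ms i))" using dim_span_eq_card_independent[OF ind] by simp
    also have "\<dots> = d i" using KE i by (simp add: mdim_def)
    finally show ?thesis .
  qed
  have scM: "scal (gm i) (E i) (PS.Pj i y) = real (d i)" if i: "i \<in> ?A" for i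
  proof -
    have "scal (gm i) (E i) (PS.Pj i y) = (\<Sum>e\<in>E i. (\<Sum>f\<in>E i. sec (gm i) (E i) (PS.Pj i y) f e / gm i (PS.Pj i y) f f) / gm i (PS.Pj i y) e e)"
      unfolding scal_def sum_divide_distrib by (subst sum.swap) simp
    also have "\<dots> = (\<Sum>e\<in>E i. 1)"
    proof (intro sum.cong refl)
      fix e assume e: "e \<in> E i"
      have eC: "e \<in> span (coords (Ms i))" by (rule frame_in[OF E[OF i] e])
      have fr: "frame (span (coords (Ms i))) (comp2 (Ms i) (gM i) (chart_at (Ms i) (pr i ?q)) (snd (chart_at (Ms i) (pr i ?q)) (pr i ?q))) (E i)"
        using E[OF i] Py[OF i] by (simp add: gm_def c_def)
      have "(\<Sum>f\<in>E i. sec (gm i) (E i) (PS.Pj i y) f e / gm i (PS.Pj i y) f f)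
          = ricci (Ms i) (gM i) (pr i ?q) (coord_vec (Ms i) (c i) (pr i ?q) e) (coord_vec (Ms i) (c i) (pr i ?q) e)"
        using ricci_coord[OF rM[OF i] prq[OF i] eC fr] Py[OF i] by (simp add: gm_def c_def)
      also have "\<dots> = gM i (pr i ?q) (coord_vec (Ms i) (c i) (pr i ?q) e) (coord_vec (Ms i) (c i) (pr i ?q) e)"
        using KE i prq[OF i] coord_vec_in_tangent[OF c[OF i] eC] by blast
      also have "\<dots> = gm i (PS.Pj i y) e e"
        unfolding Py[OF i] using cinv_chart[OF PS.wMs[OF i] c[OF i]] by (simp add: gm_def comp2_def Let_def)
      also have "\<dots> = 1" by (rule E1[OF i e])
      finally show "(\<Sum>f\<in>E i. sec (gm i) (E i) (PS.Pj i y) f e / gm i (PS.Pj i y) f f) / gm i (PS.Pj i y) e e = 1"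
        using E1[OF i e] by simp
    qed
    finally show ?thesis using card[OF i] by simp
  qed
  let ?a = "\<lambda>i. A_coef a b i x" and ?E = "\<Union>i\<in>?A. E i"
  have Gx: "x * bp.G1 z v w + bp.G0 z v w = PS.block_sum ?a gm z v w"
    if z: "z \<in> Y'" and v: "v \<in> span ?D" and w: "w \<in> span ?D" for z v w
  proof -
    have "x * bp.G1 z v w + bp.G0 z v w = (\<Sum>i\<in>?A. ?a i * bp.Gm i z v w)"
      by (simp add: bp.G1_def bp.G0_def A_coef_def sum_distrib_left sum.distrib[symmetric] algebra_simps)
    also have "\<dots> = (\<Sum>i\<in>?A. ?a i * gm i (PS.Pj i z) (PS.Pj i v) (PS.Pj i w))"
      by (rule sum.cong) (use Gm z v w in auto)
    finally show ?thesis by (simp add: PS.block_sum_def)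
  qed
  have EDs: "?E \<subseteq> span ?D" using ED by auto
  have "scal (\<lambda>y v w. x * bp.G1 y v w + bp.G0 y v w) ?E y = scal (PS.block_sum ?a gm) ?E y"
    by (rule scal_cong[OF bp.oY bp(2) EDs Gx])
  also have "\<dots> = (\<Sum>i\<in>?A. scal (gm i) (E i) (PS.Pj i y) / ?a i)" by (rule PS.scal_block[OF bl])
  also have "\<dots> = (\<Sum>i\<in>?A. real (d i) / ?a i)" by (rule sum.cong) (use scM in auto)
  finally have sc: "scal (\<lambda>y v w. x * bp.G1 y v w + bp.G0 y v w) ?E y = (\<Sum>j=1..m. real (d j) / A_coef a b j x)" .
  have "scalar_curvature M g (\<Phi> (x, \<sigma> y)) = Sc x"
    by (rule bp.scalar_curvature_Sc[where E = E, OF x bp(2) fin sp djE _ card sc]) (assumption, (rule on; assumption), assumption)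
  then show ?thesis by (simp add: bp(4))
qed

text \<open>\<open>h\<close> is recovered from \<open>g\<close> inside a parametrization of the
  base, so some point of \<open>P\<close> has to be chosen to obtain one; the resulting derivatives
  do not depend on it.\<close>

lemma h_derivatives:
  assumes x: "x \<in> I"
  shows "(h has_real_derivative dd h 1 x) (at x)" "(dd h 1 has_real_derivative dd (dd h 1) 1 x) (at x)"
proof -
  obtain p where p: "p \<in> pts P" using Pne by blast
  have q: "\<pi> p \<in> pts B" by (rule smooth_map_in[OF \<pi>sm p])
  obtain c where c: "c \<in> atlas B" "\<pi> p \<in> fst c" using wmfdD(2)[OF wB q] by blast
  have y: "snd c (\<pi> p) \<in> cimg c" using c by blast
  obtain Y' \<sigma> where bp: "base_param M g J I P B \<Phi> \<pi> R \<tau> \<theta> JB m d a b gs h (coords B) Y' (cinv c) \<sigma>" "snd c (\<pi> p) \<in> Y'"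
    by (rule base_param_chart[OF c(1) y p cinv_chart[OF wB c, symmetric]])
  show "(h has_real_derivative dd h 1 x) (at x)" "(dd h 1 has_real_derivative dd (dd h 1) 1 x) (at x)"
    by (rule base_param.h_derivs[OF bp x])+
qed

end

theorem theorem8p4:
  fixes M :: "('a, 'n::euclidean_space) mfd" and g :: "'a form2" and J :: "'a endo"
    and I :: "real set" and P :: "('p, 'r::euclidean_space) mfd"
    and B :: "('q, 'e::euclidean_space) mfd" and \<Phi> :: "real \<times> 'p \<Rightarrow> 'a" and \<pi> :: "'p \<Rightarrow> 'q"
    and R :: "real \<Rightarrow> 'p \<Rightarrow> 'p" and \<tau> :: real and \<theta> :: "'p form1" and JB :: "'q endo"
    and m :: nat and d :: "nat \<Rightarrow> nat" and a b :: "nat \<Rightarrow> real" and gs :: "nat \<Rightarrow> 'q form2"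
    and h :: "real \<Rightarrow> real"
    and G :: "'g monoid" and N :: "('g, 'k::euclidean_space) mfd" and act :: "'g \<Rightarrow> 'a \<Rightarrow> 'a"
    and \<mu> :: "'a \<Rightarrow> 'g tv \<Rightarrow> real" and K L :: "'g set" and ch :: "'g \<Rightarrow> complex"
    and qP :: "'g \<Rightarrow> 'p" and qB :: "'g \<Rightarrow> 'q" and pp :: "nat \<Rightarrow> 'p tv set"
    and Ms :: "nat \<Rightarrow> ('b, 'f::euclidean_space) mfd" and gM :: "nat \<Rightarrow> 'b form2"
    and JM :: "nat \<Rightarrow> 'b endo" and pr :: "nat \<Rightarrow> 'q \<Rightarrow> 'b"
  assumes "kaehler M g J"
    and "cohom_one_form M g J I P B \<Phi> \<pi> R \<tau> \<theta> JB m d a b gs h"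
    and "construction_one M g J I P B \<Phi> \<pi> R \<tau> \<theta> m d a b gs G N act \<mu> K L ch qP qB pp
         \<or> construction_two P B \<pi> \<theta> JB m d b gs Ms gM JM pr"
  shows "\<exists>S. (\<forall>x\<in>I. \<forall>p\<in>pts P. scalar_curvature M g (\<Phi> (x, p)) = S x) \<and>
    (\<exists>F\<^sub>1 F\<^sub>2. \<forall>x\<in>I.
       (F\<^sub>1 has_real_derivative
          ((\<Sum>j=1..m. real (d j) / (b j * x + a j)) - S x)
            * (\<Prod>j=1..m. (b j * x + a j) powr (real (d j) / 2))) (at x) \<and>
       (F\<^sub>2 has_real_derivative F\<^sub>1 x) (at x) \<and>
       h x = 1 / (\<Prod>j=1..m. (b j * x + a j) powr (real (d j) / 2)) * F\<^sub>2 x)"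
proof -
  interpret kaehler_cohom_one M g J I P B \<Phi> \<pi> R \<tau> \<theta> JB m d a b gs h
    by unfold_locales (fact assms)+
  \<comment> \<open>The same function \<open>Sc\<close> serves both constructions: they enter the
    computation only through an adapted frame with \<open>d i\<close> vectors per block and the
    scalar curvature of the base metric.\<close>
  show ?thesis
  proof (rule exI[of _ Sc], rule conjI)
    show "\<forall>x\<in>I. \<forall>p\<in>pts P. scalar_curvature M g (\<Phi> (x, p)) = Sc x"
      using assms(3) scalar_curvature_construction_one scalar_curvature_construction_two by blast
    show "\<exists>F\<^sub>1 F\<^sub>2. \<forall>x\<in>I.
       (F\<^sub>1 has_real_derivative
          ((\<Sum>j=1..m. real (d j) / (b j * x + a j)) - Sc x)
            * (\<Prod>j=1..m. (b j * x + a j) powr (real (d j) / 2))) (at x) \<and>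
       (F\<^sub>2 has_real_derivative F\<^sub>1 x) (at x) \<and>
       h x = 1 / (\<Prod>j=1..m. (b j * x + a j) powr (real (d j) / 2)) * F\<^sub>2 x"
      by (rule scalar_curvature_ode[OF h_derivatives]) (use Apos in \<open>simp_all add: A_coef_def Sc_def\<close>)
  qed
qed

end
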